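(* Let $\Omega\subset\mathbb{R}^N$ be a smooth bounded domain which is symmetric with respect to some hyperplane $H$, and such that the first nontrivial eigenvalue $\lambda_2(\Omega)$ of the Neumann Laplacian on $\Omega$ is simple; let $u_2$ be the (up to a constant unique) corresponding eigenfunction. For $p>2$ consider minimizers of $\Lambda_p(\Omega)=\inf_{u\in H_{za}(\Omega)\setminus\{0\}}\frac{\|\nabla u\|_2^2}{\|u\|_p^2}$. (a) If $u_2$ is symmetric with respect to the reflection at $H$, then for $p>2$ sufficiently close to $2$ the minimizer $u_p$ of $\Lambda_p(\Omega)$ is unique up to a constant and symmetric with respect to the reflection at $H$. (b) If $u_2$ is antisymmetric with respect to the reflection at $H$, then for $p>2$ sufficiently close to $2$ the minimizer $u_p$ of $\Lambda_p(\Omega)$ is unique up to a constant and antisymmetric with respect to the reflection at $H$.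
   Context: $H_{za}(\Omega)=\{u\in H^1(\Omega):\int_\Omega u=0\}$ with norm $\|\nabla u\|_2$. The first nontrivial Neumann eigenvalue $\lambda_2(\Omega)$ is the smallest positive eigenvalue of $-\Delta$ with homogeneous Neumann boundary conditions on $\Omega$. *)

theory Defs
  imports "HOL-Analysis.Analysis"
begin

text \<open>Smooth (C-infinity) real functions on an open set: differentiable, and all
  partial derivatives again smooth (coinductively, i.e. derivatives of every order exist).\<close>
coinductive smooth_on :: "'a::euclidean_space set \<Rightarrow> ('a \<Rightarrow> real) \<Rightarrow> bool" where
  "f differentiable_on S \<Longrightarrow>
   (\<forall>i\<in>Basis. smooth_on S (\<lambda>x. frechet_derivative f (at x) i)) \<Longrightarrow> smooth_on S f"

definition smooth_bounded_domain :: "'a::euclidean_space set \<Rightarrow> bool" where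
  "smooth_bounded_domain \<Omega> \<longleftrightarrow> bounded \<Omega> \<and> connected \<Omega> \<and> \<Omega> \<noteq> {} \<and>
     (\<exists>\<rho>. smooth_on UNIV \<rho> \<and> \<Omega> = {x. \<rho> x < 0} \<and>
          (\<forall>x. \<rho> x = 0 \<longrightarrow> frechet_derivative \<rho> (at x) \<noteq> (\<lambda>_. 0)))"

text \<open>Reflection at the hyperplane {x. a \<bullet> x = b} (a \<noteq> 0).\<close>
definition reflect :: "'a::euclidean_space \<Rightarrow> real \<Rightarrow> 'a \<Rightarrow> 'a" where
  "reflect a b x = x - (2 * (a \<bullet> x - b) / (a \<bullet> a)) *\<^sub>R a"

definition test_fun :: "'a::euclidean_space set \<Rightarrow> ('a \<Rightarrow> real) \<Rightarrow> bool" where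
  "test_fun \<Omega> \<phi> \<longleftrightarrow> smooth_on UNIV \<phi> \<and> compact (closure {x. \<phi> x \<noteq> 0})
      \<and> closure {x. \<phi> x \<noteq> 0} \<subseteq> \<Omega>"

definition L2 :: "'a::euclidean_space set \<Rightarrow> ('a \<Rightarrow> real) \<Rightarrow> bool" where
  "L2 \<Omega> u \<longleftrightarrow> u \<in> borel_measurable (lebesgue_on \<Omega>) \<and> integrable (lebesgue_on \<Omega>) (\<lambda>x. (u x)\<^sup>2)"

definition weak_gradient :: "'a::euclidean_space set \<Rightarrow> ('a \<Rightarrow> real) \<Rightarrow> ('a \<Rightarrow> 'a) \<Rightarrow> bool" where
  "weak_gradient \<Omega> u G \<longleftrightarrow> G \<in> borel_measurable (lebesgue_on \<Omega>) \<and>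
     integrable (lebesgue_on \<Omega>) (\<lambda>x. (norm (G x))\<^sup>2) \<and>
     (\<forall>\<phi> i. test_fun \<Omega> \<phi> \<longrightarrow> i \<in> Basis \<longrightarrow>
        (\<integral>x. u x * frechet_derivative \<phi> (at x) i \<partial>lebesgue_on \<Omega>)
          = - (\<integral>x. (G x \<bullet> i) * \<phi> x \<partial>lebesgue_on \<Omega>))"

definition H1 :: "'a::euclidean_space set \<Rightarrow> ('a \<Rightarrow> real) set" where
  "H1 \<Omega> = {u. L2 \<Omega> u \<and> (\<exists>G. weak_gradient \<Omega> u G)}"

definition grad :: "'a::euclidean_space set \<Rightarrow> ('a \<Rightarrow> real) \<Rightarrow> 'a \<Rightarrow> 'a" where
  "grad \<Omega> u = (SOME G. weak_gradient \<Omega> u G)"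

definition Hza :: "'a::euclidean_space set \<Rightarrow> ('a \<Rightarrow> real) set" where
  "Hza \<Omega> = {u \<in> H1 \<Omega>. (\<integral>x. u x \<partial>lebesgue_on \<Omega>) = 0}"

definition nonzero_fun :: "'a::euclidean_space set \<Rightarrow> ('a \<Rightarrow> real) \<Rightarrow> bool" where
  "nonzero_fun \<Omega> u \<longleftrightarrow> \<not> (AE x in lebesgue_on \<Omega>. u x = 0)"

definition neumann_eigenpair :: "'a::euclidean_space set \<Rightarrow> real \<Rightarrow> ('a \<Rightarrow> real) \<Rightarrow> bool" where
  "neumann_eigenpair \<Omega> lam u \<longleftrightarrow> u \<in> H1 \<Omega> \<and> nonzero_fun \<Omega> u \<and>
     (\<forall>v\<in>H1 \<Omega>. (\<integral>x. grad \<Omega> u x \<bullet> grad \<Omega> v x \<partial>lebesgue_on \<Omega>)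
                 = lam * (\<integral>x. u x * v x \<partial>lebesgue_on \<Omega>))"

definition lambda2 :: "'a::euclidean_space set \<Rightarrow> real" where
  "lambda2 \<Omega> = Inf {lam. lam > 0 \<and> (\<exists>u. neumann_eigenpair \<Omega> lam u)}"

definition dirichlet :: "'a::euclidean_space set \<Rightarrow> ('a \<Rightarrow> real) \<Rightarrow> real" where
  "dirichlet \<Omega> u = (\<integral>x. (norm (grad \<Omega> u x))\<^sup>2 \<partial>lebesgue_on \<Omega>)"

definition Lp_norm :: "'a::euclidean_space set \<Rightarrow> real \<Rightarrow> ('a \<Rightarrow> real) \<Rightarrow> real" where
  "Lp_norm \<Omega> p u = (\<integral>x. \<bar>u x\<bar> powr p \<partial>lebesgue_on \<Omega>) powr (1 / p)"

definition admissible :: "'a::euclidean_space set \<Rightarrow> real \<Rightarrow> ('a \<Rightarrow> real) set" where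
  "admissible \<Omega> p = {u \<in> Hza \<Omega>. nonzero_fun \<Omega> u \<and>
      integrable (lebesgue_on \<Omega>) (\<lambda>x. \<bar>u x\<bar> powr p)}"

definition rayleigh :: "'a::euclidean_space set \<Rightarrow> real \<Rightarrow> ('a \<Rightarrow> real) \<Rightarrow> real" where
  "rayleigh \<Omega> p u = dirichlet \<Omega> u / (Lp_norm \<Omega> p u)\<^sup>2"

definition Lambda_p :: "'a::euclidean_space set \<Rightarrow> real \<Rightarrow> real" where
  "Lambda_p \<Omega> p = (INF u \<in> admissible \<Omega> p. rayleigh \<Omega> p u)"

definition minimizer :: "'a::euclidean_space set \<Rightarrow> real \<Rightarrow> ('a \<Rightarrow> real) \<Rightarrow> bool" where
  "minimizer \<Omega> p u \<longleftrightarrow> u \<in> admissible \<Omega> p \<and> rayleigh \<Omega> p u = Lambda_p \<Omega> p"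

end

(*
Compactness. The boundary is smooth, so each point of the closure has a neighbourhood D and a
small ball K with x + t z inside the domain for all x in D, z in K and small t > 0.
Averaging u over x + tK is then defined on D without any extension operator; it differs from u
in L^2 by at most a multiple of t ||grad u||_2, and is bounded by a multiple of t^(-N) ||u||_2.
With t tending to 0 this gives the Rellich theorem, and with t chosen according to the level
{|u| > 2^k} it gives an embedding of H^1 into L^q for one explicit q > 2. Hence minimizers
exist for 2 < p < q, and so do the eigenfunctions behind the gap between lambda_2 and the
infimum over functions orthogonal to u_2.

Uniqueness. Subtracting the Euler-Lagrange equations of two minimizers u, v, normalised so that
both have scalar product 1 with u_2, shows that w = u - v satisfies
||grad w||_2^2 <= k_p lambda_2 ||w||_p^2 with k_p tending to 1 as p tends to 2. As w is orthogonal
to u_2, the spectral gap forces w = 0 for p near 2. The same estimate shows that no minimizer is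
orthogonal to u_2. So minimizers are determined up to a factor, which is recovered by pairing
with u_2; applied to the reflected minimizer this yields the symmetry.
*)

theory Submission
  imports Defs "HOL-Complex_Analysis.Great_Picard" "HOL-Library.Diagonal_Subsequence"
begin

section \<open>Smooth functions and mollifiers\<close>

text \<open>Normalising by the scalar product with u_2, and not by the p-norm, makes u - v
  orthogonal to u_2, where the spectral gap is available. The price is that u and v have different
  p-norms, so that their Euler-Lagrange equations carry different multipliers. Accordingly k_p is
  |\<Omega>|^(1-2/p) times the sum of (p-1) 2^((p-2)/p), the Lipschitz bound for |s|^(p-2) s, and p
  - 2, the effect of the multipliers; the volume comes from comparing Lambda_p with lambda_2. The
  gap is a statement in L^2, the difference estimate one in L^p. They are joined by ||w||_p^2 <=
  ||w||_2^2 + e (||w||_2^2 + ||grad w||_2^2), valid for all w in H^1 at once when p is close to 2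
  depending on e. Hence the threshold for p depends on \<Omega> alone and not on a pair of
  minimizers. In the compactness part the obstacle is the boundary. The t-derivative of the
  averaging kernel is minus the divergence of a field whose components are test functions on the
  domain as long as x + tK stays inside, so the weak gradient enters directly through its
  definition.\<close>

primrec times_diff :: "nat \<Rightarrow> ('a::euclidean_space \<Rightarrow> real) \<Rightarrow> bool" where
  "times_diff 0 f \<longleftrightarrow> True"
| "times_diff (Suc k) f \<longleftrightarrow> (\<forall>x. f differentiable (at x)) \<and>
     (\<forall>i\<in>Basis. times_diff k (\<lambda>x. frechet_derivative f (at x) i))"

lemma smooth_onE:
  assumes "smooth_on S f"
  shows "f differentiable_on S" "i \<in> Basis \<Longrightarrow> smooth_on S (\<lambda>x. frechet_derivative f (at x) i)"
  using assms by (auto elim: smooth_on.cases)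

text \<open>A coinductive proof for products would need an invariant closed under sums of products,
  because of the Leibniz rule. Counting derivatives replaces it by induction on their number, where
  sums and products are separate lemmas.\<close>

lemma smooth_on_UNIV_iff: "smooth_on UNIV f \<longleftrightarrow> (\<forall>k. times_diff k f)"
proof
  show "\<forall>k. times_diff k f" if "smooth_on UNIV f"
  proof
    fix k show "times_diff k f" using that
    proof (induction k arbitrary: f)
      case (Suc k)
      then show ?case using smooth_onE[OF Suc.prems] by (auto simp: differentiable_on_def)
    qed simp
  qed
  show "smooth_on UNIV f" if "\<forall>k. times_diff k f"
    using that
  proof (coinduction arbitrary: f)
    case smooth_on
    then have "times_diff (Suc k) f" for k by blast
    then show ?case by (auto simp: differentiable_on_def)
  qed
qed

lemma times_diff_le: "times_diff m f \<Longrightarrow> k \<le> m \<Longrightarrow> times_diff k f"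
proof (induction m arbitrary: f k)
  case (Suc m)
  then show ?case by (cases k) auto
qed simp

lemma times_diff_SucD: "times_diff (Suc k) f \<Longrightarrow> times_diff k f"
  using times_diff_le[of "Suc k" f k] by simp

lemma times_diff_SucI:
  assumes "\<And>x. (f has_derivative f' x) (at x)" "\<And>i. i \<in> Basis \<Longrightarrow> times_diff k (\<lambda>x. f' x i)"
  shows "times_diff (Suc k) f"
proof -
  have "frechet_derivative f (at x) = f' x" for x
    using frechet_derivative_at[OF assms(1)] by simp
  then show ?thesis using assms by (auto simp: differentiable_def)
qed

lemma times_diff_SucE:
  assumes "times_diff (Suc k) f"
  shows "(f has_derivative frechet_derivative f (at x)) (at x)"
    "i \<in> Basis \<Longrightarrow> times_diff k (\<lambda>x. frechet_derivative f (at x) i)"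
  using assms by (auto simp: frechet_derivative_works)

lemma times_diff_const [simp]: "times_diff k (\<lambda>x. c)"
  by (induction k arbitrary: c) (auto simp: frechet_derivative_const)

lemma times_diff_inner [simp]: "times_diff k (\<lambda>x. x \<bullet> v)"
proof (cases k)
  case (Suc m)
  show ?thesis unfolding Suc
    by (rule times_diff_SucI[where f' = "\<lambda>x h. h \<bullet> v"]) (auto intro!: derivative_eq_intros)
qed simp

lemma times_diff_add: "times_diff k f \<Longrightarrow> times_diff k g \<Longrightarrow> times_diff k (\<lambda>x. f x + g x)"
proof (induction k arbitrary: f g)
  case (Suc k)
  show ?case
    by (rule times_diff_SucI[OF has_derivative_add[OF times_diff_SucE(1)[OF Suc.prems(1)] times_diff_SucE(1)[OF Suc.prems(2)]]])
      (intro Suc.IH times_diff_SucE(2)[OF Suc.prems(1)] times_diff_SucE(2)[OF Suc.prems(2)])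
qed simp

lemma times_diff_mult: "times_diff k f \<Longrightarrow> times_diff k g \<Longrightarrow> times_diff k (\<lambda>x. f x * g x)"
proof (induction k arbitrary: f g)
  case (Suc k)
  show ?case
    by (rule times_diff_SucI[OF has_derivative_mult[OF times_diff_SucE(1)[OF Suc.prems(1)] times_diff_SucE(1)[OF Suc.prems(2)]]])
      (intro times_diff_add Suc.IH times_diff_SucE(2)[OF Suc.prems(1)] times_diff_SucE(2)[OF Suc.prems(2)]
        times_diff_SucD[OF Suc.prems(1)] times_diff_SucD[OF Suc.prems(2)])
qed simp

lemma times_diff_cmult: "times_diff k f \<Longrightarrow> times_diff k (\<lambda>x. c * f x)"
  by (rule times_diff_mult) auto

lemma times_diff_sum: "(\<And>i. i \<in> I \<Longrightarrow> times_diff k (f i)) \<Longrightarrow> times_diff k (\<lambda>x. \<Sum>i\<in>I. f i x)"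
  by (induction I rule: infinite_finite_induct) (auto intro!: times_diff_add)

text \<open>\<open>smooth_on\<close> speaks of derivatives along basis vectors only; linearity
  reduces every other direction to these.\<close>

lemma frechet_derivative_Basis_expand:
  assumes "f differentiable (at x)"
  shows "frechet_derivative f (at x) v = (\<Sum>j\<in>Basis. (v \<bullet> j) * frechet_derivative f (at x) j)"
proof -
  have lin: "linear (frechet_derivative f (at x))"
    using assms by (rule linear_frechet_derivative)
  have "frechet_derivative f (at x) v = frechet_derivative f (at x) (\<Sum>j\<in>Basis. (v \<bullet> j) *\<^sub>R j)"
    by (simp add: euclidean_representation)
  then show ?thesis using lin
    by (simp add: linear_sum linear_cmul)
qed

text \<open>The chain rule turns a basis direction i into \<open>L i\<close>, which has to be
  expanded in the basis before the induction hypothesis applies.\<close>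

lemma times_diff_affine:
  fixes f :: "'a::euclidean_space \<Rightarrow> real" and L :: "'b::euclidean_space \<Rightarrow> 'a"
  assumes "linear L"
  shows "times_diff k f \<Longrightarrow> times_diff k (\<lambda>x. f (d + L x))"
proof (induction k arbitrary: f)
  case (Suc k)
  have "(L has_derivative L) (at x)" for x
    using assms by (simp add: linear_imp_has_derivative)
  then have A: "((\<lambda>x. d + L x) has_derivative L) (at x)" for x
    by (auto intro!: derivative_eq_intros)
  have der: "((\<lambda>x. f (d + L x)) has_derivative (\<lambda>h. frechet_derivative f (at (d + L x)) (L h))) (at x)" for x
    using has_derivative_compose[OF A times_diff_SucE(1)[OF Suc.prems(1)]] .
  show ?case
  proof (rule times_diff_SucI[OF der])
    fix i :: 'b assume "i \<in> Basis"
    have "(\<lambda>x. frechet_derivative f (at (d + L x)) (L i)) =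
      (\<lambda>x. \<Sum>j\<in>Basis. (L i \<bullet> j) * frechet_derivative f (at (d + L x)) j)"
      using Suc.prems by (intro ext frechet_derivative_Basis_expand) auto
    then show "times_diff k (\<lambda>x. frechet_derivative f (at (d + L x)) (L i))"
      using Suc.prems by (auto intro!: times_diff_sum times_diff_cmult Suc.IH)
  qed
qed simp

section \<open>Smooth bump functions\<close>

definition flat_exp :: "nat \<Rightarrow> real \<Rightarrow> real" where
  "flat_exp n s = (if s > 0 then exp (-1/s) / s^n else 0)"

text \<open>Differentiation leads away from exp(-1/s), but the family over all n is closed under it
  up to linear combinations. Smoothness then follows by induction on the order with n
  arbitrary.\<close>

lemma flat_exp_deriv:
  "(flat_exp n has_real_derivative (flat_exp (n+2) s - n * flat_exp (n+1) s)) (at s)"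
proof (cases s "0::real" rule: linorder_cases)
  case less
  have "(flat_exp n has_real_derivative 0) (at s)"
    by (rule has_field_derivative_transform_within_open[of "\<lambda>x. 0" 0 s "{..<0}"])
      (use less in \<open>auto simp: flat_exp_def\<close>)
  then show ?thesis using less by (simp add: flat_exp_def)
next
  case equal
  \<comment> \<open>At 0 the right difference quotient is \<open>flat_exp (n+1)\<close>, and the
    exponential beats every power of 1/h; the left one is 0.\<close>
  have "((\<lambda>h::real. inverse h ^ (n+1) / exp (inverse h)) \<longlongrightarrow> 0) (at_right 0)"
    by (rule filterlim_compose[OF tendsto_power_div_exp_0 filterlim_inverse_at_top_right])
  then have "((\<lambda>h. flat_exp n h / h) \<longlongrightarrow> 0) (at_right 0)"
    by (rule Lim_transform_eventually)
      (rule eventually_mono[OF eventually_at_right_less[of 0]], simp add: flat_exp_def exp_minus field_simps)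
  moreover have "((\<lambda>h. flat_exp n h / h) \<longlongrightarrow> 0) (at_left 0)"
    by (rule Lim_transform_eventually[OF tendsto_const], subst eventually_at_filter) (simp add: flat_exp_def)
  ultimately have "((\<lambda>h. flat_exp n h / h) \<longlongrightarrow> 0) (at 0)"
    by (simp add: filterlim_split_at)
  then show ?thesis using equal
    by (simp add: DERIV_def flat_exp_def)
next
  case greater
  have e: "((\<lambda>s. exp (-1/s)) has_real_derivative (exp (-1/s) / s^2)) (at s)"
    using greater by (auto intro!: derivative_eq_intros simp: power2_eq_square)
  \<comment> \<open>The case n = 0 is separate because the derivative of s^n is given with the
    truncated exponent \<open>n - Suc 0\<close>.\<close>
  have q: "((\<lambda>s. 1 / s^n) has_real_derivative (- (real n / s^(n+1)))) (at s)"
  proof (cases n)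
    case (Suc m)
    have "((\<lambda>s. inverse (s^n)) has_real_derivative (- (inverse (s^n) * (real n * s^(n - Suc 0)) * inverse (s^n)))) (at s)"
      using greater by (intro DERIV_inverse' DERIV_pow) auto
    moreover have "- (inverse (s^n) * (real n * s^(n - Suc 0)) * inverse (s^n)) = - (real n / s^(n+1))"
      using greater Suc by (simp add: divide_simps)
    ultimately show ?thesis by (simp add: inverse_eq_divide)
  qed simp
  have "((\<lambda>s. exp (-1/s) * (1 / s^n)) has_real_derivative (exp (-1/s) / s^2 * (1/s^n) + (- (real n / s^(n+1))) * exp (-1/s))) (at s)"
    by (rule DERIV_mult[OF e q])
  then have "((\<lambda>s. exp (-1/s) / s^n) has_real_derivative (exp (-1/s) / s^(n+2) - n * (exp (-1/s) / s^(n+1)))) (at s)"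
    by (simp add: power_add power2_eq_square algebra_simps)
  then have "(flat_exp n has_real_derivative (exp (-1/s) / s^(n+2) - n * (exp (-1/s) / s^(n+1)))) (at s)"
    by (rule has_field_derivative_transform_within_open[where S = "{0<..}"])
      (use greater in \<open>auto simp: flat_exp_def\<close>)
  then show ?thesis using greater by (simp add: flat_exp_def)
qed

lemma times_diff_flat_exp: "times_diff k (\<lambda>x. flat_exp n (1 - x \<bullet> x))"
proof (induction k arbitrary: n)
  case (Suc k)
  have der: "((\<lambda>x::'a. flat_exp n (1 - x \<bullet> x)) has_derivative
     (\<lambda>h. (flat_exp (n+2) (1 - x \<bullet> x) + (- real n) * flat_exp (n+1) (1 - x \<bullet> x)) * ((-2) * (x \<bullet> h)))) (at x)" for x
  proof -
    have "((\<lambda>x::'a. 1 - x \<bullet> x) has_derivative (\<lambda>h. (-2) * (x \<bullet> h))) (at x)"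
      by (auto intro!: derivative_eq_intros simp: inner_commute)
    from has_derivative_compose[OF this flat_exp_deriv[unfolded has_field_derivative_def]]
    show ?thesis by simp
  qed
  show ?case
    by (rule times_diff_SucI[OF der]) (intro times_diff_mult times_diff_add Suc.IH times_diff_const times_diff_inner)
qed simp

definition bump :: "'a::euclidean_space \<Rightarrow> real" where
  "bump x = flat_exp 0 (1 - x \<bullet> x)"

lemma smooth_bump: "smooth_on UNIV bump"
  unfolding smooth_on_UNIV_iff bump_def[abs_def] by (simp add: times_diff_flat_exp)

lemma bump_nonneg: "bump x \<ge> 0"
  by (simp add: bump_def flat_exp_def)

lemma bump_pos_iff: "bump x > 0 \<longleftrightarrow> norm x < 1"
  by (simp add: bump_def flat_exp_def dot_square_norm abs_square_less_1)

lemma bump_eq_0_iff: "bump x = 0 \<longleftrightarrow> norm x \<ge> 1"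
  using bump_pos_iff[of x] bump_nonneg[of x] by linarith

lemma smooth_continuous: "smooth_on UNIV f \<Longrightarrow> continuous_on UNIV f"
  by (rule differentiable_imp_continuous_on[OF smooth_onE(1)])

lemma smooth_has_derivative: "smooth_on UNIV f \<Longrightarrow> (f has_derivative frechet_derivative f (at x)) (at x)"
  by (rule times_diff_SucE(1)[where k = 0]) (simp only: smooth_on_UNIV_iff)

lemma smooth_derivative_continuous:
  assumes "smooth_on UNIV f"
  shows "continuous_on UNIV (\<lambda>x. frechet_derivative f (at x) v)"
proof -
  have d: "f differentiable (at x)" for x using smooth_has_derivative[OF assms] by (auto simp: differentiable_def)
  have "(\<lambda>x. frechet_derivative f (at x) v) = (\<lambda>x. \<Sum>j\<in>Basis. (v \<bullet> j) * frechet_derivative f (at x) j)"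
    using frechet_derivative_Basis_expand[OF d] by blast
  then show ?thesis
    by (simp only:) (intro continuous_intros smooth_continuous[OF smooth_onE(2)[OF assms]])
qed

lemma smooth_mult: "smooth_on UNIV f \<Longrightarrow> smooth_on UNIV g \<Longrightarrow> smooth_on UNIV (\<lambda>x. f x * g x)"
  unfolding smooth_on_UNIV_iff using times_diff_mult by blast

lemma smooth_const: "smooth_on UNIV (\<lambda>x. c)"
  unfolding smooth_on_UNIV_iff by simp

lemma smooth_inner: "smooth_on UNIV (\<lambda>x. x \<bullet> v)"
  unfolding smooth_on_UNIV_iff by simp

lemma smooth_affine: "smooth_on UNIV f \<Longrightarrow> linear L \<Longrightarrow> smooth_on UNIV (\<lambda>x. f (d + L x))"
  unfolding smooth_on_UNIV_iff using times_diff_affine by blast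

section \<open>Integral inequalities and approximation in L^2\<close>

lemma nn_integral_lborel_affine:
  fixes f :: "'a::euclidean_space \<Rightarrow> ennreal"
  assumes [measurable]: "f \<in> borel_measurable borel" and c: "c \<noteq> 0"
  shows "(\<integral>\<^sup>+x. f x \<partial>lborel) = ennreal (\<bar>c\<bar> ^ DIM('a)) * (\<integral>\<^sup>+x. f (t + c *\<^sub>R x) \<partial>lborel)"
  by (subst lborel_affine[OF c, of t])
    (simp add: nn_integral_density nn_integral_distr nn_integral_cmult)

lemma compact_support_uniformly_continuous:
  fixes g :: "'a::euclidean_space \<Rightarrow> real"
  assumes g: "continuous_on UNIV g" and gs: "\<And>x. norm x > B \<Longrightarrow> g x = 0"
  shows "uniformly_continuous_on UNIV g"
  unfolding uniformly_continuous_on_def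
proof (intro allI impI)
  have uc: "uniformly_continuous_on (cball 0 (B + 1)) g"
    using g by (intro compact_uniformly_continuous continuous_on_subset[OF g]) auto
  fix e :: real assume "e > 0"
  then obtain d where d: "d > 0" "\<And>x x'. norm x \<le> B+1 \<Longrightarrow> norm x' \<le> B+1 \<Longrightarrow> dist x' x < d \<Longrightarrow> dist (g x') (g x) < e"
    using uc unfolding uniformly_continuous_on_def by (metis mem_cball_0)
  \<comment> \<open>Points at distance below 1 either both lie in the ball of radius B + 1, where
    Heine-Cantor applies, or both have norm above B, where g vanishes.\<close>
  have "dist (g x') (g x) < e" if "dist x' x < min d 1" for x x'
  proof (cases "norm x \<le> B + 1 \<and> norm x' \<le> B + 1")
    case False
    have "norm x \<le> norm x' + dist x' x" "norm x' \<le> norm x + dist x' x"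
      using norm_triangle_ineq2[of x x'] norm_triangle_ineq2[of x' x] by (auto simp: dist_norm norm_minus_commute)
    then have "norm x > B" "norm x' > B" using False that by auto
    then show ?thesis using gs \<open>e > 0\<close> by simp
  qed (use d that in auto)
  then show "\<exists>d>0. \<forall>x\<in>UNIV. \<forall>x'\<in>UNIV. dist x' x < d \<longrightarrow> dist (g x') (g x) < e"
    using d(1) by (intro exI[of _ "min d 1"]) auto
qed

text \<open>Schur's test. Taking \<open>k x\<close> as the density of a measure, Cauchy-Schwarz
  against the function 1 yields the factor A; Tonelli then yields the factor B. The second space is
  general because it will also be the space of pairs (scale, point).\<close>

lemma schur_test:
  assumes "sigma_finite_measure M1" "sigma_finite_measure M2"
  assumes k [measurable]: "(\<lambda>(x,y). k x y) \<in> borel_measurable (M1 \<Otimes>\<^sub>M M2)"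
    and f [measurable]: "f \<in> borel_measurable M2"
    and A: "\<And>x. x \<in> space M1 \<Longrightarrow> (\<integral>\<^sup>+y. k x y \<partial>M2) \<le> A"
    and B: "\<And>y. y \<in> space M2 \<Longrightarrow> (\<integral>\<^sup>+x. k x y \<partial>M1) \<le> B"
  shows "(\<integral>\<^sup>+x. (\<integral>\<^sup>+y. k x y * f y \<partial>M2)\<^sup>2 \<partial>M1) \<le> A * B * (\<integral>\<^sup>+y. (f y)\<^sup>2 \<partial>M2)"
proof -
  interpret M1: sigma_finite_measure M1 by fact
  interpret M2: sigma_finite_measure M2 by fact
  interpret P: pair_sigma_finite M1 M2 ..
  have kf [measurable]: "(\<lambda>(x,y). k x y * (f y)\<^sup>2) \<in> borel_measurable (M1 \<Otimes>\<^sub>M M2)"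
    by measurable
  have 1: "(\<integral>\<^sup>+y. k x y * f y \<partial>M2)\<^sup>2 \<le> A * (\<integral>\<^sup>+y. k x y * (f y)\<^sup>2 \<partial>M2)" if x: "x \<in> space M1" for x
  proof -
    have [measurable]: "k x \<in> borel_measurable M2"
      using measurable_Pair2[OF k x] by simp
    have "(\<integral>\<^sup>+y. k x y * f y \<partial>M2)\<^sup>2 = (\<integral>\<^sup>+y. f y * 1 \<partial>density M2 (k x))\<^sup>2"
      by (simp add: nn_integral_density)
    also have "\<dots> \<le> (\<integral>\<^sup>+y. (f y)\<^sup>2 \<partial>density M2 (k x)) * (\<integral>\<^sup>+y. 1\<^sup>2 \<partial>density M2 (k x))"
      by (rule Cauchy_Schwarz_nn_integral) auto
    also have "\<dots> = (\<integral>\<^sup>+y. k x y * (f y)\<^sup>2 \<partial>M2) * (\<integral>\<^sup>+y. k x y \<partial>M2)"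
      by (simp add: nn_integral_density emeasure_density)
    also have "\<dots> \<le> (\<integral>\<^sup>+y. k x y * (f y)\<^sup>2 \<partial>M2) * A"
      by (intro mult_left_mono A x) auto
    finally show ?thesis by (simp add: mult.commute)
  qed
  have "(\<integral>\<^sup>+x. (\<integral>\<^sup>+y. k x y * f y \<partial>M2)\<^sup>2 \<partial>M1) \<le> (\<integral>\<^sup>+x. A * (\<integral>\<^sup>+y. k x y * (f y)\<^sup>2 \<partial>M2) \<partial>M1)"
    by (intro nn_integral_mono 1)
  also have "\<dots> = A * (\<integral>\<^sup>+x. (\<integral>\<^sup>+y. k x y * (f y)\<^sup>2 \<partial>M2) \<partial>M1)"
    by (intro nn_integral_cmult) measurable
  also have "(\<integral>\<^sup>+x. (\<integral>\<^sup>+y. k x y * (f y)\<^sup>2 \<partial>M2) \<partial>M1) = (\<integral>\<^sup>+y. (\<integral>\<^sup>+x. k x y * (f y)\<^sup>2 \<partial>M1) \<partial>M2)"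
    using P.Fubini'[OF kf] by simp
  also have "\<dots> \<le> (\<integral>\<^sup>+y. B * (f y)\<^sup>2 \<partial>M2)"
  proof (intro nn_integral_mono)
    fix y assume y: "y \<in> space M2"
    have [measurable]: "(\<lambda>x. k x y) \<in> borel_measurable M1"
      using measurable_Pair1[OF k y] by simp
    have "(\<integral>\<^sup>+x. k x y * (f y)\<^sup>2 \<partial>M1) = (\<integral>\<^sup>+x. k x y \<partial>M1) * (f y)\<^sup>2"
      by (rule nn_integral_multc) simp
    also have "\<dots> \<le> B * (f y)\<^sup>2"
      by (intro mult_right_mono B y) auto
    finally show "(\<integral>\<^sup>+x. k x y * (f y)\<^sup>2 \<partial>M1) \<le> B * (f y)\<^sup>2" .
  qed
  also have "\<dots> = B * (\<integral>\<^sup>+y. (f y)\<^sup>2 \<partial>M2)"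
    by (rule nn_integral_cmult) simp
  finally show ?thesis by (simp add: mult.assoc mult_left_mono)
qed

text \<open>Two approximations by dominated convergence: first the values are clamped to [-M, M],
  then the clamped function is approached by clamped continuous functions, which
  \<open>measurable_on\<close> supplies off a negligible set.\<close>

lemma continuous_dense_L2:
  fixes f :: "'a::euclidean_space \<Rightarrow> real"
  assumes [measurable]: "f \<in> borel_measurable borel" and int: "integrable lborel (\<lambda>x. (f x)\<^sup>2)"
    and supp: "\<And>x. norm x > B \<Longrightarrow> f x = 0" and e: "e > 0"
  obtains g where "continuous_on UNIV g" "\<And>x. norm x > B + 1 \<Longrightarrow> g x = 0"
    "(\<integral>\<^sup>+x. ennreal ((f x - g x)\<^sup>2) \<partial>lborel) < ennreal e"
proof -
  define cl where "cl M r = max (- real M) (min (real M) r)" for M r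
  have cl_meas [measurable]: "cl M \<in> borel_measurable borel" for M
    unfolding cl_def[abs_def] by measurable
  have cl_lim: "(\<lambda>M. cl M r) \<longlonglongrightarrow> r" for r
  proof (rule tendsto_eventually)
    obtain N where "\<bar>r\<bar> \<le> real N" using real_arch_simple by blast
    then show "\<forall>\<^sub>F M in sequentially. cl M r = r"
      by (intro eventually_sequentiallyI[of N]) (auto simp: cl_def)
  qed
  have "(\<lambda>M. \<integral>x. (f x - cl M (f x))\<^sup>2 \<partial>lborel) \<longlonglongrightarrow> (\<integral>x. (0::real) \<partial>(lborel::'a measure))"
  proof (rule integral_dominated_convergence[where w = "\<lambda>x. (f x)\<^sup>2"])
    show "AE x in lborel. (\<lambda>M. (f x - cl M (f x))\<^sup>2) \<longlonglongrightarrow> 0"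
    proof (intro AE_I2)
      fix x
      have "(\<lambda>M. (f x - cl M (f x))\<^sup>2) \<longlonglongrightarrow> (f x - f x)\<^sup>2"
        by (intro tendsto_intros cl_lim)
      then show "(\<lambda>M. (f x - cl M (f x))\<^sup>2) \<longlonglongrightarrow> 0" by simp
    qed
    show "AE x in lborel. norm ((f x - cl M (f x))\<^sup>2) \<le> (f x)\<^sup>2" for M
      by (intro AE_I2) (auto simp: cl_def abs_le_square_iff[symmetric])
  qed (use int in auto)
  then have "\<forall>\<^sub>F M in sequentially. (\<integral>x. (f x - cl M (f x))\<^sup>2 \<partial>lborel) < e / 4"
    using e by (intro order_tendstoD(2)[of _ 0]) auto
  then obtain M where M: "(\<integral>x. (f x - cl M (f x))\<^sup>2 \<partial>lborel) < e / 4"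
    by (auto simp: eventually_sequentially)
  have intM: "integrable lborel (\<lambda>x. (f x - cl M (f x))\<^sup>2)"
    by (rule Bochner_Integration.integrable_bound[OF int])
      (auto simp: cl_def abs_le_square_iff[symmetric])
  have "f \<in> borel_measurable lebesgue" by (simp add: measurable_completion)
  then have "f measurable_on UNIV"
    by (rule lebesgue_measurable_imp_measurable_on) simp
  then obtain N g where N: "negligible N" and g: "\<And>n. continuous_on UNIV (g n)"
    and lim: "\<And>x. x \<notin> N \<Longrightarrow> (\<lambda>n. g n x) \<longlonglongrightarrow> f x"
    unfolding measurable_on_def by auto
  \<comment> \<open>A continuous cutoff, 1 on the ball of radius B and 0 beyond B + 1. It gives the
    approximants a common integrable bound and leaves the clamped f unchanged, as f vanishes where
    it is below 1.\<close>
  define cut where "cut x = max 0 (min 1 (B + 1 - norm x))" for x :: 'a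
  define h where "h n x = cut x * cl M (g n x)" for n x
  have cut: "0 \<le> cut x" "cut x \<le> 1" "norm x \<le> B \<Longrightarrow> cut x = 1" "norm x > B + 1 \<Longrightarrow> cut x = 0" for x
    by (auto simp: cut_def)
  have hc: "continuous_on UNIV (h n)" for n
    unfolding h_def cut_def cl_def by (intro continuous_intros g)
  then have [measurable]: "h n \<in> borel_measurable borel" for n
    by (rule borel_measurable_continuous_onI)
  have fcl: "cl M (f x) = cut x * cl M (f x)" for x
    using supp[of x] cut(3)[of x] by (cases "norm x \<le> B") (auto simp: cl_def)
  have bnd: "\<bar>cl M (f x) - h n x\<bar> \<le> 2 * real M * indicator (cball 0 (B+1)) x" for n x
  proof (cases "norm x \<le> B + 1")
    case True
    have "\<bar>cl M r\<bar> \<le> real M" for r by (auto simp: cl_def)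
    then have "\<bar>cut x * cl M r\<bar> \<le> 1 * real M" for r
      unfolding abs_mult using cut by (intro mult_mono) auto
    then have "\<bar>cut x * cl M (f x)\<bar> \<le> M" "\<bar>cut x * cl M (g n x)\<bar> \<le> M" by auto
    then have "\<bar>cut x * cl M (f x) - cut x * cl M (g n x)\<bar> \<le> 2 * M" by linarith
    then show ?thesis using True by (simp add: fcl[of x, symmetric] h_def)
  next
    case False
    then have "cut x = 0" using cut(4)[of x] by simp
    then show ?thesis using fcl[of x] by (simp add: h_def)
  qed
  have intb: "integrable lborel (\<lambda>x. (2 * real M * indicator (cball 0 (B+1)) (x::'a))\<^sup>2)"
  proof -
    have "(\<lambda>x. (2 * real M * indicator (cball 0 (B+1)) (x::'a))\<^sup>2) = (\<lambda>x. (2 * real M)\<^sup>2 * indicator (cball 0 (B+1)) x)"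
      by (auto simp: indicator_def)
    moreover have "integrable lborel (\<lambda>x. (2 * real M)\<^sup>2 * indicator (cball 0 (B+1)) (x::'a))"
      by (intro integrable_mult_right integrable_real_indicator) (use emeasure_lborel_cball_finite[of 0] in auto)
    ultimately show ?thesis by simp
  qed
  have bnd2: "(cl M (f x) - h n x)\<^sup>2 \<le> (2 * real M * indicator (cball 0 (B+1)) x)\<^sup>2" for n x
    using power_mono[OF bnd[of x n], of 2] by simp
  have "(\<lambda>n. \<integral>x. (cl M (f x) - h n x)\<^sup>2 \<partial>lborel) \<longlonglongrightarrow> (\<integral>x. (0::real) \<partial>(lborel::'a measure))"
  proof (rule integral_dominated_convergence[OF _ _ intb])
    have "AE x in lebesgue. x \<notin> N"
      using N by (metis AE_not_in negligible_iff_null_sets)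
    then have "AE x in lborel. x \<notin> N" by (simp add: AE_completion_iff)
    then show "AE x in lborel. (\<lambda>n. (cl M (f x) - h n x)\<^sup>2) \<longlonglongrightarrow> 0"
    proof eventually_elim
      case (elim x)
      have "(\<lambda>n. (cut x * cl M (f x) - cut x * cl M (g n x))\<^sup>2) \<longlonglongrightarrow> (cut x * cl M (f x) - cut x * cl M (f x))\<^sup>2"
        unfolding cl_def by (intro tendsto_intros lim elim)
      then show ?case by (simp add: h_def fcl[symmetric])
    qed
    show "AE x in lborel. norm ((cl M (f x) - h n x)\<^sup>2) \<le> (2 * real M * indicator (cball 0 (B+1)) x)\<^sup>2" for n
      using bnd2 by (intro AE_I2) simp
  qed auto
  then have "\<forall>\<^sub>F n in sequentially. (\<integral>x. (cl M (f x) - h n x)\<^sup>2 \<partial>lborel) < e / 4"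
    using e by (intro order_tendstoD(2)[of _ 0]) auto
  then obtain n where n: "(\<integral>x. (cl M (f x) - h n x)\<^sup>2 \<partial>lborel) < e / 4"
    by (auto simp: eventually_sequentially)
  have intn: "integrable lborel (\<lambda>x. (cl M (f x) - h n x)\<^sup>2)"
    by (rule Bochner_Integration.integrable_bound[OF intb]) (use bnd2 in auto)
  have sq: "(f x - h n x)\<^sup>2 \<le> 2 * (f x - cl M (f x))\<^sup>2 + 2 * (cl M (f x) - h n x)\<^sup>2" for x
    using sum_squares_bound[of "f x - cl M (f x)" "cl M (f x) - h n x"]
    by (simp add: power2_eq_square algebra_simps)
  have int2: "integrable lborel (\<lambda>x. 2 * (f x - cl M (f x))\<^sup>2 + 2 * (cl M (f x) - h n x)\<^sup>2)"
    using intM intn by simp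
  have "(\<integral>\<^sup>+x. ennreal ((f x - h n x)\<^sup>2) \<partial>lborel) \<le> (\<integral>\<^sup>+x. ennreal (2 * (f x - cl M (f x))\<^sup>2 + 2 * (cl M (f x) - h n x)\<^sup>2) \<partial>lborel)"
    using sq by (intro nn_integral_mono ennreal_leI) auto
  also have "\<dots> = ennreal (\<integral>x. 2 * (f x - cl M (f x))\<^sup>2 + 2 * (cl M (f x) - h n x)\<^sup>2 \<partial>lborel)"
    using int2 by (intro nn_integral_eq_integral) auto
  also have "\<dots> < ennreal e"
    using M n e intM intn by (intro ennreal_lessI) auto
  finally show ?thesis
    using cut(4) by (intro that[OF hc[of n]]) (auto simp: h_def)
qed

lemma integrable_if_square_integrable:
  fixes f :: "'a::euclidean_space \<Rightarrow> real"
  assumes [measurable]: "f \<in> borel_measurable borel" and int: "integrable lborel (\<lambda>x. (f x)\<^sup>2)"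
    and supp: "\<And>x. norm x > B \<Longrightarrow> f x = 0"
  shows "integrable lborel f"
proof (rule Bochner_Integration.integrable_bound)
  show "integrable lborel (\<lambda>x. indicator (cball 0 B) x + (f x)\<^sup>2)"
    by (intro Bochner_Integration.integrable_add int integrable_real_indicator) (use emeasure_lborel_cball_finite[of 0] in auto)
  have "\<bar>f x\<bar> \<le> 1 + (f x)\<^sup>2" for x
    using sum_squares_bound[of "\<bar>f x\<bar>" 1] by (simp add: power2_eq_square)
  then show "AE x in lborel. norm (f x) \<le> norm (indicator (cball 0 B) x + (f x)\<^sup>2)"
    using supp by (intro AE_I2) (auto simp: indicator_def not_le)
qed simp

section \<open>Mollification\<close>

locale mollifier =
  fixes \<Theta> :: "'a::euclidean_space \<Rightarrow> real" and R :: real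
  assumes smooth: "smooth_on UNIV \<Theta>" and nonneg: "\<Theta> z \<ge> 0"
    and supp: "\<Theta> z \<noteq> 0 \<Longrightarrow> norm z \<le> R" and int1: "(\<integral>\<^sup>+z. ennreal (\<Theta> z) \<partial>lborel) = 1"
begin

definition dil :: "real \<Rightarrow> 'a \<Rightarrow> real" where
  "dil s w = \<Theta> (w /\<^sub>R s) / s ^ DIM('a)"

text \<open>The kernel is taken at y - x, so the average at x looks at the points x + s z with z in
  the support of \<Theta>. For a kernel that is not even the sign matters: near the boundary the
  support will lie on the inward side and may avoid the origin.\<close>

definition moll :: "real \<Rightarrow> ('a \<Rightarrow> real) \<Rightarrow> 'a \<Rightarrow> real" where
  "moll s f x = (\<integral>y. f y * dil s (y - x) \<partial>lborel)"

lemma cont: "continuous_on UNIV \<Theta>"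
  by (rule smooth_continuous[OF smooth])

lemma meas [measurable]: "\<Theta> \<in> borel_measurable borel"
  by (rule borel_measurable_continuous_onI[OF cont])

lemma dil_meas [measurable]: "dil s \<in> borel_measurable borel"
  unfolding dil_def[abs_def] by measurable

lemma dil_nonneg: "s > 0 \<Longrightarrow> dil s w \<ge> 0"
  by (simp add: dil_def nonneg)

lemma dil_eq_0: "s > 0 \<Longrightarrow> norm w > s * R \<Longrightarrow> dil s w = 0"
  using supp[of "w /\<^sub>R s"] by (auto simp: dil_def field_simps)

lemma dil_int:
  assumes s: "s > 0"
  shows "(\<integral>\<^sup>+y. ennreal (dil s (y - x)) \<partial>lborel) = 1"
proof -
  have "(\<integral>\<^sup>+y. ennreal (dil s (y - x)) \<partial>lborel) = ennreal (\<bar>s\<bar> ^ DIM('a)) * (\<integral>\<^sup>+y. ennreal (dil s (x + s *\<^sub>R y - x)) \<partial>lborel)"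
    using s by (intro nn_integral_lborel_affine) auto
  also have "\<dots> = (\<integral>\<^sup>+y. ennreal (\<bar>s\<bar> ^ DIM('a)) * ennreal (dil s (x + s *\<^sub>R y - x)) \<partial>lborel)"
    by (rule nn_integral_cmult[symmetric]) simp
  also have "\<dots> = (\<integral>\<^sup>+y. ennreal (\<Theta> y) \<partial>lborel)"
    using s by (intro nn_integral_cong) (simp add: dil_def ennreal_mult[symmetric] nonneg)
  finally show ?thesis using int1 by simp
qed

lemma dil_int':
  assumes s: "s > 0"
  shows "(\<integral>\<^sup>+x. ennreal (dil s (y - x)) \<partial>lborel) = 1"
proof -
  have "(\<integral>\<^sup>+x. ennreal (dil s (y - x)) \<partial>lborel) = ennreal (\<bar>-1\<bar> ^ DIM('a)) * (\<integral>\<^sup>+x. ennreal (dil s (y - (y + (-1) *\<^sub>R x))) \<partial>lborel)"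
    by (intro nn_integral_lborel_affine) auto
  also have "\<dots> = 1" using dil_int[OF s, of 0] by simp
  finally show ?thesis .
qed

lemma bounded: "\<exists>C>0. \<forall>z. \<Theta> z \<le> C"
proof -
  have "compact (\<Theta> ` cball 0 R)"
    by (intro compact_continuous_image continuous_on_subset[OF cont]) auto
  then obtain C where "\<forall>x\<in>\<Theta> ` cball 0 R. norm x \<le> C"
    using compact_imp_bounded bounded_iff by blast
  then have C: "norm (\<Theta> z) \<le> C" if "norm z \<le> R" for z
    using that by simp
  have "\<Theta> z \<le> max C 1" for z
    using C[of z] supp[of z] by (cases "\<Theta> z = 0") auto
  then show ?thesis by (intro exI[of _ "max C 1"]) auto
qed

lemma dil_integrable:
  assumes "s > 0" "integrable lborel f"
  shows "integrable lborel (\<lambda>y. f y * dil s (y - x))"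
proof -
  obtain C where C: "\<And>z. \<Theta> z \<le> C" "C > 0" using bounded by blast
  have "integrable lborel (\<lambda>y. (C / s ^ DIM('a)) * f y)" using assms by simp
  then show ?thesis
  proof (rule Bochner_Integration.integrable_bound)
    have "\<bar>f y\<bar> * \<bar>\<Theta> z\<bar> / s ^ DIM('a) \<le> \<bar>f y\<bar> * C / s ^ DIM('a)" for y z
      using C assms(1) nonneg by (intro divide_right_mono mult_left_mono) auto
    from this[of _ "(_ - x) /\<^sub>R s"]
    show "AE y in lborel. norm (f y * dil s (y - x)) \<le> norm (C / s ^ DIM('a) * f y)"
      using assms(1) C by (intro AE_I2) (simp add: dil_def abs_mult mult.commute[of C])
  qed (use assms in measurable)
qed

lemma moll_meas [measurable]:
  assumes [measurable]: "f \<in> borel_measurable borel"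
  shows "moll s f \<in> borel_measurable borel"
proof -
  have "(\<lambda>x. \<integral>y. f y * dil s (y - x) \<partial>lborel) \<in> borel_measurable lborel"
    by measurable
  then show ?thesis by (simp add: moll_def[abs_def])
qed

lemma moll_diff:
  assumes "s > 0" "integrable lborel f" "integrable lborel g"
  shows "moll s (\<lambda>x. f x - g x) x = moll s f x - moll s g x"
  unfolding moll_def using dil_integrable[OF assms(1,2)] dil_integrable[OF assms(1,3)]
  by (simp add: left_diff_distrib)

text \<open>Schur's test with both marginals equal to 1, by \<open>dil_int\<close> and
  \<open>dil_int'\<close>.\<close>

lemma moll_L2_le:
  assumes [measurable]: "f \<in> borel_measurable borel" and s: "s > 0" and int: "integrable lborel f"
  shows "(\<integral>\<^sup>+x. ennreal ((moll s f x)\<^sup>2) \<partial>lborel) \<le> (\<integral>\<^sup>+x. ennreal ((f x)\<^sup>2) \<partial>lborel)"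
proof -
  have "(\<integral>\<^sup>+x. ennreal ((moll s f x)\<^sup>2) \<partial>lborel) \<le> (\<integral>\<^sup>+x. (\<integral>\<^sup>+y. ennreal (dil s (y - x)) * ennreal \<bar>f y\<bar> \<partial>lborel)\<^sup>2 \<partial>lborel)"
  proof (intro nn_integral_mono)
    fix x
    have "ennreal \<bar>moll s f x\<bar> \<le> (\<integral>\<^sup>+y. ennreal \<bar>f y * dil s (y - x)\<bar> \<partial>lborel)"
      unfolding moll_def using integral_norm_bound_ennreal[OF dil_integrable[OF s int, of x]] by simp
    also have "\<dots> = (\<integral>\<^sup>+y. ennreal (dil s (y - x)) * ennreal \<bar>f y\<bar> \<partial>lborel)"
      using dil_nonneg[OF s] by (intro nn_integral_cong) (simp add: abs_mult ennreal_mult mult.commute)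
    finally have "(ennreal \<bar>moll s f x\<bar>)\<^sup>2 \<le> (\<integral>\<^sup>+y. ennreal (dil s (y - x)) * ennreal \<bar>f y\<bar> \<partial>lborel)\<^sup>2"
      by (rule power_mono) simp
    then show "ennreal ((moll s f x)\<^sup>2) \<le> (\<integral>\<^sup>+y. ennreal (dil s (y - x)) * ennreal \<bar>f y\<bar> \<partial>lborel)\<^sup>2"
      by (simp add: ennreal_power)
  qed
  also have "\<dots> \<le> 1 * 1 * (\<integral>\<^sup>+y. (ennreal \<bar>f y\<bar>)\<^sup>2 \<partial>lborel)"
    by (intro schur_test) (auto simp: dil_int[OF s] dil_int'[OF s] sigma_finite_lborel)
  finally show ?thesis by (simp add: ennreal_power)
qed

lemma moll_continuous_approx:
  assumes g: "continuous_on UNIV g" and gs: "\<And>x. norm x > B \<Longrightarrow> g x = 0" and e: "e > 0"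
  shows "\<exists>s0>0. \<forall>s x. 0 < s \<longrightarrow> s < s0 \<longrightarrow> \<bar>moll s g x - g x\<bar> \<le> e"
proof -
  have "uniformly_continuous_on UNIV g" by (rule compact_support_uniformly_continuous[OF g gs])
  then obtain d where d: "d > 0" "\<And>x x'. dist x' x < d \<Longrightarrow> dist (g x') (g x) < e"
    using e unfolding uniformly_continuous_on_def by (metis UNIV_I)
  have [measurable]: "g \<in> borel_measurable borel" by (rule borel_measurable_continuous_onI[OF g])
  have gi: "integrable lborel g"
  proof -
    have "integrable lborel (\<lambda>x. indicator (cball 0 B) x *\<^sub>R g x)"
      by (rule borel_integrable_compact) (auto intro: continuous_on_subset[OF g])
    also have "(\<lambda>x. indicator (cball 0 B) x *\<^sub>R g x) = g"
      using gs by (auto simp: indicator_def fun_eq_iff not_le)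
    finally show ?thesis .
  qed
  show ?thesis
  proof (intro exI[of _ "d / (\<bar>R\<bar> + 1)"] conjI allI impI)
    show "d / (\<bar>R\<bar> + 1) > 0" using d by auto
    fix s x assume s: "0 < s" "s < d / (\<bar>R\<bar> + 1)"
    have di: "integrable lborel (\<lambda>y. dil s (y - x))"
      using dil_int[OF s(1), of x] dil_nonneg[OF s(1)] by (intro integrableI_nonneg) auto
    have d1: "(\<integral>y. dil s (y - x) \<partial>lborel) = 1"
      using dil_int[OF s(1), of x] dil_nonneg[OF s(1)] by (subst integral_eq_nn_integral) auto
    have sR: "s * R < d"
    proof -
      have "s * R \<le> s * (\<bar>R\<bar> + 1)" using s by (intro mult_left_mono) auto
      also have "\<dots> < d" using s by (simp add: field_simps)
      finally show ?thesis .
    qed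
    have "moll s g x - g x = (\<integral>y. g y * dil s (y - x) \<partial>lborel) - (\<integral>y. g x * dil s (y - x) \<partial>lborel)"
      using d1 by (simp add: moll_def)
    also have "\<dots> = (\<integral>y. g y * dil s (y - x) - g x * dil s (y - x) \<partial>lborel)"
      by (rule Bochner_Integration.integral_diff[symmetric]) (use dil_integrable[OF s(1) gi] di in auto)
    finally have "\<bar>moll s g x - g x\<bar> \<le> (\<integral>y. \<bar>g y * dil s (y - x) - g x * dil s (y - x)\<bar> \<partial>lborel)"
      by (simp add: integral_abs_bound)
    also have "\<dots> \<le> (\<integral>y. e * dil s (y - x) \<partial>lborel)"
    proof (rule integral_mono)
      show "\<bar>g y * dil s (y - x) - g x * dil s (y - x)\<bar> \<le> e * dil s (y - x)" for y
      proof (cases "dil s (y - x) = 0")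
        case False
        then have "norm (y - x) \<le> s * R" using dil_eq_0[OF s(1), of "y - x"] by force
        then have "dist (g y) (g x) < e" using sR by (intro d) (simp add: dist_norm)
        then have "\<bar>g y - g x\<bar> * dil s (y - x) \<le> e * dil s (y - x)"
          using dil_nonneg[OF s(1)] by (intro mult_right_mono) (auto simp: dist_real_def)
        then show ?thesis using dil_nonneg[OF s(1), of "y - x"]
          by (simp add: left_diff_distrib[symmetric] abs_mult)
      qed simp
    qed (use dil_integrable[OF s(1) gi, of x] di in auto)
    also have "\<dots> = e" using d1 by simp
    finally show "\<bar>moll s g x - g x\<bar> \<le> e" .
  qed
qed

text \<open>For continuous functions of bounded support the convergence is uniform; the contraction
  property \<open>moll_L2_le\<close> carries it over to L^2 by density.\<close>

lemma moll_L2_tendsto: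
  assumes f [measurable]: "f \<in> borel_measurable borel" and int: "integrable lborel (\<lambda>x. (f x)\<^sup>2)"
    and fs: "\<And>x. norm x > B \<Longrightarrow> f x = 0" and e: "e > 0"
  shows "\<exists>s0>0. \<forall>s. 0 < s \<longrightarrow> s < s0 \<longrightarrow> (\<integral>\<^sup>+x. ennreal ((moll s f x - f x)\<^sup>2) \<partial>lborel) \<le> ennreal e"
proof -
  \<comment> \<open>Three squared errors of at most e/9 enter with the factor 3 of (a + b + c)^2 <=
    3 a^2 + 3 b^2 + 3 c^2.\<close>
  obtain g where gc: "continuous_on UNIV g" and gs: "\<And>x. norm x > B + 1 \<Longrightarrow> g x = 0"
    and fg: "(\<integral>\<^sup>+x. ennreal ((f x - g x)\<^sup>2) \<partial>lborel) < ennreal (e / 9)"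
    using continuous_dense_L2[OF f int fs, of B "e/9"] e by auto
  have [measurable]: "g \<in> borel_measurable borel" by (rule borel_measurable_continuous_onI[OF gc])
  have fi: "integrable lborel f" by (rule integrable_if_square_integrable[OF f int fs])
  have gi: "integrable lborel g"
  proof -
    have "integrable lborel (\<lambda>x. indicator (cball 0 (B+1)) x *\<^sub>R g x)"
      by (rule borel_integrable_compact) (auto intro: continuous_on_subset[OF gc])
    also have "(\<lambda>x. indicator (cball 0 (B+1)) x *\<^sub>R g x) = g"
      using gs by (auto simp: indicator_def fun_eq_iff not_le)
    finally show ?thesis .
  qed
  \<comment> \<open>Volume of a ball that carries \<open>moll s g\<close> and g for all s < 1; it
    converts the uniform error e' into an L^2 error.\<close>
  define V where "V = measure lborel (cball (0::'a) (B + 2 + \<bar>R\<bar>))"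
  have V: "emeasure lborel (cball (0::'a) (B + 2 + \<bar>R\<bar>)) = ennreal V" "V \<ge> 0"
    unfolding V_def using emeasure_lborel_cball_finite[of "0::'a" "B + 2 + \<bar>R\<bar>"]
    by (auto intro!: emeasure_eq_ennreal_measure)
  define e' where "e' = sqrt (e / (9 * (V + 1)))"
  have e': "e' > 0" "e'\<^sup>2 * V \<le> e / 9" using e V(2) by (auto simp: e'_def field_simps)
  obtain s0 where s0: "s0 > 0" "\<And>s x. 0 < s \<Longrightarrow> s < s0 \<Longrightarrow> \<bar>moll s g x - g x\<bar> \<le> e'"
    using moll_continuous_approx[OF gc gs e'(1)] by blast
  show ?thesis
  proof (intro exI[of _ "min s0 1"] conjI allI impI)
    show "min s0 1 > 0" using s0 by simp
    fix s :: real assume s: "0 < s" "s < min s0 1"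
    have far: "moll s g x = 0" if "norm x > B + 2 + \<bar>R\<bar>" for x
    proof -
      have "g y * dil s (y - x) = 0" for y
      proof (cases "norm y > B + 1")
        case False
        have "norm x \<le> norm y + norm (y - x)" using norm_triangle_ineq2[of x y] by (simp add: norm_minus_commute)
        moreover have "s * R \<le> \<bar>R\<bar>"
        proof -
          have "s * R \<le> s * \<bar>R\<bar>" using s by (intro mult_left_mono) auto
          also have "\<dots> \<le> 1 * \<bar>R\<bar>" using s by (intro mult_right_mono) auto
          finally show ?thesis by simp
        qed
        ultimately have "norm (y - x) > s * R" using that False by auto
        then show ?thesis using dil_eq_0[OF s(1)] by simp
      qed (use gs in auto)
      then show ?thesis unfolding moll_def by (intro integral_eq_zero_AE AE_I2)
    qed
    have 2: "(\<integral>\<^sup>+x. ennreal ((moll s g x - g x)\<^sup>2) \<partial>lborel) \<le> ennreal (e / 9)"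
    proof -
      have "(\<integral>\<^sup>+x. ennreal ((moll s g x - g x)\<^sup>2) \<partial>lborel) \<le> (\<integral>\<^sup>+x. ennreal (e'\<^sup>2) * indicator (cball (0::'a) (B + 2 + \<bar>R\<bar>)) x \<partial>lborel)"
      proof (intro nn_integral_mono)
        fix x :: 'a
        have "(moll s g x - g x)\<^sup>2 \<le> e'\<^sup>2"
          using s0(2)[OF s(1), of x] s by (simp add: abs_le_square_iff[symmetric])
        then show "ennreal ((moll s g x - g x)\<^sup>2) \<le> ennreal (e'\<^sup>2) * indicator (cball 0 (B + 2 + \<bar>R\<bar>)) x"
          using far[of x] gs[of x] by (auto simp: indicator_def not_le intro: ennreal_leI)
      qed
      also have "\<dots> = ennreal (e'\<^sup>2) * ennreal V" by (simp add: nn_integral_cmult_indicator V)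
      also have "\<dots> = ennreal (e'\<^sup>2 * V)" using V(2) by (simp add: ennreal_mult)
      also have "\<dots> \<le> ennreal (e / 9)" using e' by (intro ennreal_leI)
      finally show ?thesis .
    qed
    have 1: "(\<integral>\<^sup>+x. ennreal ((moll s f x - moll s g x)\<^sup>2) \<partial>lborel) \<le> ennreal (e / 9)"
      using moll_L2_le[of "\<lambda>x. f x - g x" s] fi gi s fg by (simp add: moll_diff)
    have "(moll s f x - f x)\<^sup>2 \<le> 3 * (moll s f x - moll s g x)\<^sup>2 + 3 * (moll s g x - g x)\<^sup>2 + 3 * (f x - g x)\<^sup>2" for x
    proof -
      have "(a + b + c)\<^sup>2 \<le> 3 * a\<^sup>2 + 3 * b\<^sup>2 + 3 * c\<^sup>2" for a b c :: real
        using sum_squares_bound[of a b] sum_squares_bound[of a c] sum_squares_bound[of b c]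
        by (simp add: power2_eq_square algebra_simps)
      from this[of "moll s f x - moll s g x" "moll s g x - g x" "g x - f x"]
      show ?thesis by (simp add: power2_commute)
    qed
    then have "(\<integral>\<^sup>+x. ennreal ((moll s f x - f x)\<^sup>2) \<partial>lborel) \<le>
       (\<integral>\<^sup>+x. 3 * ennreal ((moll s f x - moll s g x)\<^sup>2) + 3 * ennreal ((moll s g x - g x)\<^sup>2) + 3 * ennreal ((f x - g x)\<^sup>2) \<partial>lborel)"
      by (intro nn_integral_mono) (simp add: ennreal_numeral[symmetric] ennreal_mult[symmetric] ennreal_plus[symmetric] ennreal_leI del: ennreal_numeral ennreal_plus)
    also have "\<dots> = 3 * (\<integral>\<^sup>+x. ennreal ((moll s f x - moll s g x)\<^sup>2) \<partial>lborel) + 3 * (\<integral>\<^sup>+x. ennreal ((moll s g x - g x)\<^sup>2) \<partial>lborel)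
        + 3 * (\<integral>\<^sup>+x. ennreal ((f x - g x)\<^sup>2) \<partial>lborel)"
      by (simp add: nn_integral_add nn_integral_cmult)
    also have "\<dots> \<le> 3 * ennreal (e/9) + 3 * ennreal (e/9) + 3 * ennreal (e/9)"
      by (intro add_mono mult_left_mono 1 2 less_imp_le[OF fg]) auto
    also have "\<dots> = ennreal e"
      using e by (simp add: ennreal_numeral[symmetric] ennreal_mult[symmetric] ennreal_plus[symmetric] del: ennreal_numeral ennreal_plus)
    finally show "(\<integral>\<^sup>+x. ennreal ((moll s f x - f x)\<^sup>2) \<partial>lborel) \<le> ennreal e" .
  qed
qed

end

section \<open>Weak gradients\<close>

lemma cauchy_schwarz_integral:
  fixes f g :: "'a \<Rightarrow> real"
  assumes [measurable]: "f \<in> borel_measurable M" "g \<in> borel_measurable M"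
    and f: "integrable M (\<lambda>x. (f x)\<^sup>2)" and g: "integrable M (\<lambda>x. (g x)\<^sup>2)"
  shows integrable_mult_L2: "integrable M (\<lambda>x. f x * g x)"
    and "(\<integral>x. f x * g x \<partial>M)\<^sup>2 \<le> (\<integral>x. (f x)\<^sup>2 \<partial>M) * (\<integral>x. (g x)\<^sup>2 \<partial>M)"
proof -
  have "\<bar>f x * g x\<bar> \<le> (f x)\<^sup>2 + (g x)\<^sup>2" for x
    using sum_squares_bound[of "\<bar>f x\<bar>" "\<bar>g x\<bar>"] mult_nonneg_nonneg[of "\<bar>f x\<bar>" "\<bar>g x\<bar>"]
    unfolding abs_mult power2_abs by linarith
  then show int: "integrable M (\<lambda>x. f x * g x)"
    by (intro Bochner_Integration.integrable_bound[OF Bochner_Integration.integrable_add[OF f g]]) auto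
  have "ennreal ((\<integral>x. f x * g x \<partial>M)\<^sup>2) = (ennreal \<bar>\<integral>x. f x * g x \<partial>M\<bar>)\<^sup>2"
    by (simp add: ennreal_power)
  also have "\<dots> \<le> (\<integral>\<^sup>+x. ennreal \<bar>f x * g x\<bar> \<partial>M)\<^sup>2"
    using integral_norm_bound_ennreal[OF int] by (intro power_mono) auto
  also have "\<dots> = (\<integral>\<^sup>+x. ennreal \<bar>f x\<bar> * ennreal \<bar>g x\<bar> \<partial>M)\<^sup>2"
    by (simp add: abs_mult ennreal_mult)
  also have "\<dots> \<le> (\<integral>\<^sup>+x. (ennreal \<bar>f x\<bar>)\<^sup>2 \<partial>M) * (\<integral>\<^sup>+x. (ennreal \<bar>g x\<bar>)\<^sup>2 \<partial>M)"
    by (rule Cauchy_Schwarz_nn_integral) auto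
  also have "\<dots> = (\<integral>\<^sup>+x. ennreal ((f x)\<^sup>2) \<partial>M) * (\<integral>\<^sup>+x. ennreal ((g x)\<^sup>2) \<partial>M)"
    by (simp add: ennreal_power)
  also have "\<dots> = ennreal ((\<integral>x. (f x)\<^sup>2 \<partial>M) * (\<integral>x. (g x)\<^sup>2 \<partial>M))"
    by (simp add: nn_integral_eq_integral f g ennreal_mult)
  finally show "(\<integral>x. f x * g x \<partial>M)\<^sup>2 \<le> (\<integral>x. (f x)\<^sup>2 \<partial>M) * (\<integral>x. (g x)\<^sup>2 \<partial>M)"
    by (simp add: ennreal_le_iff)
qed

lemma (in finite_measure) integral_L1_le_L2:
  fixes f :: "'a \<Rightarrow> 'b::{banach,second_countable_topology}"
  assumes [measurable]: "f \<in> borel_measurable M" and f: "integrable M (\<lambda>x. (norm (f x))\<^sup>2)"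
  shows "integrable M f" "(\<integral>x. norm (f x) \<partial>M)\<^sup>2 \<le> measure M (space M) * (\<integral>x. (norm (f x))\<^sup>2 \<partial>M)"
proof -
  have "integrable M (\<lambda>x. norm (f x) * 1)" "(\<integral>x. norm (f x) * 1 \<partial>M)\<^sup>2 \<le> (\<integral>x. (norm (f x))\<^sup>2 \<partial>M) * (\<integral>x. 1\<^sup>2 \<partial>M)"
    by (rule cauchy_schwarz_integral; use f in simp)+
  then show "integrable M f" "(\<integral>x. norm (f x) \<partial>M)\<^sup>2 \<le> measure M (space M) * (\<integral>x. (norm (f x))\<^sup>2 \<partial>M)"
    by (simp_all add: integrable_norm_iff mult.commute)
qed

lemma norm_add_square_le: "(norm (a + b))\<^sup>2 \<le> 2 * (norm a)\<^sup>2 + 2 * (norm (b::'b::real_normed_vector))\<^sup>2"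
proof -
  have "(norm (a + b))\<^sup>2 \<le> (norm a + norm b)\<^sup>2"
    by (intro power_mono norm_triangle_ineq) auto
  also have "\<dots> \<le> 2 * (norm a)\<^sup>2 + 2 * (norm b)\<^sup>2"
    using sum_squares_bound[of "norm a" "norm b"] by (simp add: power2_sum)
  finally show ?thesis .
qed

lemma integrable_norm_square_add:
  fixes f g :: "'a \<Rightarrow> 'b::{banach,second_countable_topology}"
  assumes [measurable]: "f \<in> borel_measurable M" "g \<in> borel_measurable M"
    and "integrable M (\<lambda>x. (norm (f x))\<^sup>2)" "integrable M (\<lambda>x. (norm (g x))\<^sup>2)"
  shows "integrable M (\<lambda>x. (norm (f x + g x))\<^sup>2)"
proof (rule Bochner_Integration.integrable_bound)
  show "integrable M (\<lambda>x. 2 * (norm (f x))\<^sup>2 + 2 * (norm (g x))\<^sup>2)" using assms by simp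
  show "AE x in M. norm ((norm (f x + g x))\<^sup>2) \<le> norm (2 * (norm (f x))\<^sup>2 + 2 * (norm (g x))\<^sup>2)"
    using norm_add_square_le[of "f _" "g _"] by (intro AE_I2) (simp add: abs_of_nonneg)
qed simp

lemma integrable_norm_square_scaleR:
  fixes f :: "'a \<Rightarrow> 'b::{banach,second_countable_topology}"
  assumes "integrable M (\<lambda>x. (norm (f x))\<^sup>2)"
  shows "integrable M (\<lambda>x. (norm (c *\<^sub>R f x))\<^sup>2)"
  using assms by (simp add: power_mult_distrib)

lemma integrable_norm_square_diff:
  fixes f g :: "'a \<Rightarrow> 'b::{banach,second_countable_topology}"
  assumes [measurable]: "f \<in> borel_measurable M" "g \<in> borel_measurable M"
    and "integrable M (\<lambda>x. (norm (f x))\<^sup>2)" "integrable M (\<lambda>x. (norm (g x))\<^sup>2)"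
  shows "integrable M (\<lambda>x. (norm (f x - g x))\<^sup>2)"
  using integrable_norm_square_add[of f M "\<lambda>x. - g x"] assms by simp

text \<open>Riesz-Fischer. On a finite measure space an L^2 Cauchy sequence is L^1 Cauchy and so has
  an a.e. convergent subsequence; Fatou's lemma bounds the L^2 distance to its limit.\<close>

lemma (in finite_measure) L2_complete:
  fixes f :: "nat \<Rightarrow> 'a \<Rightarrow> 'b::{banach,second_countable_topology}"
  assumes meas [measurable]: "\<And>n. f n \<in> borel_measurable M"
    and int: "\<And>n. integrable M (\<lambda>x. (norm (f n x))\<^sup>2)"
    and cau: "\<And>e. e > 0 \<Longrightarrow> \<exists>N. \<forall>m\<ge>N. \<forall>n\<ge>N. (\<integral>x. (norm (f m x - f n x))\<^sup>2 \<partial>M) < e"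
  obtains g where "g \<in> borel_measurable M" "integrable M (\<lambda>x. (norm (g x))\<^sup>2)"
    "\<And>e. e > 0 \<Longrightarrow> \<exists>N. \<forall>n\<ge>N. (\<integral>x. (norm (f n x - g x))\<^sup>2 \<partial>M) < e"
    "\<exists>r. strict_mono r \<and> (AE x in M. (\<lambda>n. f (r n) x) \<longlonglongrightarrow> g x)"
proof -
  let ?m = "measure M (space M)"
  have intd: "integrable M (\<lambda>x. (norm (f m x - f n x))\<^sup>2)" for m n
    by (intro integrable_norm_square_diff int meas)
  have "\<exists>N. \<forall>i\<ge>N. \<forall>j\<ge>N. (\<integral>x. norm (f i x - f j x) \<partial>M) < e" if e: "e > 0" for e
  proof -
    have "e\<^sup>2 / (?m + 1) > 0" using e by (simp add: add_nonneg_pos)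
    then obtain N where N: "\<And>i j. i \<ge> N \<Longrightarrow> j \<ge> N \<Longrightarrow> (\<integral>x. (norm (f i x - f j x))\<^sup>2 \<partial>M) < e\<^sup>2 / (?m + 1)"
      using cau by blast
    have "(\<integral>x. norm (f i x - f j x) \<partial>M) < e" if "i \<ge> N" "j \<ge> N" for i j
    proof -
      have "(\<integral>x. norm (f i x - f j x) \<partial>M)\<^sup>2 \<le> ?m * (\<integral>x. (norm (f i x - f j x))\<^sup>2 \<partial>M)"
        by (rule integral_L1_le_L2) (auto simp: intd)
      also have "\<dots> \<le> ?m * (e\<^sup>2 / (?m + 1))"
        using N[OF that] by (intro mult_left_mono) auto
      also have "\<dots> < e\<^sup>2"
      proof -
        have "?m / (?m + 1) < 1" by (simp add: divide_less_eq add_nonneg_pos)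
        then have "e\<^sup>2 * (?m / (?m + 1)) < e\<^sup>2 * 1" using e by (intro mult_strict_left_mono) auto
        then show ?thesis by (simp add: mult.commute)
      qed
      finally show ?thesis using e by (simp add: power2_less_imp_less)
    qed
    then show ?thesis by blast
  qed
  moreover have "integrable M (f n)" for n by (rule integral_L1_le_L2[OF meas int])
  ultimately obtain r where r: "strict_mono r" "AE x in M. Cauchy (\<lambda>i. f (r i) x)"
    using cauchy_L1_AE_cauchy_subseq[of M f] by blast
  define g where "g x = lim (\<lambda>i. f (r i) x)" for x
  have [measurable]: "g \<in> borel_measurable M" unfolding g_def[abs_def] by measurable
  have lim: "AE x in M. (\<lambda>i. f (r i) x) \<longlonglongrightarrow> g x"
    using r(2) by eventually_elim (simp add: g_def Cauchy_convergent_iff convergent_LIMSEQ_iff)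
  have key: "\<exists>N. \<forall>n\<ge>N. (\<integral>\<^sup>+x. ennreal ((norm (f n x - g x))\<^sup>2) \<partial>M) \<le> ennreal e" if "e > 0" for e
  proof -
    obtain N where N: "\<And>i j. i \<ge> N \<Longrightarrow> j \<ge> N \<Longrightarrow> (\<integral>x. (norm (f i x - f j x))\<^sup>2 \<partial>M) < e"
      using cau \<open>e > 0\<close> by blast
    have "(\<integral>\<^sup>+x. ennreal ((norm (f n x - g x))\<^sup>2) \<partial>M) \<le> ennreal e" if "n \<ge> N" for n
    proof -
      have "(\<integral>\<^sup>+x. ennreal ((norm (f n x - g x))\<^sup>2) \<partial>M) = (\<integral>\<^sup>+x. liminf (\<lambda>i. ennreal ((norm (f n x - f (r i) x))\<^sup>2)) \<partial>M)"
      proof (rule nn_integral_cong_AE)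
        show "AE x in M. ennreal ((norm (f n x - g x))\<^sup>2) = liminf (\<lambda>i. ennreal ((norm (f n x - f (r i) x))\<^sup>2))"
          using lim
        proof eventually_elim
          case (elim x)
          have *: "(\<lambda>i. ennreal ((norm (f n x - f (r i) x))\<^sup>2)) \<longlonglongrightarrow> ennreal ((norm (f n x - g x))\<^sup>2)"
            by (intro tendsto_intros elim)
          show ?case using lim_imp_Liminf[OF sequentially_bot *] by simp
        qed
      qed
      also have "\<dots> \<le> liminf (\<lambda>i. \<integral>\<^sup>+x. ennreal ((norm (f n x - f (r i) x))\<^sup>2) \<partial>M)"
        by (rule nn_integral_liminf) auto
      also have "\<dots> = liminf (\<lambda>i. ennreal (\<integral>x. (norm (f n x - f (r i) x))\<^sup>2 \<partial>M))"
        by (simp add: nn_integral_eq_integral intd)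
      also have "\<dots> \<le> liminf (\<lambda>i::nat. ennreal e)"
      proof (rule Liminf_mono, rule eventually_sequentiallyI)
        fix i assume "i \<ge> N"
        then have "r i \<ge> N" using seq_suble[OF r(1), of i] by simp
        then show "ennreal (\<integral>x. (norm (f n x - f (r i) x))\<^sup>2 \<partial>M) \<le> ennreal e"
          using N[OF that] by (intro ennreal_leI less_imp_le)
      qed
      also have "\<dots> = ennreal e" by (simp add: Liminf_const)
      finally show ?thesis .
    qed
    then show ?thesis by blast
  qed
  have inte: "integrable M (\<lambda>x. (norm (f n x - g x))\<^sup>2)" if "(\<integral>\<^sup>+x. ennreal ((norm (f n x - g x))\<^sup>2) \<partial>M) \<le> ennreal e" for n e
    using that by (intro integrableI_bounded) (auto simp: less_top[symmetric] top_unique)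
  obtain N where N: "\<And>n. n \<ge> N \<Longrightarrow> (\<integral>\<^sup>+x. ennreal ((norm (f n x - g x))\<^sup>2) \<partial>M) \<le> ennreal 1"
    using key[of 1] by auto
  \<comment> \<open>The limit is square integrable as \<open>f N\<close> minus a difference of
    finite L^2 norm.\<close>
  have "integrable M (\<lambda>x. (norm (f N x - (f N x - g x)))\<^sup>2)"
    by (intro integrable_norm_square_diff int inte[OF N]) auto
  then have gi: "integrable M (\<lambda>x. (norm (g x))\<^sup>2)" by simp
  have "\<exists>N. \<forall>n\<ge>N. (\<integral>x. (norm (f n x - g x))\<^sup>2 \<partial>M) < e" if "e > 0" for e
  proof -
    obtain N where N: "\<And>n. n \<ge> N \<Longrightarrow> (\<integral>\<^sup>+x. ennreal ((norm (f n x - g x))\<^sup>2) \<partial>M) \<le> ennreal (e/2)"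
      using key[of "e/2"] \<open>e > 0\<close> by auto
    have "(\<integral>x. (norm (f n x - g x))\<^sup>2 \<partial>M) < e" if "n \<ge> N" for n
    proof -
      have "ennreal (\<integral>x. (norm (f n x - g x))\<^sup>2 \<partial>M) \<le> ennreal (e/2)"
        using N[OF that] inte[OF N[OF that]] by (simp add: nn_integral_eq_integral)
      then show ?thesis using \<open>e > 0\<close> by (simp add: ennreal_le_iff)
    qed
    then show ?thesis by blast
  qed
  then show ?thesis by (rule that[OF \<open>g \<in> borel_measurable M\<close> gi _ exI[of _ r]]) (simp_all add: r(1) lim)
qed

section \<open>Passing between Lebesgue measure on a set and Borel measure on the whole
  space\<close>

lemma integral_lebesgue_on_eq_lborel:
  fixes f F :: "'a::euclidean_space \<Rightarrow> 'b::euclidean_space"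
  assumes S: "S \<in> sets borel" and F [measurable]: "F \<in> borel_measurable borel"
    and F0: "\<And>x. x \<notin> S \<Longrightarrow> F x = 0" and f: "f \<in> borel_measurable (lebesgue_on S)" and ae: "AE x in lebesgue_on S. f x = F x"
  shows "(\<integral>x. f x \<partial>lebesgue_on S) = (\<integral>x. F x \<partial>lborel)"
    "integrable (lebesgue_on S) f \<longleftrightarrow> integrable lborel F"
proof -
  have Sl: "S \<in> sets lebesgue" using S by simp
  have Fl: "F \<in> borel_measurable (lebesgue_on S)"
    by (intro measurable_restrict_space1 measurable_completion) simp
  have eq: "(\<lambda>x. indicator S x *\<^sub>R F x) = F" using F0 by (auto simp: indicator_def)
  have "(\<integral>x. f x \<partial>lebesgue_on S) = (\<integral>x. F x \<partial>lebesgue_on S)"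
    by (rule integral_cong_AE[OF f Fl ae])
  also have "\<dots> = (\<integral>x. indicator S x *\<^sub>R F x \<partial>lebesgue)"
    using Sl by (simp add: integral_restrict_space)
  also have "\<dots> = (\<integral>x. F x \<partial>lborel)" unfolding eq by (simp add: integral_completion)
  finally show "(\<integral>x. f x \<partial>lebesgue_on S) = (\<integral>x. F x \<partial>lborel)" .
  have "integrable (lebesgue_on S) f \<longleftrightarrow> integrable (lebesgue_on S) F"
    by (rule integrable_cong_AE[OF f Fl ae])
  also have "\<dots> \<longleftrightarrow> integrable lebesgue (\<lambda>x. indicator S x *\<^sub>R F x)"
    using Sl by (simp add: integrable_restrict_space)
  also have "\<dots> \<longleftrightarrow> integrable lborel F" unfolding eq by (simp add: integrable_completion)
  finally show "integrable (lebesgue_on S) f \<longleftrightarrow> integrable lborel F" .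
qed

lemma AE_lebesgue_on_iff:
  assumes "S \<in> sets borel"
  shows "(AE x in lebesgue_on S. P x) \<longleftrightarrow> (AE x in lborel. x \<in> S \<longrightarrow> P x)"
  using assms by (simp add: AE_restrict_space_iff AE_completion_iff)

text \<open>The definitions live on \<open>lebesgue_on S\<close>, whereas Fubini and translations
  are applied to Borel functions on \<open>lborel\<close>. A Borel representative extended by 0
  connects the two worlds.\<close>

lemma borel_representative_real:
  fixes u :: "'a::euclidean_space \<Rightarrow> real"
  assumes S: "S \<in> sets borel" and u: "u \<in> borel_measurable (lebesgue_on S)"
  obtains U where "U \<in> borel_measurable borel" "\<And>x. x \<notin> S \<Longrightarrow> U x = 0" "AE x in lebesgue_on S. u x = U x"
proof -
  have "(\<lambda>x. if x \<in> S then u x else 0) \<in> borel_measurable lebesgue"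
    using S u by (simp add: borel_measurable_if)
  then obtain V where V: "V \<in> borel_measurable lborel" "AE x in lborel. (if x \<in> S then u x else 0) = V x"
    using completion_ex_borel_measurable_real by blast
  show ?thesis
  proof (rule that[of "\<lambda>x. if x \<in> S then V x else 0"])
    have [measurable]: "V \<in> borel_measurable borel" "S \<in> sets borel" using V S by auto
    show "(\<lambda>x. if x \<in> S then V x else 0) \<in> borel_measurable borel" by measurable
    show "AE x in lebesgue_on S. u x = (if x \<in> S then V x else 0)"
      using V(2) unfolding AE_lebesgue_on_iff[OF S] by eventually_elim auto
  qed simp
qed

lemma borel_representative:
  fixes u :: "'a::euclidean_space \<Rightarrow> 'b::euclidean_space"
  assumes S: "S \<in> sets borel" and u: "u \<in> borel_measurable (lebesgue_on S)"
  obtains U where "U \<in> borel_measurable borel" "\<And>x. x \<notin> S \<Longrightarrow> U x = 0" "AE x in lebesgue_on S. u x = U x"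
proof -
  have "\<exists>V. \<forall>i\<in>Basis. V i \<in> borel_measurable borel \<and> (\<forall>x. x \<notin> S \<longrightarrow> V i x = 0) \<and> (AE x in lebesgue_on S. u x \<bullet> i = V i x)"
  proof (intro bchoice ballI)
    fix i :: 'b
    have "(\<lambda>x. u x \<bullet> i) \<in> borel_measurable (lebesgue_on S)" using u by simp
    from borel_representative_real[OF S this]
    show "\<exists>V. V \<in> borel_measurable borel \<and> (\<forall>x. x \<notin> S \<longrightarrow> V x = 0) \<and> (AE x in lebesgue_on S. u x \<bullet> i = V x)"
      by metis
  qed
  then obtain V where V: "\<And>i. i \<in> Basis \<Longrightarrow> V i \<in> borel_measurable borel" "\<And>i x. i \<in> Basis \<Longrightarrow> x \<notin> S \<Longrightarrow> V i x = 0"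
    "\<And>i. i \<in> Basis \<Longrightarrow> AE x in lebesgue_on S. u x \<bullet> i = V i x" by blast
  show ?thesis
  proof (rule that[of "\<lambda>x. \<Sum>i\<in>Basis. V i x *\<^sub>R i"])
    show "(\<lambda>x. \<Sum>i\<in>Basis. V i x *\<^sub>R i) \<in> borel_measurable borel"
      using V(1) by (auto intro!: borel_measurable_sum borel_measurable_scaleR)
    have "AE x in lebesgue_on S. \<forall>i\<in>Basis. u x \<bullet> i = V i x"
      using V(3) by (intro AE_finite_allI) auto
    then show "AE x in lebesgue_on S. u x = (\<Sum>i\<in>Basis. V i x *\<^sub>R i)"
      by eventually_elim (metis (no_types, lifting) euclidean_representation sum.cong)
  qed (use V(2) in auto)
qed

section \<open>Test functions and their derivatives\<close>

lemma frechet_derivative_zero_off_support: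
  fixes \<phi> :: "'a::euclidean_space \<Rightarrow> real"
  assumes "x \<notin> closure {x. \<phi> x \<noteq> 0}"
  shows "frechet_derivative \<phi> (at x) v = 0"
proof -
  have "(\<phi> has_derivative (\<lambda>h. 0)) (at x)"
  proof (rule has_derivative_transform_within_open[of "\<lambda>x. 0" _ _ _ "- closure {x. \<phi> x \<noteq> 0}"])
    show "0 = \<phi> y" if "y \<in> - closure {x. \<phi> x \<noteq> 0}" for y
      using that closure_subset[of "{x. \<phi> x \<noteq> 0}"] by auto
  qed (use assms in auto)
  then show ?thesis using frechet_derivative_at by metis
qed

lemma compact_support_bounded:
  fixes f :: "'a::euclidean_space \<Rightarrow> real"
  assumes "continuous_on UNIV f" "compact K" "\<And>x. x \<notin> K \<Longrightarrow> f x = 0"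
  obtains C where "C > 0" "\<And>x. \<bar>f x\<bar> \<le> C"
proof -
  have "compact (f ` K)"
    by (intro compact_continuous_image continuous_on_subset[OF assms(1)] assms) auto
  then obtain C where "\<forall>y\<in>f ` K. norm y \<le> C"
    using compact_imp_bounded bounded_iff by blast
  then have "\<bar>f x\<bar> \<le> max C 1" for x
    using assms(3)[of x] by (cases "x \<in> K") auto
  then show ?thesis by (intro that[of "max C 1"]) auto
qed

lemma test_funE:
  assumes "test_fun S \<phi>"
  obtains C where "C > 0" "\<And>x. \<bar>\<phi> x\<bar> \<le> C" "\<And>x i. i \<in> Basis \<Longrightarrow> \<bar>frechet_derivative \<phi> (at x) i\<bar> \<le> C"
proof -
  let ?K = "closure {x. \<phi> x \<noteq> 0}"
  have sm: "smooth_on UNIV \<phi>" and K: "compact ?K" using assms by (auto simp: test_fun_def)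
  have "\<phi> x = 0" if "x \<notin> ?K" for x using that closure_subset[of "{x. \<phi> x \<noteq> 0}"] by auto
  then obtain C0 where C0: "C0 > 0" "\<And>x. \<bar>\<phi> x\<bar> \<le> C0"
    using compact_support_bounded[OF smooth_continuous[OF sm] K] by metis
  have "\<forall>i\<in>Basis. \<exists>C. C > 0 \<and> (\<forall>x. \<bar>frechet_derivative \<phi> (at x) i\<bar> \<le> C)"
  proof
    fix i :: 'a
    show "\<exists>C. C > 0 \<and> (\<forall>x. \<bar>frechet_derivative \<phi> (at x) i\<bar> \<le> C)"
      using compact_support_bounded[OF smooth_derivative_continuous[OF sm] K, of i]
        frechet_derivative_zero_off_support by metis
  qed
  then obtain C1 where C1: "\<And>i x. i \<in> Basis \<Longrightarrow> 0 < C1 i \<and> \<bar>frechet_derivative \<phi> (at x) i\<bar> \<le> C1 i"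
    by (metis bchoice)
  show ?thesis
  proof (rule that[of "C0 + (\<Sum>i\<in>Basis. C1 i)"])
    have s: "(\<Sum>i\<in>Basis. C1 i) \<ge> 0" using C1 by (intro sum_nonneg) (auto intro: less_imp_le)
    then show "C0 + (\<Sum>i\<in>Basis. C1 i) > 0" "\<And>x. \<bar>\<phi> x\<bar> \<le> C0 + (\<Sum>i\<in>Basis. C1 i)" using C0 by (auto intro: add_increasing2)
    show "\<bar>frechet_derivative \<phi> (at x) i\<bar> \<le> C0 + (\<Sum>i\<in>Basis. C1 i)" if "i \<in> Basis" for x i
    proof -
      have "C1 i \<le> (\<Sum>i\<in>Basis. C1 i)" using C1 that by (intro member_le_sum) (auto intro: less_imp_le)
      then show ?thesis using C1[OF that, of x] C0 by linarith
    qed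
  qed
qed

lemma test_fun_measurable:
  assumes "test_fun S \<phi>"
  shows "\<phi> \<in> borel_measurable borel" "(\<lambda>x. frechet_derivative \<phi> (at x) i) \<in> borel_measurable borel"
  using assms smooth_continuous smooth_derivative_continuous
  by (auto simp: test_fun_def intro!: borel_measurable_continuous_onI)

lemma test_fun_zero:
  assumes "test_fun S \<phi>" "x \<notin> S"
  shows "\<phi> x = 0" "frechet_derivative \<phi> (at x) i = 0"
  using assms closure_subset[of "{x. \<phi> x \<noteq> 0}"] frechet_derivative_zero_off_support[of x \<phi> i]
  by (auto simp: test_fun_def)

lemma test_funI:
  assumes "smooth_on UNIV \<phi>" "compact K" "K \<subseteq> S" "\<And>x. x \<notin> K \<Longrightarrow> \<phi> x = 0"
  shows "test_fun S \<phi>"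
proof -
  have "{x. \<phi> x \<noteq> 0} \<subseteq> K" using assms(4) by auto
  then have sub: "closure {x. \<phi> x \<noteq> 0} \<subseteq> K" using assms(2) by (intro closure_minimal compact_imp_closed) auto
  then have "compact (closure {x. \<phi> x \<noteq> 0})"
    using assms(2) compact_Int_closed[OF assms(2), of "closure {x. \<phi> x \<noteq> 0}"] by (simp add: Int_absorb1)
  then show ?thesis using assms sub by (auto simp: test_fun_def)
qed

text \<open>Differentiation under the integral in integrated form: the fundamental theorem in \<tau>
  for each y, then Fubini. It serves for translating a test function, for changing the scale of a
  mollifier and for moving its centre.\<close>

lemma FTC_Fubini:
  fixes U :: "'a::euclidean_space \<Rightarrow> real" and \<Phi> \<Phi>' :: "real \<Rightarrow> 'a \<Rightarrow> real"
  assumes U: "integrable lborel U" and st: "s \<le> t"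
    and der: "\<And>\<tau> y. s \<le> \<tau> \<Longrightarrow> \<tau> \<le> t \<Longrightarrow> ((\<lambda>\<tau>. \<Phi> \<tau> y) has_real_derivative \<Phi>' \<tau> y) (at \<tau>)"
    and cont: "\<And>\<tau> y. s \<le> \<tau> \<Longrightarrow> \<tau> \<le> t \<Longrightarrow> isCont (\<lambda>\<tau>. \<Phi>' \<tau> y) \<tau>"
    and meas: "(\<lambda>(\<tau>, y). indicator {s..t} \<tau> * \<Phi>' \<tau> y) \<in> borel_measurable (borel \<Otimes>\<^sub>M borel)"
    and bnd: "\<And>\<tau> y. s \<le> \<tau> \<Longrightarrow> \<tau> \<le> t \<Longrightarrow> \<bar>\<Phi>' \<tau> y\<bar> \<le> C"
    and int: "integrable lborel (\<lambda>y. U y * \<Phi> s y)" "integrable lborel (\<lambda>y. U y * \<Phi> t y)"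
  shows "(\<integral>y. U y * \<Phi> t y \<partial>lborel) - (\<integral>y. U y * \<Phi> s y \<partial>lborel)
     = (\<integral>\<tau>. indicator {s..t} \<tau> * (\<integral>y. U y * \<Phi>' \<tau> y \<partial>lborel) \<partial>lborel)"
proof -
  have [measurable]: "U \<in> borel_measurable borel" using U by auto
  have C0: "C \<ge> 0" using bnd[of s] st by (force intro: order_trans[OF abs_ge_zero])
  have meas' [measurable]: "(\<lambda>z. indicator {s..t} (fst z) * \<Phi>' (fst z) (snd z)) \<in> borel_measurable (lborel \<Otimes>\<^sub>M lborel)"
    using meas by (simp add: case_prod_beta')
  have m2: "(\<lambda>z. U (snd z) * (indicator {s..t} (fst z) * \<Phi>' (fst z) (snd z))) \<in> borel_measurable (lborel \<Otimes>\<^sub>M lborel)"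
    by (intro borel_measurable_times meas') measurable
  have "integrable (lborel \<Otimes>\<^sub>M lborel) (\<lambda>(\<tau>,y). indicator {s..t} \<tau> * \<bar>U y\<bar>)"
  proof (rule lborel_pair.Fubini_integrable)
    show "integrable lborel (\<lambda>x. \<integral>y. norm (case (x, y) of (\<tau>, y) \<Rightarrow> indicator {s..t} \<tau> * \<bar>U y\<bar>) \<partial>lborel)"
      using st by (simp add: abs_mult)
  qed (use U in auto)
  then have "integrable (lborel \<Otimes>\<^sub>M lborel) (\<lambda>z. C * (indicator {s..t} (fst z) * \<bar>U (snd z)\<bar>))"
    by (simp add: case_prod_beta')
  then have I: "integrable (lborel \<Otimes>\<^sub>M lborel) (\<lambda>z. U (snd z) * (indicator {s..t} (fst z) * \<Phi>' (fst z) (snd z)))"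
  proof (rule Bochner_Integration.integrable_bound[OF _ m2], intro AE_I2)
    fix z :: "real \<times> 'a"
    show "norm (U (snd z) * (indicator {s..t} (fst z) * \<Phi>' (fst z) (snd z))) \<le> norm (C * (indicator {s..t} (fst z) * \<bar>U (snd z)\<bar>))"
      using bnd[of "fst z" "snd z"] C0 by (auto simp: indicator_def abs_mult mult.commute[of C] intro: mult_left_mono)
  qed
  have "(\<integral>y. U y * \<Phi> t y \<partial>lborel) - (\<integral>y. U y * \<Phi> s y \<partial>lborel) = (\<integral>y. U y * (\<Phi> t y - \<Phi> s y) \<partial>lborel)"
    using int by (simp add: right_diff_distrib)
  also have "\<dots> = (\<integral>y. (\<integral>\<tau>. U y * (indicator {s..t} \<tau> * \<Phi>' \<tau> y) \<partial>lborel) \<partial>lborel)"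
  proof (intro Bochner_Integration.integral_cong refl)
    fix y
    have "(\<integral>\<tau>. \<Phi>' \<tau> y * indicator {s..t} \<tau> \<partial>lborel) = \<Phi> t y - \<Phi> s y"
      by (rule integral_FTC_Icc_real[OF st der cont])
    then show "U y * (\<Phi> t y - \<Phi> s y) = (\<integral>\<tau>. U y * (indicator {s..t} \<tau> * \<Phi>' \<tau> y) \<partial>lborel)"
      by (simp add: mult.commute[of "indicator _ _"])
  qed
  also have "\<dots> = (\<integral>\<tau>. (\<integral>y. U y * (indicator {s..t} \<tau> * \<Phi>' \<tau> y) \<partial>lborel) \<partial>lborel)"
    by (rule lborel_pair.Fubini_integral) (use I in \<open>simp add: case_prod_beta'\<close>)
  also have "\<dots> = (\<integral>\<tau>. indicator {s..t} \<tau> * (\<integral>y. U y * \<Phi>' \<tau> y \<partial>lborel) \<partial>lborel)"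
    by (intro Bochner_Integration.integral_cong refl) (auto simp: indicator_def)
  finally show ?thesis .
qed

lemma borel_measurable_lebesgue_onI:
  "f \<in> borel_measurable borel \<Longrightarrow> f \<in> borel_measurable (lebesgue_on S)"
  by (intro measurable_restrict_space1 measurable_completion) simp

lemma integral_lborel_translate:
  fixes f :: "'a::euclidean_space \<Rightarrow> real"
  assumes [measurable]: "f \<in> borel_measurable borel"
  shows "(\<integral>x. f (c + x) \<partial>lborel) = (\<integral>x. f x \<partial>lborel)"
proof -
  have "(\<integral>x. f x \<partial>lborel) = (\<integral>x. f x \<partial>distr lborel borel ((+) c))"
    by (simp add: lborel_distr_plus)
  also have "\<dots> = (\<integral>x. f (c + x) \<partial>lborel)"
    by (rule integral_distr) auto
  finally show ?thesis by simp
qed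

lemma smooth_line_derivative:
  assumes "smooth_on UNIV \<phi>"
  shows "((\<lambda>\<tau>. \<phi> (y + \<tau> *\<^sub>R v)) has_real_derivative frechet_derivative \<phi> (at (y + \<tau> *\<^sub>R v)) v) (at \<tau>)"
proof -
  have 1: "((\<lambda>\<tau>. y + \<tau> *\<^sub>R v) has_derivative (\<lambda>h. h *\<^sub>R v)) (at \<tau>)"
    by (auto intro!: derivative_eq_intros)
  have d: "(\<phi> has_derivative frechet_derivative \<phi> (at (y + \<tau> *\<^sub>R v))) (at (y + \<tau> *\<^sub>R v))"
    by (rule smooth_has_derivative[OF assms])
  have "((\<lambda>\<tau>. \<phi> (y + \<tau> *\<^sub>R v)) has_derivative (\<lambda>h. frechet_derivative \<phi> (at (y + \<tau> *\<^sub>R v)) (h *\<^sub>R v))) (at \<tau>)"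
    by (rule has_derivative_compose[OF 1 d])
  then show ?thesis
    using linear_cmul[OF has_derivative_linear[OF d]] by (simp add: has_field_derivative_def mult.commute[of _ "frechet_derivative _ _ _"])
qed

text \<open>The support lies in a ball around e. With e an inward direction this is the kernel for
  averages at boundary points; with e = 0 it is the usual one.\<close>

lemma mollifier_exists:
  fixes e :: "'a::euclidean_space"
  assumes d: "\<delta> > 0"
  obtains \<Theta> where "mollifier \<Theta> (norm e + \<delta>)" "\<And>z. \<Theta> z \<noteq> 0 \<Longrightarrow> norm (z - e) < \<delta>"
proof -
  define g where "g z = bump ((z - e) /\<^sub>R \<delta>)" for z :: 'a
  have g: "g z = bump ((- (e /\<^sub>R \<delta>)) + (1/\<delta>) *\<^sub>R z)" for z
    by (simp add: g_def scaleR_diff_right inverse_eq_divide)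
  have sm: "smooth_on UNIV g"
    unfolding g[abs_def] by (rule smooth_affine[OF smooth_bump]) (rule linear_scale_self)
  have [measurable]: "g \<in> borel_measurable borel"
    by (rule borel_measurable_continuous_onI[OF smooth_continuous[OF sm]])
  have g0: "g z \<ge> 0" for z by (simp add: g_def bump_nonneg)
  have gpos: "g z \<noteq> 0 \<longleftrightarrow> norm (z - e) < \<delta>" for z
  proof -
    have "norm ((z - e) /\<^sub>R \<delta>) = norm (z - e) / \<delta>"
      using d by (simp add: divide_inverse mult.commute)
    then have "norm ((z - e) /\<^sub>R \<delta>) < 1 \<longleftrightarrow> norm (z - e) < \<delta>"
      using d by (simp only:) (simp add: field_simps)
    then show ?thesis unfolding g_def bump_eq_0_iff by (simp only: not_le)
  qed
  obtain C where C: "C > 0" "\<And>x. \<bar>g x\<bar> \<le> C"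
    using compact_support_bounded[OF smooth_continuous[OF sm] compact_cball[of e \<delta>]] gpos
    by (metis dist_commute dist_norm less_imp_le mem_cball)
  define I where "I = (\<integral>\<^sup>+z. ennreal (g z) \<partial>lborel)"
  have "I \<le> (\<integral>\<^sup>+z. ennreal C * indicator (cball e \<delta>) z \<partial>lborel)"
    unfolding I_def
  proof (intro nn_integral_mono)
    fix z show "ennreal (g z) \<le> ennreal C * indicator (cball e \<delta>) z"
      using C(2)[of z] gpos[of z] by (auto simp: indicator_def dist_norm norm_minus_commute intro: ennreal_leI)
  qed
  also have "\<dots> < top"
    using emeasure_lborel_cball_finite[of e \<delta>] by (simp add: nn_integral_cmult_indicator ennreal_mult_less_top)
  finally have Ifin: "I < top" .
  \<comment> \<open>The bump is positive on an open ball, which is not negligible; so it can be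
    normalised to integral 1.\<close>
  have "I \<noteq> 0"
  proof
    assume "I = 0"
    then have "AE z in lborel. g z = 0"
      using g0 unfolding I_def by (subst (asm) nn_integral_0_iff_AE) (auto simp: ennreal_eq_0_iff intro: antisym)
    then have "AE z in lebesgue. z \<notin> ball e \<delta>"
      using gpos by (auto simp: AE_completion_iff dist_norm norm_minus_commute elim: eventually_mono)
    then have "negligible (ball e \<delta>)"
      by (simp add: negligible_iff_null_sets AE_iff_null_sets)
    then show False using d open_not_negligible[of "ball e \<delta>"] by simp
  qed
  define c where "c = enn2real I"
  have c: "c > 0" "I = ennreal c"
    using \<open>I \<noteq> 0\<close> Ifin by (auto simp: c_def enn2real_positive_iff zero_less_iff_neq_zero)
  show ?thesis
  proof (rule that[of "\<lambda>z. (1/c) * g z"])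
    show "mollifier (\<lambda>z. (1/c) * g z) (norm e + \<delta>)"
    proof
      show "smooth_on UNIV (\<lambda>z. (1/c) * g z)" by (intro smooth_mult smooth_const sm)
      show "(1/c) * g z \<ge> 0" for z using c g0 by simp
      show "norm z \<le> norm e + \<delta>" if "(1/c) * g z \<noteq> 0" for z
        using that gpos[of z] norm_triangle_ineq2[of z e] by auto
      have "(\<integral>\<^sup>+z. ennreal ((1/c) * g z) \<partial>lborel) = ennreal (1/c) * I"
        unfolding I_def using c g0 by (simp add: ennreal_mult nn_integral_cmult del: times_divide_eq_left)
      also have "\<dots> = 1" using c by (simp add: ennreal_mult[symmetric])
      finally show "(\<integral>\<^sup>+z. ennreal ((1/c) * g z) \<partial>lborel) = 1" .
    qed
    show "norm (z - e) < \<delta>" if "(1/c) * g z \<noteq> 0" for z using that gpos by auto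
  qed
qed

context mollifier
begin

lemma dil_smooth: "smooth_on UNIV (\<lambda>y. dil s (y - x))"
proof -
  have eq: "(\<lambda>y. dil s (y - x)) = (\<lambda>y. \<Theta> (- (x /\<^sub>R s) + inverse s *\<^sub>R y) * (1 / s ^ DIM('a)))"
    by (auto simp: dil_def scaleR_diff_right)
  show ?thesis
    unfolding eq by (rule smooth_mult[OF smooth_affine[OF smooth linear_scale_self] smooth_const])
qed

lemma dil_test_fun:
  assumes "s > 0" "cball x (s * R) \<subseteq> S"
  shows "test_fun S (\<lambda>y. dil s (y - x))"
proof (rule test_funI[OF dil_smooth compact_cball assms(2)])
  fix y assume "y \<notin> cball x (s * R)"
  then show "dil s (y - x) = 0" using assms(1) by (intro dil_eq_0) (auto simp: dist_norm norm_minus_commute)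
qed

end

text \<open>By Lindelof countably many of the balls already cover S, and countably many null sets
  have a null union.\<close>

lemma ball_cover_AE:
  fixes S :: "'a::euclidean_space set"
  assumes "\<And>x. x \<in> S \<Longrightarrow> \<exists>r>0. AE y in lborel. y \<in> ball x r \<longrightarrow> P y"
  shows "AE y in lborel. y \<in> S \<longrightarrow> P y"
proof -
  obtain r where r: "\<And>x. x \<in> S \<Longrightarrow> r x > 0" "\<And>x. x \<in> S \<Longrightarrow> AE y in lborel. y \<in> ball x (r x) \<longrightarrow> P y"
    using assms by metis
  define F where "F = (\<lambda>x. ball x (r x)) ` S"
  have "\<And>B. B \<in> F \<Longrightarrow> open B" by (auto simp: F_def)
  then obtain F' where F': "F' \<subseteq> F" "countable F'" "\<Union>F' = \<Union>F" using Lindelof by metis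
  have "AE y in lborel. \<forall>B\<in>F'. y \<in> B \<longrightarrow> P y"
    using F'(1) r(2) by (subst AE_ball_countable[OF F'(2)]) (auto simp: F_def)
  then show ?thesis
  proof eventually_elim
    case (elim y)
    have "S \<subseteq> \<Union>F'"
      unfolding F' using r(1) by (auto simp: F_def)
    then show ?case using elim by blast
  qed
qed

section \<open>Square integrable functions and weak gradients on a bounded open set\<close>

locale bounded_open =
  fixes \<Omega> :: "'a::euclidean_space set"
  assumes open_dom: "open \<Omega>" and bounded_dom: "bounded \<Omega>"
begin

lemma borel_dom [measurable, simp]: "\<Omega> \<in> sets borel"
  using open_dom by simp

lemma lebesgue_dom: "\<Omega> \<in> lmeasurable"
  using open_dom bounded_dom by (simp add: lmeasurable_open)

sublocale M: finite_measure "lebesgue_on \<Omega>"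
  using finite_measure_lebesgue_on[OF lebesgue_dom] .

lemma outside_ball: obtains B where "B > 0" "\<And>x. norm x > B \<Longrightarrow> x \<notin> \<Omega>"
  using bounded_dom unfolding bounded_pos by (metis not_le)

lemma integrable_mult_bounded:
  fixes f \<psi> :: "'a \<Rightarrow> real"
  assumes f: "integrable (lebesgue_on \<Omega>) f" and p: "\<psi> \<in> borel_measurable (lebesgue_on \<Omega>)" and b: "\<And>x. \<bar>\<psi> x\<bar> \<le> C"
  shows "integrable (lebesgue_on \<Omega>) (\<lambda>x. f x * \<psi> x)"
proof (rule Bochner_Integration.integrable_bound)
  show "integrable (lebesgue_on \<Omega>) (\<lambda>x. C * \<bar>f x\<bar>)" using f by simp
  have "C \<ge> 0" using b[of 0] by linarith
  show "AE x in lebesgue_on \<Omega>. norm (f x * \<psi> x) \<le> norm (C * \<bar>f x\<bar>)"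
  proof (rule AE_I2)
    fix x
    have "\<bar>f x\<bar> * \<bar>\<psi> x\<bar> \<le> \<bar>f x\<bar> * C" by (intro mult_left_mono b) auto
    also have "\<dots> = norm (C * \<bar>f x\<bar>)" using \<open>C \<ge> 0\<close> by (simp add: abs_mult)
    finally show "norm (f x * \<psi> x) \<le> norm (C * \<bar>f x\<bar>)" by (simp only: real_norm_def abs_mult)
  qed
  show "(\<lambda>x. f x * \<psi> x) \<in> borel_measurable (lebesgue_on \<Omega>)"
    by (rule borel_measurable_times[OF borel_measurable_integrable[OF f] p])
qed

lemma L2D:
  assumes "L2 \<Omega> u"
  shows "u \<in> borel_measurable (lebesgue_on \<Omega>)" "integrable (lebesgue_on \<Omega>) (\<lambda>x. (u x)\<^sup>2)"
    "integrable (lebesgue_on \<Omega>) u"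
proof -
  show m: "u \<in> borel_measurable (lebesgue_on \<Omega>)" and i: "integrable (lebesgue_on \<Omega>) (\<lambda>x. (u x)\<^sup>2)"
    using assms unfolding L2_def by blast+
  show "integrable (lebesgue_on \<Omega>) u"
    by (rule M.square_integrable_imp_integrable[OF m i])
qed

lemma L2_component:
  assumes [measurable]: "G \<in> borel_measurable (lebesgue_on \<Omega>)" and i: "integrable (lebesgue_on \<Omega>) (\<lambda>x. (norm (G x :: 'a))\<^sup>2)"
    and b: "b \<in> Basis"
  shows "L2 \<Omega> (\<lambda>x. G x \<bullet> b)"
  unfolding L2_def
proof (intro conjI)
  show "integrable (lebesgue_on \<Omega>) (\<lambda>x. (G x \<bullet> b)\<^sup>2)"
  proof (rule Bochner_Integration.integrable_bound[OF i])
    show "AE x in lebesgue_on \<Omega>. norm ((G x \<bullet> b)\<^sup>2) \<le> norm ((norm (G x))\<^sup>2)"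
      using Basis_le_norm[OF b] by (intro AE_I2) (simp add: abs_le_square_iff[symmetric])
  qed measurable
qed measurable

lemma integrable_test:
  assumes "L2 \<Omega> u" "test_fun \<Omega> \<phi>"
  shows "integrable (lebesgue_on \<Omega>) (\<lambda>x. u x * \<phi> x)"
    "i \<in> Basis \<Longrightarrow> integrable (lebesgue_on \<Omega>) (\<lambda>x. u x * frechet_derivative \<phi> (at x) i)"
proof -
  obtain C where C: "C > 0" "\<And>x. \<bar>\<phi> x\<bar> \<le> C" "\<And>x i. i \<in> Basis \<Longrightarrow> \<bar>frechet_derivative \<phi> (at x) i\<bar> \<le> C"
    using test_funE[OF assms(2)] by blast
  show "integrable (lebesgue_on \<Omega>) (\<lambda>x. u x * \<phi> x)"
    by (rule integrable_mult_bounded[OF L2D(3)[OF assms(1)] _ C(2)])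
      (intro borel_measurable_lebesgue_onI test_fun_measurable[OF assms(2)])
  show "integrable (lebesgue_on \<Omega>) (\<lambda>x. u x * frechet_derivative \<phi> (at x) i)" if "i \<in> Basis"
    by (rule integrable_mult_bounded[OF L2D(3)[OF assms(1)] _ C(3)[OF that]])
      (intro borel_measurable_lebesgue_onI test_fun_measurable[OF assms(2)])
qed

lemma L2_representative:
  assumes "L2 \<Omega> u"
  obtains U where "U \<in> borel_measurable borel" "\<And>x. x \<notin> \<Omega> \<Longrightarrow> U x = 0" "AE x in lebesgue_on \<Omega>. u x = U x"
    "integrable lborel (\<lambda>x. (U x)\<^sup>2)" "integrable lborel U"
proof -
  obtain U where U: "U \<in> borel_measurable borel" "\<And>x. x \<notin> \<Omega> \<Longrightarrow> U x = 0" "AE x in lebesgue_on \<Omega>. u x = U x"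
    using borel_representative_real[OF borel_dom L2D(1)[OF assms]] by blast
  have 1: "integrable lborel U"
    using integral_lebesgue_on_eq_lborel(2)[OF borel_dom U(1,2) L2D(1)[OF assms] U(3)] L2D(3)[OF assms] by simp
  have "AE x in lebesgue_on \<Omega>. (u x)\<^sup>2 = (U x)\<^sup>2" using U(3) by eventually_elim simp
  moreover have "(\<lambda>x. (U x)\<^sup>2) \<in> borel_measurable borel" using U(1) by measurable
  moreover have "(\<lambda>x. (u x)\<^sup>2) \<in> borel_measurable (lebesgue_on \<Omega>)" using L2D(1)[OF assms] by measurable
  ultimately have "integrable lborel (\<lambda>x. (U x)\<^sup>2)"
    using integral_lebesgue_on_eq_lborel(2)[OF borel_dom, of "\<lambda>x. (U x)\<^sup>2" "\<lambda>x. (u x)\<^sup>2"] L2D(2)[OF assms] U(2) by simp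
  from U this 1 show ?thesis by (rule that)
qed

text \<open>At a point whose s-neighbourhood lies in the domain the mollified function is a pairing
  with a test function, hence 0. As s tends to 0 it converges in L^2 to g, so g vanishes a.e. near
  every point.\<close>

lemma fundamental_lemma:
  assumes g: "L2 \<Omega> g" and z: "\<And>\<phi>. test_fun \<Omega> \<phi> \<Longrightarrow> (\<integral>x. g x * \<phi> x \<partial>lebesgue_on \<Omega>) = 0"
  shows "AE x in lebesgue_on \<Omega>. g x = 0"
proof -
  obtain U where U [measurable]: "U \<in> borel_measurable borel" and U0: "\<And>x. x \<notin> \<Omega> \<Longrightarrow> U x = 0"
    and ae: "AE x in lebesgue_on \<Omega>. g x = U x" and i2: "integrable lborel (\<lambda>x. (U x)\<^sup>2)"
    using L2_representative[OF g] by blast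
  obtain B where B: "\<And>x. norm x > B \<Longrightarrow> x \<notin> \<Omega>" using outside_ball by blast
  obtain \<Theta> :: "'a \<Rightarrow> real" where "mollifier \<Theta> (norm (0::'a) + 1)"
    using mollifier_exists[of 1 0] by (metis zero_less_one)
  then interpret mollifier \<Theta> 1 by simp
  have "AE x in lborel. x \<in> \<Omega> \<longrightarrow> U x = 0"
  proof (rule ball_cover_AE)
    fix x0 assume "x0 \<in> \<Omega>"
    then obtain r where r: "r > 0" "ball x0 r \<subseteq> \<Omega>" using open_dom openE by blast
    have le: "(\<integral>\<^sup>+x. ennreal ((U x)\<^sup>2) * indicator (ball x0 (r/2)) x \<partial>lborel) \<le> ennreal e" if "e > 0" for e
    proof -
      obtain s0 where s0: "s0 > 0" "\<And>s. 0 < s \<Longrightarrow> s < s0 \<Longrightarrow> (\<integral>\<^sup>+x. ennreal ((moll s U x - U x)\<^sup>2) \<partial>lborel) \<le> ennreal e"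
        using moll_L2_tendsto[OF U i2, of B e] U0 B \<open>e > 0\<close> by metis
      define s where "s = min (s0/2) (r/4)"
      have s: "0 < s" "s < s0" "s < r / 2" using s0 r by (auto simp: s_def)
      have m0: "moll s U x = 0" if x: "x \<in> ball x0 (r/2)" for x
      proof -
        have sub: "cball x (s * 1) \<subseteq> \<Omega>"
        proof
          fix y assume "y \<in> cball x (s * 1)"
          then have "dist x0 y < r" using x s dist_triangle[of x0 y x] by auto
          then show "y \<in> \<Omega>" using r by auto
        qed
        have tf: "test_fun \<Omega> (\<lambda>y. dil s (y - x))" by (rule dil_test_fun[OF s(1) sub])
        have "(\<integral>y. g y * dil s (y - x) \<partial>lebesgue_on \<Omega>) = (\<integral>y. U y * dil s (y - x) \<partial>lborel)"
        proof (rule integral_lebesgue_on_eq_lborel(1)[OF borel_dom])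
          show "AE y in lebesgue_on \<Omega>. g y * dil s (y - x) = U y * dil s (y - x)"
            using ae by eventually_elim simp
          show "(\<lambda>y. g y * dil s (y - x)) \<in> borel_measurable (lebesgue_on \<Omega>)"
            using integrable_test(1)[OF g tf] by auto
        qed (use U0 in auto)
        then show ?thesis using z[OF tf] by (simp add: moll_def)
      qed
      have "(\<integral>\<^sup>+x. ennreal ((U x)\<^sup>2) * indicator (ball x0 (r/2)) x \<partial>lborel) \<le> (\<integral>\<^sup>+x. ennreal ((moll s U x - U x)\<^sup>2) \<partial>lborel)"
        by (intro nn_integral_mono) (auto simp: indicator_def m0)
      then show ?thesis using s0(2)[OF s(1,2)] by (rule order_trans)
    qed
    have "(\<integral>\<^sup>+x. ennreal ((U x)\<^sup>2) * indicator (ball x0 (r/2)) x \<partial>lborel) \<le> 0"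
      by (rule ennreal_le_epsilon) (simp add: le)
    then have "(\<integral>\<^sup>+x. ennreal ((U x)\<^sup>2) * indicator (ball x0 (r/2)) x \<partial>lborel) = 0"
      by simp
    then have "AE x in lborel. ennreal ((U x)\<^sup>2) * indicator (ball x0 (r/2)) x = 0"
      by (rule nn_integral_0_iff_AE[THEN iffD1, rotated])
        (intro borel_measurable_times_ennreal borel_measurable_indicator measurable_compose[OF _ measurable_ennreal]
          borel_measurable_power, use U in auto)
    then have ae0: "AE x in lborel. x \<in> ball x0 (r/2) \<longrightarrow> U x = 0"
    proof eventually_elim
      case (elim x)
      then show ?case by (simp add: indicator_def ennreal_eq_0_iff split: if_splits) auto
    qed
    show "\<exists>r>0. AE x in lborel. x \<in> ball x0 r \<longrightarrow> U x = 0"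
    proof (rule exI, rule conjI)
      show "r / 2 > 0" using r(1) by simp
    qed (rule ae0)
  qed
  then have "AE x in lebesgue_on \<Omega>. U x = 0" by (simp only: AE_lebesgue_on_iff[OF borel_dom])
  with ae show ?thesis
  proof eventually_elim
    case (elim x)
    show ?case using elim(1) unfolding elim(2) .
  qed
qed

lemma weak_gradientD:
  assumes "weak_gradient \<Omega> u G"
  shows "G \<in> borel_measurable (lebesgue_on \<Omega>)" "integrable (lebesgue_on \<Omega>) (\<lambda>x. (norm (G x))\<^sup>2)"
    "\<And>\<phi> i. test_fun \<Omega> \<phi> \<Longrightarrow> i \<in> Basis \<Longrightarrow> (\<integral>x. u x * frechet_derivative \<phi> (at x) i \<partial>lebesgue_on \<Omega>)
          = - (\<integral>x. (G x \<bullet> i) * \<phi> x \<partial>lebesgue_on \<Omega>)"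
    "\<And>i. i \<in> Basis \<Longrightarrow> L2 \<Omega> (\<lambda>x. G x \<bullet> i)"
proof -
  show m: "G \<in> borel_measurable (lebesgue_on \<Omega>)" "integrable (lebesgue_on \<Omega>) (\<lambda>x. (norm (G x))\<^sup>2)"
    using assms unfolding weak_gradient_def by blast+
  show "(\<integral>x. u x * frechet_derivative \<phi> (at x) i \<partial>lebesgue_on \<Omega>)
          = - (\<integral>x. (G x \<bullet> i) * \<phi> x \<partial>lebesgue_on \<Omega>)" if "test_fun \<Omega> \<phi>" "i \<in> Basis" for \<phi> i
    using assms that unfolding weak_gradient_def by blast
  show "L2 \<Omega> (\<lambda>x. G x \<bullet> i)" if "i \<in> Basis" for i
    by (rule L2_component[OF m that])
qed

text \<open>\<open>grad\<close> is an arbitrary choice among weak gradients, so every computation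
  with it rests on this uniqueness a.e.\<close>

lemma weak_gradient_unique:
  assumes G: "weak_gradient \<Omega> u G" and G': "weak_gradient \<Omega> v G'" and uv: "AE x in lebesgue_on \<Omega>. u x = v x"
    and u: "u \<in> borel_measurable (lebesgue_on \<Omega>)" "v \<in> borel_measurable (lebesgue_on \<Omega>)"
  shows "AE x in lebesgue_on \<Omega>. G x = G' x"
proof -
  have "AE x in lebesgue_on \<Omega>. G x \<bullet> i - G' x \<bullet> i = 0" if i: "i \<in> Basis" for i
  proof (rule fundamental_lemma)
    have "integrable (lebesgue_on \<Omega>) (\<lambda>x. (norm (G x \<bullet> i - G' x \<bullet> i))\<^sup>2)"
      by (rule integrable_norm_square_diff) (use weak_gradientD(4)[OF G i] weak_gradientD(4)[OF G' i] in \<open>auto simp: L2_def\<close>)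
    then show "L2 \<Omega> (\<lambda>x. G x \<bullet> i - G' x \<bullet> i)"
      using weak_gradientD(1)[OF G] weak_gradientD(1)[OF G'] by (simp add: L2_def)
    fix \<phi> assume t: "test_fun \<Omega> \<phi>"
    have [measurable]: "(\<lambda>x. frechet_derivative \<phi> (at x) i) \<in> borel_measurable (lebesgue_on \<Omega>)"
      by (intro borel_measurable_lebesgue_onI test_fun_measurable[OF t])
    note [measurable] = u
    have "(\<integral>x. u x * frechet_derivative \<phi> (at x) i \<partial>lebesgue_on \<Omega>) = (\<integral>x. v x * frechet_derivative \<phi> (at x) i \<partial>lebesgue_on \<Omega>)"
      by (rule integral_cong_AE) (use uv in \<open>auto elim: eventually_mono\<close>)
    then have "(\<integral>x. (G x \<bullet> i) * \<phi> x \<partial>lebesgue_on \<Omega>) = (\<integral>x. (G' x \<bullet> i) * \<phi> x \<partial>lebesgue_on \<Omega>)"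
      using weak_gradientD(3)[OF G t i] weak_gradientD(3)[OF G' t i] by simp
    then show "(\<integral>x. (G x \<bullet> i - G' x \<bullet> i) * \<phi> x \<partial>lebesgue_on \<Omega>) = 0"
      using integrable_test(1)[OF weak_gradientD(4)[OF G i] t] integrable_test(1)[OF weak_gradientD(4)[OF G' i] t]
      by (simp add: left_diff_distrib)
  qed
  then have "AE x in lebesgue_on \<Omega>. \<forall>i\<in>Basis. G x \<bullet> i - G' x \<bullet> i = 0"
    by (intro AE_finite_allI) auto
  then show ?thesis
  proof eventually_elim
    case (elim x)
    show ?case by (rule euclidean_eqI) (use elim in simp)
  qed
qed

lemma L2_lincomb:
  assumes "L2 \<Omega> u" "L2 \<Omega> v"
  shows "L2 \<Omega> (\<lambda>x. \<alpha> * u x + \<beta> * v x)"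
proof -
  have "integrable (lebesgue_on \<Omega>) (\<lambda>x. (norm (\<alpha> *\<^sub>R u x + \<beta> *\<^sub>R v x))\<^sup>2)"
    by (intro integrable_norm_square_add integrable_norm_square_scaleR) (use assms in \<open>auto simp: L2_def\<close>)
  then show ?thesis using assms by (auto simp: L2_def)
qed

lemma weak_gradient_lincomb:
  assumes u: "L2 \<Omega> u" "weak_gradient \<Omega> u G" and v: "L2 \<Omega> v" "weak_gradient \<Omega> v G'"
  shows "weak_gradient \<Omega> (\<lambda>x. \<alpha> * u x + \<beta> * v x) (\<lambda>x. \<alpha> *\<^sub>R G x + \<beta> *\<^sub>R G' x)"
  unfolding weak_gradient_def
proof (intro conjI allI impI)
  show "(\<lambda>x. \<alpha> *\<^sub>R G x + \<beta> *\<^sub>R G' x) \<in> borel_measurable (lebesgue_on \<Omega>)"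
    using weak_gradientD(1)[OF u(2)] weak_gradientD(1)[OF v(2)] by measurable
  show "integrable (lebesgue_on \<Omega>) (\<lambda>x. (norm (\<alpha> *\<^sub>R G x + \<beta> *\<^sub>R G' x))\<^sup>2)"
    by (intro integrable_norm_square_add integrable_norm_square_scaleR)
      (use weak_gradientD(1,2)[OF u(2)] weak_gradientD(1,2)[OF v(2)] in auto)
  fix \<phi> and i :: 'a assume t: "test_fun \<Omega> \<phi>" and i: "i \<in> Basis"
  have "(\<integral>x. (\<alpha> * u x + \<beta> * v x) * frechet_derivative \<phi> (at x) i \<partial>lebesgue_on \<Omega>) =
    (\<integral>x. \<alpha> * (u x * frechet_derivative \<phi> (at x) i) + \<beta> * (v x * frechet_derivative \<phi> (at x) i) \<partial>lebesgue_on \<Omega>)"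
    by (intro Bochner_Integration.integral_cong refl) (simp add: distrib_right)
  also have "\<dots> = \<alpha> * (\<integral>x. u x * frechet_derivative \<phi> (at x) i \<partial>lebesgue_on \<Omega>) + \<beta> * (\<integral>x. v x * frechet_derivative \<phi> (at x) i \<partial>lebesgue_on \<Omega>)"
    using integrable_test(2)[OF u(1) t i] integrable_test(2)[OF v(1) t i] by simp
  also have "\<dots> = - (\<alpha> * (\<integral>x. (G x \<bullet> i) * \<phi> x \<partial>lebesgue_on \<Omega>) + \<beta> * (\<integral>x. (G' x \<bullet> i) * \<phi> x \<partial>lebesgue_on \<Omega>))"
    using weak_gradientD(3)[OF u(2) t i] weak_gradientD(3)[OF v(2) t i] by simp
  also have "\<dots> = - (\<integral>x. \<alpha> * ((G x \<bullet> i) * \<phi> x) + \<beta> * ((G' x \<bullet> i) * \<phi> x) \<partial>lebesgue_on \<Omega>)"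
    using integrable_test(1)[OF weak_gradientD(4)[OF u(2) i] t] integrable_test(1)[OF weak_gradientD(4)[OF v(2) i] t] by simp
  finally show "(\<integral>x. (\<alpha> * u x + \<beta> * v x) * frechet_derivative \<phi> (at x) i \<partial>lebesgue_on \<Omega>) = - (\<integral>x. (\<alpha> *\<^sub>R G x + \<beta> *\<^sub>R G' x) \<bullet> i * \<phi> x \<partial>lebesgue_on \<Omega>)"
    by (simp only: inner_add_left inner_scaleR_left distrib_right mult.assoc)
qed

text \<open>Translation invariance: the integrals of \<phi>(y + i) and \<phi>(y) agree, and their
  difference is the average over \<tau> in [0,1] of the integral of the derivative at y + \<tau> i,
  which is the same number for every \<tau>.\<close>

lemma integral_derivative_test:
  assumes t: "test_fun \<Omega> \<phi>" and i: "i \<in> Basis"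
  shows "(\<integral>x. frechet_derivative \<phi> (at x) i \<partial>lebesgue_on \<Omega>) = 0"
proof -
  define \<psi> where "\<psi> x = frechet_derivative \<phi> (at x) i" for x
  have sm: "smooth_on UNIV \<phi>" using t by (simp add: test_fun_def)
  have pc: "continuous_on UNIV \<psi>" unfolding \<psi>_def[abs_def] by (rule smooth_derivative_continuous[OF sm])
  note [measurable] = test_fun_measurable[OF t]
  have [measurable]: "\<psi> \<in> borel_measurable borel" unfolding \<psi>_def[abs_def] by measurable
  obtain C where C: "C > 0" "\<And>x. \<bar>\<phi> x\<bar> \<le> C" "\<And>x i. i \<in> Basis \<Longrightarrow> \<bar>frechet_derivative \<phi> (at x) i\<bar> \<le> C"
    using test_funE[OF t] by blast
  obtain B where B: "\<And>x. norm x > B \<Longrightarrow> x \<notin> \<Omega>" using outside_ball by blast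
  \<comment> \<open>\<open>FTC_Fubini\<close> wants an integrable weight, so 1 is cut off. The spare
    radius 1 ensures that translates by \<tau> i with \<tau> in [0,1] still see the whole
    support.\<close>
  define U :: "'a \<Rightarrow> real" where "U = indicator (cball 0 (B + 1))"
  have [measurable]: "U \<in> borel_measurable borel"
    unfolding U_def by (intro borel_measurable_indicator) simp
  have U: "integrable lborel U"
    unfolding U_def by (intro integrable_real_indicator) (use emeasure_lborel_cball_finite[of "0::'a"] in auto)
  have U1: "U y * f (y + \<tau> *\<^sub>R i) = f (y + \<tau> *\<^sub>R i)" if "\<tau> \<in> {0..1}" "\<And>x. x \<notin> \<Omega> \<Longrightarrow> f x = 0" for f :: "'a \<Rightarrow> real" and y \<tau>
  proof (cases "norm y \<le> B + 1")
    case False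
    have "norm (\<tau> *\<^sub>R i) \<le> 1" using that(1) i by simp
    then have "norm (y + \<tau> *\<^sub>R i) > B" using False norm_triangle_ineq2[of y "- (\<tau> *\<^sub>R i)"] by simp
    then show ?thesis using that(2) B by simp
  qed (simp add: U_def)
  have z: "\<And>x. x \<notin> \<Omega> \<Longrightarrow> \<phi> x = 0" "\<And>x. x \<notin> \<Omega> \<Longrightarrow> \<psi> x = 0"
    using test_fun_zero[OF t] by (auto simp: \<psi>_def)
  have tr: "(\<integral>y. U y * f (y + \<tau> *\<^sub>R i) \<partial>lborel) = (\<integral>y. f y \<partial>lborel)"
    if "\<tau> \<in> {0..1}" "\<And>x. x \<notin> \<Omega> \<Longrightarrow> f x = 0" "f \<in> borel_measurable borel" for f :: "'a \<Rightarrow> real" and \<tau>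
  proof -
    have "U y * f (y + \<tau> *\<^sub>R i) = f (\<tau> *\<^sub>R i + y)" for y
      using U1[where f = f, OF that(1)] that(2) by (simp add: add.commute)
    then show ?thesis by (simp only: integral_lborel_translate[OF that(3)])
  qed
  have int: "integrable lborel (\<lambda>y. U y * \<phi> (y + \<tau> *\<^sub>R i))" for \<tau>
  proof (rule Bochner_Integration.integrable_bound)
    show "integrable lborel (\<lambda>y. C * U y)" using U by simp
    show "AE y in lborel. norm (U y * \<phi> (y + \<tau> *\<^sub>R i)) \<le> norm (C * U y)"
      using C by (intro AE_I2) (auto simp: U_def indicator_def)
  qed measurable
  have "(\<integral>y. U y * \<phi> (y + 1 *\<^sub>R i) \<partial>lborel) - (\<integral>y. U y * \<phi> (y + 0 *\<^sub>R i) \<partial>lborel)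
     = (\<integral>\<tau>. indicator {0..1} \<tau> * (\<integral>y. U y * \<psi> (y + \<tau> *\<^sub>R i) \<partial>lborel) \<partial>lborel)"
  proof (rule FTC_Fubini[where C = C])
    show "((\<lambda>\<tau>. \<phi> (y + \<tau> *\<^sub>R i)) has_real_derivative \<psi> (y + \<tau> *\<^sub>R i)) (at \<tau>)" for y \<tau>
      unfolding \<psi>_def by (rule smooth_line_derivative[OF sm])
    show "isCont (\<lambda>\<tau>. \<psi> (y + \<tau> *\<^sub>R i)) \<tau>" for y \<tau>
      using continuous_on_compose2[OF pc, of UNIV "\<lambda>\<tau>. y + \<tau> *\<^sub>R i"]
      by (simp add: continuous_on_eq_continuous_at continuous_intros)
    show "\<bar>\<psi> (y + \<tau> *\<^sub>R i)\<bar> \<le> C" for y \<tau> using C(3)[OF i] by (simp add: \<psi>_def)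
  qed (use U int[of 0] int[of 1] in auto)
  then have "(\<integral>\<tau>. indicator {0..1} \<tau> * (\<integral>y. U y * \<psi> (y + \<tau> *\<^sub>R i) \<partial>lborel) \<partial>lborel) = 0"
    using tr[of 1 \<phi>] tr[of 0 \<phi>] z by simp
  moreover have "(\<integral>\<tau>. indicator {0..1} \<tau> * (\<integral>y. U y * \<psi> (y + \<tau> *\<^sub>R i) \<partial>lborel) \<partial>lborel) = (\<integral>\<tau>. indicator {0..1::real} \<tau> * (\<integral>y. \<psi> y \<partial>lborel) \<partial>lborel)"
    using tr[of _ \<psi>] z by (intro Bochner_Integration.integral_cong refl) (auto simp: indicator_def)
  ultimately have "(\<integral>y. \<psi> y \<partial>lborel) = 0" by simp
  moreover have "(\<integral>x. \<psi> x \<partial>lebesgue_on \<Omega>) = (\<integral>y. \<psi> y \<partial>lborel)"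
    by (rule integral_lebesgue_on_eq_lborel(1)[OF borel_dom _ z(2)]) (auto intro: borel_measurable_lebesgue_onI)
  ultimately show ?thesis by (simp add: \<psi>_def)
qed

lemma weak_gradient_const: "weak_gradient \<Omega> (\<lambda>x. c) (\<lambda>x. 0)"
  unfolding weak_gradient_def using integral_derivative_test by simp

lemma L2_const: "L2 \<Omega> (\<lambda>x. c)"
  by (simp add: L2_def)

lemma L2_inner:
  assumes j: "j \<in> Basis"
  shows "L2 \<Omega> (\<lambda>x. x \<bullet> j)"
proof -
  obtain B where B: "\<And>x. norm x > B \<Longrightarrow> x \<notin> \<Omega>" "B > 0" using outside_ball by metis
  show ?thesis
    unfolding L2_def
  proof
    show m: "(\<lambda>x. x \<bullet> j) \<in> borel_measurable (lebesgue_on \<Omega>)" by (rule borel_measurable_lebesgue_onI) simp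
    have "AE x in lebesgue_on \<Omega>. norm ((x \<bullet> j)\<^sup>2) \<le> norm (B\<^sup>2)"
    proof (rule AE_I2)
      fix x assume "x \<in> space (lebesgue_on \<Omega>)"
      then have "\<not> norm x > B" using B(1)[of x] by auto
      then have "\<bar>x \<bullet> j\<bar> \<le> \<bar>B\<bar>" using Basis_le_norm[OF j, of x] by linarith
      then show "norm ((x \<bullet> j)\<^sup>2) \<le> norm (B\<^sup>2)" by (simp add: abs_le_square_iff)
    qed
    then show "integrable (lebesgue_on \<Omega>) (\<lambda>x. (x \<bullet> j)\<^sup>2)"
      by (rule Bochner_Integration.integrable_bound[rotated 2]) (use m in auto)
  qed
qed

text \<open>The integral of the derivative of the test function
  \<open>(x \<bullet> j) * \<phi> x\<close> vanishes, and the product rule splits it. Coordinates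
  will provide the nonzero elements of H_za.\<close>

lemma weak_gradient_inner:
  assumes j: "j \<in> Basis"
  shows "weak_gradient \<Omega> (\<lambda>x. x \<bullet> j) (\<lambda>x. j)"
  unfolding weak_gradient_def
proof (intro conjI allI impI)
  fix \<phi> and i :: 'a assume t: "test_fun \<Omega> \<phi>" and i: "i \<in> Basis"
  have sm: "smooth_on UNIV \<phi>" using t by (simp add: test_fun_def)
  have t': "test_fun \<Omega> (\<lambda>x. (x \<bullet> j) * \<phi> x)"
  proof (rule test_funI[where K = "closure {x. \<phi> x \<noteq> 0}"])
    show "smooth_on UNIV (\<lambda>x. x \<bullet> j * \<phi> x)" by (intro smooth_mult smooth_inner sm)
    show "x \<bullet> j * \<phi> x = 0" if "x \<notin> closure {x. \<phi> x \<noteq> 0}" for x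
      using that closure_subset[of "{x. \<phi> x \<noteq> 0}"] by auto
  qed (use t in \<open>auto simp: test_fun_def\<close>)
  have fd: "frechet_derivative (\<lambda>x. (x \<bullet> j) * \<phi> x) (at x) i = (x \<bullet> j) * frechet_derivative \<phi> (at x) i + (i \<bullet> j) * \<phi> x" for x
  proof -
    have "((\<lambda>x. (x \<bullet> j) * \<phi> x) has_derivative (\<lambda>h. (x \<bullet> j) * frechet_derivative \<phi> (at x) h + (h \<bullet> j) * \<phi> x)) (at x)"
      by (intro has_derivative_mult smooth_has_derivative[OF sm] has_derivative_inner_left has_derivative_ident)
    from frechet_derivative_at[OF this] show ?thesis by metis
  qed
  have "0 = (\<integral>x. (x \<bullet> j) * frechet_derivative \<phi> (at x) i + (i \<bullet> j) * \<phi> x \<partial>lebesgue_on \<Omega>)"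
    using integral_derivative_test[OF t' i] unfolding fd by simp
  also have "\<dots> = (\<integral>x. (x \<bullet> j) * frechet_derivative \<phi> (at x) i \<partial>lebesgue_on \<Omega>) + (\<integral>x. (i \<bullet> j) * \<phi> x \<partial>lebesgue_on \<Omega>)"
    by (intro Bochner_Integration.integral_add integrable_test(2)[OF L2_inner[OF j] t i] integrable_test(1)[OF L2_const t])
  finally show "(\<integral>x. (x \<bullet> j) * frechet_derivative \<phi> (at x) i \<partial>lebesgue_on \<Omega>) = - (\<integral>x. (j \<bullet> i) * \<phi> x \<partial>lebesgue_on \<Omega>)"
    by (simp add: inner_commute)
qed auto

definition dist2 :: "('a \<Rightarrow> 'b::real_normed_vector) \<Rightarrow> ('a \<Rightarrow> 'b) \<Rightarrow> real" where
  "dist2 f g = (\<integral>x. (norm (f x - g x))\<^sup>2 \<partial>lebesgue_on \<Omega>)"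

lemma tendsto_integral_mult_bounded:
  fixes f :: "nat \<Rightarrow> 'a \<Rightarrow> real"
  assumes f: "\<And>n. L2 \<Omega> (f n)" and g: "L2 \<Omega> g" and lim: "(\<lambda>n. dist2 (f n) g) \<longlonglongrightarrow> 0"
    and p: "L2 \<Omega> \<psi>"
  shows "(\<lambda>n. \<integral>x. f n x * \<psi> x \<partial>lebesgue_on \<Omega>) \<longlonglongrightarrow> (\<integral>x. g x * \<psi> x \<partial>lebesgue_on \<Omega>)"
proof -
  let ?c = "\<integral>x. (\<psi> x)\<^sup>2 \<partial>lebesgue_on \<Omega>"
  have d: "L2 \<Omega> (\<lambda>x. f n x - g x)" for n using L2_lincomb[OF f[of n] g, of 1 "-1"] by simp
  have bound: "((\<integral>x. f n x * \<psi> x \<partial>lebesgue_on \<Omega>) - (\<integral>x. g x * \<psi> x \<partial>lebesgue_on \<Omega>))\<^sup>2 \<le> dist2 (f n) g * ?c" for n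
  proof -
    have "(\<integral>x. f n x * \<psi> x \<partial>lebesgue_on \<Omega>) - (\<integral>x. g x * \<psi> x \<partial>lebesgue_on \<Omega>) = (\<integral>x. (f n x - g x) * \<psi> x \<partial>lebesgue_on \<Omega>)"
      unfolding left_diff_distrib
      by (rule Bochner_Integration.integral_diff[symmetric];
          rule integrable_mult_L2[OF L2D(1)[OF _] L2D(1)[OF p] L2D(2)[OF _] L2D(2)[OF p]]; rule f g)
    then show ?thesis
      using cauchy_schwarz_integral(2)[OF L2D(1)[OF d[of n]] L2D(1)[OF p] L2D(2)[OF d[of n]] L2D(2)[OF p]]
      by (simp add: dist2_def)
  qed
  have "(\<lambda>n. dist2 (f n) g * ?c) \<longlonglongrightarrow> 0"
    using tendsto_mult_right[OF lim, of ?c] by simp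
  then have "(\<lambda>n. ((\<integral>x. f n x * \<psi> x \<partial>lebesgue_on \<Omega>) - (\<integral>x. g x * \<psi> x \<partial>lebesgue_on \<Omega>))\<^sup>2) \<longlonglongrightarrow> 0"
  proof (rule tendsto_0_le[where K = 1], intro always_eventually allI)
    fix n
    show "norm (((\<integral>x. f n x * \<psi> x \<partial>lebesgue_on \<Omega>) - (\<integral>x. g x * \<psi> x \<partial>lebesgue_on \<Omega>))\<^sup>2) \<le> norm (dist2 (f n) g * ?c) * 1"
      using order_trans[OF bound[of n] abs_ge_self] by simp
  qed
  then have "(\<lambda>n. (\<integral>x. f n x * \<psi> x \<partial>lebesgue_on \<Omega>) - (\<integral>x. g x * \<psi> x \<partial>lebesgue_on \<Omega>)) \<longlonglongrightarrow> 0"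
    by (subst (asm) power_tendsto_0_iff) simp_all
  then show ?thesis by (rule LIM_zero_cancel)
qed

lemma test_fun_L2:
  assumes "test_fun \<Omega> \<phi>"
  shows "L2 \<Omega> \<phi>" "i \<in> Basis \<Longrightarrow> L2 \<Omega> (\<lambda>x. frechet_derivative \<phi> (at x) i)"
proof -
  obtain C where C: "C > 0" "\<And>x. \<bar>\<phi> x\<bar> \<le> C" "\<And>x i. i \<in> Basis \<Longrightarrow> \<bar>frechet_derivative \<phi> (at x) i\<bar> \<le> C"
    using test_funE[OF assms] by blast
  have *: "L2 \<Omega> f" if "f \<in> borel_measurable borel" "\<And>x. \<bar>f x\<bar> \<le> C" for f
    unfolding L2_def
  proof
    show m: "f \<in> borel_measurable (lebesgue_on \<Omega>)" using that(1) by (rule borel_measurable_lebesgue_onI)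
    have "AE x in lebesgue_on \<Omega>. norm ((f x)\<^sup>2) \<le> norm (C\<^sup>2)"
      using that(2) C(1) by (intro AE_I2) (simp add: abs_le_square_iff[symmetric])
    then show "integrable (lebesgue_on \<Omega>) (\<lambda>x. (f x)\<^sup>2)"
      by (rule Bochner_Integration.integrable_bound[rotated 2]) (use m in auto)
  qed
  show "L2 \<Omega> \<phi>" by (rule *[OF test_fun_measurable(1)[OF assms] C(2)])
  show "L2 \<Omega> (\<lambda>x. frechet_derivative \<phi> (at x) i)" if "i \<in> Basis"
    by (rule *[OF test_fun_measurable(2)[OF assms] C(3)[OF that]])
qed

text \<open>For a fixed test function both sides of the defining identity are pairings with L^2
  functions, hence continuous under L^2 convergence. This is what makes H^1 complete in
  \<open>existence\<close>.\<close>

lemma weak_gradient_closed: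
  assumes u: "\<And>n. L2 \<Omega> (u n)" "\<And>n. weak_gradient \<Omega> (u n) (G n)"
    and v: "L2 \<Omega> v" "(\<lambda>n. dist2 (u n) v) \<longlonglongrightarrow> 0"
    and H: "H \<in> borel_measurable (lebesgue_on \<Omega>)" "integrable (lebesgue_on \<Omega>) (\<lambda>x. (norm (H x))\<^sup>2)" "(\<lambda>n. dist2 (G n) H) \<longlonglongrightarrow> 0"
  shows "weak_gradient \<Omega> v H"
  unfolding weak_gradient_def
proof (intro conjI allI impI H)
  fix \<phi> and i :: 'a assume t: "test_fun \<Omega> \<phi>" and i: "i \<in> Basis"
  note [measurable] = H(1) weak_gradientD(1)[OF u(2)]
  have "(\<lambda>n. \<integral>x. u n x * frechet_derivative \<phi> (at x) i \<partial>lebesgue_on \<Omega>) \<longlonglongrightarrow> (\<integral>x. v x * frechet_derivative \<phi> (at x) i \<partial>lebesgue_on \<Omega>)"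
    by (intro tendsto_integral_mult_bounded u v test_fun_L2[OF t] i)
  moreover have "(\<lambda>n. dist2 (\<lambda>x. G n x \<bullet> i) (\<lambda>x. H x \<bullet> i)) \<longlonglongrightarrow> 0"
  proof (rule tendsto_sandwich[OF _ _ tendsto_const H(3)])
    show "\<forall>\<^sub>F n in sequentially. 0 \<le> dist2 (\<lambda>x. G n x \<bullet> i) (\<lambda>x. H x \<bullet> i)"
      by (intro always_eventually allI) (simp add: dist2_def)
    have "dist2 (\<lambda>x. G n x \<bullet> i) (\<lambda>x. H x \<bullet> i) \<le> dist2 (G n) H" for n
      unfolding dist2_def
    proof (rule integral_mono_AE)
      have D: "integrable (lebesgue_on \<Omega>) (\<lambda>x. (norm (G n x - H x))\<^sup>2)"
        by (rule integrable_norm_square_diff) (use weak_gradientD(2)[OF u(2)] H in auto)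
      show "integrable (lebesgue_on \<Omega>) (\<lambda>x. (norm (G n x - H x))\<^sup>2)" by fact
      have le: "norm ((norm (G n x \<bullet> i - H x \<bullet> i))\<^sup>2) \<le> (norm (G n x - H x))\<^sup>2" for x
        using Basis_le_norm[OF i, of "G n x - H x"] by (simp add: inner_diff_left abs_le_square_iff[symmetric])
      show "integrable (lebesgue_on \<Omega>) (\<lambda>x. (norm (G n x \<bullet> i - H x \<bullet> i))\<^sup>2)"
        by (rule Bochner_Integration.integrable_bound[OF D]) (use le in auto)
      show "AE x in lebesgue_on \<Omega>. (norm (G n x \<bullet> i - H x \<bullet> i))\<^sup>2 \<le> (norm (G n x - H x))\<^sup>2"
        using le by auto
    qed
    then show "\<forall>\<^sub>F n in sequentially. dist2 (\<lambda>x. G n x \<bullet> i) (\<lambda>x. H x \<bullet> i) \<le> dist2 (G n) H"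
      by (intro always_eventually allI)
  qed
  then have "(\<lambda>n. \<integral>x. (G n x \<bullet> i) * \<phi> x \<partial>lebesgue_on \<Omega>) \<longlonglongrightarrow> (\<integral>x. (H x \<bullet> i) * \<phi> x \<partial>lebesgue_on \<Omega>)"
    by (intro tendsto_integral_mult_bounded weak_gradientD(4)[OF u(2)] L2_component H test_fun_L2[OF t] i)
  then have "(\<lambda>n. - (\<integral>x. (G n x \<bullet> i) * \<phi> x \<partial>lebesgue_on \<Omega>)) \<longlonglongrightarrow> - (\<integral>x. (H x \<bullet> i) * \<phi> x \<partial>lebesgue_on \<Omega>)"
    by (rule tendsto_minus)
  ultimately show "(\<integral>x. v x * frechet_derivative \<phi> (at x) i \<partial>lebesgue_on \<Omega>) = - (\<integral>x. (H x \<bullet> i) * \<phi> x \<partial>lebesgue_on \<Omega>)"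
    using weak_gradientD(3)[OF u(2) t i] by (simp add: LIMSEQ_unique)
qed

end

section \<open>Mollification along a cone\<close>

context bounded_open
begin

lemma gradient_representative:
  assumes G: "weak_gradient \<Omega> u G"
  obtains H where "H \<in> borel_measurable borel" "\<And>x. x \<notin> \<Omega> \<Longrightarrow> H x = 0" "AE x in lebesgue_on \<Omega>. G x = H x"
    "integrable lborel (\<lambda>x. (norm (H x))\<^sup>2)" "(\<integral>x. (norm (H x))\<^sup>2 \<partial>lborel) = (\<integral>x. (norm (G x))\<^sup>2 \<partial>lebesgue_on \<Omega>)"
proof -
  note m = weak_gradientD(1)[OF G]
  obtain H where H: "H \<in> borel_measurable borel" "\<And>x. x \<notin> \<Omega> \<Longrightarrow> H x = 0" "AE x in lebesgue_on \<Omega>. G x = H x"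
    using borel_representative[OF borel_dom m] by metis
  have ae: "AE x in lebesgue_on \<Omega>. (norm (G x))\<^sup>2 = (norm (H x))\<^sup>2" using H(3) by eventually_elim simp
  have mH: "(\<lambda>x. (norm (H x))\<^sup>2) \<in> borel_measurable borel" using H(1) by measurable
  have mG: "(\<lambda>x. (norm (G x))\<^sup>2) \<in> borel_measurable (lebesgue_on \<Omega>)" using m by measurable
  have z: "(norm (H x))\<^sup>2 = 0" if "x \<notin> \<Omega>" for x using H(2)[OF that] by simp
  note I = integral_lebesgue_on_eq_lborel[OF borel_dom mH z mG ae]
  have "integrable lborel (\<lambda>x. (norm (H x))\<^sup>2)" using I(2) weak_gradientD(2)[OF G] by simp
  from H this I(1)[symmetric] show ?thesis by (rule that)
qed

end

text \<open>\<open>\<Theta>\<close> is supported in \<open>K\<close>, which need not contain the origin: averages at points of \<open>D\<close>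
  only look in the directions of the cone over \<open>K\<close>, which stays inside \<open>\<Omega>\<close>.\<close>

locale cone_piece = bounded_open \<Omega> + mollifier \<Theta> R for \<Omega> :: "'a::euclidean_space set" and \<Theta> :: "'a \<Rightarrow> real" and R +
  fixes D K :: "'a set" and h :: real
  assumes D_borel: "D \<in> sets borel" and D_sub: "D \<subseteq> \<Omega>" and h_pos: "h > 0"
    and K_compact: "compact K" and K_supp: "z \<notin> K \<Longrightarrow> \<Theta> z = 0"
    and cone: "x \<in> D \<Longrightarrow> 0 < t \<Longrightarrow> t \<le> h \<Longrightarrow> z \<in> K \<Longrightarrow> x + t *\<^sub>R z \<in> \<Omega>"

context mollifier
begin

definition radial_deriv :: "'a \<Rightarrow> real" where
  "radial_deriv z = frechet_derivative \<Theta> (at z) z"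

text \<open>The derivative of \<open>dil \<tau> w\<close> in \<open>\<tau>\<close>; by \<open>vtest_divergence\<close> below it is minus the divergence in \<open>w\<close> of \<open>(w / \<tau>) dil \<tau> w\<close>.\<close>

definition ddil :: "real \<Rightarrow> 'a \<Rightarrow> real" where
  "ddil \<tau> w = - (radial_deriv (w /\<^sub>R \<tau>) + DIM('a) * \<Theta> (w /\<^sub>R \<tau>)) / \<tau> ^ (DIM('a) + 1)"

lemma radial_deriv_continuous: "continuous_on UNIV radial_deriv"
proof -
  have d: "\<Theta> differentiable (at x)" for x using smooth_has_derivative[OF smooth] by (auto simp: differentiable_def)
  have eq: "radial_deriv = (\<lambda>x. \<Sum>j\<in>Basis. (x \<bullet> j) * frechet_derivative \<Theta> (at x) j)"
    unfolding radial_deriv_def using frechet_derivative_Basis_expand[OF d] by blast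
  show ?thesis
    unfolding eq by (intro continuous_intros smooth_derivative_continuous[OF smooth])
qed

lemma radial_deriv_meas [measurable]: "radial_deriv \<in> borel_measurable borel"
  by (rule borel_measurable_continuous_onI[OF radial_deriv_continuous])

lemma radial_deriv_bounded: "\<exists>C>0. \<forall>z. \<bar>radial_deriv z\<bar> \<le> C"
proof -
  have "{z. \<Theta> z \<noteq> 0} \<subseteq> cball 0 R" using supp by auto
  then have sub: "closure {z. \<Theta> z \<noteq> 0} \<subseteq> cball 0 R" by (intro closure_minimal) auto
  have "radial_deriv z = 0" if "z \<notin> cball 0 R" for z
    unfolding radial_deriv_def by (rule frechet_derivative_zero_off_support) (use that sub in auto)
  then show ?thesis
    using compact_support_bounded[OF radial_deriv_continuous compact_cball[of 0 R]] by metis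
qed

lemma dil_derivative:
  assumes "\<tau> > 0"
  shows "((\<lambda>\<tau>. dil \<tau> w) has_real_derivative ddil \<tau> w) (at \<tau>)"
proof -
  let ?N = "DIM('a)"
  have 1: "((\<lambda>\<tau>. w /\<^sub>R \<tau>) has_derivative (\<lambda>h. (- h / \<tau>\<^sup>2) *\<^sub>R w)) (at \<tau>)"
    using assms by (auto intro!: derivative_eq_intros simp: power2_eq_square divide_inverse)
  have d: "(\<Theta> has_derivative frechet_derivative \<Theta> (at (w /\<^sub>R \<tau>))) (at (w /\<^sub>R \<tau>))"
    by (rule smooth_has_derivative[OF smooth])
  note lin = has_derivative_linear[OF d]
  have "((\<lambda>\<tau>. \<Theta> (w /\<^sub>R \<tau>)) has_derivative (\<lambda>h. frechet_derivative \<Theta> (at (w /\<^sub>R \<tau>)) ((- h / \<tau>\<^sup>2) *\<^sub>R w))) (at \<tau>)"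
    by (rule has_derivative_compose[OF 1 d])
  moreover have rd: "frechet_derivative \<Theta> (at (w /\<^sub>R \<tau>)) ((- h / \<tau>\<^sup>2) *\<^sub>R w) = (- radial_deriv (w /\<^sub>R \<tau>) / \<tau>) * h" for h
  proof -
    have "(- h / \<tau>\<^sup>2) *\<^sub>R w = (- h / \<tau>) *\<^sub>R (w /\<^sub>R \<tau>)" using assms by (simp add: power2_eq_square divide_inverse)
    then show ?thesis unfolding radial_deriv_def by (simp only: linear_cmul[OF lin]) simp
  qed
  ultimately have 2: "((\<lambda>\<tau>. \<Theta> (w /\<^sub>R \<tau>)) has_real_derivative (- radial_deriv (w /\<^sub>R \<tau>) / \<tau>)) (at \<tau>)"
    unfolding has_field_derivative_def by (simp only: rd)
  have 3: "((\<lambda>\<tau>. inverse (\<tau> ^ ?N)) has_real_derivative (- (inverse (\<tau> ^ ?N) * (real ?N * \<tau> ^ (?N - Suc 0)) * inverse (\<tau> ^ ?N)))) (at \<tau>)"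
    using assms by (intro DERIV_inverse' DERIV_pow) auto
  have 4: "- (inverse (\<tau> ^ ?N) * (real ?N * \<tau> ^ (?N - Suc 0)) * inverse (\<tau> ^ ?N)) = - (real ?N / \<tau> ^ (?N + 1))"
  proof -
    obtain m where m: "?N = Suc m" using DIM_positive[where 'a='a] by (metis Suc_pred)
    show ?thesis unfolding m using assms by (simp add: divide_simps)
  qed
  have "((\<lambda>\<tau>. \<Theta> (w /\<^sub>R \<tau>) * inverse (\<tau> ^ ?N)) has_real_derivative
      (- radial_deriv (w /\<^sub>R \<tau>) / \<tau>) * inverse (\<tau> ^ ?N) + (- (real ?N / \<tau> ^ (?N + 1))) * \<Theta> (w /\<^sub>R \<tau>)) (at \<tau>)"
    by (rule DERIV_mult[OF 2 3[unfolded 4]])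
  moreover have "(- radial_deriv (w /\<^sub>R \<tau>) / \<tau>) * inverse (\<tau> ^ ?N) + (- (real ?N / \<tau> ^ (?N + 1))) * \<Theta> (w /\<^sub>R \<tau>) = ddil \<tau> w"
    unfolding ddil_def using assms by (simp add: divide_simps)
  ultimately show ?thesis by (simp add: dil_def[abs_def] divide_inverse)
qed

lemma ddil_continuous: "\<tau> > 0 \<Longrightarrow> isCont (\<lambda>\<tau>. ddil \<tau> w) \<tau>"
proof -
  assume t: "\<tau> > 0"
  have c: "isCont (\<lambda>\<tau>. w /\<^sub>R \<tau>) \<tau>" using t by (intro continuous_intros) auto
  have "isCont radial_deriv (w /\<^sub>R \<tau>)" "isCont \<Theta> (w /\<^sub>R \<tau>)"
    using radial_deriv_continuous cont by (simp_all add: continuous_on_eq_continuous_at)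
  then have "isCont (\<lambda>\<tau>. radial_deriv (w /\<^sub>R \<tau>)) \<tau>" "isCont (\<lambda>\<tau>. \<Theta> (w /\<^sub>R \<tau>)) \<tau>"
    using isCont_o2[OF c] by blast+
  then show ?thesis unfolding ddil_def using t by (intro continuous_intros) auto
qed

lemma ddil_bounded:
  assumes "s > 0"
  shows "\<exists>C. \<forall>\<tau> w. s \<le> \<tau> \<longrightarrow> \<bar>ddil \<tau> w\<bar> \<le> C"
proof -
  obtain A where A: "A > 0" "\<And>z. \<bar>radial_deriv z\<bar> \<le> A" using radial_deriv_bounded by blast
  obtain B where B: "B > 0" "\<And>z. \<Theta> z \<le> B" using bounded by blast
  have "\<bar>ddil \<tau> w\<bar> \<le> (A + DIM('a) * B) / s ^ (DIM('a) + 1)" if "s \<le> \<tau>" for \<tau> w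
  proof -
    have "\<bar>radial_deriv (w /\<^sub>R \<tau>) + DIM('a) * \<Theta> (w /\<^sub>R \<tau>)\<bar> \<le> \<bar>radial_deriv (w /\<^sub>R \<tau>)\<bar> + \<bar>DIM('a) * \<Theta> (w /\<^sub>R \<tau>)\<bar>"
      by (rule abs_triangle_ineq)
    also have "\<dots> \<le> A + DIM('a) * B"
      using A(2) B(2) nonneg by (intro add_mono) (simp_all add: abs_mult mult_left_mono)
    finally have 1: "\<bar>radial_deriv (w /\<^sub>R \<tau>) + DIM('a) * \<Theta> (w /\<^sub>R \<tau>)\<bar> \<le> A + DIM('a) * B" .
    have 2: "s ^ (DIM('a) + 1) \<le> \<tau> ^ (DIM('a) + 1)" using assms that by (intro power_mono) auto
    have "\<bar>ddil \<tau> w\<bar> = \<bar>radial_deriv (w /\<^sub>R \<tau>) + DIM('a) * \<Theta> (w /\<^sub>R \<tau>)\<bar> / \<tau> ^ (DIM('a) + 1)"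
      using assms that by (simp add: ddil_def abs_divide)
    also have "\<dots> \<le> (A + DIM('a) * B) / s ^ (DIM('a) + 1)"
      using assms A B by (intro frac_le 1 2) (auto intro!: add_nonneg_nonneg)
    finally show ?thesis .
  qed
  then show ?thesis by blast
qed

lemma dil_frechet:
  assumes "\<tau> \<noteq> 0"
  shows "frechet_derivative (\<lambda>y. dil \<tau> (y - x)) (at y) v = frechet_derivative \<Theta> (at ((y - x) /\<^sub>R \<tau>)) (v /\<^sub>R \<tau>) / \<tau> ^ DIM('a)"
proof -
  have 1: "((\<lambda>y. (y - x) /\<^sub>R \<tau>) has_derivative (\<lambda>v. v /\<^sub>R \<tau>)) (at y)"
    by (auto intro!: derivative_eq_intros)
  have "((\<lambda>y. \<Theta> ((y - x) /\<^sub>R \<tau>)) has_derivative (\<lambda>v. frechet_derivative \<Theta> (at ((y - x) /\<^sub>R \<tau>)) (v /\<^sub>R \<tau>))) (at y)"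
    by (rule has_derivative_compose[OF 1 smooth_has_derivative[OF smooth]])
  from has_derivative_mult_left[OF this, of "inverse (\<tau> ^ DIM('a))"]
  have "((\<lambda>y. dil \<tau> (y - x)) has_derivative (\<lambda>v. frechet_derivative \<Theta> (at ((y - x) /\<^sub>R \<tau>)) (v /\<^sub>R \<tau>) / \<tau> ^ DIM('a))) (at y)"
    unfolding dil_def[abs_def] divide_inverse .
  from frechet_derivative_at[OF this] show ?thesis by metis
qed

end

context cone_piece
begin

definition vtest :: "real \<Rightarrow> 'a \<Rightarrow> 'a \<Rightarrow> 'a \<Rightarrow> real" where
  "vtest \<tau> x i y = ((y - x) \<bullet> i) / \<tau> * dil \<tau> (y - x)"

text \<open>Here the cone condition enters: the kernel centred at x with scale \<tau> is supported
  in x + \<tau> K, a compact subset of the domain even when x is close to the boundary.\<close>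

lemma vtest_test_fun:
  assumes x: "x \<in> D" and t: "0 < \<tau>" "\<tau> \<le> h"
  shows "test_fun \<Omega> (vtest \<tau> x i)" "test_fun \<Omega> (\<lambda>y. dil \<tau> (y - x))"
proof -
  have zero: "dil \<tau> (y - x) = 0" if "y \<notin> (\<lambda>z. x + \<tau> *\<^sub>R z) ` K" for y
  proof -
    have "(y - x) /\<^sub>R \<tau> \<notin> K"
    proof
      assume "(y - x) /\<^sub>R \<tau> \<in> K"
      moreover have "y = x + \<tau> *\<^sub>R ((y - x) /\<^sub>R \<tau>)" using t by simp
      ultimately show False using that by blast
    qed
    then show ?thesis using K_supp by (simp add: dil_def)
  qed
  have cK: "compact ((\<lambda>z. x + \<tau> *\<^sub>R z) ` K)"
    by (intro compact_continuous_image continuous_intros K_compact)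
  have sub: "(\<lambda>z. x + \<tau> *\<^sub>R z) ` K \<subseteq> \<Omega>" using cone[OF x t] by auto
  have "(\<lambda>y. vtest \<tau> x i y) = (\<lambda>y. (y \<bullet> i) * ((1/\<tau>) * dil \<tau> (y - x)) + (- (x \<bullet> i) / \<tau>) * dil \<tau> (y - x))"
    using t by (simp add: vtest_def fun_eq_iff inner_diff_left field_simps)
  moreover have "smooth_on UNIV (\<lambda>y. (y \<bullet> i) * ((1/\<tau>) * dil \<tau> (y - x)) + (- (x \<bullet> i) / \<tau>) * dil \<tau> (y - x))"
    unfolding smooth_on_UNIV_iff
    by (intro allI times_diff_add times_diff_mult times_diff_const times_diff_inner)
      (use dil_smooth[unfolded smooth_on_UNIV_iff] in blast)+
  ultimately have "smooth_on UNIV (vtest \<tau> x i)" by simp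
  then show "test_fun \<Omega> (vtest \<tau> x i)"
    by (rule test_funI[OF _ cK sub]) (simp add: vtest_def zero)
  show "test_fun \<Omega> (\<lambda>y. dil \<tau> (y - x))"
    by (rule test_funI[OF dil_smooth cK sub zero])
qed

text \<open>A continuity equation: as \<tau> grows, the mass of the kernel is carried along rays
  from x with velocity (y - x) / \<tau>. The radial derivative comes from differentiating the
  kernel, the dimension from the divergence of y - x.\<close>

lemma vtest_divergence:
  assumes t: "0 < \<tau>"
  shows "(\<Sum>i\<in>Basis. frechet_derivative (vtest \<tau> x i) (at y) i) = - ddil \<tau> (y - x)"
proof -
  define L where "L = frechet_derivative \<Theta> (at ((y - x) /\<^sub>R \<tau>))"
  have d: "\<Theta> differentiable (at z)" for z using smooth_has_derivative[OF smooth] by (auto simp: differentiable_def)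
  have lin: "linear L" unfolding L_def by (rule linear_frechet_derivative[OF d])
  have fd: "frechet_derivative (vtest \<tau> x i) (at y) i = ((y - x) \<bullet> i) / \<tau> * (L (i /\<^sub>R \<tau>) / \<tau> ^ DIM('a)) + (i \<bullet> i) / \<tau> * dil \<tau> (y - x)" for i
  proof -
    have 1: "((\<lambda>y. ((y - x) \<bullet> i) / \<tau>) has_derivative (\<lambda>v. (v \<bullet> i) / \<tau>)) (at y)"
      using t by (auto intro!: derivative_eq_intros)
    have 2: "((\<lambda>y. dil \<tau> (y - x)) has_derivative frechet_derivative (\<lambda>y. dil \<tau> (y - x)) (at y)) (at y)"
      by (rule smooth_has_derivative[OF dil_smooth])
    from frechet_derivative_at[OF has_derivative_mult[OF 1 2]]
    have "frechet_derivative (vtest \<tau> x i) (at y) = (\<lambda>v. ((y - x) \<bullet> i) / \<tau> * frechet_derivative (\<lambda>y. dil \<tau> (y - x)) (at y) v + (v \<bullet> i) / \<tau> * dil \<tau> (y - x))"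
      unfolding vtest_def[abs_def] by simp
    then show ?thesis using t by (simp add: dil_frechet L_def)
  qed
  have "radial_deriv ((y - x) /\<^sub>R \<tau>) = (\<Sum>i\<in>Basis. (((y - x) /\<^sub>R \<tau>) \<bullet> i) * L i)"
    unfolding radial_deriv_def L_def by (rule frechet_derivative_Basis_expand[OF d])
  then have 1: "(\<Sum>i\<in>Basis. ((y - x) \<bullet> i) / \<tau> * (L (i /\<^sub>R \<tau>) / \<tau> ^ DIM('a))) = radial_deriv ((y - x) /\<^sub>R \<tau>) / \<tau> ^ (DIM('a) + 1)"
  proof -
    have "((y - x) \<bullet> i) / \<tau> * (L (i /\<^sub>R \<tau>) / \<tau> ^ DIM('a)) = (((y - x) /\<^sub>R \<tau>) \<bullet> i * L i) / \<tau> ^ (DIM('a) + 1)" for i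
      by (simp add: linear_cmul[OF lin] divide_inverse mult_ac)
    then show ?thesis unfolding \<open>radial_deriv _ = _\<close> by (simp only: sum_divide_distrib)
  qed
  have 2: "(\<Sum>i\<in>Basis. ((i::'a) \<bullet> i) / \<tau> * dil \<tau> (y - x)) = DIM('a) * \<Theta> ((y - x) /\<^sub>R \<tau>) / \<tau> ^ (DIM('a) + 1)"
    using t by (simp add: dil_def)
  show ?thesis
    unfolding fd sum.distrib 1 2 ddil_def
    by (simp only: minus_divide_left[symmetric] minus_minus add_divide_distrib)
qed

text \<open>Integration by parts coordinate by coordinate. After it, the change of the average with
  the scale is expressed by the gradient alone.\<close>

lemma ddil_identity:
  assumes u: "L2 \<Omega> u" and G: "weak_gradient \<Omega> u G" and x: "x \<in> D" and t: "0 < \<tau>" "\<tau> \<le> h"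
  shows "(\<integral>y. u y * ddil \<tau> (y - x) \<partial>lebesgue_on \<Omega>) = (\<integral>y. (G y \<bullet> (y - x)) / \<tau> * dil \<tau> (y - x) \<partial>lebesgue_on \<Omega>)"
    "integrable (lebesgue_on \<Omega>) (\<lambda>y. (G y \<bullet> (y - x)) / \<tau> * dil \<tau> (y - x))"
proof -
  note tf = vtest_test_fun(1)[OF x t]
  have "(\<integral>y. u y * ddil \<tau> (y - x) \<partial>lebesgue_on \<Omega>) = - (\<integral>y. (\<Sum>i\<in>Basis. u y * frechet_derivative (vtest \<tau> x i) (at y) i) \<partial>lebesgue_on \<Omega>)"
    unfolding sum_distrib_left[symmetric] vtest_divergence[OF t(1)] by simp
  also have "\<dots> = - (\<Sum>i\<in>Basis. \<integral>y. u y * frechet_derivative (vtest \<tau> x i) (at y) i \<partial>lebesgue_on \<Omega>)"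
    by (subst Bochner_Integration.integral_sum) (use integrable_test(2)[OF u tf] in auto)
  also have "\<dots> = (\<Sum>i\<in>Basis. \<integral>y. (G y \<bullet> i) * vtest \<tau> x i y \<partial>lebesgue_on \<Omega>)"
    using weak_gradientD(3)[OF G tf] by (simp add: sum_negf)
  also have "\<dots> = (\<integral>y. (\<Sum>i\<in>Basis. (G y \<bullet> i) * vtest \<tau> x i y) \<partial>lebesgue_on \<Omega>)"
    by (rule Bochner_Integration.integral_sum[symmetric]) (rule integrable_test(1)[OF weak_gradientD(4)[OF G] tf])
  also have eq: "(\<lambda>y. \<Sum>i\<in>Basis. (G y \<bullet> i) * vtest \<tau> x i y) = (\<lambda>y. (G y \<bullet> (y - x)) / \<tau> * dil \<tau> (y - x))"
  proof
    fix y
    have "G y \<bullet> (y - x) = (\<Sum>i\<in>Basis. (G y \<bullet> i) * ((y - x) \<bullet> i))" by (rule euclidean_inner)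
    then show "(\<Sum>i\<in>Basis. (G y \<bullet> i) * vtest \<tau> x i y) = (G y \<bullet> (y - x)) / \<tau> * dil \<tau> (y - x)"
      by (simp add: vtest_def sum_divide_distrib sum_distrib_right mult.assoc)
  qed
  finally show "(\<integral>y. u y * ddil \<tau> (y - x) \<partial>lebesgue_on \<Omega>) = (\<integral>y. (G y \<bullet> (y - x)) / \<tau> * dil \<tau> (y - x) \<partial>lebesgue_on \<Omega>)" .
  have "integrable (lebesgue_on \<Omega>) (\<lambda>y. \<Sum>i\<in>Basis. (G y \<bullet> i) * vtest \<tau> x i y)"
    by (rule Bochner_Integration.integrable_sum) (rule integrable_test(1)[OF weak_gradientD(4)[OF G] tf])
  then show "integrable (lebesgue_on \<Omega>) (\<lambda>y. (G y \<bullet> (y - x)) / \<tau> * dil \<tau> (y - x))"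
    unfolding eq .
qed

text \<open>\<open>ddil_identity\<close> integrated over the scales from s to t. The bound is an
  integral over pairs (scale, point) with the indicator of \<open>{s..t}\<close> in the kernel as
  well as in the function, which is the form that \<open>schur_test\<close> exploits.\<close>

lemma moll_difference:
  assumes u: "L2 \<Omega> u" and G: "weak_gradient \<Omega> u G"
    and U: "U \<in> borel_measurable borel" "\<And>x. x \<notin> \<Omega> \<Longrightarrow> U x = 0" "AE x in lebesgue_on \<Omega>. u x = U x" "integrable lborel U"
    and H: "H \<in> borel_measurable borel" "\<And>x. x \<notin> \<Omega> \<Longrightarrow> H x = 0" "AE x in lebesgue_on \<Omega>. G x = H x"
    and x: "x \<in> D" and st: "0 < s" "s \<le> t" "t \<le> h"
  shows "ennreal \<bar>moll t U x - moll s U x\<bar> \<le>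
    (\<integral>\<^sup>+z. (indicator {s..t} (fst z) * ennreal (dil (fst z) (snd z - x))) * (indicator {s..t} (fst z) * ennreal (\<bar>R\<bar> * norm (H (snd z)))) \<partial>(lborel \<Otimes>\<^sub>M lborel))"
proof -
  note [measurable] = U(1) H(1)
  obtain C where C: "\<And>\<tau> w. s \<le> \<tau> \<Longrightarrow> \<bar>ddil \<tau> w\<bar> \<le> C" using ddil_bounded[OF st(1)] by blast
  have eq: "moll t U x - moll s U x = (\<integral>\<tau>. indicator {s..t} \<tau> * (\<integral>y. U y * ddil \<tau> (y - x) \<partial>lborel) \<partial>lborel)"
    unfolding moll_def
  proof (rule FTC_Fubini[OF U(4) st(2)])
    show "((\<lambda>\<tau>. dil \<tau> (y - x)) has_real_derivative ddil \<tau> (y - x)) (at \<tau>)" if "s \<le> \<tau>" "\<tau> \<le> t" for \<tau> y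
      by (rule dil_derivative) (use that st in simp)
    show "isCont (\<lambda>\<tau>. ddil \<tau> (y - x)) \<tau>" if "s \<le> \<tau>" "\<tau> \<le> t" for \<tau> y
      by (rule ddil_continuous) (use that st in simp)
    show "\<bar>ddil \<tau> (y - x)\<bar> \<le> C" if "s \<le> \<tau>" "\<tau> \<le> t" for \<tau> y
      by (rule C[OF that(1)])
    show "(\<lambda>(\<tau>, y). indicator {s..t} \<tau> * ddil \<tau> (y - x)) \<in> borel_measurable (borel \<Otimes>\<^sub>M borel)"
      unfolding ddil_def by measurable
    show "integrable lborel (\<lambda>y. U y * dil s (y - x))" by (rule dil_integrable[OF st(1) U(4)])
    show "integrable lborel (\<lambda>y. U y * dil t (y - x))" by (rule dil_integrable[OF _ U(4)]) (use st in simp)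
  qed
  have inner: "ennreal \<bar>\<integral>y. U y * ddil \<tau> (y - x) \<partial>lborel\<bar> \<le> (\<integral>\<^sup>+y. ennreal (dil \<tau> (y - x)) * ennreal (\<bar>R\<bar> * norm (H y)) \<partial>lborel)"
    if tau: "s \<le> \<tau>" "\<tau> \<le> t" for \<tau>
  proof -
    have tp: "0 < \<tau>" "\<tau> \<le> h" using tau st by auto
    note id = ddil_identity[OF u G x tp]
    have "(\<integral>y. u y * ddil \<tau> (y - x) \<partial>lebesgue_on \<Omega>) = (\<integral>y. U y * ddil \<tau> (y - x) \<partial>lborel)"
    proof (rule integral_lebesgue_on_eq_lborel(1)[OF borel_dom])
      show "(\<lambda>y. U y * ddil \<tau> (y - x)) \<in> borel_measurable borel" unfolding ddil_def by measurable
      show "AE y in lebesgue_on \<Omega>. u y * ddil \<tau> (y - x) = U y * ddil \<tau> (y - x)" using U(3) by eventually_elim simp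
      have "(\<lambda>y. ddil \<tau> (y - x)) \<in> borel_measurable (lebesgue_on \<Omega>)"
        by (rule borel_measurable_lebesgue_onI) (unfold ddil_def, measurable)
      then show "(\<lambda>y. u y * ddil \<tau> (y - x)) \<in> borel_measurable (lebesgue_on \<Omega>)"
        by (rule borel_measurable_times[OF L2D(1)[OF u]])
      show "U y * ddil \<tau> (y - x) = 0" if "y \<notin> \<Omega>" for y using U(2)[OF that] by simp
    qed
    moreover have AEH: "AE y in lebesgue_on \<Omega>. (G y \<bullet> (y - x)) / \<tau> * dil \<tau> (y - x) = (H y \<bullet> (y - x)) / \<tau> * dil \<tau> (y - x)"
      using H(3) by eventually_elim simp
    have Hm: "(\<lambda>y. (H y \<bullet> (y - x)) / \<tau> * dil \<tau> (y - x)) \<in> borel_measurable borel" by measurable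
    have Hz: "(H y \<bullet> (y - x)) / \<tau> * dil \<tau> (y - x) = 0" if "y \<notin> \<Omega>" for y using H(2)[OF that] by simp
    have I: "(\<integral>y. (G y \<bullet> (y - x)) / \<tau> * dil \<tau> (y - x) \<partial>lebesgue_on \<Omega>) = (\<integral>y. (H y \<bullet> (y - x)) / \<tau> * dil \<tau> (y - x) \<partial>lborel)"
      "integrable lborel (\<lambda>y. (H y \<bullet> (y - x)) / \<tau> * dil \<tau> (y - x))"
      using integral_lebesgue_on_eq_lborel[OF borel_dom Hm _ borel_measurable_integrable[OF id(2)] AEH] Hz id(2) by metis+
    ultimately have e: "(\<integral>y. U y * ddil \<tau> (y - x) \<partial>lborel) = (\<integral>y. (H y \<bullet> (y - x)) / \<tau> * dil \<tau> (y - x) \<partial>lborel)"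
      using id(1) I(1) by simp
    have "ennreal \<bar>\<integral>y. U y * ddil \<tau> (y - x) \<partial>lborel\<bar> \<le> (\<integral>\<^sup>+y. ennreal \<bar>(H y \<bullet> (y - x)) / \<tau> * dil \<tau> (y - x)\<bar> \<partial>lborel)"
      unfolding e using integral_norm_bound_ennreal[OF I(2)] by simp
    also have "\<dots> \<le> (\<integral>\<^sup>+y. ennreal (dil \<tau> (y - x)) * ennreal (\<bar>R\<bar> * norm (H y)) \<partial>lborel)"
    proof (rule nn_integral_mono)
      fix y
      have "\<bar>(H y \<bullet> (y - x)) / \<tau> * dil \<tau> (y - x)\<bar> \<le> dil \<tau> (y - x) * (\<bar>R\<bar> * norm (H y))"
      \<comment> \<open>On the support of the kernel |y - x| <= \<tau> R, which cancels the division
        by \<tau>.\<close>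
      proof (cases "dil \<tau> (y - x) = 0")
        case False
        then have "norm (y - x) \<le> \<tau> * R" using dil_eq_0[OF tp(1), of "y - x"] by (meson not_less)
        then have "norm (y - x) / \<tau> \<le> R" using tp(1) by (simp add: pos_divide_le_eq mult.commute)
        then have n: "norm (y - x) / \<tau> \<le> \<bar>R\<bar>" by linarith
        have "\<bar>H y \<bullet> (y - x)\<bar> / \<tau> \<le> norm (H y) * norm (y - x) / \<tau>"
          using tp(1) Cauchy_Schwarz_ineq2[of "H y" "y - x"] by (intro divide_right_mono) auto
        also have "\<dots> \<le> norm (H y) * \<bar>R\<bar>" using mult_left_mono[OF n, of "norm (H y)"] by simp
        finally have "\<bar>H y \<bullet> (y - x)\<bar> / \<tau> * dil \<tau> (y - x) \<le> norm (H y) * \<bar>R\<bar> * dil \<tau> (y - x)"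
          by (rule mult_right_mono) (rule dil_nonneg[OF tp(1)])
        then show ?thesis using tp(1) dil_nonneg[OF tp(1), of "y - x"]
          by (simp add: abs_mult mult_ac)
      qed simp
      then have "ennreal \<bar>(H y \<bullet> (y - x)) / \<tau> * dil \<tau> (y - x)\<bar> \<le> ennreal (dil \<tau> (y - x) * (\<bar>R\<bar> * norm (H y)))"
        by (rule ennreal_leI)
      also have "\<dots> = ennreal (dil \<tau> (y - x)) * ennreal (\<bar>R\<bar> * norm (H y))"
        by (rule ennreal_mult) (use dil_nonneg[OF tp(1)] in auto)
      finally show "ennreal \<bar>(H y \<bullet> (y - x)) / \<tau> * dil \<tau> (y - x)\<bar> \<le> ennreal (dil \<tau> (y - x)) * ennreal (\<bar>R\<bar> * norm (H y))" .
    qed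
    finally show ?thesis .
  qed
  have "ennreal \<bar>moll t U x - moll s U x\<bar> \<le> (\<integral>\<^sup>+\<tau>. ennreal \<bar>indicator {s..t} \<tau> * (\<integral>y. U y * ddil \<tau> (y - x) \<partial>lborel)\<bar> \<partial>lborel)"
  \<comment> \<open>If the outer integrand were not integrable its integral would be 0 by
    convention, and the bound would hold trivially.\<close>
  proof (cases "integrable lborel (\<lambda>\<tau>. indicator {s..t} \<tau> * (\<integral>y. U y * ddil \<tau> (y - x) \<partial>lborel))")
    case True
    then show ?thesis unfolding eq using integral_norm_bound_ennreal[OF True] by simp
  next
    case False
    show ?thesis unfolding eq not_integrable_integral_eq[OF False] by (simp only: abs_zero ennreal_0 zero_le)
  qed
  also have "\<dots> \<le> (\<integral>\<^sup>+\<tau>. (\<integral>\<^sup>+y. (indicator {s..t} \<tau> * ennreal (dil \<tau> (y - x))) * (indicator {s..t} \<tau> * ennreal (\<bar>R\<bar> * norm (H y))) \<partial>lborel) \<partial>lborel)"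
  proof (rule nn_integral_mono)
    fix \<tau> :: real
    show "ennreal \<bar>indicator {s..t} \<tau> * (\<integral>y. U y * ddil \<tau> (y - x) \<partial>lborel)\<bar>
       \<le> (\<integral>\<^sup>+y. (indicator {s..t} \<tau> * ennreal (dil \<tau> (y - x))) * (indicator {s..t} \<tau> * ennreal (\<bar>R\<bar> * norm (H y))) \<partial>lborel)"
      using inner[of \<tau>] by (cases "\<tau> \<in> {s..t}") simp_all
  qed
  also have "\<dots> = (\<integral>\<^sup>+z. (indicator {s..t} (fst z) * ennreal (dil (fst z) (snd z - x))) * (indicator {s..t} (fst z) * ennreal (\<bar>R\<bar> * norm (H (snd z)))) \<partial>(lborel \<Otimes>\<^sub>M lborel))"
  proof (subst lborel.nn_integral_fst[symmetric])
    show "(\<lambda>z. (indicator {s..t} (fst z) * ennreal (dil (fst z) (snd z - x))) * (indicator {s..t} (fst z) * ennreal (\<bar>R\<bar> * norm (H (snd z))))) \<in> borel_measurable (lborel \<Otimes>\<^sub>M lborel)"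
      unfolding dil_def by measurable
  qed simp
  finally show ?thesis .
qed

text \<open>In Schur's test over pairs the kernel has total mass t - s in (\<tau>, y) and at most 1
  in x, while the squared function contributes another t - s. The product of the two lengths is at
  most t^2, with no trace of s.\<close>

lemma moll_difference_L2:
  assumes u: "L2 \<Omega> u" and G: "weak_gradient \<Omega> u G"
    and U: "U \<in> borel_measurable borel" "\<And>x. x \<notin> \<Omega> \<Longrightarrow> U x = 0" "AE x in lebesgue_on \<Omega>. u x = U x" "integrable lborel U"
    and st: "0 < s" "s \<le> t" "t \<le> h"
  shows "(\<integral>\<^sup>+x. indicator D x * ennreal ((moll t U x - moll s U x)\<^sup>2) \<partial>lborel)
     \<le> ennreal (R\<^sup>2 * t\<^sup>2 * (\<integral>x. (norm (G x))\<^sup>2 \<partial>lebesgue_on \<Omega>))"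
proof -
  obtain H where H: "H \<in> borel_measurable borel" "\<And>x. x \<notin> \<Omega> \<Longrightarrow> H x = 0" "AE x in lebesgue_on \<Omega>. G x = H x"
    "integrable lborel (\<lambda>x. (norm (H x))\<^sup>2)" "(\<integral>x. (norm (H x))\<^sup>2 \<partial>lborel) = (\<integral>x. (norm (G x))\<^sup>2 \<partial>lebesgue_on \<Omega>)"
    using gradient_representative[OF G] by blast
  note [measurable] = U(1) H(1) D_borel
  let ?k = "\<lambda>x z. indicator {s..t} (fst z) * ennreal (dil (fst z) (snd z - x))"
  let ?f = "\<lambda>z::real \<times> 'a. indicator {s..t} (fst z) * ennreal (\<bar>R\<bar> * norm (H (snd z)))"
  let ?P = "lborel \<Otimes>\<^sub>M lborel :: (real \<times> 'a) measure"
  have "(\<integral>\<^sup>+x. indicator D x * ennreal ((moll t U x - moll s U x)\<^sup>2) \<partial>lborel) \<le> (\<integral>\<^sup>+x. (\<integral>\<^sup>+z. ?k x z * ?f z \<partial>?P)\<^sup>2 \<partial>lborel)"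
  proof (rule nn_integral_mono)
    fix x :: 'a
    show "indicator D x * ennreal ((moll t U x - moll s U x)\<^sup>2) \<le> (\<integral>\<^sup>+z. ?k x z * ?f z \<partial>?P)\<^sup>2"
    proof (cases "x \<in> D")
      case True
      have "ennreal ((moll t U x - moll s U x)\<^sup>2) = (ennreal \<bar>moll t U x - moll s U x\<bar>)\<^sup>2"
        by (simp add: ennreal_power)
      also have "\<dots> \<le> (\<integral>\<^sup>+z. ?k x z * ?f z \<partial>?P)\<^sup>2"
        by (rule power_mono[OF moll_difference[OF u G U H(1,2,3) True st]]) auto
      finally show ?thesis using True by simp
    qed simp
  qed
  also have "\<dots> \<le> ennreal (t - s) * 1 * (\<integral>\<^sup>+z. (?f z)\<^sup>2 \<partial>?P)"
  proof (rule schur_test)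
    show "sigma_finite_measure (lborel :: 'a measure)" by (rule sigma_finite_lborel)
    show "sigma_finite_measure ?P" by (rule sigma_finite_pair_measure) (rule sigma_finite_lborel)+
    show "(\<lambda>(x, z). ?k x z) \<in> borel_measurable (lborel \<Otimes>\<^sub>M ?P)" unfolding dil_def by measurable
    show "?f \<in> borel_measurable ?P" by measurable
    show "(\<integral>\<^sup>+z. ?k x z \<partial>?P) \<le> ennreal (t - s)" for x
    proof -
      have "(\<integral>\<^sup>+z. ?k x z \<partial>?P) = (\<integral>\<^sup>+\<tau>. (\<integral>\<^sup>+y. indicator {s..t} \<tau> * ennreal (dil \<tau> (y - x)) \<partial>lborel) \<partial>lborel)"
      proof (subst lborel.nn_integral_fst[symmetric])
        show "?k x \<in> borel_measurable ?P" unfolding dil_def by measurable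
      qed simp
      also have "\<dots> = (\<integral>\<^sup>+\<tau>. indicator {s..t} \<tau> \<partial>lborel)"
      proof (rule nn_integral_cong)
        fix \<tau> show "(\<integral>\<^sup>+y. indicator {s..t} \<tau> * ennreal (dil \<tau> (y - x)) \<partial>lborel) = indicator {s..t} \<tau>"
          using dil_int[of \<tau> x] st(1) by (cases "\<tau> \<in> {s..t}") auto
      qed
      also have "\<dots> = ennreal (t - s)" using st by simp
      finally show ?thesis by simp
    qed
    show "(\<integral>\<^sup>+x. ?k x z \<partial>lborel) \<le> 1" for z
      using dil_int'[of "fst z" "snd z"] st(1) by (cases "fst z \<in> {s..t}") auto
  qed
  also have "(\<integral>\<^sup>+z. (?f z)\<^sup>2 \<partial>?P) = ennreal (t - s) * ennreal (R\<^sup>2 * (\<integral>x. (norm (H x))\<^sup>2 \<partial>lborel))"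
  proof -
    have "(\<integral>\<^sup>+z. (?f z)\<^sup>2 \<partial>?P) = (\<integral>\<^sup>+z. indicator {s..t} (fst z) * ennreal (R\<^sup>2 * (norm (H (snd z)))\<^sup>2) \<partial>?P)"
    proof (rule nn_integral_cong)
      fix z show "(?f z)\<^sup>2 = indicator {s..t} (fst z) * ennreal (R\<^sup>2 * (norm (H (snd z)))\<^sup>2)"
        by (cases "fst z \<in> {s..t}") (simp_all add: ennreal_power power_mult_distrib)
    qed
    also have "\<dots> = (\<integral>\<^sup>+\<tau>. (\<integral>\<^sup>+y. indicator {s..t} \<tau> * ennreal (R\<^sup>2 * (norm (H y))\<^sup>2) \<partial>lborel) \<partial>lborel)"
      by (subst lborel.nn_integral_fst[symmetric]) simp_all
    also have "\<dots> = (\<integral>\<^sup>+\<tau>. indicator {s..t} \<tau> * ennreal (R\<^sup>2 * (\<integral>x. (norm (H x))\<^sup>2 \<partial>lborel)) \<partial>lborel)"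
    proof (rule nn_integral_cong)
      fix \<tau>
      have "(\<integral>\<^sup>+y. ennreal (R\<^sup>2 * (norm (H y))\<^sup>2) \<partial>lborel) = ennreal (\<integral>x. R\<^sup>2 * (norm (H x))\<^sup>2 \<partial>lborel)"
        by (rule nn_integral_eq_integral) (use H(4) in auto)
      then show "(\<integral>\<^sup>+y. indicator {s..t} \<tau> * ennreal (R\<^sup>2 * (norm (H y))\<^sup>2) \<partial>lborel) = indicator {s..t} \<tau> * ennreal (R\<^sup>2 * (\<integral>x. (norm (H x))\<^sup>2 \<partial>lborel))"
        by (cases "\<tau> \<in> {s..t}") simp_all
    qed
    also have "\<dots> = ennreal (t - s) * ennreal (R\<^sup>2 * (\<integral>x. (norm (H x))\<^sup>2 \<partial>lborel))"
      using st by (simp add: nn_integral_multc)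
    finally show ?thesis .
  qed
  also have "ennreal (t - s) * 1 * (ennreal (t - s) * ennreal (R\<^sup>2 * (\<integral>x. (norm (H x))\<^sup>2 \<partial>lborel)))
     = ennreal ((t - s) * ((t - s) * (R\<^sup>2 * (\<integral>x. (norm (H x))\<^sup>2 \<partial>lborel))))"
    using st by (simp add: ennreal_mult[symmetric])
  also have "\<dots> \<le> ennreal (R\<^sup>2 * t\<^sup>2 * (\<integral>x. (norm (H x))\<^sup>2 \<partial>lborel))"
  proof (rule ennreal_leI)
    have "(t - s) * (t - s) \<le> t * t" using st by (intro mult_mono) auto
    then have "((t - s) * (t - s)) * (R\<^sup>2 * (\<integral>x. (norm (H x))\<^sup>2 \<partial>lborel)) \<le> (t * t) * (R\<^sup>2 * (\<integral>x. (norm (H x))\<^sup>2 \<partial>lborel))"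
      by (rule mult_right_mono) simp
    then show "(t - s) * ((t - s) * (R\<^sup>2 * (\<integral>x. (norm (H x))\<^sup>2 \<partial>lborel))) \<le> R\<^sup>2 * t\<^sup>2 * (\<integral>x. (norm (H x))\<^sup>2 \<partial>lborel)"
      by (simp add: power2_eq_square mult_ac)
  qed
  finally show ?thesis unfolding H(5) .
qed

text \<open>\<open>moll_difference_L2\<close> is uniform in s, so s may tend to 0, where
  \<open>moll_L2_tendsto\<close> replaces the smaller average by U. The factor 2 is that of (a +
  b)^2 <= 2 a^2 + 2 b^2.\<close>

lemma moll_estimate:
  assumes u: "L2 \<Omega> u" and G: "weak_gradient \<Omega> u G"
    and U: "U \<in> borel_measurable borel" "\<And>x. x \<notin> \<Omega> \<Longrightarrow> U x = 0" "AE x in lebesgue_on \<Omega>. u x = U x"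
      "integrable lborel (\<lambda>x. (U x)\<^sup>2)" "integrable lborel U"
    and t: "0 < t" "t \<le> h"
  shows "(\<integral>\<^sup>+x. indicator D x * ennreal ((moll t U x - U x)\<^sup>2) \<partial>lborel)
     \<le> ennreal (2 * R\<^sup>2 * t\<^sup>2 * (\<integral>x. (norm (G x))\<^sup>2 \<partial>lebesgue_on \<Omega>))"
proof (rule ennreal_le_epsilon)
  fix e :: real assume e: "0 < e"
  note [measurable] = U(1) D_borel
  obtain B where B: "\<And>x. norm x > B \<Longrightarrow> x \<notin> \<Omega>" using outside_ball by metis
  have UB: "U x = 0" if "norm x > B" for x using U(2)[OF B[OF that]] .
  obtain s0 where s0: "s0 > 0" "\<And>s. 0 < s \<Longrightarrow> s < s0 \<Longrightarrow> (\<integral>\<^sup>+x. ennreal ((moll s U x - U x)\<^sup>2) \<partial>lborel) \<le> ennreal (e/2)"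
    using moll_L2_tendsto[OF U(1,4) UB, of B "e/2"] e by auto
  define s where "s = min t (s0/2)"
  have s: "0 < s" "s \<le> t" "s < s0" using t s0(1) by (auto simp: s_def)
  let ?I = "\<integral>x. (norm (G x))\<^sup>2 \<partial>lebesgue_on \<Omega>"
  have sq: "(a - c)\<^sup>2 \<le> 2 * (a - b)\<^sup>2 + 2 * (b - c)\<^sup>2" for a b c :: real
    using norm_add_square_le[of "a - b" "b - c"] by simp
  have "(\<integral>\<^sup>+x. indicator D x * ennreal ((moll t U x - U x)\<^sup>2) \<partial>lborel)
    \<le> (\<integral>\<^sup>+x. 2 * (indicator D x * ennreal ((moll t U x - moll s U x)\<^sup>2)) + 2 * ennreal ((moll s U x - U x)\<^sup>2) \<partial>lborel)"
  proof (rule nn_integral_mono)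
    fix x
    have "ennreal ((moll t U x - U x)\<^sup>2) \<le> ennreal (2 * (moll t U x - moll s U x)\<^sup>2 + 2 * (moll s U x - U x)\<^sup>2)"
      by (rule ennreal_leI[OF sq])
    also have "\<dots> = 2 * ennreal ((moll t U x - moll s U x)\<^sup>2) + 2 * ennreal ((moll s U x - U x)\<^sup>2)"
      by (simp add: ennreal_plus ennreal_mult)
    finally show "indicator D x * ennreal ((moll t U x - U x)\<^sup>2) \<le> 2 * (indicator D x * ennreal ((moll t U x - moll s U x)\<^sup>2)) + 2 * ennreal ((moll s U x - U x)\<^sup>2)"
      by (cases "x \<in> D") simp_all
  qed
  also have "\<dots> = 2 * (\<integral>\<^sup>+x. indicator D x * ennreal ((moll t U x - moll s U x)\<^sup>2) \<partial>lborel) + 2 * (\<integral>\<^sup>+x. ennreal ((moll s U x - U x)\<^sup>2) \<partial>lborel)"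
    by (subst nn_integral_add) (auto simp: nn_integral_cmult)
  also have "\<dots> \<le> 2 * ennreal (R\<^sup>2 * t\<^sup>2 * ?I) + 2 * ennreal (e/2)"
    by (intro add_mono mult_left_mono moll_difference_L2[OF u G U(1,2,3,5) s(1,2) t(2)] s0(2)[OF s(1,3)]) auto
  also have "\<dots> = ennreal (2 * R\<^sup>2 * t\<^sup>2 * ?I) + ennreal e"
    using e by (simp add: ennreal_mult'[symmetric] ennreal_numeral[symmetric] mult.assoc del: ennreal_numeral)
  finally show "(\<integral>\<^sup>+x. indicator D x * ennreal ((moll t U x - U x)\<^sup>2) \<partial>lborel) \<le> ennreal (2 * R\<^sup>2 * t\<^sup>2 * ?I) + ennreal e" .
qed

end

lemma nn_integral_lebesgue_on_eq_lborel:
  fixes f F :: "'a::euclidean_space \<Rightarrow> ennreal"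
  assumes S: "S \<in> sets borel" and F0: "\<And>x. x \<notin> S \<Longrightarrow> F x = 0" and ae: "AE x in lebesgue_on S. f x = F x"
  shows "(\<integral>\<^sup>+x. f x \<partial>lebesgue_on S) = (\<integral>\<^sup>+x. F x \<partial>lborel)"
proof -
  have "(\<integral>\<^sup>+x. f x \<partial>lebesgue_on S) = (\<integral>\<^sup>+x. F x \<partial>lebesgue_on S)"
    by (rule nn_integral_cong_AE[OF ae])
  also have "\<dots> = (\<integral>\<^sup>+x. F x * indicator S x \<partial>lebesgue)"
    using S by (intro nn_integral_restrict_space) simp
  also have "(\<lambda>x. F x * indicator S x) = F" using F0 by (auto simp: indicator_def fun_eq_iff)
  finally show ?thesis by (simp add: nn_integral_completion)
qed

section \<open>Smoothing operators and their gluing\<close>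

context bounded_open
begin

definition sqint :: "('a \<Rightarrow> real) \<Rightarrow> real" where
  "sqint u = (\<integral>x. (u x)\<^sup>2 \<partial>lebesgue_on \<Omega>)"

definition gradint :: "('a \<Rightarrow> 'a) \<Rightarrow> real" where
  "gradint G = (\<integral>x. (norm (G x))\<^sup>2 \<partial>lebesgue_on \<Omega>)"

lemma sqint_nonneg: "sqint u \<ge> 0" and gradint_nonneg: "gradint G \<ge> 0"
  by (simp_all add: sqint_def gradint_def)

definition uniform_Cauchy :: "(nat \<Rightarrow> 'a \<Rightarrow> real) \<Rightarrow> bool" where
  "uniform_Cauchy f \<longleftrightarrow> (\<forall>e>0. \<exists>N. \<forall>m\<ge>N. \<forall>n\<ge>N. \<forall>x\<in>\<Omega>. \<bar>f m x - f n x\<bar> < e)"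

text \<open>What the compactness theorems need from a smoothing operator. Unlike mollification itself, this
  passes to finite unions of pieces by cutting and pasting.\<close>

definition smoothing :: "'a set \<Rightarrow> real \<Rightarrow> real \<Rightarrow> (('a \<Rightarrow> real) \<Rightarrow> 'a \<Rightarrow> real) \<Rightarrow> bool" where
  "smoothing D A E T \<longleftrightarrow>
     (\<forall>u. L2 \<Omega> u \<longrightarrow> T u \<in> borel_measurable borel \<and> (\<forall>x. \<bar>T u x\<bar> \<le> A * sqrt (sqint u)) \<and>
        (\<forall>G. weak_gradient \<Omega> u G \<longrightarrow>
           (\<integral>\<^sup>+x. indicator D x * ennreal ((u x - T u x)\<^sup>2) \<partial>lebesgue_on \<Omega>) \<le> ennreal (E * gradint G))) \<and>
     (\<forall>us B. (\<forall>n. L2 \<Omega> (us n) \<and> sqint (us n) \<le> B) \<longrightarrow>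
        (\<exists>r::nat\<Rightarrow>nat. strict_mono r \<and> uniform_Cauchy (\<lambda>n. T (us (r n)))))"

text \<open>Both rates are recorded for all small t: compactness only lets t tend to 0, but the L^q
  bound balances the growth t^(-N) against the error t^2. A single constant C keeps finite unions
  simple.\<close>

definition smoothable :: "'a set \<Rightarrow> bool" where
  "smoothable D \<longleftrightarrow> D \<in> sets borel \<and> (\<exists>C h. 0 < C \<and> 0 < h \<and>
     (\<forall>t. 0 < t \<and> t \<le> h \<longrightarrow> (\<exists>T. smoothing D (C / t ^ DIM('a)) (C * t\<^sup>2) T)))"

lemma smoothingD:
  assumes "smoothing D A E T" "L2 \<Omega> u"
  shows "T u \<in> borel_measurable borel" "\<bar>T u x\<bar> \<le> A * sqrt (sqint u)"
    "weak_gradient \<Omega> u G \<Longrightarrow> (\<integral>\<^sup>+x. indicator D x * ennreal ((u x - T u x)\<^sup>2) \<partial>lebesgue_on \<Omega>) \<le> ennreal (E * gradint G)"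
  using assms unfolding smoothing_def by blast+

lemma smoothing_compact:
  assumes "smoothing D A E T" "\<And>n. L2 \<Omega> (us n)" "\<And>n. sqint (us n) \<le> B"
  obtains r :: "nat \<Rightarrow> nat" where "strict_mono r" "uniform_Cauchy (\<lambda>n. T (us (r n)))"
  using assms unfolding smoothing_def by blast

lemma smoothing_mono:
  assumes "smoothing D A E T" "A \<le> A'" "E \<le> E'"
  shows "smoothing D A' E' T"
proof -
  have "\<bar>T u x\<bar> \<le> A' * sqrt (sqint u)" if "L2 \<Omega> u" for u x
    using smoothingD(2)[OF assms(1) that, of x] mult_right_mono[OF assms(2), of "sqrt (sqint u)"] sqint_nonneg[of u] by simp
  moreover have "(\<integral>\<^sup>+x. indicator D x * ennreal ((u x - T u x)\<^sup>2) \<partial>lebesgue_on \<Omega>) \<le> ennreal (E' * gradint G)"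
    if "L2 \<Omega> u" "weak_gradient \<Omega> u G" for u G
    by (rule order_trans[OF smoothingD(3)[OF assms(1) that]]) (intro ennreal_leI mult_right_mono assms gradint_nonneg)
  ultimately show ?thesis using assms(1) unfolding smoothing_def by blast
qed

text \<open>The glued operator may jump across the edge of \<open>D1\<close>. This is harmless,
  since only measurability, a sup bound, the L^2 error and uniform Cauchy subsequences are demanded,
  and all of these can be checked separately on the two pieces.\<close>

lemma smoothing_Un:
  assumes D: "D1 \<in> sets borel" "D2 \<in> sets borel"
    and 1: "smoothing D1 A E1 T1" and 2: "smoothing D2 A E2 T2" and E: "0 \<le> E1" "0 \<le> E2"
  shows "smoothing (D1 \<union> D2) A (E1 + E2) (\<lambda>u x. if x \<in> D1 then T1 u x else T2 u x)"
  unfolding smoothing_def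
proof (intro conjI allI impI)
  fix u assume u: "L2 \<Omega> u"
  note [measurable] = smoothingD(1)[OF 1 u] smoothingD(1)[OF 2 u] D
  show "(\<lambda>x. if x \<in> D1 then T1 u x else T2 u x) \<in> borel_measurable borel" by measurable
  show "\<bar>if x \<in> D1 then T1 u x else T2 u x\<bar> \<le> A * sqrt (sqint u)" for x
    using smoothingD(2)[OF 1 u, of x] smoothingD(2)[OF 2 u, of x] by simp
  fix G assume G: "weak_gradient \<Omega> u G"
  note [measurable] = L2D(1)[OF u]
  have [measurable]: "T1 u \<in> borel_measurable (lebesgue_on \<Omega>)" "T2 u \<in> borel_measurable (lebesgue_on \<Omega>)"
    "(indicator D1 :: 'a \<Rightarrow> ennreal) \<in> borel_measurable (lebesgue_on \<Omega>)" "(indicator D2 :: 'a \<Rightarrow> ennreal) \<in> borel_measurable (lebesgue_on \<Omega>)"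
    by (rule borel_measurable_lebesgue_onI, rule smoothingD(1)[OF 1 u] smoothingD(1)[OF 2 u] borel_measurable_indicator,
        (rule D)?)+
  have "(\<integral>\<^sup>+x. indicator (D1 \<union> D2) x * ennreal ((u x - (if x \<in> D1 then T1 u x else T2 u x))\<^sup>2) \<partial>lebesgue_on \<Omega>)
    \<le> (\<integral>\<^sup>+x. indicator D1 x * ennreal ((u x - T1 u x)\<^sup>2) + indicator D2 x * ennreal ((u x - T2 u x)\<^sup>2) \<partial>lebesgue_on \<Omega>)"
    by (rule nn_integral_mono) (simp add: indicator_def)
  also have "\<dots> = (\<integral>\<^sup>+x. indicator D1 x * ennreal ((u x - T1 u x)\<^sup>2) \<partial>lebesgue_on \<Omega>) + (\<integral>\<^sup>+x. indicator D2 x * ennreal ((u x - T2 u x)\<^sup>2) \<partial>lebesgue_on \<Omega>)"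
    by (rule nn_integral_add) measurable
  also have "\<dots> \<le> ennreal (E1 * gradint G) + ennreal (E2 * gradint G)"
    by (intro add_mono smoothingD(3)[OF 1 u G] smoothingD(3)[OF 2 u G])
  also have "\<dots> = ennreal ((E1 + E2) * gradint G)"
    using E gradint_nonneg[of G] by (simp add: ennreal_plus[symmetric] distrib_right del: ennreal_plus)
  finally show "(\<integral>\<^sup>+x. indicator (D1 \<union> D2) x * ennreal ((u x - (if x \<in> D1 then T1 u x else T2 u x))\<^sup>2) \<partial>lebesgue_on \<Omega>) \<le> ennreal ((E1 + E2) * gradint G)" .
next
  fix us :: "nat \<Rightarrow> 'a \<Rightarrow> real" and B assume us: "\<forall>n. L2 \<Omega> (us n) \<and> sqint (us n) \<le> B"
  then have l: "\<And>n. L2 \<Omega> (us n)" "\<And>n. sqint (us n) \<le> B" by blast+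
  obtain r :: "nat \<Rightarrow> nat" where r: "strict_mono r" "uniform_Cauchy (\<lambda>n. T1 (us (r n)))"
    by (rule smoothing_compact[OF 1 l])
  \<comment> \<open>A subsequence of the subsequence just found, so that both operators converge
    along it.\<close>
  obtain q :: "nat \<Rightarrow> nat" where q: "strict_mono q" "uniform_Cauchy (\<lambda>n. T2 (us (r (q n))))"
    by (rule smoothing_compact[OF 2, of "\<lambda>n. us (r n)" B]) (use l in auto)
  have "uniform_Cauchy (\<lambda>n x. if x \<in> D1 then T1 (us (r (q n))) x else T2 (us (r (q n))) x)"
    unfolding uniform_Cauchy_def
  proof (intro allI impI)
    fix e :: real assume e: "e > 0"
    obtain N1 where N1: "\<And>m n x. m \<ge> N1 \<Longrightarrow> n \<ge> N1 \<Longrightarrow> x \<in> \<Omega> \<Longrightarrow> \<bar>T1 (us (r m)) x - T1 (us (r n)) x\<bar> < e"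
      using r(2) e unfolding uniform_Cauchy_def by blast
    obtain N2 where N2: "\<And>m n x. m \<ge> N2 \<Longrightarrow> n \<ge> N2 \<Longrightarrow> x \<in> \<Omega> \<Longrightarrow> \<bar>T2 (us (r (q m))) x - T2 (us (r (q n))) x\<bar> < e"
      using q(2) e unfolding uniform_Cauchy_def by blast
    have qn: "q n \<ge> n" for n by (rule seq_suble[OF q(1)])
    show "\<exists>N. \<forall>m\<ge>N. \<forall>n\<ge>N. \<forall>x\<in>\<Omega>. \<bar>(if x \<in> D1 then T1 (us (r (q m))) x else T2 (us (r (q m))) x) - (if x \<in> D1 then T1 (us (r (q n))) x else T2 (us (r (q n))) x)\<bar> < e"
    proof (rule exI[of _ "max N1 N2"], intro allI impI ballI)
      fix m n x assume mn: "m \<ge> max N1 N2" "n \<ge> max N1 N2" and x: "x \<in> \<Omega>"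
      have "q m \<ge> N1" "q n \<ge> N1" using qn[of m] qn[of n] mn by linarith+
      then show "\<bar>(if x \<in> D1 then T1 (us (r (q m))) x else T2 (us (r (q m))) x) - (if x \<in> D1 then T1 (us (r (q n))) x else T2 (us (r (q n))) x)\<bar> < e"
        using N1[of "q m" "q n" x] N2[of m n x] mn x by simp
    qed
  qed
  moreover have "strict_mono (\<lambda>n. r (q n))" using strict_mono_o[OF r(1) q(1)] by (simp add: o_def)
  ultimately show "\<exists>r::nat\<Rightarrow>nat. strict_mono r \<and> uniform_Cauchy (\<lambda>n x. if x \<in> D1 then T1 (us (r n)) x else T2 (us (r n)) x)"
    by (intro exI[of _ "\<lambda>n. r (q n)"] conjI)
qed

lemma smoothable_Un:
  assumes "smoothable D1" "smoothable D2"
  shows "smoothable (D1 \<union> D2)"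
proof -
  obtain C1 h1 where 1: "0 < C1" "0 < h1" "\<And>t. 0 < t \<Longrightarrow> t \<le> h1 \<Longrightarrow> \<exists>T. smoothing D1 (C1 / t ^ DIM('a)) (C1 * t\<^sup>2) T"
    using assms(1) unfolding smoothable_def by blast
  obtain C2 h2 where 2: "0 < C2" "0 < h2" "\<And>t. 0 < t \<Longrightarrow> t \<le> h2 \<Longrightarrow> \<exists>T. smoothing D2 (C2 / t ^ DIM('a)) (C2 * t\<^sup>2) T"
    using assms(2) unfolding smoothable_def by blast
  have D: "D1 \<in> sets borel" "D2 \<in> sets borel" using assms unfolding smoothable_def by blast+
  have "\<exists>T. smoothing (D1 \<union> D2) ((C1 + C2) / t ^ DIM('a)) ((C1 + C2) * t\<^sup>2) T" if t: "0 < t" "t \<le> min h1 h2" for t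
  proof -
    obtain T1 where "smoothing D1 (C1 / t ^ DIM('a)) (C1 * t\<^sup>2) T1" using 1(3)[of t] t(1) t(2) by auto
    then have s1: "smoothing D1 ((C1 + C2) / t ^ DIM('a)) (C1 * t\<^sup>2) T1"
      by (rule smoothing_mono) (use 1(1) 2(1) t(1) in \<open>auto intro!: divide_right_mono\<close>)
    obtain T2 where "smoothing D2 (C2 / t ^ DIM('a)) (C2 * t\<^sup>2) T2" using 2(3)[of t] t by auto
    then have s2: "smoothing D2 ((C1 + C2) / t ^ DIM('a)) (C2 * t\<^sup>2) T2"
      by (rule smoothing_mono) (use 1(1) 2(1) t(1) in \<open>auto intro!: divide_right_mono\<close>)
    have "0 \<le> C1 * t\<^sup>2" "0 \<le> C2 * t\<^sup>2" using 1(1) 2(1) by auto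
    from smoothing_Un[OF D s1 s2 this] show ?thesis by (auto simp: distrib_right)
  qed
  moreover have "0 < C1 + C2" "0 < min h1 h2" using 1(1,2) 2(1,2) by auto
  moreover have "D1 \<union> D2 \<in> sets borel" using D by simp
  ultimately show ?thesis unfolding smoothable_def by blast
qed

lemma smoothable_empty: "smoothable {}"
proof -
  have "smoothing {} (1 / t ^ DIM('a)) (1 * t\<^sup>2) (\<lambda>u x. 0)" if "0 < t" for t
    unfolding smoothing_def
  proof (intro conjI allI impI)
    fix us :: "nat \<Rightarrow> 'a \<Rightarrow> real" and B assume "\<forall>n. L2 \<Omega> (us n) \<and> sqint (us n) \<le> B"
    show "\<exists>r::nat\<Rightarrow>nat. strict_mono r \<and> uniform_Cauchy (\<lambda>n x. 0)"
      by (rule exI[of _ id]) (simp add: strict_mono_def uniform_Cauchy_def)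
  qed (use that sqint_nonneg in auto)
  then have "\<exists>T. smoothing {} (1 / t ^ DIM('a)) (1 * t\<^sup>2) T" if "0 < t" for t using that by blast
  then show ?thesis unfolding smoothable_def by (intro conjI exI[of _ 1]) auto
qed

lemma smoothable_Union:
  assumes "finite I" "\<And>i. i \<in> I \<Longrightarrow> smoothable (D i)"
  shows "smoothable (\<Union>i\<in>I. D i)"
  using assms by (induction I rule: finite_induct) (simp_all add: smoothable_empty smoothable_Un)

end

section \<open>Mollification along a cone as a smoothing operator\<close>

context cone_piece
begin

text \<open>Written as an integral over the domain, so that it is an operator on u itself;
  \<open>moll\<close> acts on a Borel representative that depends on a choice.\<close>

definition smooth_op :: "real \<Rightarrow> ('a \<Rightarrow> real) \<Rightarrow> 'a \<Rightarrow> real" where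
  "smooth_op t u x = (\<integral>y. u y * dil t (y - x) \<partial>lebesgue_on \<Omega>)"

lemma smooth_op_eq_moll:
  assumes u: "L2 \<Omega> u"
    and U: "U \<in> borel_measurable borel" "\<And>x. x \<notin> \<Omega> \<Longrightarrow> U x = 0" "AE x in lebesgue_on \<Omega>. u x = U x"
  shows "smooth_op t u x = moll t U x"
  unfolding smooth_op_def moll_def
proof (rule integral_lebesgue_on_eq_lborel(1)[OF borel_dom])
  note [measurable] = U(1)
  show "(\<lambda>y. U y * dil t (y - x)) \<in> borel_measurable borel" by measurable
  show "U y * dil t (y - x) = 0" if "y \<notin> \<Omega>" for y using U(2)[OF that] by simp
  have "(\<lambda>y. dil t (y - x)) \<in> borel_measurable (lebesgue_on \<Omega>)" by (rule borel_measurable_lebesgue_onI) measurable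
  then show "(\<lambda>y. u y * dil t (y - x)) \<in> borel_measurable (lebesgue_on \<Omega>)"
    by (rule borel_measurable_times[OF L2D(1)[OF u]])
  show "AE y in lebesgue_on \<Omega>. u y * dil t (y - x) = U y * dil t (y - x)" using U(3) by eventually_elim simp
qed

lemma L1_le: "L2 \<Omega> u \<Longrightarrow> (\<integral>x. \<bar>u x\<bar> \<partial>lebesgue_on \<Omega>) \<le> sqrt (measure lebesgue \<Omega>) * sqrt (sqint u)"
proof -
  assume u: "L2 \<Omega> u"
  have "(\<integral>x. \<bar>u x\<bar> \<partial>lebesgue_on \<Omega>)\<^sup>2 \<le> measure (lebesgue_on \<Omega>) (space (lebesgue_on \<Omega>)) * sqint u"
    using M.integral_L1_le_L2(2)[OF L2D(1)[OF u]] L2D(2)[OF u] by (simp add: sqint_def)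
  also have "measure (lebesgue_on \<Omega>) (space (lebesgue_on \<Omega>)) = measure lebesgue \<Omega>"
    by (simp add: measure_restrict_space)
  finally show ?thesis by (simp add: real_le_rsqrt real_sqrt_mult[symmetric])
qed

text \<open>Used with k a translated kernel for the sup bound and for uniform boundedness, and with
  k a difference of two translates for equicontinuity.\<close>

lemma kernel_difference:
  assumes u: "L2 \<Omega> u" and k: "k \<in> borel_measurable borel" "\<And>y. \<bar>k y\<bar> \<le> \<omega>"
  shows "\<bar>\<integral>y. u y * k y \<partial>lebesgue_on \<Omega>\<bar> \<le> \<omega> * (sqrt (measure lebesgue \<Omega>) * sqrt (sqint u))"
proof -
  have w: "\<omega> \<ge> 0" using k(2)[of 0] by linarith
  have i: "integrable (lebesgue_on \<Omega>) (\<lambda>y. u y * k y)"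
    by (rule integrable_mult_bounded[OF L2D(3)[OF u] borel_measurable_lebesgue_onI[OF k(1)] k(2)])
  have "\<bar>\<integral>y. u y * k y \<partial>lebesgue_on \<Omega>\<bar> \<le> (\<integral>y. \<bar>u y * k y\<bar> \<partial>lebesgue_on \<Omega>)"
    by (rule integral_abs_bound)
  also have "\<dots> \<le> (\<integral>y. \<omega> * \<bar>u y\<bar> \<partial>lebesgue_on \<Omega>)"
  proof (rule integral_mono)
    show "integrable (lebesgue_on \<Omega>) (\<lambda>y. \<bar>u y * k y\<bar>)" using i by simp
    show "integrable (lebesgue_on \<Omega>) (\<lambda>y. \<omega> * \<bar>u y\<bar>)" using L2D(3)[OF u] by simp
    show "\<bar>u y * k y\<bar> \<le> \<omega> * \<bar>u y\<bar>" for y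
      using mult_left_mono[OF k(2)[of y], of "\<bar>u y\<bar>"] by (simp add: abs_mult mult.commute)
  qed
  also have "\<dots> = \<omega> * (\<integral>y. \<bar>u y\<bar> \<partial>lebesgue_on \<Omega>)" by simp
  also have "\<dots> \<le> \<omega> * (sqrt (measure lebesgue \<Omega>) * sqrt (sqint u))"
    by (intro mult_left_mono L1_le u w)
  finally show ?thesis .
qed

lemma smooth_op_difference:
  assumes u: "L2 \<Omega> u" and t: "t > 0"
  shows "smooth_op t u x - smooth_op t u x' = (\<integral>y. u y * (dil t (y - x) - dil t (y - x')) \<partial>lebesgue_on \<Omega>)"
proof -
  obtain C where C: "\<And>z. \<Theta> z \<le> C" "C > 0" using bounded by blast
  have b: "\<bar>dil t w\<bar> \<le> C / t ^ DIM('a)" for w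
    using C t nonneg by (simp add: dil_def divide_right_mono)
  have i: "integrable (lebesgue_on \<Omega>) (\<lambda>y. u y * dil t (y - x))" for x
    by (rule integrable_mult_bounded[OF L2D(3)[OF u] _ b]) (rule borel_measurable_lebesgue_onI, measurable)
  show ?thesis unfolding smooth_op_def right_diff_distrib
    by (rule Bochner_Integration.integral_diff[symmetric, OF i i])
qed

lemma smoothable_piece: "smoothable D"
proof -
  obtain C where C: "\<And>z. \<Theta> z \<le> C" "C > 0" using bounded by blast
  define m where "m = sqrt (measure lebesgue \<Omega>)"
  have m: "m \<ge> 0" by (simp add: m_def)
  have "smoothing D ((C * m) / t ^ DIM('a)) (2 * R\<^sup>2 * t\<^sup>2) (smooth_op t)" if t: "0 < t" "t \<le> h" for t
    unfolding smoothing_def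
  proof (intro conjI allI impI)
    fix u assume u: "L2 \<Omega> u"
    obtain U where U: "U \<in> borel_measurable borel" "\<And>x. x \<notin> \<Omega> \<Longrightarrow> U x = 0" "AE x in lebesgue_on \<Omega>. u x = U x"
      "integrable lborel (\<lambda>x. (U x)\<^sup>2)" "integrable lborel U"
      using L2_representative[OF u] by blast
    have eq: "smooth_op t u = moll t U" by (rule ext) (rule smooth_op_eq_moll[OF u U(1,2,3)])
    show meas: "smooth_op t u \<in> borel_measurable borel" unfolding eq by (rule moll_meas[OF U(1)])
    show "\<bar>smooth_op t u x\<bar> \<le> C * m / t ^ DIM('a) * sqrt (sqint u)" for x
    proof -
      have "\<bar>dil t w\<bar> \<le> C / t ^ DIM('a)" for w
        using C t nonneg by (simp add: dil_def divide_right_mono)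
      then have "\<bar>smooth_op t u x\<bar> \<le> C / t ^ DIM('a) * (sqrt (measure lebesgue \<Omega>) * sqrt (sqint u))"
        unfolding smooth_op_def by (intro kernel_difference[OF u]) measurable
      then show ?thesis by (simp add: m_def)
    qed
    fix G assume G: "weak_gradient \<Omega> u G"
    have "(\<integral>\<^sup>+x. indicator D x * ennreal ((u x - smooth_op t u x)\<^sup>2) \<partial>lebesgue_on \<Omega>)
       = (\<integral>\<^sup>+x. indicator D x * ennreal ((moll t U x - U x)\<^sup>2) \<partial>lborel)"
    proof (rule nn_integral_lebesgue_on_eq_lborel[OF borel_dom])
      show "indicator D x * ennreal ((moll t U x - U x)\<^sup>2) = 0" if "x \<notin> \<Omega>" for x using that D_sub by (auto simp: indicator_def)
      show "AE x in lebesgue_on \<Omega>. indicator D x * ennreal ((u x - smooth_op t u x)\<^sup>2) = indicator D x * ennreal ((moll t U x - U x)\<^sup>2)"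
        using U(3) by eventually_elim (simp add: eq power2_commute)
    qed
    also have "\<dots> \<le> ennreal (2 * R\<^sup>2 * t\<^sup>2 * gradint G)"
      unfolding gradint_def by (rule moll_estimate[OF u G U t])
    finally show "(\<integral>\<^sup>+x. indicator D x * ennreal ((u x - smooth_op t u x)\<^sup>2) \<partial>lebesgue_on \<Omega>) \<le> ennreal (2 * R\<^sup>2 * t\<^sup>2 * gradint G)" .
  next
    fix us :: "nat \<Rightarrow> 'a \<Rightarrow> real" and B assume "\<forall>n. L2 \<Omega> (us n) \<and> sqint (us n) \<le> B"
    then have us: "\<And>n. L2 \<Omega> (us n)" "\<And>n. sqint (us n) \<le> B" by blast+
    obtain r0 where r0: "r0 > 0" "\<And>x. norm x > r0 \<Longrightarrow> x \<notin> \<Omega>" using outside_ball by metis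
    have sB: "m * sqrt (sqint (us n)) \<le> m * sqrt B" for n
      using us(2)[of n] m by (intro mult_left_mono) auto
    have B0: "B \<ge> 0" using us(2)[of 0] sqint_nonneg[of "us 0"] by linarith
    obtain g k where k: "strict_mono (k :: nat \<Rightarrow> nat)"
      and lim: "\<And>e. 0 < e \<Longrightarrow> \<exists>N. \<forall>n x. n \<ge> N \<and> x \<in> cball 0 r0 \<longrightarrow> norm (smooth_op t (us (k n)) x - g x) < e"
    proof (rule Arzela_Ascoli[where S = "cball 0 r0" and \<F> = "\<lambda>n. smooth_op t (us n)" and M = "C / t ^ DIM('a) * (m * sqrt B)"])
      show "compact (cball (0::'a) r0)" by simp
      show "norm (smooth_op t (us n) x) \<le> C / t ^ DIM('a) * (m * sqrt B)" for n x
      proof -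
        have "\<bar>dil t w\<bar> \<le> C / t ^ DIM('a)" for w
          using C t nonneg by (simp add: dil_def divide_right_mono)
        then have "\<bar>smooth_op t (us n) x\<bar> \<le> C / t ^ DIM('a) * (m * sqrt (sqint (us n)))"
          unfolding smooth_op_def m_def by (intro kernel_difference[OF us(1)]) measurable
        also have "\<dots> \<le> C / t ^ DIM('a) * (m * sqrt B)" using C t by (intro mult_left_mono sB) auto
        finally show ?thesis by simp
      qed
      fix x :: 'a and e :: real assume e: "0 < e"
      \<comment> \<open>Uniform continuity of the kernel passes to all averages with bounded L^2
        norm at once, which is the equicontinuity that Arzela-Ascoli wants.\<close>
      have uc: "uniformly_continuous_on UNIV (dil t)"
      proof (rule compact_support_uniformly_continuous)
        show "continuous_on UNIV (dil t)" using smooth_continuous[OF dil_smooth[of t 0]] by simp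
        show "dil t w = 0" if "norm w > t * R" for w by (rule dil_eq_0[OF t(1) that])
      qed
      define e' where "e' = e / (2 * (m * sqrt B + 1))"
      have e': "e' > 0" using e m B0 by (simp add: e'_def add_nonneg_pos)
      obtain d where d: "d > 0" "\<And>w w'. dist w' w < d \<Longrightarrow> dist (dil t w') (dil t w) < e'"
        using uc e' unfolding uniformly_continuous_on_def by (metis UNIV_I)
      show "\<exists>d>0. \<forall>n y. y \<in> cball 0 r0 \<and> norm (x - y) < d \<longrightarrow> norm (smooth_op t (us n) x - smooth_op t (us n) y) < e"
      proof (intro exI[of _ d] conjI d(1) allI impI)
        fix n y assume "y \<in> cball 0 r0 \<and> norm (x - y) < d"
        then have xy: "norm (x - y) < d" by blast
        have "\<bar>dil t (z - x) - dil t (z - y)\<bar> \<le> e'" for z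
          using d(2)[of "z - x" "z - y"] xy by (simp add: dist_norm norm_minus_commute)
        then have "\<bar>smooth_op t (us n) x - smooth_op t (us n) y\<bar> \<le> e' * (m * sqrt (sqint (us n)))"
          unfolding smooth_op_difference[OF us(1) t(1)] m_def by (intro kernel_difference[OF us(1)]) measurable
        also have "\<dots> \<le> e' * (m * sqrt B)" using e' by (intro mult_left_mono sB) auto
        also have "\<dots> \<le> e' * (m * sqrt B + 1)" using e' by (intro mult_left_mono) auto
        also have "\<dots> < e"
        proof -
          have gen: "e / (2 * c) * c = e / 2" if "c > 0" for c :: real using that by simp
          have "m * sqrt B + 1 > 0" using m B0 by (simp add: add_nonneg_pos)
          then have "e' * (m * sqrt B + 1) = e / 2" unfolding e'_def by (rule gen)
          then show ?thesis using e by simp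
        qed
        finally show "norm (smooth_op t (us n) x - smooth_op t (us n) y) < e" by simp
      qed
    qed (rule that)
    have "uniform_Cauchy (\<lambda>n. smooth_op t (us (k n)))"
      unfolding uniform_Cauchy_def
    proof (intro allI impI)
      fix e :: real assume e: "e > 0"
      obtain N where N: "\<And>n x. n \<ge> N \<Longrightarrow> x \<in> cball 0 r0 \<Longrightarrow> norm (smooth_op t (us (k n)) x - g x) < e/2"
        using lim[of "e/2"] e by auto
      show "\<exists>N. \<forall>m\<ge>N. \<forall>n\<ge>N. \<forall>x\<in>\<Omega>. \<bar>smooth_op t (us (k m)) x - smooth_op t (us (k n)) x\<bar> < e"
      proof (rule exI[of _ N], intro allI impI ballI)
        fix m n x assume mn: "m \<ge> N" "n \<ge> N" and "x \<in> \<Omega>"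
        then have x: "x \<in> cball 0 r0" using r0(2)[of x] by force
        show "\<bar>smooth_op t (us (k m)) x - smooth_op t (us (k n)) x\<bar> < e"
          using N[OF mn(1) x] N[OF mn(2) x] unfolding real_norm_def by linarith
      qed
    qed
    then show "\<exists>r::nat\<Rightarrow>nat. strict_mono r \<and> uniform_Cauchy (\<lambda>n. smooth_op t (us (r n)))"
      using k by blast
  qed
  \<comment> \<open>One constant above both C m and 2 R^2, with + 1 for strict positivity.\<close>
  then have s: "smoothing D ((C * m + 2 * R\<^sup>2 + 1) / t ^ DIM('a)) ((C * m + 2 * R\<^sup>2 + 1) * t\<^sup>2) (smooth_op t)" if "0 < t" "t \<le> h" for t
    by (rule smoothing_mono) (use that C m in \<open>auto intro!: divide_right_mono mult_right_mono\<close>)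
  have "0 < C * m + 2 * R\<^sup>2 + 1" using C m by (simp add: add_nonneg_pos)
  then show ?thesis unfolding smoothable_def using D_borel h_pos s by blast
qed

end

section \<open>Inward cones at the points of the closure of a smooth domain\<close>

lemma local_cone:
  fixes \<rho> :: "'a::euclidean_space \<Rightarrow> real"
  assumes sm: "smooth_on UNIV \<rho>" and reg: "\<And>x. \<rho> x = 0 \<Longrightarrow> frechet_derivative \<rho> (at x) \<noteq> (\<lambda>_. 0)"
    and x0: "x0 \<in> closure {x. \<rho> x < 0}"
  obtains r e \<delta> h where "r > 0" "\<delta> > 0" "h > 0"
    "\<And>x t z. \<rho> x < 0 \<Longrightarrow> x \<in> ball x0 r \<Longrightarrow> 0 < t \<Longrightarrow> t \<le> h \<Longrightarrow> z \<in> cball e \<delta> \<Longrightarrow> \<rho> (x + t *\<^sub>R z) < 0"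
proof (cases "\<rho> x0 < 0")
  case True
  \<comment> \<open>At an interior point no direction is preferred: e = 0 and the unit ball serve,
    with h half the distance that is available.\<close>
  have "open {x. \<rho> x < 0}"
    using open_Collect_less[OF smooth_continuous[OF sm] continuous_on_const] by simp
  then obtain d where d: "d > 0" "ball x0 d \<subseteq> {x. \<rho> x < 0}" using True openE by blast
  show ?thesis
  proof (rule that[of "d/2" 1 "d/2" 0])
    fix x t and z :: 'a assume x: "x \<in> ball x0 (d/2)" and t: "0 < t" "t \<le> d/2" and z: "z \<in> cball 0 1"
    have "dist x0 (x + t *\<^sub>R z) \<le> dist x0 x + norm (t *\<^sub>R z)"
      using dist_triangle[of x0 "x + t *\<^sub>R z" x] by (simp add: dist_norm)
    moreover have "norm (t *\<^sub>R z) \<le> d/2" using mult_mono[of t "d/2" "norm z" 1] t z d(1) by simp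
    ultimately have "x + t *\<^sub>R z \<in> ball x0 d" using x by simp
    then show "\<rho> (x + t *\<^sub>R z) < 0" using d(2) by blast
  qed (use d in auto)
next
  case False
  have "closure {x. \<rho> x < 0} \<subseteq> {x. \<rho> x \<le> 0}"
    by (intro closure_minimal closed_Collect_le smooth_continuous[OF sm] continuous_on_const) auto
  then have "\<rho> x0 = 0" using False x0 by auto
  then obtain v where v: "frechet_derivative \<rho> (at x0) v \<noteq> 0" using reg by blast
  \<comment> \<open>The directional derivative as a function of point and direction together. Its
    joint continuity gives a neighbourhood of (x0, e) on which \<rho> decreases along every
    admissible direction.\<close>
  define Df where "Df p = (\<Sum>j\<in>Basis. (snd p \<bullet> j) * frechet_derivative \<rho> (at (fst p)) j)" for p :: "'a \<times> 'a"
  have d: "\<rho> differentiable (at x)" for x using smooth_has_derivative[OF sm] by (auto simp: differentiable_def)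
  have Df: "frechet_derivative \<rho> (at x) z = Df (x, z)" for x z
    unfolding Df_def fst_conv snd_conv by (rule frechet_derivative_Basis_expand[OF d])
  \<comment> \<open>Regularity gives a direction with nonzero derivative; it or its negative points
    inward.\<close>
  obtain e where e: "Df (x0, e) < 0"
  proof (cases "Df (x0, v) < 0")
    case False
    have "Df (x0, - v) = - Df (x0, v)" by (simp add: Df_def sum_negf)
    then show ?thesis using False v Df[of x0 v] by (intro that[of "- v"]) simp
  qed (rule that)
  have "continuous_on UNIV Df"
    unfolding Df_def
  proof (intro continuous_intros)
    fix j :: 'a
    show "continuous_on UNIV (\<lambda>p::'a\<times>'a. frechet_derivative \<rho> (at (fst p)) j)"
      by (rule continuous_on_compose2[OF smooth_derivative_continuous[OF sm] continuous_on_fst[OF continuous_on_id]]) auto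
  qed
  then have "open {p. Df p < 0}" using open_Collect_less[OF _ continuous_on_const] by blast
  moreover have "(x0, e) \<in> {p. Df p < 0}" using e by simp
  ultimately obtain A B where AB: "open A" "open B" "(x0, e) \<in> A \<times> B" "A \<times> B \<subseteq> {p. Df p < 0}"
    by (rule open_prod_elim)
  have "x0 \<in> A" "e \<in> B" using AB(3) by auto
  obtain a where a: "a > 0" "ball x0 a \<subseteq> A" using AB(1) \<open>x0 \<in> A\<close> openE by blast
  obtain b where b: "b > 0" "cball e b \<subseteq> B" using AB(2) \<open>e \<in> B\<close> open_contains_cball by blast
  \<comment> \<open>All directions have norm at most |e| + b, so steps up to h move a point by at
    most a/2 and the segment stays in the ball of radius a.\<close>
  define h where "h = a / (2 * (norm e + b))"
  have nb: "norm e + b > 0" using b(1) by (simp add: add_nonneg_pos)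
  have h: "h > 0" using a nb by (simp add: h_def)
  show ?thesis
  proof (rule that[of "a/2" b h e])
    fix x t z assume x: "\<rho> x < 0" "x \<in> ball x0 (a/2)" and t: "0 < t" "t \<le> h" and z: "z \<in> cball e b"
    have nz: "norm z \<le> norm e + b" using z norm_triangle_ineq2[of z e] by (simp add: dist_norm norm_minus_commute)
    have neg: "frechet_derivative \<rho> (at (x + s *\<^sub>R z)) z < 0" if s: "0 \<le> s" "s \<le> t" for s
    proof -
      have "norm (s *\<^sub>R z) \<le> h * (norm e + b)"
        using mult_mono[of s h "norm z" "norm e + b"] s t nz h by simp
      also have "\<dots> = a / 2"
      proof -
        have "a / (2 * c) * c = a / 2" if "c > 0" for c :: real using that by simp
        then show ?thesis unfolding h_def using nb by blast
      qed
      finally have "norm (s *\<^sub>R z) \<le> a / 2" .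
      then have "x + s *\<^sub>R z \<in> ball x0 a"
        using x(2) dist_triangle[of x0 "x + s *\<^sub>R z" x] by (simp add: dist_norm)
      then have "(x + s *\<^sub>R z, z) \<in> A \<times> B" using a b z by blast
      then show ?thesis using AB(4) unfolding Df by blast
    qed
    have "\<rho> (x + t *\<^sub>R z) < \<rho> (x + 0 *\<^sub>R z)"
    proof (rule DERIV_neg_imp_decreasing[OF t(1)])
      fix s assume s: "0 \<le> s" "s \<le> t"
      show "\<exists>y. ((\<lambda>s. \<rho> (x + s *\<^sub>R z)) has_real_derivative y) (at s) \<and> y < 0"
        by (rule exI[of _ "frechet_derivative \<rho> (at (x + s *\<^sub>R z)) z"])
          (rule conjI[OF smooth_line_derivative[OF sm] neg[OF s]])
    qed
    then show "\<rho> (x + t *\<^sub>R z) < 0" using x by simp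
  qed (use a(1) b(1) h in auto)
qed

lemma smooth_bounded_domain_bounded_open:
  assumes "smooth_bounded_domain \<Omega>"
  shows "bounded_open \<Omega>"
proof
  obtain \<rho> where \<rho>: "smooth_on UNIV \<rho>" "\<Omega> = {x. \<rho> x < 0}" using assms unfolding smooth_bounded_domain_def by blast
  show "open \<Omega>" unfolding \<rho>(2) using open_Collect_less[OF smooth_continuous[OF \<rho>(1)] continuous_on_const] by simp
  show "bounded \<Omega>" using assms unfolding smooth_bounded_domain_def by blast
qed

text \<open>The axis e and the opening \<delta> of the local cone become centre and radius of the
  support of the kernel. Compactness of the closure leaves finitely many pieces to be glued.\<close>

lemma smooth_bounded_domain_smoothable:
  fixes \<Omega> :: "'a::euclidean_space set"
  assumes dom: "smooth_bounded_domain \<Omega>"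
  shows "bounded_open.smoothable \<Omega> \<Omega>"
proof -
  interpret bounded_open \<Omega> by (rule smooth_bounded_domain_bounded_open[OF dom])
  obtain \<rho> where \<rho>: "smooth_on UNIV \<rho>" "\<Omega> = {x. \<rho> x < 0}" "\<And>x. \<rho> x = 0 \<Longrightarrow> frechet_derivative \<rho> (at x) \<noteq> (\<lambda>_. 0)"
    using dom unfolding smooth_bounded_domain_def by blast
  have "\<exists>r>0. smoothable (\<Omega> \<inter> ball x0 r)" if x0: "x0 \<in> closure \<Omega>" for x0
  proof -
    obtain r e \<delta> h where c: "r > 0" "\<delta> > 0" "h > 0"
      "\<And>x t z. \<rho> x < 0 \<Longrightarrow> x \<in> ball x0 r \<Longrightarrow> 0 < t \<Longrightarrow> t \<le> h \<Longrightarrow> z \<in> cball e \<delta> \<Longrightarrow> \<rho> (x + t *\<^sub>R z) < 0"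
      by (rule local_cone[OF \<rho>(1,3)]) (use x0 \<rho>(2) in blast)+
    obtain \<Theta> where T: "mollifier \<Theta> (norm e + \<delta>)" "\<And>z. \<Theta> z \<noteq> 0 \<Longrightarrow> norm (z - e) < \<delta>"
      by (rule mollifier_exists[OF c(2), of e]) blast
    interpret T: mollifier \<Theta> "norm e + \<delta>" by (rule T(1))
    have "cone_piece \<Omega> \<Theta> (norm e + \<delta>) (\<Omega> \<inter> ball x0 r) (cball e \<delta>) h"
    proof
      show "\<Omega> \<inter> ball x0 r \<in> sets borel" using open_dom by (intro borel_open open_Int) auto
      show "\<Theta> z = 0" if "z \<notin> cball e \<delta>" for z
        using T(2)[of z] that by (force simp: dist_norm norm_minus_commute)
      show "x + t *\<^sub>R z \<in> \<Omega>" if "x \<in> \<Omega> \<inter> ball x0 r" "0 < t" "t \<le> h" "z \<in> cball e \<delta>" for x t z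
        using c(4)[of x t z] that \<rho>(2) by blast
    qed (use c in auto)
    then have "smoothable (\<Omega> \<inter> ball x0 r)" by (rule cone_piece.smoothable_piece)
    then show ?thesis using c(1) by blast
  qed
  then obtain r where r: "\<And>x. x \<in> closure \<Omega> \<Longrightarrow> r x > 0" "\<And>x. x \<in> closure \<Omega> \<Longrightarrow> smoothable (\<Omega> \<inter> ball x (r x))"
    by metis
  have "compact (closure \<Omega>)" using bounded_dom by (simp add: compact_closure)
  then obtain I where I: "I \<subseteq> closure \<Omega>" "finite I" "closure \<Omega> \<subseteq> (\<Union>x\<in>I. ball x (r x))"
  proof (rule compactE_image)
    show "closure \<Omega> \<subseteq> (\<Union>x\<in>closure \<Omega>. ball x (r x))" using r(1) by force
  qed auto
  have "smoothable (\<Union>x\<in>I. \<Omega> \<inter> ball x (r x))"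
    by (rule smoothable_Union[OF I(2)]) (use I(1) r(2) in blast)
  moreover have "(\<Union>x\<in>I. \<Omega> \<inter> ball x (r x)) = \<Omega>" using I(3) closure_subset[of \<Omega>] by blast
  ultimately show ?thesis by simp
qed

section \<open>Rellich and Sobolev theorems\<close>

context bounded_open
begin

lemma smoothing_error:
  assumes s: "smoothing \<Omega> A E T" and E: "0 \<le> E" and u: "L2 \<Omega> u" and G: "weak_gradient \<Omega> u G"
  shows "L2 \<Omega> (\<lambda>x. u x - T u x)" "sqint (\<lambda>x. u x - T u x) \<le> E * gradint G"
proof -
  have m: "(\<lambda>x. u x - T u x) \<in> borel_measurable (lebesgue_on \<Omega>)"
    by (rule borel_measurable_diff[OF L2D(1)[OF u] borel_measurable_lebesgue_onI[OF smoothingD(1)[OF s u]]])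
  have m2: "(\<lambda>x. (u x - T u x)\<^sup>2) \<in> borel_measurable (lebesgue_on \<Omega>)" using m by measurable
  have "(\<integral>\<^sup>+x. ennreal ((u x - T u x)\<^sup>2) \<partial>lebesgue_on \<Omega>) = (\<integral>\<^sup>+x. indicator \<Omega> x * ennreal ((u x - T u x)\<^sup>2) \<partial>lebesgue_on \<Omega>)"
    by (rule nn_integral_cong) (simp add: space_restrict_space)
  also have "\<dots> \<le> ennreal (E * gradint G)" by (rule smoothingD(3)[OF s u G])
  finally have le: "(\<integral>\<^sup>+x. ennreal ((u x - T u x)\<^sup>2) \<partial>lebesgue_on \<Omega>) \<le> ennreal (E * gradint G)" .
  have "(\<integral>\<^sup>+x. ennreal (norm ((u x - T u x)\<^sup>2)) \<partial>lebesgue_on \<Omega>) < \<infinity>"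
    using le_less_trans[OF le ennreal_less_top] by simp
  then have i: "integrable (lebesgue_on \<Omega>) (\<lambda>x. (u x - T u x)\<^sup>2)"
    by (rule integrableI_bounded[OF m2])
  show "L2 \<Omega> (\<lambda>x. u x - T u x)" unfolding L2_def using m i by blast
  have "ennreal (sqint (\<lambda>x. u x - T u x)) \<le> ennreal (E * gradint G)"
    using le nn_integral_eq_integral[OF i] by (simp add: sqint_def)
  then show "sqint (\<lambda>x. u x - T u x) \<le> E * gradint G"
    using E gradint_nonneg[of G] by (simp add: ennreal_le_iff)
qed

lemma sqint_add:
  assumes "L2 \<Omega> f" "L2 \<Omega> g"
  shows "L2 \<Omega> (\<lambda>x. f x + g x)" "sqint (\<lambda>x. f x + g x) \<le> 2 * sqint f + 2 * sqint g"
proof -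
  show L: "L2 \<Omega> (\<lambda>x. f x + g x)" using L2_lincomb[OF assms, of 1 1] by simp
  have "sqint (\<lambda>x. f x + g x) \<le> (\<integral>x. 2 * (f x)\<^sup>2 + 2 * (g x)\<^sup>2 \<partial>lebesgue_on \<Omega>)"
    unfolding sqint_def
  proof (rule integral_mono)
    show "integrable (lebesgue_on \<Omega>) (\<lambda>x. (f x + g x)\<^sup>2)" by (rule L2D(2)[OF L])
    show "integrable (lebesgue_on \<Omega>) (\<lambda>x. 2 * (f x)\<^sup>2 + 2 * (g x)\<^sup>2)"
      using L2D(2)[OF assms(1)] L2D(2)[OF assms(2)] by simp
    show "(f x + g x)\<^sup>2 \<le> 2 * (f x)\<^sup>2 + 2 * (g x)\<^sup>2" for x
      using norm_add_square_le[of "f x" "g x"] by simp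
  qed
  also have "\<dots> = 2 * sqint f + 2 * sqint g"
    using L2D(2)[OF assms(1)] L2D(2)[OF assms(2)] by (simp add: sqint_def)
  finally show "sqint (\<lambda>x. f x + g x) \<le> 2 * sqint f + 2 * sqint g" .
qed

lemma sqint_bounded:
  assumes m: "f \<in> borel_measurable (lebesgue_on \<Omega>)" and b: "\<And>x. x \<in> \<Omega> \<Longrightarrow> \<bar>f x\<bar> \<le> e"
  shows "L2 \<Omega> f" "sqint f \<le> e\<^sup>2 * measure lebesgue \<Omega>"
proof -
  have le: "(f x)\<^sup>2 \<le> e\<^sup>2" if "x \<in> \<Omega>" for x
    using power_mono[OF b[OF that], of 2] by simp
  have i: "integrable (lebesgue_on \<Omega>) (\<lambda>x. (f x)\<^sup>2)"
  proof (rule Bochner_Integration.integrable_bound)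
    show "integrable (lebesgue_on \<Omega>) (\<lambda>x. e\<^sup>2)" by simp
    show "AE x in lebesgue_on \<Omega>. norm ((f x)\<^sup>2) \<le> norm (e\<^sup>2)"
      by (rule AE_I2) (use le in \<open>simp add: space_restrict_space\<close>)
  qed (use m in measurable)
  then show "L2 \<Omega> f" using m unfolding L2_def by blast
  have "sqint f \<le> (\<integral>x. e\<^sup>2 \<partial>lebesgue_on \<Omega>)"
    unfolding sqint_def by (rule integral_mono[OF i]) (use le in \<open>simp_all add: space_restrict_space\<close>)
  also have "\<dots> = e\<^sup>2 * measure lebesgue \<Omega>" by (simp add: measure_restrict_space)
  finally show "sqint f \<le> e\<^sup>2 * measure lebesgue \<Omega>" .
qed

lemma uniform_Cauchy_subseq:
  assumes "uniform_Cauchy f" "strict_mono r"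
  shows "uniform_Cauchy (\<lambda>n. f (r n))"
  unfolding uniform_Cauchy_def
proof (intro allI impI)
  fix e :: real assume "e > 0"
  then obtain N where N: "\<And>m n x. m \<ge> N \<Longrightarrow> n \<ge> N \<Longrightarrow> x \<in> \<Omega> \<Longrightarrow> \<bar>f m x - f n x\<bar> < e"
    using assms(1) unfolding uniform_Cauchy_def by blast
  have "r n \<ge> N" if "n \<ge> N" for n using seq_suble[OF assms(2), of n] that by linarith
  then show "\<exists>N. \<forall>m\<ge>N. \<forall>n\<ge>N. \<forall>x\<in>\<Omega>. \<bar>f (r m) x - f (r n) x\<bar> < e"
    using N by (intro exI[of _ N]) blast
qed

text \<open>A diagonal sequence over scales t_k tending to 0. For each k the smoothed functions are
  eventually uniformly Cauchy along it, and what remains is a smoothing error of squared size C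
  t_k^2 B.\<close>

lemma rellich:
  fixes us :: "nat \<Rightarrow> 'a \<Rightarrow> real"
  assumes S: "smoothable \<Omega>" and us: "\<And>n. L2 \<Omega> (us n)" "\<And>n. weak_gradient \<Omega> (us n) (Gs n)"
    and B: "\<And>n. sqint (us n) \<le> B" "\<And>n. gradint (Gs n) \<le> B"
  obtains r :: "nat \<Rightarrow> nat" where "strict_mono r"
    "\<And>e. e > 0 \<Longrightarrow> \<exists>N. \<forall>m\<ge>N. \<forall>n\<ge>N. sqint (\<lambda>x. us (r m) x - us (r n) x) < e"
proof -
  obtain C h where C: "0 < C" "0 < h" "\<And>t. 0 < t \<Longrightarrow> t \<le> h \<Longrightarrow> \<exists>T. smoothing \<Omega> (C / t ^ DIM('a)) (C * t\<^sup>2) T"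
    using S unfolding smoothable_def by blast
  define t where "t k = min h (1 / real (Suc k))" for k
  have t: "0 < t k" "t k \<le> h" "t k \<le> 1 / real (Suc k)" for k using C(2) by (auto simp: t_def)
  have "\<forall>k. \<exists>T. smoothing \<Omega> (C / t k ^ DIM('a)) (C * (t k)\<^sup>2) T" using C(3) t by blast
  then obtain T where T: "\<And>k. smoothing \<Omega> (C / t k ^ DIM('a)) (C * (t k)\<^sup>2) (T k)" by metis
  interpret subseqs "\<lambda>k s. uniform_Cauchy (\<lambda>n. T k (us (s n)))"
  proof
    fix k and s :: "nat \<Rightarrow> nat"
    obtain r :: "nat \<Rightarrow> nat" where "strict_mono r" "uniform_Cauchy (\<lambda>n. T k (us (s (r n))))"
      by (rule smoothing_compact[OF T[of k], of "\<lambda>n. us (s n)" B]) (use us B in auto)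
    then show "\<exists>r'. strict_mono r' \<and> uniform_Cauchy (\<lambda>n. T k (us ((s \<circ> r') n)))"
      unfolding o_def by blast
  qed
  define r where "r = diagseq"
  have r: "strict_mono r" unfolding r_def by (rule subseq_diagseq)
  \<comment> \<open>Only from index \<open>Suc k\<close> on is the diagonal sequence a subsequence
    of the k-th one, hence the shift.\<close>
  have uc: "uniform_Cauchy (\<lambda>n. T k (us (r (Suc k + n))))" for k
  proof -
    have "uniform_Cauchy (\<lambda>n. T k (us ((diagseq \<circ> (+) (Suc k)) n)))"
    proof (rule diagseq_holds)
      fix q s :: "nat \<Rightarrow> nat" and n assume "strict_mono q" "uniform_Cauchy (\<lambda>m. T n (us (s m)))"
      from uniform_Cauchy_subseq[OF this(2,1)]
      show "uniform_Cauchy (\<lambda>m. T n (us ((s \<circ> q) m)))" by (simp add: o_def)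
    qed
    then show ?thesis by (simp add: r_def o_def)
  qed
  have B0: "B \<ge> 0" using B(1)[of 0] sqint_nonneg[of "us 0"] by linarith
  let ?V = "measure lebesgue \<Omega>"
  have V0: "?V \<ge> 0" by simp
  show ?thesis
  proof (rule that[OF r])
    fix e :: real assume e: "e > 0"
    \<comment> \<open>Chosen so that t_k^2 <= 1/(k+1) brings 6 C t_k^2 B below e/2.\<close>
    obtain k :: nat where k: "12 * C * B / e < real k" using reals_Archimedean2 by blast
    have tk: "6 * (C * (t k)\<^sup>2 * B) < e / 2"
    proof -
      have "t k \<le> 1" using t(3)[of k] by (rule order_trans) simp
      then have "(t k)\<^sup>2 \<le> 1 / real (Suc k)"
        using t(3)[of k] mult_right_mono[of "t k" 1 "t k"] less_imp_le[OF t(1)[of k]]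
        unfolding power2_eq_square by linarith
      then have "6 * (C * (t k)\<^sup>2 * B) \<le> 6 * (C * (1 / real (Suc k)) * B)"
        using C(1) B0 by (intro mult_left_mono mult_right_mono) auto
      also have "\<dots> < e / 2"
      proof -
        have "12 * C * B < e * real k" using k e by (simp add: pos_divide_less_eq mult.commute)
        also have "\<dots> \<le> e * real (Suc k)" using e by (intro mult_left_mono) auto
        finally show ?thesis by (simp add: pos_divide_less_eq mult_ac)
      qed
      finally show ?thesis .
    qed
    define \<epsilon> where "\<epsilon> = sqrt (e / (8 * (?V + 1)))"
    have V1: "?V + 1 > 0" using V0 by linarith
    have eps: "\<epsilon> > 0" "4 * (\<epsilon>\<^sup>2 * ?V) \<le> e / 2"
    proof -
      show "\<epsilon> > 0" using e V1 by (simp add: \<epsilon>_def)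
      have "\<epsilon>\<^sup>2 = e / (8 * (?V + 1))" using e V1 by (simp add: \<epsilon>_def)
      moreover have "?V / (?V + 1) \<le> 1" by (subst pos_divide_le_eq[OF V1]) simp
      then have "e / 8 * (?V / (?V + 1)) \<le> e / 8 * 1" using e by (intro mult_left_mono) auto
      moreover have "4 * (e / (8 * c) * v) = 4 * (e / 8 * (v / c))" for c v :: real by simp
      ultimately show "4 * (\<epsilon>\<^sup>2 * ?V) \<le> e / 2" by (simp only:)
    qed
    obtain N where N: "\<And>m n x. m \<ge> N \<Longrightarrow> n \<ge> N \<Longrightarrow> x \<in> \<Omega> \<Longrightarrow> \<bar>T k (us (r (Suc k + m))) x - T k (us (r (Suc k + n))) x\<bar> < \<epsilon>"
      using uc[of k] eps(1) unfolding uniform_Cauchy_def by blast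
    show "\<exists>N. \<forall>m\<ge>N. \<forall>n\<ge>N. sqint (\<lambda>x. us (r m) x - us (r n) x) < e"
    proof (rule exI[of _ "Suc k + N"], intro allI impI)
      fix m n assume mn: "m \<ge> Suc k + N" "n \<ge> Suc k + N"
      let ?u = "us (r m)" and ?v = "us (r n)"
      have Et: "0 \<le> C * (t k)\<^sup>2" using C(1) by simp
      note eu = smoothing_error[OF T[of k] Et us(1)[of "r m"] us(2)[of "r m"]]
      note ev = smoothing_error[OF T[of k] Et us(1)[of "r n"] us(2)[of "r n"]]
      have mid: "L2 \<Omega> (\<lambda>x. T k ?u x - T k ?v x)" "sqint (\<lambda>x. T k ?u x - T k ?v x) \<le> \<epsilon>\<^sup>2 * ?V"
      proof -
        have m: "(\<lambda>x. T k ?u x - T k ?v x) \<in> borel_measurable (lebesgue_on \<Omega>)"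
          by (rule borel_measurable_diff) (rule borel_measurable_lebesgue_onI, rule smoothingD(1)[OF T us(1)])+
        have b: "\<bar>T k ?u x - T k ?v x\<bar> \<le> \<epsilon>" if x: "x \<in> \<Omega>" for x
        proof -
          have mk: "N \<le> m - Suc k" "N \<le> n - Suc k" using mn by linarith+
          have "Suc k + (m - Suc k) = m" "Suc k + (n - Suc k) = n" using mn by linarith+
          then show ?thesis using N[OF mk x] by simp
        qed
        show "L2 \<Omega> (\<lambda>x. T k ?u x - T k ?v x)" "sqint (\<lambda>x. T k ?u x - T k ?v x) \<le> \<epsilon>\<^sup>2 * ?V"
          using sqint_bounded[OF m b] by blast+
      qed
      have neg: "sqint (\<lambda>x. - f x) = sqint f" for f by (simp add: sqint_def)
      have nv1: "L2 \<Omega> (\<lambda>x. - (?v x - T k ?v x))"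
        using L2_lincomb[OF ev(1) ev(1), of "-1" 0] by simp
      note nv = nv1 neg[of "\<lambda>x. ?v x - T k ?v x"]
      \<comment> \<open>Difference of the smoothed functions plus two smoothing errors; the two-term
        bound applied twice gives the first the weight 2 and each error the weight 4.\<close>
      have "sqint (\<lambda>x. ?u x - ?v x) = sqint (\<lambda>x. (T k ?u x - T k ?v x) + ((?u x - T k ?u x) + (- (?v x - T k ?v x))))"
        by (simp add: sqint_def)
      also have "\<dots> \<le> 2 * sqint (\<lambda>x. T k ?u x - T k ?v x) + 2 * sqint (\<lambda>x. (?u x - T k ?u x) + (- (?v x - T k ?v x)))"
        by (rule sqint_add(2)[OF mid(1) sqint_add(1)[OF eu(1) nv(1)]])
      also have "\<dots> \<le> 2 * (\<epsilon>\<^sup>2 * ?V) + 2 * (2 * (C * (t k)\<^sup>2 * B) + 2 * (C * (t k)\<^sup>2 * B))"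
      proof -
        have "sqint (\<lambda>x. ?u x - T k ?u x) \<le> C * (t k)\<^sup>2 * B"
          using eu(2) mult_left_mono[OF B(2)[of "r m"] Et] by linarith
        moreover have "sqint (\<lambda>x. - (?v x - T k ?v x)) \<le> C * (t k)\<^sup>2 * B"
          using ev(2) mult_left_mono[OF B(2)[of "r n"] Et] unfolding nv(2) by linarith
        moreover have "2 * a + 2 * b \<le> 2 * M + 2 * (2 * c + 2 * c)" if "b \<le> 2 * d + 2 * f" "d \<le> c" "f \<le> c" "a \<le> M"
          for a b c d f M :: real using that by argo
        ultimately show ?thesis using sqint_add(2)[OF eu(1) nv(1)] mid(2) by blast
      qed
      \<comment> \<open>The smoothed part takes at most e/4 and the errors less than 2e/3.\<close>
      also have "\<dots> < e"
      proof -
        have "0 \<le> \<epsilon>\<^sup>2 * ?V" by simp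
        moreover have "2 * (\<epsilon>\<^sup>2 * ?V) \<le> e / 4" using eps(2) by linarith
        moreover have "8 * (C * (t k)\<^sup>2 * B) < 2 * e / 3" using tk by linarith
        ultimately show ?thesis using e by argo
      qed
      finally show "sqint (\<lambda>x. ?u x - ?v x) < e" .
    qed
  qed
qed

section \<open>An L^q bound for some q above 2\<close>

lemma sobolev_tail:
  assumes s: "smoothing \<Omega> A E T" and E: "0 \<le> E" and u: "L2 \<Omega> u" and G: "weak_gradient \<Omega> u G"
    and one: "sqint u \<le> 1" "gradint G \<le> 1" and A: "0 \<le> A" "A \<le> \<sigma>"
  shows "(\<integral>\<^sup>+x. indicator {x. \<bar>u x\<bar> > 2 * \<sigma>} x * ennreal ((u x)\<^sup>2) \<partial>lebesgue_on \<Omega>) \<le> ennreal (4 * E)"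
proof -
  note err = smoothing_error[OF s E u G]
  have "(\<integral>\<^sup>+x. indicator {x. \<bar>u x\<bar> > 2 * \<sigma>} x * ennreal ((u x)\<^sup>2) \<partial>lebesgue_on \<Omega>) \<le> (\<integral>\<^sup>+x. ennreal (4 * (u x - T u x)\<^sup>2) \<partial>lebesgue_on \<Omega>)"
  proof (rule nn_integral_mono)
    fix x
    show "indicator {x. \<bar>u x\<bar> > 2 * \<sigma>} x * ennreal ((u x)\<^sup>2) \<le> ennreal (4 * (u x - T u x)\<^sup>2)"
    proof (cases "\<bar>u x\<bar> > 2 * \<sigma>")
      case True
      \<comment> \<open>Where |u| exceeds twice the sup bound of T u, more than half of u is
        smoothing error; so |u| <= 2 |u - T u| there.\<close>
      have "sqrt (sqint u) \<le> 1" using one(1) by simp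
      then have "A * sqrt (sqint u) \<le> A" using mult_left_mono[of "sqrt (sqint u)" 1 A] A(1) by simp
      then have "\<bar>T u x\<bar> \<le> \<sigma>" using smoothingD(2)[OF s u, of x] A by linarith
      moreover have "a \<le> 2 * d" if "t \<le> \<sigma>" "2 * \<sigma> < a" "a - t \<le> d" for a d t using that by linarith
      ultimately have "\<bar>u x\<bar> \<le> 2 * \<bar>u x - T u x\<bar>" using True abs_triangle_ineq2[of "u x" "T u x"] by blast
      then have "\<bar>u x\<bar>\<^sup>2 \<le> (2 * \<bar>u x - T u x\<bar>)\<^sup>2" by (rule power_mono) simp
      then have "(u x)\<^sup>2 \<le> 4 * (u x - T u x)\<^sup>2" by (simp add: power_mult_distrib)
      then show ?thesis using True by (simp add: ennreal_leI)
    qed simp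
  qed
  also have "\<dots> = ennreal (4 * sqint (\<lambda>x. u x - T u x))"
    using L2D(2)[OF err(1)] by (subst nn_integral_eq_integral) (auto simp: sqint_def)
  also have "\<dots> \<le> ennreal (4 * E)"
  proof (rule ennreal_leI)
    have "E * gradint G \<le> E * 1" using E one(2) by (intro mult_left_mono) auto
    then show "4 * sqint (\<lambda>x. u x - T u x) \<le> 4 * E" using err(2) by simp
  qed
  finally show ?thesis .
qed

end

text \<open>Above 2, y lies in exactly one dyadic layer, and the term of that layer already
  dominates; the first summand takes care of y <= 2.\<close>

lemma dyadic_bound:
  fixes y b :: real
  assumes y: "0 \<le> y" and N: "N > 0" and b: "b = 2 powr (1 / real N)"
  shows "ennreal (y\<^sup>2 * y powr (1 / real N)) \<le> ennreal (b\<^sup>2) * ennreal (y\<^sup>2)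
     + (\<Sum>k. ennreal (b ^ (k + 2)) * (indicator {y. y > 2 * 2 ^ k} y * ennreal (y\<^sup>2)))"
proof -
  have b1: "b \<ge> 1" unfolding b by (rule ge_one_powr_ge_zero) auto
  have bk: "(2 ^ k) powr (1 / real N) = b ^ k" for k
    unfolding b by (simp add: powr_realpow[symmetric] powr_powr mult.commute)
  show ?thesis
  proof (cases "y \<le> 2")
    case True
    have "y powr (1 / real N) \<le> b ^ 1" unfolding bk[symmetric] using y True by (intro powr_mono2) auto
    also have "\<dots> \<le> b\<^sup>2" using b1 by (intro power_increasing) auto
    finally have "y\<^sup>2 * y powr (1 / real N) \<le> b\<^sup>2 * y\<^sup>2" by (subst mult.commute) (rule mult_right_mono, auto)
    then have "ennreal (y\<^sup>2 * y powr (1 / real N)) \<le> ennreal (b\<^sup>2) * ennreal (y\<^sup>2)"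
      by (simp add: ennreal_mult[symmetric] ennreal_leI)
    then show ?thesis by (rule order_trans) simp
  next
    case False
    obtain n where "y < 2 ^ n" using real_arch_pow[of 2 y] by auto
    then have ex: "\<exists>n. y \<le> 2 * 2 ^ n" by (intro exI[of _ n]) (use y in auto)
    define n0 where "n0 = (LEAST n. y \<le> 2 * 2 ^ n)"
    have n0: "y \<le> 2 * 2 ^ n0" unfolding n0_def by (rule LeastI_ex[OF ex])
    then have "n0 \<noteq> 0" using False by (intro notI) simp
    then obtain k where k: "n0 = Suc k" by (metis not0_implies_Suc)
    have yk: "2 * 2 ^ k < y" using not_less_Least[of k "\<lambda>n. y \<le> 2 * 2 ^ n"] k unfolding n0_def by simp
    \<comment> \<open>As n0 = k + 1, y is at most 2 * 2^(k+1) = 2^(k+2), which is where the exponent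
      k + 2 comes from.\<close>
    have "y powr (1 / real N) \<le> b ^ (k + 2)"
      unfolding bk[symmetric] using y n0 k by (intro powr_mono2) auto
    then have "y\<^sup>2 * y powr (1 / real N) \<le> b ^ (k + 2) * y\<^sup>2" by (subst mult.commute) (rule mult_right_mono, auto)
    then have "ennreal (y\<^sup>2 * y powr (1 / real N)) \<le> ennreal (b ^ (k + 2)) * (indicator {y. y > 2 * 2 ^ k} y * ennreal (y\<^sup>2))"
      using yk b1 by (simp add: ennreal_mult[symmetric] ennreal_leI)
    also have "\<dots> \<le> (\<Sum>k. ennreal (b ^ (k + 2)) * (indicator {y. y > 2 * 2 ^ k} y * ennreal (y\<^sup>2)))"
      using sum_le_suminf[OF summableI, of "{k}" "\<lambda>k. ennreal (b ^ (k + 2)) * (indicator {y. y > 2 * 2 ^ k} y * ennreal (y\<^sup>2))"] by simp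
    finally show ?thesis by (rule order_trans) simp
  qed
qed

context bounded_open
begin

text \<open>Far from the critical Sobolev exponent, but the layer-cake argument is only needed for some exponent above 2.\<close>

definition q_exp :: real where "q_exp = 2 + 1 / real DIM('a)"

lemma q_exp_gt: "q_exp > 2" by (simp add: q_exp_def)

text \<open>At level 2^k the scale is t = C^(1/N) b^(-k) with b = 2^(1/N), so that the sup bound C /
  t^N equals 2^k. The squared tail is then of order t^2, that is b^(-2k), against the weight
  b^(k+2): a geometric series with ratio 1/b.\<close>

lemma sobolev_unit:
  assumes S: "smoothable \<Omega>"
  obtains K where "K > 0" "\<And>u G. L2 \<Omega> u \<Longrightarrow> weak_gradient \<Omega> u G \<Longrightarrow> sqint u \<le> 1 \<Longrightarrow> gradint G \<le> 1 \<Longrightarrow>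
    (\<integral>\<^sup>+x. ennreal (\<bar>u x\<bar> powr q_exp) \<partial>lebesgue_on \<Omega>) \<le> ennreal K"
proof -
  obtain C h where C: "0 < C" "0 < h" "\<And>t. 0 < t \<Longrightarrow> t \<le> h \<Longrightarrow> \<exists>T. smoothing \<Omega> (C / t ^ DIM('a)) (C * t\<^sup>2) T"
    using S unfolding smoothable_def by blast
  let ?N = "DIM('a)"
  have Np: "?N > 0" by simp
  define b where "b = 2 powr (1 / real ?N)"
  define c0 where "c0 = C powr (1 / real ?N)"
  \<comment> \<open>Covers two cases: 4 C for scales t <= h, where \<open>sobolev_tail\<close>
    applies, and 1 / h^2 for t > h, where the trivial bound 1 is at most t^2 / h^2.\<close>
  define C3 where "C3 = (4 * C + 1 / h\<^sup>2) * c0\<^sup>2"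
  have b1: "b > 1" unfolding b_def by (rule gr_one_powr) auto
  have bN: "b ^ ?N = 2" unfolding b_def by (simp add: powr_realpow[symmetric] powr_powr)
  have c0: "c0 > 0" "c0 ^ ?N = C" using C(1) unfolding c0_def by (simp_all add: powr_realpow[symmetric] powr_powr)
  have C3: "C3 > 0" using C c0 unfolding C3_def by (intro mult_pos_pos add_pos_pos) auto
  have tail: "(\<integral>\<^sup>+x. indicator {x. \<bar>u x\<bar> > 2 * 2 ^ k} x * ennreal ((u x)\<^sup>2) \<partial>lebesgue_on \<Omega>) \<le> ennreal (C3 / b ^ (2 * k))"
    if u: "L2 \<Omega> u" and G: "weak_gradient \<Omega> u G" and one: "sqint u \<le> 1" "gradint G \<le> 1" for u G k
  proof -
    define t where "t = c0 / b ^ k"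
    have t: "t > 0" using c0 b1 by (simp add: t_def)
    have t2: "c0\<^sup>2 / b ^ (2 * k) = t\<^sup>2" by (simp add: t_def power_divide power_mult[symmetric] mult.commute)
    show ?thesis
    proof (cases "t \<le> h")
      case True
      obtain T where T: "smoothing \<Omega> (C / t ^ ?N) (C * t\<^sup>2) T" using C(3)[OF t True] by blast
      have "t ^ ?N = C / 2 ^ k"
        unfolding t_def power_divide c0 by (simp add: power_mult[symmetric] mult.commute[of k]) (simp add: power_mult bN)
      then have A: "C / t ^ ?N = 2 ^ k" using C(1) by simp
      have "(\<integral>\<^sup>+x. indicator {x. \<bar>u x\<bar> > 2 * 2 ^ k} x * ennreal ((u x)\<^sup>2) \<partial>lebesgue_on \<Omega>) \<le> ennreal (4 * (C * t\<^sup>2))"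
        by (rule sobolev_tail[OF T _ u G one]) (use C(1) A in auto)
      also have "\<dots> \<le> ennreal (C3 / b ^ (2 * k))"
      proof (rule ennreal_leI)
        have "C3 / b ^ (2 * k) = (4 * C + 1 / h\<^sup>2) * t\<^sup>2" unfolding C3_def t2[symmetric] by simp
        then show "4 * (C * t\<^sup>2) \<le> C3 / b ^ (2 * k)" by (simp add: distrib_right)
      qed
      finally show ?thesis .
    next
      case False
      have "(\<integral>\<^sup>+x. indicator {x. \<bar>u x\<bar> > 2 * 2 ^ k} x * ennreal ((u x)\<^sup>2) \<partial>lebesgue_on \<Omega>) \<le> (\<integral>\<^sup>+x. ennreal ((u x)\<^sup>2) \<partial>lebesgue_on \<Omega>)"
        by (rule nn_integral_mono) (simp add: indicator_def)
      also have "\<dots> = ennreal (sqint u)" unfolding sqint_def by (rule nn_integral_eq_integral[OF L2D(2)[OF u]]) simp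
      also have "\<dots> \<le> ennreal (C3 / b ^ (2 * k))"
      proof (rule ennreal_leI)
        have "h\<^sup>2 \<le> t\<^sup>2" using False C(2) by (intro power_mono) auto
        then have "1 \<le> 1 / h\<^sup>2 * t\<^sup>2" using C(2) by (simp add: pos_le_divide_eq)
        also have "\<dots> \<le> (4 * C + 1 / h\<^sup>2) * t\<^sup>2" using C(1) by (intro mult_right_mono) auto
        also have "\<dots> = C3 / b ^ (2 * k)" unfolding C3_def t2[symmetric] by simp
        finally show "sqint u \<le> C3 / b ^ (2 * k)" using one(1) by linarith
      qed
      finally show ?thesis .
    qed
  qed
  define K where "K = b\<^sup>2 + b\<^sup>2 * C3 * (1 / (1 - 1 / b))"
  have ib: "0 < 1 / b" "1 / b < 1" using b1 by auto
  show ?thesis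
  proof (rule that[of K])
    have "0 < 1 / (1 - 1 / b)" using ib by simp
    then show "K > 0" unfolding K_def using b1 C3 by (intro add_pos_pos mult_pos_pos) auto
    fix u G assume u: "L2 \<Omega> u" and G: "weak_gradient \<Omega> u G" and one: "sqint u \<le> 1" "gradint G \<le> 1"
    note [measurable] = L2D(1)[OF u]
    let ?f = "\<lambda>k x. ennreal (b ^ (k + 2)) * (indicator {x. \<bar>u x\<bar> > 2 * 2 ^ k} x * ennreal ((u x)\<^sup>2))"
    have ind [measurable]: "(\<lambda>x. indicator {x. \<bar>u x\<bar> > 2 * 2 ^ k} x :: ennreal) \<in> borel_measurable (lebesgue_on \<Omega>)" for k :: nat
    proof -
      have "(\<lambda>x. if \<bar>u x\<bar> > 2 * 2 ^ k then 1 else 0 :: ennreal) \<in> borel_measurable (lebesgue_on \<Omega>)" by measurable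
      then show ?thesis by (simp add: indicator_def)
    qed
    have "(\<integral>\<^sup>+x. ennreal (\<bar>u x\<bar> powr q_exp) \<partial>lebesgue_on \<Omega>) \<le> (\<integral>\<^sup>+x. ennreal (b\<^sup>2) * ennreal ((u x)\<^sup>2) + (\<Sum>k. ?f k x) \<partial>lebesgue_on \<Omega>)"
    proof (rule nn_integral_mono)
      fix x
      have "\<bar>u x\<bar> powr q_exp = \<bar>u x\<bar>\<^sup>2 * \<bar>u x\<bar> powr (1 / real ?N)"
        by (cases "u x = 0") (simp_all add: q_exp_def powr_add)
      then show "ennreal (\<bar>u x\<bar> powr q_exp) \<le> ennreal (b\<^sup>2) * ennreal ((u x)\<^sup>2) + (\<Sum>k. ?f k x)"
        using dyadic_bound[OF abs_ge_zero[of "u x"] Np b_def] by (simp add: indicator_def)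
    qed
    also have "\<dots> = (\<integral>\<^sup>+x. ennreal (b\<^sup>2) * ennreal ((u x)\<^sup>2) \<partial>lebesgue_on \<Omega>) + (\<integral>\<^sup>+x. (\<Sum>k. ?f k x) \<partial>lebesgue_on \<Omega>)"
      by (rule nn_integral_add) measurable
    also have "(\<integral>\<^sup>+x. (\<Sum>k. ?f k x) \<partial>lebesgue_on \<Omega>) = (\<Sum>k. \<integral>\<^sup>+x. ?f k x \<partial>lebesgue_on \<Omega>)"
      by (rule nn_integral_suminf) measurable
    also have "(\<integral>\<^sup>+x. ennreal (b\<^sup>2) * ennreal ((u x)\<^sup>2) \<partial>lebesgue_on \<Omega>) = ennreal (b\<^sup>2 * sqint u)"
      using L2D(2)[OF u] by (simp add: nn_integral_cmult nn_integral_eq_integral sqint_def ennreal_mult)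
    also have "ennreal (b\<^sup>2 * sqint u) + (\<Sum>k. \<integral>\<^sup>+x. ?f k x \<partial>lebesgue_on \<Omega>) \<le> ennreal (b\<^sup>2) + ennreal (b\<^sup>2 * C3 * (1 / (1 - 1 / b)))"
    proof (rule add_mono)
      show "ennreal (b\<^sup>2 * sqint u) \<le> ennreal (b\<^sup>2)"
        using mult_left_mono[OF one(1), of "b\<^sup>2"] by (simp add: ennreal_leI)
      have "(\<integral>\<^sup>+x. ?f k x \<partial>lebesgue_on \<Omega>) \<le> ennreal (b\<^sup>2 * C3 * (1 / b) ^ k)" for k
      proof -
        have "(\<integral>\<^sup>+x. ?f k x \<partial>lebesgue_on \<Omega>) = ennreal (b ^ (k + 2)) * (\<integral>\<^sup>+x. indicator {x. \<bar>u x\<bar> > 2 * 2 ^ k} x * ennreal ((u x)\<^sup>2) \<partial>lebesgue_on \<Omega>)"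
          by (rule nn_integral_cmult) measurable
        also have "\<dots> \<le> ennreal (b ^ (k + 2)) * ennreal (C3 / b ^ (2 * k))"
          by (rule mult_left_mono[OF tail[OF u G one]]) simp
        also have "\<dots> = ennreal (b ^ (k + 2) * (C3 / b ^ (2 * k)))"
          using b1 C3 by (intro ennreal_mult[symmetric]) auto
        also have "b ^ (k + 2) * (C3 / b ^ (2 * k)) = b\<^sup>2 * C3 * (1 / b) ^ k"
          using b1 by (simp add: power_add mult_2 power_divide power2_eq_square)
        finally show ?thesis .
      qed
      then have "(\<Sum>k. \<integral>\<^sup>+x. ?f k x \<partial>lebesgue_on \<Omega>) \<le> (\<Sum>k. ennreal (b\<^sup>2 * C3 * (1 / b) ^ k))"
        by (intro suminf_le summableI)
      also have "\<dots> = ennreal (b\<^sup>2 * C3 * (1 / (1 - 1 / b)))"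
      proof (rule suminf_ennreal_eq)
        show "(\<lambda>k. b\<^sup>2 * C3 * (1 / b) ^ k) sums (b\<^sup>2 * C3 * (1 / (1 - 1 / b)))"
          by (rule sums_mult[OF geometric_sums]) (use ib in simp)
      qed (use b1 C3 in auto)
      finally show "(\<Sum>k. \<integral>\<^sup>+x. ?f k x \<partial>lebesgue_on \<Omega>) \<le> ennreal (b\<^sup>2 * C3 * (1 / (1 - 1 / b)))" .
    qed
    also have "\<dots> = ennreal K" unfolding K_def using b1 C3 ib by (intro ennreal_plus[symmetric]) auto
    finally show "(\<integral>\<^sup>+x. ennreal (\<bar>u x\<bar> powr q_exp) \<partial>lebesgue_on \<Omega>) \<le> ennreal K" .
  qed
qed

text \<open>Homogeneity reduces this to \<open>sobolev_unit\<close>: u is divided by the square root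
  of s, its squared H^1 norm. If s = 0 the function vanishes a.e.\<close>

lemma sobolev:
  assumes S: "smoothable \<Omega>"
  obtains K where "K > 0" "\<And>u G. L2 \<Omega> u \<Longrightarrow> weak_gradient \<Omega> u G \<Longrightarrow>
    integrable (lebesgue_on \<Omega>) (\<lambda>x. \<bar>u x\<bar> powr q_exp) \<and>
    (\<integral>x. \<bar>u x\<bar> powr q_exp \<partial>lebesgue_on \<Omega>) \<le> K * (sqint u + gradint G) powr (q_exp / 2)"
proof -
  obtain K where K: "K > 0" "\<And>u G. L2 \<Omega> u \<Longrightarrow> weak_gradient \<Omega> u G \<Longrightarrow> sqint u \<le> 1 \<Longrightarrow> gradint G \<le> 1 \<Longrightarrow>
    (\<integral>\<^sup>+x. ennreal (\<bar>u x\<bar> powr q_exp) \<partial>lebesgue_on \<Omega>) \<le> ennreal K"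
    using sobolev_unit[OF S] by blast
  show ?thesis
  proof (rule that[OF K(1)])
    fix u G assume u: "L2 \<Omega> u" and G: "weak_gradient \<Omega> u G"
    note [measurable] = L2D(1)[OF u]
    define s where "s = sqint u + gradint G"
    have s0: "s \<ge> 0" using sqint_nonneg[of u] gradint_nonneg[of G] by (simp add: s_def)
    show "integrable (lebesgue_on \<Omega>) (\<lambda>x. \<bar>u x\<bar> powr q_exp) \<and>
      (\<integral>x. \<bar>u x\<bar> powr q_exp \<partial>lebesgue_on \<Omega>) \<le> K * (sqint u + gradint G) powr (q_exp / 2)"
    proof (cases "s = 0")
      case True
      then have "sqint u = 0" using sqint_nonneg[of u] gradint_nonneg[of G] unfolding s_def by linarith
      then have "AE x in lebesgue_on \<Omega>. (u x)\<^sup>2 = 0"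
        using integral_nonneg_eq_0_iff_AE[OF L2D(2)[OF u]] unfolding sqint_def by simp
      then have ae: "AE x in lebesgue_on \<Omega>. \<bar>u x\<bar> powr q_exp = 0" by eventually_elim simp
      have "integrable (lebesgue_on \<Omega>) (\<lambda>x. \<bar>u x\<bar> powr q_exp) \<longleftrightarrow> integrable (lebesgue_on \<Omega>) (\<lambda>x. 0::real)"
        by (rule integrable_cong_AE) (use ae in auto)
      moreover have "(\<integral>x. \<bar>u x\<bar> powr q_exp \<partial>lebesgue_on \<Omega>) = 0" by (rule integral_eq_zero_AE[OF ae])
      ultimately show ?thesis using K(1) by simp
    next
      case False
      then have sp: "s > 0" using s0 by simp
      define c where "c = 1 / sqrt s"
      have c: "c > 0" "c\<^sup>2 = 1 / s" using sp by (simp_all add: c_def power_divide)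
      have cu: "L2 \<Omega> (\<lambda>x. c * u x)" using L2_lincomb[OF u u, of c 0] by simp
      have cG: "weak_gradient \<Omega> (\<lambda>x. c * u x) (\<lambda>x. c *\<^sub>R G x)" using weak_gradient_lincomb[OF u G u G, of c 0] by simp
      have "sqint (\<lambda>x. c * u x) = sqint u / s" "gradint (\<lambda>x. c *\<^sub>R G x) = gradint G / s"
        unfolding sqint_def gradint_def using c by (simp_all add: power_mult_distrib)
      moreover have "sqint u / s \<le> 1" "gradint G / s \<le> 1"
        using sp sqint_nonneg[of u] gradint_nonneg[of G] by (simp_all add: s_def)
      ultimately have le: "(\<integral>\<^sup>+x. ennreal (\<bar>c * u x\<bar> powr q_exp) \<partial>lebesgue_on \<Omega>) \<le> ennreal K"
        using K(2)[OF cu cG] by simp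
      have "c powr q_exp = s powr (- (q_exp / 2))"
      proof -
        have "c = s powr (- 1/2)" using sp by (simp add: c_def powr_minus_divide powr_half_sqrt)
        then show ?thesis by (simp add: powr_powr)
      qed
      then have cp: "c powr q_exp * s powr (q_exp / 2) = 1" using sp by (simp add: powr_add[symmetric])
      have eq: "\<bar>c * u x\<bar> powr q_exp = c powr q_exp * \<bar>u x\<bar> powr q_exp" for x
        using c by (simp add: abs_mult powr_mult)
      have cpos: "c powr q_exp > 0" using c by simp
      have i: "integrable (lebesgue_on \<Omega>) (\<lambda>x. c powr q_exp * \<bar>u x\<bar> powr q_exp)"
      proof (rule integrableI_bounded)
        have "(\<integral>\<^sup>+x. ennreal (norm (c powr q_exp * \<bar>u x\<bar> powr q_exp)) \<partial>lebesgue_on \<Omega>) \<le> ennreal K"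
          using le cpos unfolding eq by simp
        from le_less_trans[OF this ennreal_less_top]
        show "(\<integral>\<^sup>+x. ennreal (norm (c powr q_exp * \<bar>u x\<bar> powr q_exp)) \<partial>lebesgue_on \<Omega>) < \<infinity>"
          by simp
      qed measurable
      then have i': "integrable (lebesgue_on \<Omega>) (\<lambda>x. \<bar>u x\<bar> powr q_exp)" using cpos by simp
      have "ennreal (c powr q_exp * (\<integral>x. \<bar>u x\<bar> powr q_exp \<partial>lebesgue_on \<Omega>)) \<le> ennreal K"
        using le nn_integral_eq_integral[OF i] cpos unfolding eq by simp
      then have "c powr q_exp * (\<integral>x. \<bar>u x\<bar> powr q_exp \<partial>lebesgue_on \<Omega>) \<le> K"
        using K(1) by (simp add: ennreal_le_iff)
      then have "s powr (q_exp / 2) * (c powr q_exp * (\<integral>x. \<bar>u x\<bar> powr q_exp \<partial>lebesgue_on \<Omega>)) \<le> s powr (q_exp / 2) * K"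
        by (rule mult_left_mono) simp
      moreover have "s powr (q_exp / 2) * (c powr q_exp * (\<integral>x. \<bar>u x\<bar> powr q_exp \<partial>lebesgue_on \<Omega>)) = (\<integral>x. \<bar>u x\<bar> powr q_exp \<partial>lebesgue_on \<Omega>)"
        unfolding mult.assoc[symmetric] mult.commute[of "s powr _"] cp by simp
      ultimately show ?thesis using i' unfolding s_def by (simp add: mult.commute)
    qed
  qed
qed

section \<open>Functions with vanishing gradient are constant\<close>

lemma zero_gradient_locally_constant:
  assumes u: "L2 \<Omega> u" and G: "weak_gradient \<Omega> u G" and z: "AE x in lebesgue_on \<Omega>. G x = 0" and x0: "x0 \<in> \<Omega>"
  obtains r c where "r > 0" "ball x0 r \<subseteq> \<Omega>" "AE x in lborel. x \<in> ball x0 r \<longrightarrow> u x = c"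
proof -
  obtain U where U: "U \<in> borel_measurable borel" "\<And>x. x \<notin> \<Omega> \<Longrightarrow> U x = 0" "AE x in lebesgue_on \<Omega>. u x = U x"
    "integrable lborel (\<lambda>x. (U x)\<^sup>2)" "integrable lborel U"
    using L2_representative[OF u] by blast
  obtain r where r: "r > 0" "ball x0 (2 * r) \<subseteq> \<Omega>"
  proof -
    obtain d where "d > 0" "ball x0 d \<subseteq> \<Omega>" using open_dom x0 openE by blast
    then show ?thesis by (intro that[of "d/2"]) auto
  qed
  define D where "D = ball x0 r"
  define h where "h = r / 2"
  have hp: "h > 0" using r by (simp add: h_def)
  obtain \<Theta> :: "'a \<Rightarrow> real" where T: "mollifier \<Theta> (norm (0::'a) + 1)" "\<And>z. \<Theta> z \<noteq> 0 \<Longrightarrow> norm (z - 0) < 1"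
    by (rule mollifier_exists[of 1 0]) auto
  interpret mollifier \<Theta> 1 using T(1) by simp
  interpret cone_piece \<Omega> \<Theta> 1 D "cball 0 1" h
  proof
    show "D \<in> sets borel" by (simp add: D_def)
    show "D \<subseteq> \<Omega>" using r by (force simp: D_def)
    show "\<Theta> z = 0" if "z \<notin> cball 0 1" for z using T(2)[of z] that by force
    show "x + t *\<^sub>R z \<in> \<Omega>" if x: "x \<in> D" and t: "0 < t" "t \<le> h" and z: "z \<in> cball 0 1" for x t z
    proof -
      have "norm (t *\<^sub>R z) \<le> h * 1" using mult_mono[of t h "norm z" 1] t z hp by simp
      moreover have "dist x0 (x + t *\<^sub>R z) \<le> dist x0 x + norm (t *\<^sub>R z)"
        using dist_triangle[of x0 "x + t *\<^sub>R z" x] by (simp add: dist_norm)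
      ultimately have "x + t *\<^sub>R z \<in> ball x0 (2 * r)" using x r(1) by (simp add: D_def h_def)
      then show ?thesis using r(2) by blast
    qed
  qed (use hp in auto)
  have mD: "(\<lambda>x. indicator D x * ennreal ((moll h U x - U x)\<^sup>2)) \<in> borel_measurable lborel"
  proof -
    note [measurable] = D_borel U(1) moll_meas[OF U(1)]
    show ?thesis by measurable
  qed
  have "gradint G = 0"
    unfolding gradint_def by (rule integral_eq_zero_AE) (use z in eventually_elim, simp)
  \<comment> \<open>For a vanishing gradient the smoothing error is 0 at the fixed scale h, without
    any limit: on D the function equals its own average a.e.\<close>
  then have "(\<integral>\<^sup>+x. indicator D x * ennreal ((moll h U x - U x)\<^sup>2) \<partial>lborel) \<le> ennreal 0"
    using moll_estimate[OF u G U hp order_refl] by (simp add: gradint_def)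
  then have "(\<integral>\<^sup>+x. indicator D x * ennreal ((moll h U x - U x)\<^sup>2) \<partial>lborel) = 0" by simp
  then have aeD: "AE x in lborel. indicator D x * ennreal ((moll h U x - U x)\<^sup>2) = 0"
    by (rule nn_integral_0_iff_AE[THEN iffD1, rotated]) (rule mD)
  \<comment> \<open>Moving the centre of the kernel from x0 to x. The derivative of the average
    tests u against a directional derivative of a test function, which is a pairing with the
    gradient and so vanishes.\<close>
  have const: "moll h U x = moll h U x0" if x: "x \<in> D" for x
  proof -
    define v where "v = x - x0"
    have seg: "x0 + \<tau> *\<^sub>R v \<in> D" if "0 \<le> \<tau>" "\<tau> \<le> 1" for \<tau>
    proof -
      have "norm (\<tau> *\<^sub>R v) \<le> 1 * norm v" unfolding norm_scaleR by (rule mult_right_mono) (use that in auto)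
      then show ?thesis using x by (simp add: D_def v_def dist_norm norm_minus_commute)
    qed
    have sm: "smooth_on UNIV (dil h)" using dil_smooth[of h 0] by simp
    define \<Phi>' where "\<Phi>' \<tau> y = frechet_derivative (dil h) (at ((y - x0) + \<tau> *\<^sub>R (- v))) (- v)" for \<tau> y
    have dilz: "dil h w = 0" if "w \<notin> cball 0 h" for w using dil_eq_0[OF hp, of w] that by simp
    have fz: "frechet_derivative (dil h) (at w) a = 0" if "w \<notin> cball 0 h" for w a
    proof (rule frechet_derivative_zero_off_support)
      have "closure {w. dil h w \<noteq> 0} \<subseteq> cball 0 h" by (intro closure_minimal closed_cball) (use dilz in blast)
      then show "w \<notin> closure {w. dil h w \<noteq> 0}" using that by blast
    qed
    obtain C where C: "C > 0" "\<And>w. \<bar>frechet_derivative (dil h) (at w) (- v)\<bar> \<le> C"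
      by (rule compact_support_bounded[OF smooth_derivative_continuous[OF sm] compact_cball fz]) blast+
    have cont': "continuous_on UNIV (\<lambda>w. frechet_derivative (dil h) (at w) (- v))"
      by (rule smooth_derivative_continuous[OF sm])
    have [measurable]: "(\<lambda>w. frechet_derivative (dil h) (at w) (- v)) \<in> borel_measurable borel"
      by (rule borel_measurable_continuous_onI[OF cont'])
    have inner0: "(\<integral>y. U y * \<Phi>' \<tau> y \<partial>lborel) = 0" if tau: "0 \<le> \<tau>" "\<tau> \<le> 1" for \<tau>
    proof -
      let ?x = "x0 + \<tau> *\<^sub>R v"
      note tf = vtest_test_fun(2)[OF seg[OF tau] hp order_refl]
      have dif: "dil h differentiable (at w)" for w using smooth_has_derivative[OF sm] by (auto simp: differentiable_def)
      have fd: "frechet_derivative (\<lambda>y. dil h (y - ?x)) (at y) j = frechet_derivative (dil h) (at (y - ?x)) j" for y j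
      proof -
        have 1: "((\<lambda>y. y - ?x) has_derivative (\<lambda>v. v)) (at y)" by (auto intro!: derivative_eq_intros)
        have "((\<lambda>y. dil h (y - ?x)) has_derivative frechet_derivative (dil h) (at (y - ?x))) (at y)"
          by (rule has_derivative_compose[OF 1 smooth_has_derivative[OF sm]])
        from frechet_derivative_at[OF this] show ?thesis by metis
      qed
      have "u y * \<Phi>' \<tau> y = (\<Sum>j\<in>Basis. (- v \<bullet> j) * (u y * frechet_derivative (\<lambda>y. dil h (y - ?x)) (at y) j))" for y
      proof -
        have "(y - x0) + \<tau> *\<^sub>R (- v) = y - ?x" by simp
        then have "\<Phi>' \<tau> y = (\<Sum>j\<in>Basis. (- v \<bullet> j) * frechet_derivative (dil h) (at (y - ?x)) j)"
          unfolding \<Phi>'_def by (simp only:) (rule frechet_derivative_Basis_expand[OF dif])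
        then show ?thesis unfolding fd by (simp only: sum_distrib_left mult.left_commute)
      qed
      then have "(\<integral>y. u y * \<Phi>' \<tau> y \<partial>lebesgue_on \<Omega>) = (\<integral>y. (\<Sum>j\<in>Basis. (- v \<bullet> j) * (u y * frechet_derivative (\<lambda>y. dil h (y - ?x)) (at y) j)) \<partial>lebesgue_on \<Omega>)"
        by (simp only:)
      also have "\<dots> = (\<Sum>j\<in>Basis. \<integral>y. (- v \<bullet> j) * (u y * frechet_derivative (\<lambda>y. dil h (y - ?x)) (at y) j) \<partial>lebesgue_on \<Omega>)"
        by (rule Bochner_Integration.integral_sum) (rule integrable_mult_right, rule integrable_test(2)[OF u tf])
      also have "\<dots> = 0"
      proof (rule sum.neutral, rule ballI)
        fix j :: 'a assume j: "j \<in> Basis"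
        have "(\<integral>y. (G y \<bullet> j) * dil h (y - ?x) \<partial>lebesgue_on \<Omega>) = 0"
          by (rule integral_eq_zero_AE) (use z in eventually_elim, simp)
        then have "(\<integral>y. u y * frechet_derivative (\<lambda>y. dil h (y - ?x)) (at y) j \<partial>lebesgue_on \<Omega>) = 0"
          using weak_gradientD(3)[OF G tf j] by linarith
        then show "(\<integral>y. (- v \<bullet> j) * (u y * frechet_derivative (\<lambda>y. dil h (y - ?x)) (at y) j) \<partial>lebesgue_on \<Omega>) = 0"
          by (simp only: integral_mult_right_zero mult_zero_right)
      qed
      finally have 0: "(\<integral>y. u y * \<Phi>' \<tau> y \<partial>lebesgue_on \<Omega>) = 0" .
      have pm: "\<Phi>' \<tau> \<in> borel_measurable borel" unfolding \<Phi>'_def by measurable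
      have "(\<integral>y. u y * \<Phi>' \<tau> y \<partial>lebesgue_on \<Omega>) = (\<integral>y. U y * \<Phi>' \<tau> y \<partial>lborel)"
      proof (rule integral_lebesgue_on_eq_lborel(1)[OF borel_dom])
        show "(\<lambda>y. U y * \<Phi>' \<tau> y) \<in> borel_measurable borel" by (rule borel_measurable_times[OF U(1) pm])
        show "U y * \<Phi>' \<tau> y = 0" if "y \<notin> \<Omega>" for y using U(2)[OF that] by simp
        show "(\<lambda>y. u y * \<Phi>' \<tau> y) \<in> borel_measurable (lebesgue_on \<Omega>)"
          by (rule borel_measurable_times[OF L2D(1)[OF u] borel_measurable_lebesgue_onI[OF pm]])
        show "AE y in lebesgue_on \<Omega>. u y * \<Phi>' \<tau> y = U y * \<Phi>' \<tau> y" using U(3) by eventually_elim simp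
      qed
      then show ?thesis using 0 by simp
    qed
    have "(\<integral>y. U y * dil h ((y - x0) + 1 *\<^sub>R (- v)) \<partial>lborel) - (\<integral>y. U y * dil h ((y - x0) + 0 *\<^sub>R (- v)) \<partial>lborel)
      = (\<integral>\<tau>. indicator {0..1} \<tau> * (\<integral>y. U y * \<Phi>' \<tau> y \<partial>lborel) \<partial>lborel)"
    proof (rule FTC_Fubini[OF U(5)])
      show "((\<lambda>\<tau>. dil h ((y - x0) + \<tau> *\<^sub>R (- v))) has_real_derivative \<Phi>' \<tau> y) (at \<tau>)" for \<tau> y
        unfolding \<Phi>'_def by (rule smooth_line_derivative[OF sm])
      show "isCont (\<lambda>\<tau>. \<Phi>' \<tau> y) \<tau>" for \<tau> y
      proof -
        have "continuous_on UNIV (\<lambda>\<tau>. \<Phi>' \<tau> y)"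
          unfolding \<Phi>'_def
          by (rule continuous_on_compose2[OF cont', of UNIV "\<lambda>\<tau>. (y - x0) + \<tau> *\<^sub>R (- v)"]) (auto intro!: continuous_intros)
        then show ?thesis by (simp add: continuous_on_eq_continuous_at)
      qed
      show "\<bar>\<Phi>' \<tau> y\<bar> \<le> C" for \<tau> y unfolding \<Phi>'_def by (rule C(2))
      show "(\<lambda>(\<tau>, y). indicator {0..1} \<tau> * \<Phi>' \<tau> y) \<in> borel_measurable (borel \<Otimes>\<^sub>M borel)"
        unfolding \<Phi>'_def by measurable
      have e: "(y - x0) + \<tau> *\<^sub>R (- v) = y - (x0 + \<tau> *\<^sub>R v)" for \<tau> y by simp
      show "integrable lborel (\<lambda>y. U y * dil h ((y - x0) + 0 *\<^sub>R (- v)))"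
        "integrable lborel (\<lambda>y. U y * dil h ((y - x0) + 1 *\<^sub>R (- v)))"
        unfolding e by (rule dil_integrable[OF hp U(5)])+
    qed simp
    also have "\<dots> = (\<integral>\<tau>. 0 \<partial>(lborel :: real measure))"
    proof (rule Bochner_Integration.integral_cong[OF refl])
      fix \<tau> :: real
      show "indicator {0..1} \<tau> * (\<integral>y. U y * \<Phi>' \<tau> y \<partial>lborel) = 0"
        using inner0[of \<tau>] by (cases "\<tau> \<in> {0..1}") simp_all
    qed
    finally have "(\<integral>y. U y * dil h ((y - x0) + 1 *\<^sub>R (- v)) \<partial>lborel) = (\<integral>y. U y * dil h ((y - x0) + 0 *\<^sub>R (- v)) \<partial>lborel)"
      by simp
    moreover have "(y - x0) + 1 *\<^sub>R (- v) = y - x" "(y - x0) + 0 *\<^sub>R (- v) = y - x0" for y by (simp_all add: v_def)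
    ultimately show ?thesis unfolding moll_def by (simp only:)
  qed
  show ?thesis
  proof (rule that[of r "moll h U x0"])
    show "r > 0" by fact
    show "ball x0 r \<subseteq> \<Omega>" using D_sub by (simp add: D_def)
    have "AE x in lborel. x \<in> \<Omega> \<longrightarrow> u x = U x" using U(3) by (simp only: AE_lebesgue_on_iff[OF borel_dom])
    with aeD show "AE x in lborel. x \<in> ball x0 r \<longrightarrow> u x = moll h U x0"
    proof eventually_elim
      case (elim x)
      show ?case
      proof
        assume "x \<in> ball x0 r"
        then have xD: "x \<in> D" by (simp add: D_def)
        then have "moll h U x - U x = 0" using elim(1) by (simp add: ennreal_eq_0_iff)
        then show "u x = moll h U x0" using const[OF xD] elim(2) xD D_sub by auto
      qed
    qed
  qed
qed

text \<open>The local constants define an honest function c on the domain that is locally constant,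
  hence constant by connectedness; a countable cover then gathers the exceptional null sets.\<close>

lemma zero_gradient_constant:
  assumes u: "L2 \<Omega> u" and G: "weak_gradient \<Omega> u G" and z: "AE x in lebesgue_on \<Omega>. G x = 0"
    and conn: "connected \<Omega>"
  obtains c where "AE x in lebesgue_on \<Omega>. u x = c"
proof -
  have "\<forall>x0\<in>\<Omega>. \<exists>r c. r > 0 \<and> ball x0 r \<subseteq> \<Omega> \<and> (AE x in lborel. x \<in> ball x0 r \<longrightarrow> u x = c)"
    using zero_gradient_locally_constant[OF u G z] by metis
  then obtain r c where rc: "\<And>x0. x0 \<in> \<Omega> \<Longrightarrow> r x0 > 0" "\<And>x0. x0 \<in> \<Omega> \<Longrightarrow> ball x0 (r x0) \<subseteq> \<Omega>"
    "\<And>x0. x0 \<in> \<Omega> \<Longrightarrow> AE x in lborel. x \<in> ball x0 (r x0) \<longrightarrow> u x = c x0" by metis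
  have same: "c y = c x" if x: "x \<in> \<Omega>" and y: "y \<in> ball x (r x)" for x y
  proof (rule ccontr)
    assume ne: "c y \<noteq> c x"
    have y\<Omega>: "y \<in> \<Omega>" using rc(2)[OF x] y by blast
    \<comment> \<open>If the constants differed, the overlap of the two balls would be a null set;
      but it is open and contains y.\<close>
    have "AE w in lborel. w \<notin> ball x (r x) \<inter> ball y (r y)"
      using rc(3)[OF x] rc(3)[OF y\<Omega>] by eventually_elim (use ne in auto)
    then have "AE w in lebesgue. w \<notin> ball x (r x) \<inter> ball y (r y)" by (simp only: AE_completion_iff)
    then have "negligible (ball x (r x) \<inter> ball y (r y))"
      by (simp add: negligible_iff_null_sets AE_iff_null_sets)
    moreover have "open (ball x (r x) \<inter> ball y (r y))" by (intro open_Int open_ball)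
    moreover have "y \<in> ball x (r x) \<inter> ball y (r y)" using y rc(1)[OF y\<Omega>] by simp
    ultimately show False using open_not_negligible by blast
  qed
  have "c constant_on \<Omega>"
  proof (rule locally_constant_imp_constant[OF conn])
    fix x assume x: "x \<in> \<Omega>"
    show "\<exists>T. openin (top_of_set \<Omega>) T \<and> x \<in> T \<and> (\<forall>y\<in>T. c y = c x)"
    proof (rule exI[of _ "ball x (r x)"], intro conjI ballI)
      show "openin (top_of_set \<Omega>) (ball x (r x))" using rc(2)[OF x] by (intro open_openin_trans open_dom open_ball)
      show "x \<in> ball x (r x)" using rc(1)[OF x] by simp
    qed (rule same[OF x])
  qed
  then obtain c0 where c0: "\<And>x. x \<in> \<Omega> \<Longrightarrow> c x = c0" unfolding constant_on_def by blast
  have "AE y in lborel. y \<in> \<Omega> \<longrightarrow> u y = c0"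
  proof (rule ball_cover_AE)
    fix x assume x: "x \<in> \<Omega>"
    show "\<exists>r>0. AE y in lborel. y \<in> ball x r \<longrightarrow> u y = c0"
      using rc(1)[OF x] rc(3)[OF x] c0[OF x] by auto
  qed
  then have "AE x in lebesgue_on \<Omega>. u x = c0" by (simp only: AE_lebesgue_on_iff[OF borel_dom])
  then show ?thesis by (rule that)
qed

end

section \<open>Lebesgue norms and the Dirichlet energy\<close>

lemma weighted_young:
  fixes x y a :: real
  assumes "0 < a" "a < 1" "x \<ge> 0" "y \<ge> 0"
  shows "x powr a * y powr (1 - a) \<le> a * x + (1 - a) * y"
proof (cases "x = 0 \<or> y = 0")
  case False
  then show ?thesis using Youngs_inequality_0[of a "1 - a" x y] assms by simp
qed (use assms in auto)

text \<open>Weighted Young pointwise, after dividing f and g by their integrals. This symmetric form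
  of Holder's inequality yields all the variants below by inserting powers for f and g.\<close>

lemma holder_weighted:
  fixes f g :: "'a \<Rightarrow> real"
  assumes f: "integrable M f" "\<And>x. f x \<ge> 0" and g: "integrable M g" "\<And>x. g x \<ge> 0"
    and a: "0 < a" "a < 1"
  shows "integrable M (\<lambda>x. f x powr a * g x powr (1 - a))"
    "(\<integral>x. f x powr a * g x powr (1 - a) \<partial>M) \<le> (\<integral>x. f x \<partial>M) powr a * (\<integral>x. g x \<partial>M) powr (1 - a)"
proof -
  note [measurable] = borel_measurable_integrable[OF f(1)] borel_measurable_integrable[OF g(1)]
  have young: "x powr a * y powr (1 - a) \<le> a * x + (1 - a) * y" if "x \<ge> 0" "y \<ge> 0" for x y :: real
    by (rule weighted_young[OF a that])
  have int: "integrable M (\<lambda>x. a * f x + (1 - a) * g x)" using f g by simp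
  show i: "integrable M (\<lambda>x. f x powr a * g x powr (1 - a))"
  proof (rule Bochner_Integration.integrable_bound[OF int])
    show "AE x in M. norm (f x powr a * g x powr (1 - a)) \<le> norm (a * f x + (1 - a) * g x)"
    proof (rule AE_I2)
      fix x
      show "norm (f x powr a * g x powr (1 - a)) \<le> norm (a * f x + (1 - a) * g x)"
        using young[OF f(2)[of x] g(2)[of x]] by (simp add: abs_of_nonneg)
    qed
  qed measurable
  let ?F = "\<integral>x. f x \<partial>M" and ?G = "\<integral>x. g x \<partial>M"
  have FG: "?F \<ge> 0" "?G \<ge> 0" using f(2) g(2) by (auto intro: integral_nonneg_AE)
  show "(\<integral>x. f x powr a * g x powr (1 - a) \<partial>M) \<le> ?F powr a * ?G powr (1 - a)"
  proof (cases "?F = 0 \<or> ?G = 0")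
    case True
    have "AE x in M. f x = 0 \<or> g x = 0"
    proof (cases "?F = 0")
      case True
      then have "AE x in M. f x = 0" using integral_nonneg_eq_0_iff_AE[OF f(1)] f(2) by simp
      then show ?thesis by eventually_elim simp
    next
      case False
      then have "?G = 0" using \<open>?F = 0 \<or> ?G = 0\<close> by blast
      then have "AE x in M. g x = 0" using integral_nonneg_eq_0_iff_AE[OF g(1)] g(2) by simp
      then show ?thesis by eventually_elim simp
    qed
    then have "AE x in M. f x powr a * g x powr (1 - a) = 0" by eventually_elim auto
    then have "(\<integral>x. f x powr a * g x powr (1 - a) \<partial>M) = 0" by (rule integral_eq_zero_AE)
    then show ?thesis by simp
  next
    case False
    then have p: "?F > 0" "?G > 0" using FG by auto
    have "(\<integral>x. f x powr a * g x powr (1 - a) \<partial>M) = ?F powr a * ?G powr (1 - a) * (\<integral>x. (f x / ?F) powr a * (g x / ?G) powr (1 - a) \<partial>M)"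
      using p f(2) g(2) by (simp add: powr_divide mult.assoc)
    also have "\<dots> \<le> ?F powr a * ?G powr (1 - a) * (\<integral>x. a * (f x / ?F) + (1 - a) * (g x / ?G) \<partial>M)"
    proof (rule mult_left_mono[OF integral_mono])
      show "integrable M (\<lambda>x. (f x / ?F) powr a * (g x / ?G) powr (1 - a))"
        using i p f(2) g(2) by (simp add: powr_divide)
      show "integrable M (\<lambda>x. a * (f x / ?F) + (1 - a) * (g x / ?G))" using f g by simp
      show "(f x / ?F) powr a * (g x / ?G) powr (1 - a) \<le> a * (f x / ?F) + (1 - a) * (g x / ?G)" for x
        by (rule young) (use p f(2) g(2) in auto)
    qed simp
    also have "(\<integral>x. a * (f x / ?F) + (1 - a) * (g x / ?G) \<partial>M) = 1"
      using f(1) g(1) p by simp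
    finally show ?thesis by simp
  qed
qed

section \<open>The nonlinearity |s|^(p-2) s, the derivative of |s|^p / p\<close>

definition signed_powr :: "real \<Rightarrow> real \<Rightarrow> real" where
  "signed_powr p s = sgn s * \<bar>s\<bar> powr (p - 1)"

lemma signed_powr_2 [simp]: "signed_powr 2 s = s"
  by (simp add: signed_powr_def sgn_mult_abs)

lemma abs_signed_powr: "\<bar>signed_powr p s\<bar> = \<bar>s\<bar> powr (p - 1)"
  by (cases "s = 0") (simp_all add: signed_powr_def abs_mult abs_sgn_eq)

lemma powr_young:
  assumes p: "p > 1"
  shows "p * (\<bar>x\<bar> powr (p - 1) * \<bar>y\<bar>) \<le> (p - 1) * \<bar>x\<bar> powr p + \<bar>y :: real\<bar> powr p"
proof -
  have c: "1 - (p - 1) / p = 1 / p" using p by (simp add: divide_simps)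
  have "(\<bar>x\<bar> powr p) powr ((p - 1) / p) * (\<bar>y\<bar> powr p) powr (1 - (p - 1) / p)
      \<le> (p - 1) / p * \<bar>x\<bar> powr p + (1 - (p - 1) / p) * \<bar>y\<bar> powr p"
    by (rule weighted_young) (use p in simp_all)
  then have "(\<bar>x\<bar> powr p) powr ((p - 1) / p) * (\<bar>y\<bar> powr p) powr (1 / p) \<le> (p - 1) / p * \<bar>x\<bar> powr p + 1 / p * \<bar>y\<bar> powr p"
    unfolding c .
  then have "\<bar>x\<bar> powr (p - 1) * \<bar>y\<bar> \<le> ((p - 1) * \<bar>x\<bar> powr p + \<bar>y\<bar> powr p) / p"
    using p by (simp add: powr_powr add_divide_distrib)
  then have "\<bar>x\<bar> powr (p - 1) * \<bar>y\<bar> * p \<le> (p - 1) * \<bar>x\<bar> powr p + \<bar>y\<bar> powr p"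
    using p by (subst (asm) pos_le_divide_eq) auto
  then show ?thesis by (simp add: mult.commute)
qed

text \<open>The tangent line of the convex function |s|^p lies below its graph. Deriving it from
  Young's inequality treats x = 0 like any other point.\<close>

lemma powr_tangent:
  assumes p: "p > 1"
  shows "\<bar>x\<bar> powr p + p * (signed_powr p x * y) \<le> \<bar>x + y\<bar> powr p"
proof -
  have "signed_powr p x * (x + y) \<le> \<bar>x\<bar> powr (p - 1) * \<bar>x + y\<bar>"
    using abs_ge_self[of "signed_powr p x * (x + y)"] by (simp add: abs_mult abs_signed_powr)
  then have "p * (signed_powr p x * (x + y)) \<le> p * (\<bar>x\<bar> powr (p - 1) * \<bar>x + y\<bar>)"
    using p by (intro mult_left_mono) auto
  also have "\<dots> \<le> (p - 1) * \<bar>x\<bar> powr p + \<bar>x + y\<bar> powr p" by (rule powr_young[OF p])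
  finally have 1: "p * (signed_powr p x * (x + y)) \<le> (p - 1) * \<bar>x\<bar> powr p + \<bar>x + y\<bar> powr p" .
  have "signed_powr p x * x = \<bar>x\<bar> powr p"
  proof (cases "x = 0")
    case False
    have "signed_powr p x * x = \<bar>x\<bar> powr (p - 1) * (x * sgn x)"
      by (simp only: signed_powr_def mult_ac)
    also have "\<dots> = \<bar>x\<bar> powr (p - 1) * \<bar>x\<bar> powr 1"
      unfolding abs_sgn[of x, symmetric] by simp
    also have "\<dots> = \<bar>x\<bar> powr p" by (subst powr_add[symmetric]) simp
    finally show ?thesis .
  qed (simp add: signed_powr_def)
  then have "p * (signed_powr p x * (x + y)) = p * \<bar>x\<bar> powr p + p * (signed_powr p x * y)"
    by (simp add: distrib_left)
  then show ?thesis using 1 by (simp add: left_diff_distrib)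
qed

text \<open>An interpolation cut at a free threshold K. For fixed p < q a large K makes the q-part
  small; for fixed K the coefficient of the square tends to 1 as p tends to 2.\<close>

lemma powr_split:
  assumes p: "2 \<le> p" "p \<le> q" and K: "K > (0::real)"
  shows "\<bar>w\<bar> powr p \<le> K powr (p - 2) * w\<^sup>2 + K powr (p - q) * \<bar>w\<bar> powr q"
proof (cases "w = 0")
  case False
  then have w: "\<bar>w\<bar> > 0" by simp
  show ?thesis
  proof (cases "\<bar>w\<bar> \<le> K")
    case True
    have "\<bar>w\<bar> powr p = \<bar>w\<bar> powr (p - 2) * \<bar>w\<bar> powr 2" by (subst powr_add[symmetric]) simp
    also have "\<dots> = \<bar>w\<bar> powr (p - 2) * w\<^sup>2" using w by simp
    also have "\<dots> \<le> K powr (p - 2) * w\<^sup>2"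
      by (intro mult_right_mono powr_mono2) (use p True in auto)
    finally show ?thesis by (simp add: add_increasing2)
  next
    case False
    have "\<bar>w\<bar> powr p = \<bar>w\<bar> powr (p - q) * \<bar>w\<bar> powr q" by (subst powr_add[symmetric]) simp
    also have "\<dots> \<le> K powr (p - q) * \<bar>w\<bar> powr q"
      by (intro mult_right_mono powr_mono2') (use p False K in auto)
    finally show ?thesis by (simp add: add_increasing)
  qed
qed simp

section \<open>Lebesgue norms on a finite measure space\<close>

context finite_measure
begin

definition Lp :: "real \<Rightarrow> ('a \<Rightarrow> real) \<Rightarrow> bool" where
  "Lp p u \<longleftrightarrow> u \<in> borel_measurable M \<and> integrable M (\<lambda>x. \<bar>u x\<bar> powr p)"

definition pint :: "real \<Rightarrow> ('a \<Rightarrow> real) \<Rightarrow> real" where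
  "pint p u = (\<integral>x. \<bar>u x\<bar> powr p \<partial>M)"

definition pnorm :: "real \<Rightarrow> ('a \<Rightarrow> real) \<Rightarrow> real" where
  "pnorm p u = pint p u powr (1 / p)"

lemma pint_nonneg: "pint p u \<ge> 0" by (simp add: pint_def)
lemma pnorm_nonneg: "pnorm p u \<ge> 0" by (simp add: pnorm_def)

lemma pnorm_powr: "p > 0 \<Longrightarrow> pnorm p u powr p = pint p u"
  using pint_nonneg by (simp add: pnorm_def powr_powr)

lemma Lp_scale: "Lp p u \<Longrightarrow> Lp p (\<lambda>x. c * u x)"
  by (auto simp: Lp_def abs_mult powr_mult)

lemma pnorm_scale: "p > 0 \<Longrightarrow> pnorm p (\<lambda>x. c * u x) = \<bar>c\<bar> * pnorm p u"
  using pint_nonneg[of p u] by (simp add: pnorm_def pint_def abs_mult powr_mult powr_powr)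

lemma Lp_add:
  assumes p: "p > 1" and u: "Lp p u" and v: "Lp p v"
  shows "Lp p (\<lambda>x. u x + v x)"
  unfolding Lp_def
proof
  note [measurable] = u[unfolded Lp_def, THEN conjunct1] v[unfolded Lp_def, THEN conjunct1]
  show "(\<lambda>x. u x + v x) \<in> borel_measurable M" by measurable
  show "integrable M (\<lambda>x. \<bar>u x + v x\<bar> powr p)"
  proof (rule Bochner_Integration.integrable_bound)
    show "integrable M (\<lambda>x. 2 powr p * \<bar>u x\<bar> powr p + 2 powr p * \<bar>v x\<bar> powr p)"
      using u v by (simp add: Lp_def)
    show "AE x in M. norm (\<bar>u x + v x\<bar> powr p) \<le> norm (2 powr p * \<bar>u x\<bar> powr p + 2 powr p * \<bar>v x\<bar> powr p)"
    proof (rule AE_I2)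
      fix x
      have "\<bar>u x + v x\<bar> \<le> 2 * max \<bar>u x\<bar> \<bar>v x\<bar>" by linarith
      then have "\<bar>u x + v x\<bar> powr p \<le> (2 * max \<bar>u x\<bar> \<bar>v x\<bar>) powr p" using p by (intro powr_mono2) auto
      also have "\<dots> = 2 powr p * max \<bar>u x\<bar> \<bar>v x\<bar> powr p" by (simp add: powr_mult)
      also have "\<dots> \<le> 2 powr p * (\<bar>u x\<bar> powr p + \<bar>v x\<bar> powr p)"
        by (intro mult_left_mono) (auto simp: max_def)
      finally show "norm (\<bar>u x + v x\<bar> powr p) \<le> norm (2 powr p * \<bar>u x\<bar> powr p + 2 powr p * \<bar>v x\<bar> powr p)"
        by (simp add: distrib_left)
    qed
  qed measurable
qed

lemma Lp_diff: "p > 1 \<Longrightarrow> Lp p u \<Longrightarrow> Lp p v \<Longrightarrow> Lp p (\<lambda>x. u x - v x)"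
  using Lp_add[of p u "\<lambda>x. -1 * v x"] Lp_scale[of p v "-1"] by simp

lemma holder_signed:
  assumes p: "p > 1" and u: "Lp p u" and v: "Lp p v"
  shows "integrable M (\<lambda>x. signed_powr p (u x) * v x)"
    "integrable M (\<lambda>x. \<bar>u x\<bar> powr (p - 1) * \<bar>v x\<bar>)"
    "(\<integral>x. \<bar>u x\<bar> powr (p - 1) * \<bar>v x\<bar> \<partial>M) \<le> pnorm p u powr (p - 1) * pnorm p v"
proof -
  note [measurable] = u[unfolded Lp_def, THEN conjunct1] v[unfolded Lp_def, THEN conjunct1]
  have e: "(\<bar>u x\<bar> powr p) powr ((p - 1) / p) * (\<bar>v x\<bar> powr p) powr (1 - (p - 1) / p) = \<bar>u x\<bar> powr (p - 1) * \<bar>v x\<bar>" for x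
  proof -
    have "1 - (p - 1) / p = 1 / p" using p by (simp add: divide_simps)
    then show ?thesis using p by (simp add: powr_powr)
  qed
  have a: "0 < (p - 1) / p" "(p - 1) / p < 1" using p by simp_all
  note H = holder_weighted[of M "\<lambda>x. \<bar>u x\<bar> powr p" "\<lambda>x. \<bar>v x\<bar> powr p", OF _ _ _ _ a, unfolded e]
  show i: "integrable M (\<lambda>x. \<bar>u x\<bar> powr (p - 1) * \<bar>v x\<bar>)"
    by (rule H(1)) (use u v in \<open>auto simp: Lp_def\<close>)
  show "integrable M (\<lambda>x. signed_powr p (u x) * v x)"
  proof (rule Bochner_Integration.integrable_bound[OF i])
    show "AE x in M. norm (signed_powr p (u x) * v x) \<le> norm (\<bar>u x\<bar> powr (p - 1) * \<bar>v x\<bar>)"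
      by (rule AE_I2) (simp add: abs_mult abs_signed_powr)
    show "(\<lambda>x. signed_powr p (u x) * v x) \<in> borel_measurable M" unfolding signed_powr_def by measurable
  qed
  have "(\<integral>x. \<bar>u x\<bar> powr (p - 1) * \<bar>v x\<bar> \<partial>M) \<le> (\<integral>x. \<bar>u x\<bar> powr p \<partial>M) powr ((p - 1) / p) * (\<integral>x. \<bar>v x\<bar> powr p \<partial>M) powr (1 - (p - 1) / p)"
    by (rule H(2)) (use u v in \<open>auto simp: Lp_def\<close>)
  also have "\<dots> = pnorm p u powr (p - 1) * pnorm p v"
  proof -
    have "1 - (p - 1) / p = 1 / p" using p by (simp add: divide_simps)
    then show ?thesis by (simp add: pnorm_def pint_def powr_powr)
  qed
  finally show "(\<integral>x. \<bar>u x\<bar> powr (p - 1) * \<bar>v x\<bar> \<partial>M) \<le> pnorm p u powr (p - 1) * pnorm p v" .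
qed

text \<open>Holder applied to |w|^p <= |w|^(p-1) (|u| + |v|), followed by division by the power p -
  1 of the norm of w.\<close>

lemma minkowski:
  assumes p: "p > 1" and u: "Lp p u" and v: "Lp p v"
  shows "pnorm p (\<lambda>x. u x + v x) \<le> pnorm p u + pnorm p v"
proof -
  let ?w = "\<lambda>x. u x + v x"
  note w = Lp_add[OF p u v]
  note hu = holder_signed[OF p w u] and hv = holder_signed[OF p w v]
  have "pint p ?w \<le> (\<integral>x. \<bar>?w x\<bar> powr (p - 1) * \<bar>u x\<bar> + \<bar>?w x\<bar> powr (p - 1) * \<bar>v x\<bar> \<partial>M)"
    unfolding pint_def
  proof (rule integral_mono)
    show "integrable M (\<lambda>x. \<bar>?w x\<bar> powr p)" using w by (simp add: Lp_def)
    show "integrable M (\<lambda>x. \<bar>?w x\<bar> powr (p - 1) * \<bar>u x\<bar> + \<bar>?w x\<bar> powr (p - 1) * \<bar>v x\<bar>)" using hu(2) hv(2) by simp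
    show "\<bar>?w x\<bar> powr p \<le> \<bar>?w x\<bar> powr (p - 1) * \<bar>u x\<bar> + \<bar>?w x\<bar> powr (p - 1) * \<bar>v x\<bar>" for x
    proof -
      have "\<bar>?w x\<bar> powr p = \<bar>?w x\<bar> powr (p - 1) * \<bar>?w x\<bar> powr 1" by (subst powr_add[symmetric]) simp
      also have "\<dots> = \<bar>?w x\<bar> powr (p - 1) * \<bar>?w x\<bar>" by simp
      also have "\<dots> \<le> \<bar>?w x\<bar> powr (p - 1) * (\<bar>u x\<bar> + \<bar>v x\<bar>)" by (intro mult_left_mono abs_triangle_ineq) simp
      finally show ?thesis by (simp only: distrib_left)
    qed
  qed
  also have "\<dots> = (\<integral>x. \<bar>?w x\<bar> powr (p - 1) * \<bar>u x\<bar> \<partial>M) + (\<integral>x. \<bar>?w x\<bar> powr (p - 1) * \<bar>v x\<bar> \<partial>M)"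
    by (rule Bochner_Integration.integral_add[OF hu(2) hv(2)])
  also have "\<dots> \<le> pnorm p ?w powr (p - 1) * pnorm p u + pnorm p ?w powr (p - 1) * pnorm p v"
    by (rule add_mono[OF hu(3) hv(3)])
  finally have 1: "pnorm p ?w powr p \<le> pnorm p ?w powr (p - 1) * (pnorm p u + pnorm p v)"
    using p by (simp add: pnorm_powr distrib_left)
  show ?thesis
  proof (cases "pnorm p ?w = 0")
    case False
    then have n: "pnorm p ?w > 0" using pnorm_nonneg[of p ?w] by linarith
    have "pnorm p ?w powr p = pnorm p ?w powr (p - 1) * pnorm p ?w powr 1" by (subst powr_add[symmetric]) simp
    then have "pnorm p ?w powr (p - 1) * pnorm p ?w \<le> pnorm p ?w powr (p - 1) * (pnorm p u + pnorm p v)"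
      using 1 n by simp
    then show ?thesis using n by (simp only: mult_le_cancel_left_pos powr_gt_zero[THEN iffD2])  qed (simp add: pnorm_nonneg)
qed

lemma pnorm_triangle_lower:
  assumes p: "p > 1" and u: "Lp p u" and v: "Lp p v"
  shows "pnorm p u - pnorm p v \<le> pnorm p (\<lambda>x. u x - v x)"
  using minkowski[OF p Lp_diff[OF p u v] v] by simp

lemma pint_zero_iff:
  assumes "Lp p u"
  shows "pint p u = 0 \<longleftrightarrow> (AE x in M. u x = 0)"
  unfolding pint_def using integral_nonneg_eq_0_iff_AE[of M "\<lambda>x. \<bar>u x\<bar> powr p"] assms by (simp add: Lp_def)

lemma pnorm_zero_iff: "Lp p u \<Longrightarrow> pnorm p u = 0 \<longleftrightarrow> (AE x in M. u x = 0)"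
  using pint_zero_iff by (simp add: pnorm_def)

lemma pnorm_2: "(pnorm 2 u)\<^sup>2 = (\<integral>x. (u x)\<^sup>2 \<partial>M)"
  using pint_nonneg[of 2 u] by (simp add: pnorm_def pint_def powr_half_sqrt)

lemma L2_le_pnorm:
  assumes p: "p > 2" and u: "Lp p u"
  shows "integrable M (\<lambda>x. (u x)\<^sup>2)" "(\<integral>x. (u x)\<^sup>2 \<partial>M) \<le> (pnorm p u)\<^sup>2 * measure M (space M) powr (1 - 2 / p)"
proof -
  have e: "(\<bar>u x\<bar> powr p) powr (2 / p) * 1 powr (1 - 2 / p) = (u x)\<^sup>2" for x
    using p by (simp add: powr_powr)
  have a: "0 < 2 / p" "2 / p < 1" using p by simp_all
  note H = holder_weighted[of M "\<lambda>x. \<bar>u x\<bar> powr p" "\<lambda>x. 1", OF _ _ _ _ a, unfolded e]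
  show "integrable M (\<lambda>x. (u x)\<^sup>2)" by (rule H(1)) (use u in \<open>auto simp: Lp_def\<close>)
  have "(\<integral>x. (u x)\<^sup>2 \<partial>M) \<le> (\<integral>x. \<bar>u x\<bar> powr p \<partial>M) powr (2 / p) * (\<integral>x. 1 \<partial>M) powr (1 - 2 / p)"
    by (rule H(2)) (use u in \<open>auto simp: Lp_def\<close>)
  also have "(\<integral>x. \<bar>u x\<bar> powr p \<partial>M) powr (2 / p) = (pnorm p u)\<^sup>2"
    using pint_nonneg[of p u] unfolding pnorm_def by (cases "pint p u = 0") (simp_all add: pint_def powr_powr flip: powr_numeral)
  finally show "(\<integral>x. (u x)\<^sup>2 \<partial>M) \<le> (pnorm p u)\<^sup>2 * measure M (space M) powr (1 - 2 / p)" by simp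
qed

text \<open>Holder with the exponents p/(p-2) and p/2. The weight |f|^(p-2) will be the local
  Lipschitz constant of the nonlinearity.\<close>

lemma holder_square:
  assumes p: "p > 2" and f: "Lp p f" and w: "Lp p w"
  shows "integrable M (\<lambda>x. \<bar>f x\<bar> powr (p - 2) * (w x)\<^sup>2)"
    "(\<integral>x. \<bar>f x\<bar> powr (p - 2) * (w x)\<^sup>2 \<partial>M) \<le> pint p f powr ((p - 2) / p) * (pnorm p w)\<^sup>2"
proof -
  have c: "1 - (p - 2) / p = 2 / p" using p by (simp add: divide_simps)
  have e: "(\<bar>f x\<bar> powr p) powr ((p - 2) / p) * (\<bar>w x\<bar> powr p) powr (1 - (p - 2) / p) = \<bar>f x\<bar> powr (p - 2) * (w x)\<^sup>2" for x
    unfolding c using p by (simp add: powr_powr)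
  have a: "0 < (p - 2) / p" "(p - 2) / p < 1" using p by simp_all
  note H = holder_weighted[of M "\<lambda>x. \<bar>f x\<bar> powr p" "\<lambda>x. \<bar>w x\<bar> powr p", OF _ _ _ _ a, unfolded e]
  show "integrable M (\<lambda>x. \<bar>f x\<bar> powr (p - 2) * (w x)\<^sup>2)" by (rule H(1)) (use f w in \<open>auto simp: Lp_def\<close>)
  have "(\<integral>x. \<bar>f x\<bar> powr (p - 2) * (w x)\<^sup>2 \<partial>M) \<le> (\<integral>x. \<bar>f x\<bar> powr p \<partial>M) powr ((p - 2) / p) * (\<integral>x. \<bar>w x\<bar> powr p \<partial>M) powr (1 - (p - 2) / p)"
    by (rule H(2)) (use f w in \<open>auto simp: Lp_def\<close>)
  also have "(\<integral>x. \<bar>w x\<bar> powr p \<partial>M) powr (1 - (p - 2) / p) = (pnorm p w)\<^sup>2"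
    unfolding c using pint_nonneg[of p w] unfolding pnorm_def by (cases "pint p w = 0") (simp_all add: pint_def powr_powr flip: powr_numeral)
  finally show "(\<integral>x. \<bar>f x\<bar> powr (p - 2) * (w x)\<^sup>2 \<partial>M) \<le> pint p f powr ((p - 2) / p) * (pnorm p w)\<^sup>2"
    by (simp add: pint_def)
qed

end

section \<open>Energy and scalar product on H^1\<close>

context bounded_open
begin

abbreviation energy :: "('a \<Rightarrow> real) \<Rightarrow> ('a \<Rightarrow> real) \<Rightarrow> real" where
  "energy u v \<equiv> (\<integral>x. grad \<Omega> u x \<bullet> grad \<Omega> v x \<partial>lebesgue_on \<Omega>)"

abbreviation scal :: "('a \<Rightarrow> real) \<Rightarrow> ('a \<Rightarrow> real) \<Rightarrow> real" where
  "scal u v \<equiv> (\<integral>x. u x * v x \<partial>lebesgue_on \<Omega>)"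

lemma H1I: "L2 \<Omega> u \<Longrightarrow> weak_gradient \<Omega> u G \<Longrightarrow> u \<in> H1 \<Omega>"
  by (auto simp: H1_def)

lemma H1D:
  assumes "u \<in> H1 \<Omega>"
  shows "L2 \<Omega> u" "weak_gradient \<Omega> u (grad \<Omega> u)"
  using assms unfolding H1_def grad_def by (blast, metis (mono_tags) mem_Collect_eq someI_ex)

lemma grad_AE:
  assumes "u \<in> H1 \<Omega>" "weak_gradient \<Omega> u G"
  shows "AE x in lebesgue_on \<Omega>. grad \<Omega> u x = G x"
  by (rule weak_gradient_unique[OF H1D(2)[OF assms(1)] assms(2)]) (use L2D(1)[OF H1D(1)[OF assms(1)]] in auto)

lemma grad_measurable: "u \<in> H1 \<Omega> \<Longrightarrow> grad \<Omega> u \<in> borel_measurable (lebesgue_on \<Omega>)"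
  by (rule weak_gradientD(1)[OF H1D(2)])

lemma dirichlet_gradint: "dirichlet \<Omega> u = gradint (grad \<Omega> u)"
  by (simp add: dirichlet_def gradint_def)

lemma dirichlet_energy: "dirichlet \<Omega> u = energy u u"
  by (simp add: dirichlet_def power2_norm_eq_inner)

lemma dirichlet_nonneg: "dirichlet \<Omega> u \<ge> 0"
  by (simp add: dirichlet_def)

lemma energy_commute: "energy u v = energy v u"
  by (simp add: inner_commute)

lemma energy_integrable:
  assumes "u \<in> H1 \<Omega>" "v \<in> H1 \<Omega>"
  shows "integrable (lebesgue_on \<Omega>) (\<lambda>x. grad \<Omega> u x \<bullet> grad \<Omega> v x)"
    "(energy u v)\<^sup>2 \<le> dirichlet \<Omega> u * dirichlet \<Omega> v"
proof -
  note [measurable] = grad_measurable[OF assms(1)] grad_measurable[OF assms(2)]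
  have n: "integrable (lebesgue_on \<Omega>) (\<lambda>x. (norm (grad \<Omega> u x))\<^sup>2)" "integrable (lebesgue_on \<Omega>) (\<lambda>x. (norm (grad \<Omega> v x))\<^sup>2)"
    using weak_gradientD(2)[OF H1D(2)] assms by blast+
  have cs: "integrable (lebesgue_on \<Omega>) (\<lambda>x. norm (grad \<Omega> u x) * norm (grad \<Omega> v x))"
    "(\<integral>x. norm (grad \<Omega> u x) * norm (grad \<Omega> v x) \<partial>lebesgue_on \<Omega>)\<^sup>2 \<le> dirichlet \<Omega> u * dirichlet \<Omega> v"
    unfolding dirichlet_def
    by (rule cauchy_schwarz_integral[OF measurable_compose[OF grad_measurable[OF assms(1)] borel_measurable_norm]
        measurable_compose[OF grad_measurable[OF assms(2)] borel_measurable_norm] n])+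
  show i: "integrable (lebesgue_on \<Omega>) (\<lambda>x. grad \<Omega> u x \<bullet> grad \<Omega> v x)"
  proof (rule Bochner_Integration.integrable_bound[OF cs(1)])
    show "AE x in lebesgue_on \<Omega>. norm (grad \<Omega> u x \<bullet> grad \<Omega> v x) \<le> norm (norm (grad \<Omega> u x) * norm (grad \<Omega> v x))"
      using Cauchy_Schwarz_ineq2 by (intro AE_I2) simp
  qed measurable
  have "\<bar>energy u v\<bar> \<le> (\<integral>x. \<bar>grad \<Omega> u x \<bullet> grad \<Omega> v x\<bar> \<partial>lebesgue_on \<Omega>)" by (rule integral_abs_bound)
  also have "\<dots> \<le> (\<integral>x. norm (grad \<Omega> u x) * norm (grad \<Omega> v x) \<partial>lebesgue_on \<Omega>)"
    by (rule integral_mono[OF _ cs(1)]) (use i Cauchy_Schwarz_ineq2 in auto)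
  finally have "\<bar>energy u v\<bar>\<^sup>2 \<le> (\<integral>x. norm (grad \<Omega> u x) * norm (grad \<Omega> v x) \<partial>lebesgue_on \<Omega>)\<^sup>2"
    by (rule power_mono) simp
  then show "(energy u v)\<^sup>2 \<le> dirichlet \<Omega> u * dirichlet \<Omega> v" using cs(2) by simp
qed

lemma H1_lincomb:
  assumes u: "u \<in> H1 \<Omega>" and v: "v \<in> H1 \<Omega>"
  shows "(\<lambda>x. \<alpha> * u x + \<beta> * v x) \<in> H1 \<Omega>"
    "AE x in lebesgue_on \<Omega>. grad \<Omega> (\<lambda>x. \<alpha> * u x + \<beta> * v x) x = \<alpha> *\<^sub>R grad \<Omega> u x + \<beta> *\<^sub>R grad \<Omega> v x"
proof -
  note g = weak_gradient_lincomb[OF H1D[OF u] H1D[OF v], of \<alpha> \<beta>]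
  show 1: "(\<lambda>x. \<alpha> * u x + \<beta> * v x) \<in> H1 \<Omega>" by (rule H1I[OF L2_lincomb[OF H1D(1)[OF u] H1D(1)[OF v]] g])
  show "AE x in lebesgue_on \<Omega>. grad \<Omega> (\<lambda>x. \<alpha> * u x + \<beta> * v x) x = \<alpha> *\<^sub>R grad \<Omega> u x + \<beta> *\<^sub>R grad \<Omega> v x"
    by (rule grad_AE[OF 1 g])
qed

lemma energy_lincomb:
  assumes u: "u \<in> H1 \<Omega>" and v: "v \<in> H1 \<Omega>" and w: "w \<in> H1 \<Omega>"
  shows "energy (\<lambda>x. \<alpha> * u x + \<beta> * v x) w = \<alpha> * energy u w + \<beta> * energy v w"
proof -
  note [measurable] = grad_measurable[OF u] grad_measurable[OF v] grad_measurable[OF w] grad_measurable[OF H1_lincomb(1)[OF u v, of \<alpha> \<beta>]]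
  have "energy (\<lambda>x. \<alpha> * u x + \<beta> * v x) w = (\<integral>x. \<alpha> * (grad \<Omega> u x \<bullet> grad \<Omega> w x) + \<beta> * (grad \<Omega> v x \<bullet> grad \<Omega> w x) \<partial>lebesgue_on \<Omega>)"
  proof (rule integral_cong_AE)
    show "AE x in lebesgue_on \<Omega>. grad \<Omega> (\<lambda>x. \<alpha> * u x + \<beta> * v x) x \<bullet> grad \<Omega> w x = \<alpha> * (grad \<Omega> u x \<bullet> grad \<Omega> w x) + \<beta> * (grad \<Omega> v x \<bullet> grad \<Omega> w x)"
      using H1_lincomb(2)[OF u v, of \<alpha> \<beta>] by eventually_elim (simp add: inner_add_left)
  qed measurable
  also have "\<dots> = \<alpha> * energy u w + \<beta> * energy v w"
    using energy_integrable(1)[OF u w] energy_integrable(1)[OF v w] by simp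
  finally show ?thesis .
qed

lemma dirichlet_lincomb:
  assumes u: "u \<in> H1 \<Omega>" and v: "v \<in> H1 \<Omega>"
  shows "dirichlet \<Omega> (\<lambda>x. \<alpha> * u x + \<beta> * v x) = \<alpha>\<^sup>2 * dirichlet \<Omega> u + 2 * \<alpha> * \<beta> * energy u v + \<beta>\<^sup>2 * dirichlet \<Omega> v"
proof -
  note l = H1_lincomb(1)[OF u v, of \<alpha> \<beta>]
  let ?l = "\<lambda>x. \<alpha> * u x + \<beta> * v x"
  have m: "energy ?l ?l = \<alpha> * energy u ?l + \<beta> * energy v ?l"
    by (rule energy_lincomb[OF u v l])
  have e1: "energy u ?l = \<alpha> * energy u u + \<beta> * energy v u"
    by (rule trans[OF energy_commute energy_lincomb[OF u v u]])
  have e2: "energy v ?l = \<alpha> * energy u v + \<beta> * energy v v"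
    by (rule trans[OF energy_commute energy_lincomb[OF u v v]])
  show ?thesis unfolding dirichlet_energy m e1 e2 energy_commute[of v u]
    by (simp add: power2_eq_square algebra_simps)
qed

lemma dirichlet_scale: "u \<in> H1 \<Omega> \<Longrightarrow> dirichlet \<Omega> (\<lambda>x. c * u x) = c\<^sup>2 * dirichlet \<Omega> u"
  using dirichlet_lincomb[of u u c 0] by simp

lemma H1_scale: "u \<in> H1 \<Omega> \<Longrightarrow> (\<lambda>x. c * u x) \<in> H1 \<Omega>"
  using H1_lincomb(1)[of u u c 0] by simp

lemma H1_diff: "u \<in> H1 \<Omega> \<Longrightarrow> v \<in> H1 \<Omega> \<Longrightarrow> (\<lambda>x. u x - v x) \<in> H1 \<Omega>"
  using H1_lincomb(1)[of u v 1 "-1"] by simp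

lemma H1_const: "(\<lambda>x. c) \<in> H1 \<Omega>"
  by (rule H1I[OF L2_const weak_gradient_const])

lemma energy_const:
  assumes u: "u \<in> H1 \<Omega>"
  shows "energy u (\<lambda>x. c) = 0"
proof (rule integral_eq_zero_AE)
  show "AE x in lebesgue_on \<Omega>. grad \<Omega> u x \<bullet> grad \<Omega> (\<lambda>x. c) x = 0"
    using grad_AE[OF H1_const[of c] weak_gradient_const[of c]] by eventually_elim simp
qed

lemma Hza_lincomb:
  assumes u: "u \<in> Hza \<Omega>" and v: "v \<in> Hza \<Omega>"
  shows "(\<lambda>x. \<alpha> * u x + \<beta> * v x) \<in> Hza \<Omega>"
proof -
  have h: "u \<in> H1 \<Omega>" "v \<in> H1 \<Omega>" and z: "(\<integral>x. u x \<partial>lebesgue_on \<Omega>) = 0" "(\<integral>x. v x \<partial>lebesgue_on \<Omega>) = 0"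
    using u v by (auto simp: Hza_def)
  have "(\<integral>x. \<alpha> * u x + \<beta> * v x \<partial>lebesgue_on \<Omega>) = 0"
    using L2D(3)[OF H1D(1)[OF h(1)]] L2D(3)[OF H1D(1)[OF h(2)]] z by simp
  then show ?thesis using H1_lincomb(1)[OF h] by (simp add: Hza_def)
qed

lemma Hza_H1: "u \<in> Hza \<Omega> \<Longrightarrow> u \<in> H1 \<Omega>"
  by (simp add: Hza_def)

lemma Lp_norm_pnorm: "Lp_norm \<Omega> p u = M.pnorm p u"
  by (simp add: Lp_norm_def M.pnorm_def M.pint_def)

end

section \<open>Connected domains with a Sobolev inequality\<close>

locale neumann_domain = bounded_open +
  assumes conn: "connected \<Omega>" and nonempty: "\<Omega> \<noteq> {}" and smoothable: "smoothable \<Omega>"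
begin

text \<open>Choosing one Sobolev constant for the domain lets later thresholds be given by explicit
  terms.\<close>

definition K_sob :: real where
  "K_sob = (SOME K. K > 0 \<and> (\<forall>u G. L2 \<Omega> u \<longrightarrow> weak_gradient \<Omega> u G \<longrightarrow>
    integrable (lebesgue_on \<Omega>) (\<lambda>x. \<bar>u x\<bar> powr q_exp) \<and>
    (\<integral>x. \<bar>u x\<bar> powr q_exp \<partial>lebesgue_on \<Omega>) \<le> K * (sqint u + gradint G) powr (q_exp / 2)))"

lemma K_sob:
  "K_sob > 0"
  "u \<in> H1 \<Omega> \<Longrightarrow> M.Lp q_exp u"
  "u \<in> H1 \<Omega> \<Longrightarrow> M.pint q_exp u \<le> K_sob * (sqint u + dirichlet \<Omega> u) powr (q_exp / 2)"
proof -
  have "\<exists>K. K > 0 \<and> (\<forall>u G. L2 \<Omega> u \<longrightarrow> weak_gradient \<Omega> u G \<longrightarrow>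
    integrable (lebesgue_on \<Omega>) (\<lambda>x. \<bar>u x\<bar> powr q_exp) \<and>
    (\<integral>x. \<bar>u x\<bar> powr q_exp \<partial>lebesgue_on \<Omega>) \<le> K * (sqint u + gradint G) powr (q_exp / 2))"
  proof (rule sobolev[OF smoothable])
    fix K assume K: "K > 0" "\<And>u G. L2 \<Omega> u \<Longrightarrow> weak_gradient \<Omega> u G \<Longrightarrow>
    integrable (lebesgue_on \<Omega>) (\<lambda>x. \<bar>u x\<bar> powr q_exp) \<and>
    (\<integral>x. \<bar>u x\<bar> powr q_exp \<partial>lebesgue_on \<Omega>) \<le> K * (sqint u + gradint G) powr (q_exp / 2)"
    show ?thesis by (rule exI[of _ K]) (intro conjI allI impI K(1), (drule K(2), assumption, erule conjunct1), (drule K(2), assumption, erule conjunct2))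
  qed
  from someI_ex[OF this, folded K_sob_def]
  have K: "K_sob > 0" and *: "\<And>u G. L2 \<Omega> u \<Longrightarrow> weak_gradient \<Omega> u G \<Longrightarrow>
    integrable (lebesgue_on \<Omega>) (\<lambda>x. \<bar>u x\<bar> powr q_exp) \<and>
    (\<integral>x. \<bar>u x\<bar> powr q_exp \<partial>lebesgue_on \<Omega>) \<le> K_sob * (sqint u + gradint G) powr (q_exp / 2)" by blast+
  show "K_sob > 0" by fact
  show "M.Lp q_exp u" if "u \<in> H1 \<Omega>"
    using *[OF H1D[OF that]] L2D(1)[OF H1D(1)[OF that]] by (simp add: M.Lp_def)
  show "M.pint q_exp u \<le> K_sob * (sqint u + dirichlet \<Omega> u) powr (q_exp / 2)" if "u \<in> H1 \<Omega>"
    using *[OF H1D[OF that]] by (simp add: M.pint_def dirichlet_gradint)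
qed

lemma H1_Lp:
  assumes u: "u \<in> H1 \<Omega>" and p: "2 \<le> p" "p \<le> q_exp" and K: "K > 0"
  shows "M.Lp p u" "M.pint p u \<le> K powr (p - 2) * sqint u + K powr (p - q_exp) * M.pint q_exp u"
proof -
  note L = H1D(1)[OF u]
  note [measurable] = L2D(1)[OF L]
  have q: "integrable (lebesgue_on \<Omega>) (\<lambda>x. \<bar>u x\<bar> powr q_exp)" using K_sob(2)[OF u] by (simp add: M.Lp_def)
  have i: "integrable (lebesgue_on \<Omega>) (\<lambda>x. K powr (p - 2) * (u x)\<^sup>2 + K powr (p - q_exp) * \<bar>u x\<bar> powr q_exp)"
    using q L2D(2)[OF L] by simp
  have ip: "integrable (lebesgue_on \<Omega>) (\<lambda>x. \<bar>u x\<bar> powr p)"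
  proof (rule Bochner_Integration.integrable_bound[OF i])
    show "AE x in lebesgue_on \<Omega>. norm (\<bar>u x\<bar> powr p) \<le> norm (K powr (p - 2) * (u x)\<^sup>2 + K powr (p - q_exp) * \<bar>u x\<bar> powr q_exp)"
      using powr_split[OF p K] by (intro AE_I2) (simp add: order_trans[OF _ abs_ge_self])
  qed measurable
  then show "M.Lp p u" using L2D(1)[OF L] by (simp add: M.Lp_def)
  have "M.pint p u \<le> (\<integral>x. K powr (p - 2) * (u x)\<^sup>2 + K powr (p - q_exp) * \<bar>u x\<bar> powr q_exp \<partial>lebesgue_on \<Omega>)"
    unfolding M.pint_def by (rule integral_mono[OF ip i]) (rule powr_split[OF p K])
  also have "\<dots> = K powr (p - 2) * sqint u + K powr (p - q_exp) * M.pint q_exp u"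
    using q L2D(2)[OF L] by (simp add: sqint_def M.pint_def)
  finally show "M.pint p u \<le> K powr (p - 2) * sqint u + K powr (p - q_exp) * M.pint q_exp u" .
qed

end

section \<open>Minimizers and eigenfunctions\<close>

context bounded_open
begin

lemma tendsto_dist2I:
  assumes "\<And>e. e > 0 \<Longrightarrow> \<exists>N. \<forall>n\<ge>N. (\<integral>x. (norm (f n x - g x))\<^sup>2 \<partial>lebesgue_on \<Omega>) < e"
  shows "(\<lambda>n. dist2 (f n) g) \<longlonglongrightarrow> 0"
proof (rule LIMSEQ_I)
  fix e :: real assume "e > 0"
  then obtain N where N: "\<And>n. n \<ge> N \<Longrightarrow> (\<integral>x. (norm (f n x - g x))\<^sup>2 \<partial>lebesgue_on \<Omega>) < e" using assms by blast
  show "\<exists>N. \<forall>n\<ge>N. norm (dist2 (f n) g - 0) < e"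
    by (rule exI[of _ N]) (use N in \<open>simp add: dist2_def\<close>)
qed

lemma dirichlet_eq_gradint:
  assumes u: "u \<in> H1 \<Omega>" and G: "weak_gradient \<Omega> u G"
  shows "dirichlet \<Omega> u = gradint G"
  unfolding dirichlet_def gradint_def
proof (rule integral_cong_AE)
  show "AE x in lebesgue_on \<Omega>. (norm (grad \<Omega> u x))\<^sup>2 = (norm (G x))\<^sup>2"
    using grad_AE[OF u G] by eventually_elim simp
  show "(\<lambda>x. (norm (grad \<Omega> u x))\<^sup>2) \<in> borel_measurable (lebesgue_on \<Omega>)" using grad_measurable[OF u] by measurable
  show "(\<lambda>x. (norm (G x))\<^sup>2) \<in> borel_measurable (lebesgue_on \<Omega>)" using weak_gradientD(1)[OF G] by measurable
qed

lemma dirichlet_diff: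
  assumes u: "u \<in> H1 \<Omega>" and v: "L2 \<Omega> v" "weak_gradient \<Omega> v H"
  shows "dirichlet \<Omega> (\<lambda>x. u x - v x) = dist2 (grad \<Omega> u) H"
proof -
  have vH: "v \<in> H1 \<Omega>" by (rule H1I[OF v])
  have "weak_gradient \<Omega> (\<lambda>x. u x - v x) (\<lambda>x. grad \<Omega> u x - H x)"
    using weak_gradient_lincomb[OF H1D[OF u] v, of 1 "-1"] by simp
  from dirichlet_eq_gradint[OF H1_diff[OF u vH] this] show ?thesis by (simp add: gradint_def dist2_def)
qed

text \<open>Existence of minimizers is needed on all of \<open>Hza \<Omega>\<close>, and on the orthogonal complement of the second
  eigenfunction for the spectral gap.\<close>

definition closed_subspace :: "('a \<Rightarrow> real) set \<Rightarrow> bool" where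
  "closed_subspace V \<longleftrightarrow> V \<subseteq> Hza \<Omega> \<and> (\<forall>u\<in>V. \<forall>v\<in>V. \<forall>\<alpha> \<beta>. (\<lambda>x. \<alpha> * u x + \<beta> * v x) \<in> V) \<and>
     (\<forall>us v. (\<forall>n. us n \<in> V) \<longrightarrow> v \<in> H1 \<Omega> \<longrightarrow> (\<lambda>n. dist2 (us n) v) \<longlonglongrightarrow> 0 \<longrightarrow> v \<in> V)"

lemma closed_subspaceD:
  assumes "closed_subspace V"
  shows "u \<in> V \<Longrightarrow> u \<in> Hza \<Omega>" "u \<in> V \<Longrightarrow> u \<in> H1 \<Omega>"
    "u \<in> V \<Longrightarrow> v \<in> V \<Longrightarrow> (\<lambda>x. \<alpha> * u x + \<beta> * v x) \<in> V"
    "(\<And>n. us n \<in> V) \<Longrightarrow> v \<in> H1 \<Omega> \<Longrightarrow> (\<lambda>n. dist2 (us n) v) \<longlonglongrightarrow> 0 \<Longrightarrow> v \<in> V"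
  using assms unfolding closed_subspace_def Hza_def by blast+

end

section \<open>Existence of minimizers and the Euler-Lagrange equation\<close>

context neumann_domain
begin

lemma measure_pos: "measure (lebesgue_on \<Omega>) (space (lebesgue_on \<Omega>)) > 0"
proof -
  have "\<not> negligible \<Omega>" by (rule open_not_negligible[OF open_dom nonempty])
  then have "measure lebesgue \<Omega> \<noteq> 0"
    using negligible_iff_measure0[OF lebesgue_dom] by blast
  then show ?thesis by (simp add: measure_restrict_space less_le)
qed

lemma pnorm_2_sqint: "(M.pnorm 2 u)\<^sup>2 = sqint u"
  by (simp add: M.pnorm_2 sqint_def)

lemma sqint_le_pnorm:
  assumes p: "2 \<le> p" "p \<le> q_exp" and u: "u \<in> H1 \<Omega>"
  shows "sqint u \<le> (M.pnorm p u)\<^sup>2 * measure (lebesgue_on \<Omega>) (space (lebesgue_on \<Omega>)) powr (1 - 2 / p)"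
proof (cases "p = 2")
  case True
  then show ?thesis using pnorm_2_sqint[of u] measure_pos by simp
next
  case False
  then have p2: "p > 2" using p by simp
  show ?thesis using M.L2_le_pnorm(2)[OF p2 H1_Lp(1)[OF u p, of 1]] by (simp add: sqint_def)
qed

lemma H1_Lp': "u \<in> H1 \<Omega> \<Longrightarrow> 2 \<le> p \<Longrightarrow> p \<le> q_exp \<Longrightarrow> M.Lp p u"
  by (rule H1_Lp(1)[of _ _ 1]) auto

text \<open>For bounded energy, smallness in L^2 implies smallness in L^p. The threshold K of
  \<open>powr_split\<close> is chosen first, to make the q-part at most half, and d afterwards. It
  upgrades the convergence from \<open>rellich\<close> to L^p.\<close>

lemma pnorm_small:
  assumes p: "2 \<le> p" "p < q_exp" and e: "e > 0" and B: "B \<ge> 0"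
  obtains d where "d > 0" "\<And>w. w \<in> H1 \<Omega> \<Longrightarrow> sqint w < d \<Longrightarrow> dirichlet \<Omega> w \<le> B \<Longrightarrow> M.pnorm p w < e"
proof -
  define CB where "CB = K_sob * (1 + B) powr (q_exp / 2)"
  have CB: "CB > 0" using K_sob(1) B by (simp add: CB_def)
  have ep: "e powr p > 0" using e by simp
  have "((\<lambda>K. K powr (p - q_exp)) \<longlongrightarrow> 0) at_top"
    by (rule tendsto_neg_powr) (use p filterlim_ident in auto)
  then have "\<forall>\<^sub>F K in at_top. K powr (p - q_exp) < e powr p / (2 * CB)"
    by (rule order_tendstoD(2)) (use ep CB in simp)
  then obtain K0 where K0: "\<And>K. K \<ge> K0 \<Longrightarrow> K powr (p - q_exp) < e powr p / (2 * CB)"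
    unfolding eventually_at_top_linorder by blast
  define K where "K = max K0 1"
  have K: "K > 0" "K powr (p - q_exp) < e powr p / (2 * CB)" using K0[of K] by (auto simp: K_def)
  define d where "d = min 1 (e powr p / (2 * K powr (p - 2)))"
  have Kp: "K powr (p - 2) > 0" using K by simp
  show ?thesis
  proof (rule that[of d])
    show "d > 0" using ep Kp by (simp add: d_def)
    fix w assume w: "w \<in> H1 \<Omega>" and s: "sqint w < d" and D: "dirichlet \<Omega> w \<le> B"
    have "M.pint q_exp w \<le> K_sob * (sqint w + dirichlet \<Omega> w) powr (q_exp / 2)" by (rule K_sob(3)[OF w])
    also have "\<dots> \<le> CB" unfolding CB_def
    proof (intro mult_left_mono powr_mono2)
      show "0 \<le> sqint w + dirichlet \<Omega> w" using sqint_nonneg[of w] dirichlet_nonneg[of w] by simp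
      have "sqint w \<le> 1" using s by (simp add: d_def)
      then show "sqint w + dirichlet \<Omega> w \<le> 1 + B" using D by simp
    qed (use K_sob(1) q_exp_gt in auto)
    finally have q: "M.pint q_exp w \<le> CB" .
    have "M.pint p w \<le> K powr (p - 2) * sqint w + K powr (p - q_exp) * M.pint q_exp w"
      by (rule H1_Lp(2)[OF w _ _ K(1)]) (use p in auto)
    also have "\<dots> < e powr p / 2 + e powr p / 2"
    proof (rule add_less_le_mono)
      have "sqint w < e powr p / (2 * K powr (p - 2))" using s by (simp add: d_def)
      then have "K powr (p - 2) * sqint w < K powr (p - 2) * (e powr p / (2 * K powr (p - 2)))"
        by (rule mult_strict_left_mono[OF _ Kp])
      then show "K powr (p - 2) * sqint w < e powr p / 2" using Kp by simp
      have "K powr (p - q_exp) * M.pint q_exp w \<le> (e powr p / (2 * CB)) * CB"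
        by (intro mult_mono less_imp_le[OF K(2)] q M.pint_nonneg) (use ep CB in auto)
      then show "K powr (p - q_exp) * M.pint q_exp w \<le> e powr p / 2" using CB by simp
    qed
    finally have "M.pint p w < e powr p" by simp
    then have "M.pnorm p w powr p < e powr p" using M.pnorm_powr[of p w] p by simp
    then show "M.pnorm p w < e"
      using powr_mono2[of p e "M.pnorm p w"] p e by (intro not_le_imp_less notI) simp
  qed
qed

text \<open>Quantitative form of \<open>\<parallel>w\<parallel>\<^sub>p \<rightarrow> \<parallel>w\<parallel>\<^sub>2\<close> as \<open>p \<rightarrow> 2\<close>, uniformly on bounded subsets of \<open>H\<^sup>1\<close>.\<close>

lemma pnorm_near_2:
  assumes e: "e > 0"
  shows "\<forall>\<^sub>F p in at_right 2. \<forall>w\<in>H1 \<Omega>. (M.pnorm p w)\<^sup>2 \<le> sqint w + e * (sqint w + dirichlet \<Omega> w)"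
proof -
  \<comment> \<open>For p < 2 + \<gamma> the exponent p - q is below -\<gamma>, so one threshold K
    works for all these p.\<close>
  define \<gamma> where "\<gamma> = (q_exp - 2) / 2"
  have g: "\<gamma> > 0" using q_exp_gt by (simp add: \<gamma>_def)
  have "((\<lambda>K. K powr (- \<gamma>)) \<longlongrightarrow> 0) at_top"
    by (rule tendsto_neg_powr) (use g filterlim_ident in auto)
  then have "\<forall>\<^sub>F K in at_top. K powr (- \<gamma>) < e / (3 * K_sob)"
    by (rule order_tendstoD(2)) (use e K_sob(1) in simp)
  then obtain K0 where K0: "\<And>K. K \<ge> K0 \<Longrightarrow> K powr (- \<gamma>) < e / (3 * K_sob)"
    unfolding eventually_at_top_linorder by blast
  define K where "K = max K0 1"
  have K: "K \<ge> 1" "K powr (- \<gamma>) < e / (3 * K_sob)" using K0[of K] by (auto simp: K_def)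
  have "((\<lambda>p. K powr (p - 2)) \<longlongrightarrow> K powr (2 - 2)) (at_right 2)"
    by (intro tendsto_intros) (use K in auto)
  then have ev1: "\<forall>\<^sub>F p in at_right 2. K powr (p - 2) < 1 + e / 3"
    by (rule order_tendstoD(2)) (use e K in simp)
  have "((\<lambda>p. 1 - 2 / p) \<longlongrightarrow> 1 - 2 / 2) (at_right (2::real))"
    by (intro tendsto_intros) auto
  then have ev2: "\<forall>\<^sub>F p in at_right (2::real). 1 - 2 / p < e / 3"
    by (rule order_tendstoD(2)) (use e in simp)
  have ev3: "\<forall>\<^sub>F p in at_right (2::real). p < 2 + \<gamma>"
    using eventually_at_right_real[of 2 "2 + \<gamma>"] g by (auto elim: eventually_mono)
  show ?thesis using ev1 ev2 ev3 eventually_at_right_less[of 2]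
  proof eventually_elim
    case (elim p)
    have pq: "2 \<le> p" "p \<le> q_exp" using elim(3,4) q_exp_gt unfolding \<gamma>_def by argo+
    \<comment> \<open>Both sides are homogeneous of degree 2, so it suffices to treat functions of
      H^1 norm 1.\<close>
    have unit: "(M.pnorm p w)\<^sup>2 \<le> sqint w + e" if w: "w \<in> H1 \<Omega>" and one: "sqint w + dirichlet \<Omega> w = 1" for w
    proof -
      have s1: "sqint w \<le> 1" using one dirichlet_nonneg[of w] by linarith
      have "M.pint p w \<le> K powr (p - 2) * sqint w + K powr (p - q_exp) * M.pint q_exp w"
        by (rule H1_Lp(2)[OF w pq]) (use K in simp)
      also have "\<dots> \<le> (sqint w + e / 3) + e / 3"
      proof (rule add_mono)
        have "K powr (p - 2) * sqint w \<le> (1 + e / 3) * sqint w"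
          by (intro mult_right_mono less_imp_le[OF elim(1)] sqint_nonneg)
        also have "\<dots> \<le> sqint w + e / 3" using mult_left_mono[OF s1, of "e / 3"] e by (simp add: distrib_right)
        finally show "K powr (p - 2) * sqint w \<le> sqint w + e / 3" .
        have "p - q_exp \<le> - \<gamma>" using elim(3) unfolding \<gamma>_def by argo
        then have "K powr (p - q_exp) \<le> K powr (- \<gamma>)" using K(1) by (rule powr_mono)
        then have "K powr (p - q_exp) * M.pint q_exp w \<le> (e / (3 * K_sob)) * K_sob"
          using K_sob(3)[OF w] K(2) K_sob(1) e M.pint_nonneg[of q_exp w] unfolding one
          by (intro mult_mono) auto
        then show "K powr (p - q_exp) * M.pint q_exp w \<le> e / 3" using K_sob(1) by simp
      qed
      finally have ip: "M.pint p w \<le> sqint w + e / 3 + e / 3" .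
      have "(M.pnorm p w)\<^sup>2 = M.pint p w powr (2 / p)"
        using M.pint_nonneg[of p w] unfolding M.pnorm_def
        by (cases "M.pint p w = 0") (simp_all add: powr_powr flip: powr_numeral)
      \<comment> \<open>The factor 1 makes this a weighted geometric mean; Young's inequality turns
        the power 2/p into a multiple of the integral plus 1 - 2/p, which is small.\<close>
      also have "\<dots> = M.pint p w powr (2 / p) * 1 powr (1 - 2 / p)" by simp
      also have "\<dots> \<le> 2 / p * M.pint p w + (1 - 2 / p) * 1"
        by (rule weighted_young) (use elim(4) M.pint_nonneg in auto)
      also have "\<dots> \<le> M.pint p w + e / 3"
        using elim(2) mult_right_mono[of "2 / p" 1 "M.pint p w"] M.pint_nonneg[of p w] elim(4) by simp
      also have "\<dots> \<le> sqint w + e" using ip by simp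
      finally show ?thesis .
    qed
    show ?case
    proof
      fix w assume w: "w \<in> H1 \<Omega>"
      define s where "s = sqint w + dirichlet \<Omega> w"
      have s0: "s \<ge> 0" using sqint_nonneg[of w] dirichlet_nonneg[of w] by (simp add: s_def)
      show "(M.pnorm p w)\<^sup>2 \<le> sqint w + e * (sqint w + dirichlet \<Omega> w)"
      proof (cases "s = 0")
        case True
        then have "sqint w = 0" using sqint_nonneg[of w] dirichlet_nonneg[of w] unfolding s_def by linarith
        then have "M.pnorm 2 w = 0" using pnorm_2_sqint[of w] by simp
        then have "AE x in lebesgue_on \<Omega>. w x = 0" using M.pnorm_zero_iff[OF H1_Lp'[OF w, of 2]] pq by simp
        then have "M.pnorm p w = 0" using M.pnorm_zero_iff[OF H1_Lp'[OF w pq]] by simp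
        then show ?thesis using e sqint_nonneg[of w] dirichlet_nonneg[of w] by simp
      next
        case False
        then have sp: "s > 0" using s0 by simp
        define c where "c = 1 / sqrt s"
        have c: "c > 0" "c\<^sup>2 = 1 / s" using sp by (simp_all add: c_def power_divide)
        have sc: "sqint (\<lambda>x. c * w x) = sqint w / s" unfolding sqint_def using c by (simp add: power_mult_distrib)
        have dc: "dirichlet \<Omega> (\<lambda>x. c * w x) = dirichlet \<Omega> w / s" using dirichlet_scale[OF w, of c] c by simp
        have "sqint (\<lambda>x. c * w x) + dirichlet \<Omega> (\<lambda>x. c * w x) = 1"
          unfolding sc dc using sp by (simp add: s_def add_divide_distrib[symmetric])
        from unit[OF H1_scale[OF w] this]
        have "c\<^sup>2 * (M.pnorm p w)\<^sup>2 \<le> sqint w / s + e"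
          unfolding sc using M.pnorm_scale[of p c w] elim(4) by (simp add: power_mult_distrib)
        then have "s * ((M.pnorm p w)\<^sup>2 / s) \<le> s * (sqint w / s + e)"
          using sp c by (intro mult_left_mono) auto
        then show ?thesis using sp by (simp add: distrib_left s_def[symmetric] mult.commute[of e])
      qed
    qed
  qed
qed

text \<open>The direct method with strong limits. A subsequence of a minimizing sequence is Cauchy
  in L^2 by Rellich and in L^p by \<open>pnorm_small\<close>; sums of two late members then have
  p-norm near 2, hence energy almost 4m, and the parallelogram law makes the energies of the
  differences small.\<close>

lemma existence:
  assumes V: "closed_subspace V" and p: "2 \<le> p" "p < q_exp" and w0: "w0 \<in> V" "M.pnorm p w0 \<noteq> 0"
  obtains u where "u \<in> V" "M.pnorm p u = 1" "\<And>w. w \<in> V \<Longrightarrow> dirichlet \<Omega> u * (M.pnorm p w)\<^sup>2 \<le> dirichlet \<Omega> w"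
proof -
  note VH = closed_subspaceD(2)[OF V]
  have pq: "2 \<le> p" "p \<le> q_exp" "p > 1" "p > 0" using p by auto
  note LpV = H1_Lp'[OF VH pq(1,2)]
  have Vs: "(\<lambda>x. c * w x) \<in> V" if "w \<in> V" for c w
    using closed_subspaceD(3)[OF V that that, of c 0] by simp
  have Vd: "(\<lambda>x. u x - w x) \<in> V" if "u \<in> V" "w \<in> V" for u w
    using closed_subspaceD(3)[OF V that, of 1 "-1"] by simp
  define A where "A = {dirichlet \<Omega> w | w. w \<in> V \<and> M.pnorm p w = 1}"
  define m where "m = Inf A"
  have bdd: "bdd_below A" by (rule bdd_belowI[of _ 0]) (auto simp: A_def dirichlet_nonneg)
  have normalise: "(\<lambda>x. (1 / M.pnorm p w) * w x) \<in> V" "M.pnorm p (\<lambda>x. (1 / M.pnorm p w) * w x) = 1"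
    "dirichlet \<Omega> (\<lambda>x. (1 / M.pnorm p w) * w x) = dirichlet \<Omega> w / (M.pnorm p w)\<^sup>2"
    if "w \<in> V" "M.pnorm p w \<noteq> 0" for w
  proof -
    show "(\<lambda>x. (1 / M.pnorm p w) * w x) \<in> V" by (rule Vs[OF that(1)])
    show "M.pnorm p (\<lambda>x. (1 / M.pnorm p w) * w x) = 1"
      using M.pnorm_scale[OF pq(4), of "1 / M.pnorm p w" w] that(2) M.pnorm_nonneg[of p w] by simp
    show "dirichlet \<Omega> (\<lambda>x. (1 / M.pnorm p w) * w x) = dirichlet \<Omega> w / (M.pnorm p w)\<^sup>2"
      using dirichlet_scale[OF VH[OF that(1)], of "1 / M.pnorm p w"] by (simp add: power_divide)
  qed
  have ne: "A \<noteq> {}" using normalise[OF w0] unfolding A_def by blast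
  have m0: "m \<ge> 0" unfolding m_def by (rule cInf_greatest[OF ne]) (auto simp: A_def dirichlet_nonneg)
  have low1: "m \<le> dirichlet \<Omega> w" if "w \<in> V" "M.pnorm p w = 1" for w
    unfolding m_def by (rule cInf_lower[OF _ bdd]) (use that in \<open>auto simp: A_def\<close>)
  have low: "m * (M.pnorm p w)\<^sup>2 \<le> dirichlet \<Omega> w" if w: "w \<in> V" for w
  proof (cases "M.pnorm p w = 0")
    case False
    have "m \<le> dirichlet \<Omega> w / (M.pnorm p w)\<^sup>2"
      using low1[OF normalise(1,2)[OF w False]] normalise(3)[OF w False] by simp
    then show ?thesis using False by (simp add: pos_le_divide_eq)
  qed (simp add: dirichlet_nonneg)
  have "\<exists>w. w \<in> V \<and> M.pnorm p w = 1 \<and> dirichlet \<Omega> w < m + 1 / real (Suc n)" for n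
  proof -
    have "Inf A < m + 1 / real (Suc n)" unfolding m_def[symmetric] by simp
    then obtain a where "a \<in> A" "a < m + 1 / real (Suc n)" using cInf_lessD[OF ne] by blast
    then show ?thesis unfolding A_def by blast
  qed
  then obtain ws where ws: "\<And>n. ws n \<in> V" "\<And>n. M.pnorm p (ws n) = 1" "\<And>n. dirichlet \<Omega> (ws n) < m + 1 / real (Suc n)"
    by metis
  have wsb: "dirichlet \<Omega> (ws n) \<le> m + 1" for n
  proof -
    have "1 / real (Suc n) \<le> 1" by simp
    then show ?thesis using ws(3)[of n] by linarith
  qed
  \<comment> \<open>Rellich also asks for an L^2 bound; on a set of finite measure p-norm 1 provides
    one.\<close>
  define cm where "cm = measure (lebesgue_on \<Omega>) (space (lebesgue_on \<Omega>)) powr (1 - 2 / p)"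
  have sb: "sqint (ws n) \<le> cm" for n
    using sqint_le_pnorm[OF pq(1,2) VH[OF ws(1)[of n]]] ws(2)[of n] by (simp add: cm_def)
  obtain r :: "nat \<Rightarrow> nat" where r: "strict_mono r"
    "\<And>e. e > 0 \<Longrightarrow> \<exists>N. \<forall>i\<ge>N. \<forall>j\<ge>N. sqint (\<lambda>x. ws (r i) x - ws (r j) x) < e"
  proof (rule rellich[OF smoothable, of ws "\<lambda>n. grad \<Omega> (ws n)" "max cm (m + 1)"])
    show "L2 \<Omega> (ws n)" "weak_gradient \<Omega> (ws n) (grad \<Omega> (ws n))" for n
      using H1D[OF VH[OF ws(1)[of n]]] by blast+
    show "sqint (ws n) \<le> max cm (m + 1)" "gradint (grad \<Omega> (ws n)) \<le> max cm (m + 1)" for n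
      using sb[of n] wsb[of n] unfolding dirichlet_gradint by linarith+
  qed blast
  define us where "us n = ws (r n)" for n
  have rn: "1 / real (Suc (r n)) \<le> 1 / real (Suc n)" for n
    using seq_suble[OF r(1), of n] by (intro divide_left_mono) auto
  have us: "us n \<in> V" "M.pnorm p (us n) = 1" "dirichlet \<Omega> (us n) < m + 1 / real (Suc n)" "dirichlet \<Omega> (us n) \<le> m + 1" for n
    using ws(1,2) wsb order_less_le_trans[OF ws(3)[of "r n"] add_left_mono[OF rn[of n], of m]] unfolding us_def by blast+
  note usH = VH[OF us(1)]
  have dbound: "dirichlet \<Omega> (\<lambda>x. us i x - us j x) \<le> 4 * (m + 1)" for i j
  proof -
    have "dirichlet \<Omega> (\<lambda>x. us i x - us j x) + dirichlet \<Omega> (\<lambda>x. us i x + us j x) = 2 * dirichlet \<Omega> (us i) + 2 * dirichlet \<Omega> (us j)"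
      using dirichlet_lincomb[OF usH[of i] usH[of j], of 1 "-1"] dirichlet_lincomb[OF usH[of i] usH[of j], of 1 1] by simp
    moreover have "D \<le> 4 * (m + 1)" if "D + S = 2 * a + 2 * b" "0 \<le> S" "a \<le> m + 1" "b \<le> m + 1" for D S a b
      using that by argo
    ultimately show ?thesis using dirichlet_nonneg us(4) by blast
  qed
  have pcau: "\<exists>N. \<forall>i\<ge>N. \<forall>j\<ge>N. M.pnorm p (\<lambda>x. us i x - us j x) < e" if e: "e > 0" for e
  proof -
    have "0 \<le> 4 * (m + 1)" using m0 by simp
    then obtain d where d: "d > 0" "\<And>w. w \<in> H1 \<Omega> \<Longrightarrow> sqint w < d \<Longrightarrow> dirichlet \<Omega> w \<le> 4 * (m + 1) \<Longrightarrow> M.pnorm p w < e"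
      using pnorm_small[OF p e] by metis
    obtain N where N: "\<And>i j. i \<ge> N \<Longrightarrow> j \<ge> N \<Longrightarrow> sqint (\<lambda>x. us i x - us j x) < d"
      using r(2)[OF d(1)] unfolding us_def by blast
    have "M.pnorm p (\<lambda>x. us i x - us j x) < e" if "i \<ge> N" "j \<ge> N" for i j
      by (rule d(2)[OF VH[OF Vd[OF us(1) us(1)]] N[OF that] dbound])
    then show ?thesis by blast
  qed
  have dcau: "\<exists>N. \<forall>i\<ge>N. \<forall>j\<ge>N. dirichlet \<Omega> (\<lambda>x. us i x - us j x) < e" if e: "e > 0" for e
  proof -
    \<comment> \<open>The p-norm of a sum being at least 2 - \<eta>, its energy falls short of 4m by
      at most 4 m \<eta>, which is made at most e/2.\<close>
    define \<eta> where "\<eta> = min 1 (e / (8 * (m + 1)))"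
    have \<eta>: "\<eta> > 0" "\<eta> \<le> 1" "4 * m * \<eta> \<le> e / 2"
    proof -
      show "\<eta> > 0" "\<eta> \<le> 1" using e m0 by (simp_all add: \<eta>_def)
      have "m * \<eta> \<le> (m + 1) * \<eta>" using \<open>\<eta> > 0\<close> by (intro mult_right_mono) auto
      also have "\<dots> \<le> (m + 1) * (e / (8 * (m + 1)))" using m0 by (intro mult_left_mono) (auto simp: \<eta>_def)
      also have "\<dots> = e / 8"
      proof -
        have gen: "c * (e / (8 * c)) = e / 8" if "c > 0" for c using that by simp
        show ?thesis by (rule gen) (use m0 in simp)
      qed
      finally show "4 * m * \<eta> \<le> e / 2" by simp
    qed
    obtain N1 where N1: "\<And>i j. i \<ge> N1 \<Longrightarrow> j \<ge> N1 \<Longrightarrow> M.pnorm p (\<lambda>x. us i x - us j x) < \<eta>"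
      using pcau[OF \<eta>(1)] by blast
    obtain N2 :: nat where N2: "8 / e < real N2" using reals_Archimedean2 by blast
    have small: "1 / real (Suc n) < e / 8" if "n \<ge> N2" for n
    proof -
      have "8 / e < real (Suc n)" using N2 that by simp
      then show ?thesis using e by (simp add: field_simps)
    qed
    have "dirichlet \<Omega> (\<lambda>x. us i x - us j x) < e" if ij: "i \<ge> max N1 N2" "j \<ge> max N1 N2" for i j
    proof -
      let ?d = "\<lambda>x. us i x - us j x" and ?s = "\<lambda>x. us i x + us j x"
      have sV: "?s \<in> V" using closed_subspaceD(3)[OF V us(1)[of i] us(1)[of j], of 1 1] by simp
      \<comment> \<open>Sum and difference add up to 2 u_i, which has p-norm 2.\<close>
      have "2 - \<eta> \<le> M.pnorm p ?s"
      proof -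
        have "M.pnorm p (\<lambda>x. ?s x + ?d x) \<le> M.pnorm p ?s + M.pnorm p ?d"
          by (rule M.minkowski[OF pq(3) LpV[OF sV] LpV[OF Vd[OF us(1) us(1)]]])
        moreover have "M.pnorm p (\<lambda>x. ?s x + ?d x) = 2"
          using M.pnorm_scale[OF pq(4), of 2 "us i"] us(2)[of i] by simp
        ultimately show ?thesis using N1[of i j] ij by simp
      qed
      then have "(2 - \<eta>)\<^sup>2 \<le> (M.pnorm p ?s)\<^sup>2" using \<eta>(2) by (intro power_mono) auto
      moreover have "4 - 4 * \<eta> \<le> (2 - \<eta>)\<^sup>2" by (simp add: power2_eq_square algebra_simps)
      ultimately have "m * (4 - 4 * \<eta>) \<le> m * (M.pnorm p ?s)\<^sup>2" using m0 by (intro mult_left_mono) auto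
      also have "\<dots> \<le> dirichlet \<Omega> ?s" by (rule low[OF sV])
      finally have 1: "4 * m - 4 * m * \<eta> \<le> dirichlet \<Omega> ?s" by (simp add: right_diff_distrib)
      have 2: "dirichlet \<Omega> ?d + dirichlet \<Omega> ?s = 2 * dirichlet \<Omega> (us i) + 2 * dirichlet \<Omega> (us j)"
        using dirichlet_lincomb[OF usH[of i] usH[of j], of 1 "-1"] dirichlet_lincomb[OF usH[of i] usH[of j], of 1 1] by simp
      have "dirichlet \<Omega> (us i) < m + e / 8" "dirichlet \<Omega> (us j) < m + e / 8"
        using us(3)[of i] us(3)[of j] small[of i] small[of j] ij by auto
      \<comment> \<open>Twice the two energies is below 4m + e/2, and the energy of the sum is at
        least 4m - e/2; the parallelogram law leaves less than e.\<close>
      moreover have "D < e" if "4 * m - X \<le> S" "D + S = 2 * a + 2 * b" "a < m + e / 8" "b < m + e / 8" "X \<le> e / 2" for D S a b X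
        using that by argo
      ultimately show ?thesis using 1 2 \<eta>(3) by blast
    qed
    then show ?thesis by blast
  qed
  have um: "us n \<in> borel_measurable (lebesgue_on \<Omega>)" and gm: "grad \<Omega> (us n) \<in> borel_measurable (lebesgue_on \<Omega>)" for n
    using L2D(1)[OF H1D(1)[OF usH]] grad_measurable[OF usH] by blast+
  obtain g where g: "g \<in> borel_measurable (lebesgue_on \<Omega>)" "integrable (lebesgue_on \<Omega>) (\<lambda>x. (norm (g x))\<^sup>2)"
    "\<And>e. e > 0 \<Longrightarrow> \<exists>N. \<forall>n\<ge>N. (\<integral>x. (norm (us n x - g x))\<^sup>2 \<partial>lebesgue_on \<Omega>) < e"
  proof (rule M.L2_complete[of us, OF um])
    show "integrable (lebesgue_on \<Omega>) (\<lambda>x. (norm (us n x))\<^sup>2)" for n using L2D(2)[OF H1D(1)[OF usH]] by simp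
    show "\<exists>N. \<forall>m\<ge>N. \<forall>n\<ge>N. (\<integral>x. (norm (us m x - us n x))\<^sup>2 \<partial>lebesgue_on \<Omega>) < e" if "e > 0" for e
      using r(2)[OF that] unfolding us_def sqint_def by simp
  qed blast
  obtain H where H: "H \<in> borel_measurable (lebesgue_on \<Omega>)" "integrable (lebesgue_on \<Omega>) (\<lambda>x. (norm (H x))\<^sup>2)"
    "\<And>e. e > 0 \<Longrightarrow> \<exists>N. \<forall>n\<ge>N. (\<integral>x. (norm (grad \<Omega> (us n) x - H x))\<^sup>2 \<partial>lebesgue_on \<Omega>) < e"
  proof (rule M.L2_complete[of "\<lambda>n. grad \<Omega> (us n)", OF gm])
    show "integrable (lebesgue_on \<Omega>) (\<lambda>x. (norm (grad \<Omega> (us n) x))\<^sup>2)" for n by (rule weak_gradientD(2)[OF H1D(2)[OF usH]])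
    show "\<exists>N. \<forall>m\<ge>N. \<forall>n\<ge>N. (\<integral>x. (norm (grad \<Omega> (us m) x - grad \<Omega> (us n) x))\<^sup>2 \<partial>lebesgue_on \<Omega>) < e" if "e > 0" for e
      using dcau[OF that] dirichlet_diff[OF usH H1D[OF usH]] unfolding dist2_def by simp
  qed blast
  have gL: "L2 \<Omega> g" using g(1,2) by (simp add: L2_def)
  note lim1 = tendsto_dist2I[OF g(3)] and lim2 = tendsto_dist2I[OF H(3)]
  have wg: "weak_gradient \<Omega> g H"
    by (rule weak_gradient_closed[OF H1D(1)[OF usH] H1D(2)[OF usH] gL lim1 H(1,2) lim2])
  have gH: "g \<in> H1 \<Omega>" by (rule H1I[OF gL wg])
  have gV: "g \<in> V" by (rule closed_subspaceD(4)[OF V us(1) gH lim1])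
  have ddiff: "dirichlet \<Omega> (\<lambda>x. us n x - g x) = dist2 (grad \<Omega> (us n)) H" for n by (rule dirichlet_diff[OF usH gL wg])
  have limD: "(\<lambda>n. dirichlet \<Omega> (\<lambda>x. us n x - g x)) \<longlonglongrightarrow> 0" unfolding ddiff by (rule lim2)
  have gp: "M.pnorm p g = 1"
  proof (rule ccontr)
    assume "M.pnorm p g \<noteq> 1"
    then have e: "\<bar>M.pnorm p g - 1\<bar> > 0" by simp
    obtain d where d: "d > 0" "\<And>w. w \<in> H1 \<Omega> \<Longrightarrow> sqint w < d \<Longrightarrow> dirichlet \<Omega> w \<le> 1 \<Longrightarrow> M.pnorm p w < \<bar>M.pnorm p g - 1\<bar>"
      using pnorm_small[OF p e, of 1] by (metis zero_le_one)
    \<comment> \<open>Late members are closer to g in p-norm than g is to norm 1, which contradicts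
      that they all have norm 1.\<close>
    have "\<forall>\<^sub>F n in sequentially. dist2 (us n) g < d" by (rule order_tendstoD(2)[OF lim1 d(1)])
    moreover have "\<forall>\<^sub>F n in sequentially. dirichlet \<Omega> (\<lambda>x. us n x - g x) < 1" by (rule order_tendstoD(2)[OF limD]) simp
    ultimately have "\<forall>\<^sub>F n in sequentially. False"
    proof eventually_elim
      case (elim n)
      have dV: "(\<lambda>x. us n x - g x) \<in> V" by (rule Vd[OF us(1) gV])
      have "sqint (\<lambda>x. us n x - g x) < d" using elim(1) by (simp add: sqint_def dist2_def)
      then have lt: "M.pnorm p (\<lambda>x. us n x - g x) < \<bar>M.pnorm p g - 1\<bar>" using d(2)[OF VH[OF dV]] elim(2) by simp
      have "(\<lambda>x. -1 * (us n x - g x)) = (\<lambda>x. g x - us n x)" by (simp add: fun_eq_iff)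
      then have sw: "M.pnorm p (\<lambda>x. g x - us n x) = M.pnorm p (\<lambda>x. us n x - g x)"
        using M.pnorm_scale[OF pq(4), of "-1" "\<lambda>x. us n x - g x"] by simp
      show ?case
        using M.pnorm_triangle_lower[OF pq(3) LpV[OF us(1)[of n]] LpV[OF gV]] M.pnorm_triangle_lower[OF pq(3) LpV[OF gV] LpV[OF us(1)[of n]]]
          lt us(2)[of n] unfolding sw by linarith
    qed
    then show False by simp
  qed
  have "dirichlet \<Omega> g \<le> m"
  proof (rule LIMSEQ_le_const)
    have "(\<lambda>n. (m + inverse (real (Suc n))) + 2 * sqrt ((m + 1) * dirichlet \<Omega> (\<lambda>x. us n x - g x)) + dirichlet \<Omega> (\<lambda>x. us n x - g x))
      \<longlonglongrightarrow> (m + 0) + 2 * sqrt ((m + 1) * 0) + 0"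
      by (intro tendsto_intros limD LIMSEQ_inverse_real_of_nat)
    then show "(\<lambda>n. (m + inverse (real (Suc n))) + 2 * sqrt ((m + 1) * dirichlet \<Omega> (\<lambda>x. us n x - g x)) + dirichlet \<Omega> (\<lambda>x. us n x - g x)) \<longlonglongrightarrow> m"
      by simp
    show "\<exists>N. \<forall>n\<ge>N. dirichlet \<Omega> g \<le> (m + inverse (real (Suc n))) + 2 * sqrt ((m + 1) * dirichlet \<Omega> (\<lambda>x. us n x - g x)) + dirichlet \<Omega> (\<lambda>x. us n x - g x)"
    proof (rule exI[of _ 0], intro allI impI)
      fix n
      let ?d = "\<lambda>x. us n x - g x"
      note dH = H1_diff[OF usH[of n] gH]
      have eq: "dirichlet \<Omega> g = dirichlet \<Omega> (us n) - 2 * energy (us n) ?d + dirichlet \<Omega> ?d"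
        using dirichlet_lincomb[OF usH[of n] dH, of 1 "-1"] by simp
      have "(energy (us n) ?d)\<^sup>2 \<le> dirichlet \<Omega> (us n) * dirichlet \<Omega> ?d" by (rule energy_integrable(2)[OF usH dH])
      also have "\<dots> \<le> (m + 1) * dirichlet \<Omega> ?d" by (intro mult_right_mono us(4) dirichlet_nonneg)
      finally have "\<bar>energy (us n) ?d\<bar> \<le> sqrt ((m + 1) * dirichlet \<Omega> ?d)"
        using real_le_rsqrt[of "\<bar>energy (us n) ?d\<bar>"] by simp
      moreover have "X \<le> (m + i) + 2 * s + D" if "X = U - 2 * E + D" "\<bar>E\<bar> \<le> s" "U < m + i" for X U E D s i using that by argo
      ultimately show "dirichlet \<Omega> g \<le> (m + inverse (real (Suc n))) + 2 * sqrt ((m + 1) * dirichlet \<Omega> ?d) + dirichlet \<Omega> ?d"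
        using eq us(3)[of n] unfolding inverse_eq_divide by blast
    qed
  qed
  then have "dirichlet \<Omega> g * (M.pnorm p w)\<^sup>2 \<le> dirichlet \<Omega> w" if "w \<in> V" for w
    using mult_right_mono[of "dirichlet \<Omega> g" m "(M.pnorm p w)\<^sup>2"] low[OF that] by simp
  then show ?thesis using that[OF gV gp] by blast
qed

text \<open>Instead of differentiating the p-integral along u + s \<phi>, convexity replaces it by
  its tangent, which is a lower bound and explicit in s. The minimality of u survives this
  replacement, and an elementary function of s remains to be differentiated.\<close>

lemma euler_lagrange:
  assumes V: "closed_subspace V" and p: "2 \<le> p" "p \<le> q_exp" and u: "u \<in> V" "M.pnorm p u = 1"
    and min: "\<And>w. w \<in> V \<Longrightarrow> dirichlet \<Omega> u * (M.pnorm p w)\<^sup>2 \<le> dirichlet \<Omega> w" and \<phi>: "\<phi> \<in> V"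
  shows "energy u \<phi> = dirichlet \<Omega> u * (\<integral>x. signed_powr p (u x) * \<phi> x \<partial>lebesgue_on \<Omega>)"
proof -
  note VH = closed_subspaceD(2)[OF V]
  have p1: "p > 1" "p > 0" using p by auto
  note Lu = H1_Lp'[OF VH[OF u(1)] p] and L\<phi> = H1_Lp'[OF VH[OF \<phi>] p]
  define m where "m = dirichlet \<Omega> u"
  define a where "a = (\<integral>x. signed_powr p (u x) * \<phi> x \<partial>lebesgue_on \<Omega>)"
  have m0: "m \<ge> 0" by (simp add: m_def dirichlet_nonneg)
  \<comment> \<open>The energy of u + s \<phi> minus m times a lower bound for its squared p-norm. F
    is nonnegative near 0 and vanishes at 0, so its derivative there is 0.\<close>
  define F where "F s = m + 2 * s * energy u \<phi> + s\<^sup>2 * dirichlet \<Omega> \<phi> - m * (1 + p * s * a) powr (2 / p)" for s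
  have Fnonneg: "F s \<ge> 0" if pos: "1 + p * s * a > 0" for s
  proof -
    let ?w = "\<lambda>x. 1 * u x + s * \<phi> x"
    have wV: "?w \<in> V" by (rule closed_subspaceD(3)[OF V u(1) \<phi>])
    note Lw = H1_Lp'[OF VH[OF wV] p]
    have "1 + p * s * a = (\<integral>x. \<bar>u x\<bar> powr p + (p * s) * (signed_powr p (u x) * \<phi> x) \<partial>lebesgue_on \<Omega>)"
    proof -
      have "M.pint p u = 1" using M.pnorm_powr[OF p1(2), of u] u(2) by simp
      then show ?thesis
        using Lu M.holder_signed(1)[OF p1(1) Lu L\<phi>] by (simp add: M.Lp_def a_def M.pint_def)
    qed
    also have "\<dots> \<le> M.pint p ?w"
      unfolding M.pint_def
    proof (rule integral_mono)
      show "integrable (lebesgue_on \<Omega>) (\<lambda>x. \<bar>u x\<bar> powr p + (p * s) * (signed_powr p (u x) * \<phi> x))"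
        using Lu M.holder_signed(1)[OF p1(1) Lu L\<phi>] by (simp add: M.Lp_def)
      show "integrable (lebesgue_on \<Omega>) (\<lambda>x. \<bar>?w x\<bar> powr p)" using Lw by (simp only: M.Lp_def)
      show "\<bar>u x\<bar> powr p + (p * s) * (signed_powr p (u x) * \<phi> x) \<le> \<bar>?w x\<bar> powr p" for x
        using powr_tangent[OF p1(1), of "u x" "s * \<phi> x"] by (simp add: mult_ac)
    qed
    finally have "(1 + p * s * a) powr (2 / p) \<le> M.pint p ?w powr (2 / p)"
      using pos p1 by (intro powr_mono2) auto
    also have "\<dots> = (M.pnorm p ?w)\<^sup>2"
      using M.pint_nonneg[of p ?w] unfolding M.pnorm_def
      by (cases "M.pint p ?w = 0") (simp_all add: powr_powr flip: powr_numeral)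
    finally have "m * (1 + p * s * a) powr (2 / p) \<le> m * (M.pnorm p ?w)\<^sup>2" using m0 by (rule mult_left_mono)
    also have "\<dots> \<le> dirichlet \<Omega> ?w" unfolding m_def by (rule min[OF wV])
    also have "\<dots> = m + 2 * s * energy u \<phi> + s\<^sup>2 * dirichlet \<Omega> \<phi>"
      using dirichlet_lincomb[OF VH[OF u(1)] VH[OF \<phi>], of 1 s] by (simp add: m_def)
    finally show ?thesis by (simp add: F_def)
  qed
  have F0: "F 0 = 0" by (simp add: F_def)
  have d1: "((\<lambda>s. (1 + p * s * a) powr (2 / p)) has_real_derivative 2 * a) (at 0)"
  proof -
    have l: "((\<lambda>s. 1 + p * s * a) has_real_derivative p * a) (at 0)" by (auto intro!: derivative_eq_intros)
    show ?thesis using DERIV_fun_powr[OF l, of "2 / p"] p1 by simp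
  qed
  have dF: "(F has_real_derivative (2 * energy u \<phi> - m * (2 * a))) (at 0)"
  proof -
    have "((\<lambda>s. m + 2 * s * energy u \<phi> + s\<^sup>2 * dirichlet \<Omega> \<phi>) has_real_derivative 2 * energy u \<phi>) (at 0)"
      by (auto intro!: derivative_eq_intros)
    from DERIV_diff[OF this DERIV_cmult[OF d1]] show ?thesis unfolding F_def .
  qed
  obtain d where d: "d > 0" "\<And>s. \<bar>s\<bar> < d \<Longrightarrow> 1 + p * s * a > 0"
  proof (rule that[of "1 / (p * \<bar>a\<bar> + 1)"])
    have c: "p * \<bar>a\<bar> + 1 > 0" using p1 by (intro add_nonneg_pos) auto
    then show "1 / (p * \<bar>a\<bar> + 1) > 0" by simp
    fix s assume s: "\<bar>s\<bar> < 1 / (p * \<bar>a\<bar> + 1)"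
    have "\<bar>s\<bar> * (p * \<bar>a\<bar> + 1) < 1" using s c by (simp add: pos_less_divide_eq)
    moreover have "\<bar>p * s * a\<bar> = \<bar>s\<bar> * (p * \<bar>a\<bar>)" using p1 by (simp add: abs_mult)
    ultimately have "\<bar>p * s * a\<bar> < 1" using abs_ge_zero[of s] by (simp only: distrib_left mult_1_right)
    then show "1 + p * s * a > 0" by linarith
  qed
  have "2 * energy u \<phi> - m * (2 * a) = 0"
  proof (rule DERIV_local_min[OF dF d(1)])
    show "\<forall>y. \<bar>0 - y\<bar> < d \<longrightarrow> F 0 \<le> F y" using Fnonneg d(2) F0 by simp
  qed
  then show ?thesis by (simp add: m_def a_def)
qed

end

section \<open>The second Neumann eigenvalue and the spectral gap\<close>

context neumann_domain
begin

lemma scal_integrable: "u \<in> H1 \<Omega> \<Longrightarrow> v \<in> H1 \<Omega> \<Longrightarrow> integrable (lebesgue_on \<Omega>) (\<lambda>x. u x * v x)"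
  using integrable_mult_L2[OF L2D(1)[OF H1D(1)] L2D(1)[OF H1D(1)] L2D(2)[OF H1D(1)] L2D(2)[OF H1D(1)]] .

lemma scal_lincomb:
  assumes u: "u \<in> H1 \<Omega>" and v: "v \<in> H1 \<Omega>" and w: "w \<in> H1 \<Omega>"
  shows "scal (\<lambda>x. \<alpha> * u x + \<beta> * v x) w = \<alpha> * scal u w + \<beta> * scal v w"
proof -
  have "scal (\<lambda>x. \<alpha> * u x + \<beta> * v x) w = (\<integral>x. \<alpha> * (u x * w x) + \<beta> * (v x * w x) \<partial>lebesgue_on \<Omega>)"
    by (rule Bochner_Integration.integral_cong[OF refl]) (simp only: distrib_right mult.assoc)
  also have "\<dots> = \<alpha> * scal u w + \<beta> * scal v w"
    using scal_integrable[OF u w] scal_integrable[OF v w] by simp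
  finally show ?thesis .
qed

lemma scal_self: "scal u u = sqint u"
  by (simp add: sqint_def power2_eq_square)

text \<open>Orthogonality to f and vanishing mean are both pairings with a fixed L^2 function, f and
  1, hence stable under L^2 limits. For f = 0 the subspace is H_za itself.\<close>

lemma closed_subspace_Hza_orth:
  assumes f: "f \<in> H1 \<Omega>"
  shows "closed_subspace {w \<in> Hza \<Omega>. scal w f = 0}"
  unfolding closed_subspace_def
proof (intro conjI ballI allI impI)
  show "{w \<in> Hza \<Omega>. scal w f = 0} \<subseteq> Hza \<Omega>" by blast
  fix u v \<alpha> \<beta> assume uv: "u \<in> {w \<in> Hza \<Omega>. scal w f = 0}" "v \<in> {w \<in> Hza \<Omega>. scal w f = 0}"
  then have h: "u \<in> Hza \<Omega>" "v \<in> Hza \<Omega>" "scal u f = 0" "scal v f = 0" by blast+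
  have "scal (\<lambda>x. \<alpha> * u x + \<beta> * v x) f = 0"
    unfolding scal_lincomb[OF Hza_H1[OF h(1)] Hza_H1[OF h(2)] f] h by simp
  then show "(\<lambda>x. \<alpha> * u x + \<beta> * v x) \<in> {w \<in> Hza \<Omega>. scal w f = 0}"
    using Hza_lincomb[OF h(1,2)] by blast
next
  fix us v assume us: "\<forall>n. us n \<in> {w \<in> Hza \<Omega>. scal w f = 0}" and v: "v \<in> H1 \<Omega>" and lim: "(\<lambda>n. dist2 (us n) v) \<longlonglongrightarrow> 0"
  have h: "us n \<in> Hza \<Omega>" "scal (us n) f = 0" for n using us by blast+
  note L = H1D(1)[OF Hza_H1[OF h(1)]]
  have "(\<lambda>n. scal (us n) f) \<longlonglongrightarrow> scal v f"
    by (rule tendsto_integral_mult_bounded[OF L H1D(1)[OF v] lim H1D(1)[OF f]])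
  then have 1: "scal v f = 0" unfolding h(2) by (rule LIMSEQ_unique[OF _ tendsto_const])
  have "(\<lambda>n. \<integral>x. us n x * 1 \<partial>lebesgue_on \<Omega>) \<longlonglongrightarrow> (\<integral>x. v x * 1 \<partial>lebesgue_on \<Omega>)"
    by (rule tendsto_integral_mult_bounded[OF L H1D(1)[OF v] lim L2_const])
  moreover have "(\<integral>x. us n x * 1 \<partial>lebesgue_on \<Omega>) = 0" for n using h(1)[of n] by (simp add: Hza_def)
  ultimately have "(\<integral>x. v x * 1 \<partial>lebesgue_on \<Omega>) = 0" using LIMSEQ_unique[OF _ tendsto_const] by (simp only:)
  then show "v \<in> {w \<in> Hza \<Omega>. scal w f = 0}" using v 1 by (simp add: Hza_def)
qed

lemma closed_subspace_Hza: "closed_subspace (Hza \<Omega>)"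
  using closed_subspace_Hza_orth[OF H1_const[of 0]] by simp

lemma mean_zero_part:
  assumes v: "v \<in> H1 \<Omega>"
  obtains c where "(\<lambda>x. v x - c) \<in> Hza \<Omega>"
proof -
  let ?V = "measure (lebesgue_on \<Omega>) (space (lebesgue_on \<Omega>))"
  define c where "c = (\<integral>x. v x \<partial>lebesgue_on \<Omega>) / ?V"
  have "(\<integral>x. v x - c \<partial>lebesgue_on \<Omega>) = (\<integral>x. v x \<partial>lebesgue_on \<Omega>) - ?V * c"
    using L2D(3)[OF H1D(1)[OF v]] by simp
  also have "\<dots> = 0" using measure_pos unfolding c_def by (metis cancel_comm_monoid_add_class.diff_cancel less_irrefl nonzero_mult_div_cancel_left times_divide_eq_right)
  finally show ?thesis using that[of c] H1_diff[OF v H1_const[of c]] by (simp add: Hza_def)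
qed

lemma sqint_zero_iff: "u \<in> H1 \<Omega> \<Longrightarrow> sqint u = 0 \<longleftrightarrow> (AE x in lebesgue_on \<Omega>. u x = 0)"
  using M.pnorm_zero_iff[of 2 u] H1_Lp'[of u 2] q_exp_gt by (simp flip: pnorm_2_sqint)

lemma pnorm_zero_iff_sqint:
  assumes "u \<in> H1 \<Omega>" "2 \<le> p" "p \<le> q_exp"
  shows "M.pnorm p u = 0 \<longleftrightarrow> sqint u = 0"
  using M.pnorm_zero_iff[OF H1_Lp'[OF assms]] sqint_zero_iff[OF assms(1)] by simp

text \<open>A coordinate minus its mean does not vanish a.e., because the level sets of a coordinate
  are null. Without a nonzero element the infima would range over empty sets.\<close>

lemma Hza_nontrivial: obtains w where "w \<in> Hza \<Omega>" "sqint w \<noteq> 0"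
proof -
  obtain j :: 'a where j: "j \<in> Basis" using nonempty_Basis by blast
  have cH: "(\<lambda>x. x \<bullet> j) \<in> H1 \<Omega>" by (rule H1I[OF L2_inner[OF j] weak_gradient_inner[OF j]])
  obtain c where c: "(\<lambda>x. x \<bullet> j - c) \<in> Hza \<Omega>" by (rule mean_zero_part[OF cH])
  have "sqint (\<lambda>x. x \<bullet> j - c) \<noteq> 0"
  proof
    assume "sqint (\<lambda>x. x \<bullet> j - c) = 0"
    then have "AE x in lebesgue_on \<Omega>. x \<bullet> j - c = 0" using sqint_zero_iff[OF Hza_H1[OF c]] by blast
    then have "AE x in lborel. x \<in> \<Omega> \<longrightarrow> x \<bullet> j - c = 0" by (simp only: AE_lebesgue_on_iff[OF borel_dom])
    with AE_lborel_inner_neq[OF j, of c] have "AE x in lborel. x \<notin> \<Omega>" by eventually_elim simp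
    then have "AE x in lebesgue. x \<notin> \<Omega>" by (simp only: AE_completion_iff)
    then have "negligible \<Omega>" using lebesgue_dom by (simp add: negligible_iff_null_sets AE_iff_null_sets fmeasurableD)
    then show False using open_not_negligible[OF open_dom nonempty] by blast
  qed
  then show ?thesis using that c by blast
qed

text \<open>The Euler-Lagrange equation for p = 2 is known for test functions of mean zero only; it
  extends to all of H^1 because both sides vanish on constants, the right one since u has mean
  zero.\<close>

lemma minimal_eigenpair:
  assumes u: "u \<in> Hza \<Omega>" "sqint u = 1" and min: "\<And>w. w \<in> Hza \<Omega> \<Longrightarrow> dirichlet \<Omega> u * sqint w \<le> dirichlet \<Omega> w"
  shows "neumann_eigenpair \<Omega> (dirichlet \<Omega> u) u"
proof -
  note uH = Hza_H1[OF u(1)]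
  have "M.pnorm 2 u = 1" using pnorm_2_sqint[of u] u(2) M.pnorm_nonneg[of 2 u] by (simp add: power2_eq_1_iff)
  then have el: "energy u \<phi> = dirichlet \<Omega> u * scal u \<phi>" if "\<phi> \<in> Hza \<Omega>" for \<phi>
    using euler_lagrange[OF closed_subspace_Hza _ _ u(1), of 2 \<phi>] that min q_exp_gt by (simp add: pnorm_2_sqint)
  show ?thesis
    unfolding neumann_eigenpair_def
  proof (intro conjI ballI uH)
    show "nonzero_fun \<Omega> u" unfolding nonzero_fun_def using sqint_zero_iff[OF uH] u(2) by simp
    fix v assume v: "v \<in> H1 \<Omega>"
    obtain c where c: "(\<lambda>x. v x - c) \<in> Hza \<Omega>" by (rule mean_zero_part[OF v])
    have "energy u v = energy v u" by (rule energy_commute)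
    also have "\<dots> = energy (\<lambda>x. 1 * (v x - c) + 1 * c) u" by simp
    also have "\<dots> = 1 * energy (\<lambda>x. v x - c) u + 1 * energy (\<lambda>x. c) u"
      by (rule energy_lincomb[OF Hza_H1[OF c] H1_const uH])
    also have "energy (\<lambda>x. c) u = energy u (\<lambda>x. c)" by (rule energy_commute)
    also have "energy u (\<lambda>x. c) = 0" by (rule energy_const[OF uH])
    also have "energy (\<lambda>x. v x - c) u = energy u (\<lambda>x. v x - c)" by (rule energy_commute)
    also have "\<dots> = dirichlet \<Omega> u * scal u (\<lambda>x. v x - c)" by (rule el[OF c])
    also have "scal u (\<lambda>x. v x - c) = scal u v - c * (\<integral>x. u x \<partial>lebesgue_on \<Omega>)"
      using scal_integrable[OF uH v] L2D(3)[OF H1D(1)[OF uH]] by (simp add: right_diff_distrib mult.commute[of _ c])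
    also have "(\<integral>x. u x \<partial>lebesgue_on \<Omega>) = 0" using u(1) by (simp add: Hza_def)
    finally show "energy u v = dirichlet \<Omega> u * scal u v" by simp
  qed
qed

text \<open>Connectedness enters here: the function is a.e. constant, and a constant with mean zero
  on a set of positive measure is 0.\<close>

lemma dirichlet_zero:
  assumes u: "u \<in> Hza \<Omega>" and D: "dirichlet \<Omega> u = 0"
  shows "sqint u = 0"
proof -
  note uH = Hza_H1[OF u]
  have "AE x in lebesgue_on \<Omega>. (norm (grad \<Omega> u x))\<^sup>2 = 0"
    using integral_nonneg_eq_0_iff_AE[OF weak_gradientD(2)[OF H1D(2)[OF uH]]] D unfolding dirichlet_def by simp
  then have "AE x in lebesgue_on \<Omega>. grad \<Omega> u x = 0" by eventually_elim simp
  then obtain c where c: "AE x in lebesgue_on \<Omega>. u x = c"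
    using zero_gradient_constant[OF H1D[OF uH] _ conn] by blast
  have "(\<integral>x. u x \<partial>lebesgue_on \<Omega>) = (\<integral>x. c \<partial>lebesgue_on \<Omega>)"
    by (rule integral_cong_AE) (use c L2D(1)[OF H1D(1)[OF uH]] in auto)
  then have "measure (lebesgue_on \<Omega>) (space (lebesgue_on \<Omega>)) * c = 0" using u by (simp add: Hza_def)
  then have "c = 0" using measure_pos by simp
  then show ?thesis using c sqint_zero_iff[OF uH] by simp
qed

lemma normalised_minimiser:
  assumes V: "closed_subspace V" and w0: "w0 \<in> V" "sqint w0 \<noteq> 0"
  obtains u where "u \<in> V" "sqint u = 1" "\<And>w. w \<in> V \<Longrightarrow> dirichlet \<Omega> u * sqint w \<le> dirichlet \<Omega> w"
proof -
  have n: "M.pnorm 2 w0 \<noteq> 0" using pnorm_2_sqint[of w0] w0(2) by auto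
  obtain u where u: "u \<in> V" "M.pnorm 2 u = 1" "\<And>w. w \<in> V \<Longrightarrow> dirichlet \<Omega> u * (M.pnorm 2 w)\<^sup>2 \<le> dirichlet \<Omega> w"
    by (rule existence[OF V order_refl q_exp_gt w0(1) n]) blast
  have "sqint u = 1" using pnorm_2_sqint[of u] u(2) by simp
  then show ?thesis using that[OF u(1)] u(3) unfolding pnorm_2_sqint by blast
qed

text \<open>Testing the equation with the constant 1 gives mean zero, as lam is not 0; testing it
  with u gives the energy.\<close>

lemma eigenpair_props:
  assumes e: "neumann_eigenpair \<Omega> lam u" and l: "lam > 0"
  shows "u \<in> Hza \<Omega>" "dirichlet \<Omega> u = lam * sqint u" "sqint u > 0"
proof -
  have uH: "u \<in> H1 \<Omega>" and nz: "nonzero_fun \<Omega> u" and ev: "\<And>v. v \<in> H1 \<Omega> \<Longrightarrow> energy u v = lam * scal u v"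
    using e unfolding neumann_eigenpair_def by blast+
  have "lam * scal u (\<lambda>x. 1) = 0" using ev[OF H1_const[of 1]] energy_const[OF uH] by simp
  then show "u \<in> Hza \<Omega>" using uH l by (simp add: Hza_def)
  show "dirichlet \<Omega> u = lam * sqint u" unfolding dirichlet_energy ev[OF uH] scal_self ..
  have "sqint u \<noteq> 0" using nz sqint_zero_iff[OF uH] unfolding nonzero_fun_def by blast
  then show "sqint u > 0" using sqint_nonneg[of u] by linarith
qed

text \<open>The minimum of the Rayleigh quotient over H_za is attained; it is positive by
  \<open>dirichlet_zero\<close>, is an eigenvalue, and lies below every positive eigenvalue. So it
  is the infimum defining \<open>lambda2\<close>, and minimality is the Poincare inequality.\<close>

lemma lambda2_props:
  "lambda2 \<Omega> > 0" "w \<in> Hza \<Omega> \<Longrightarrow> lambda2 \<Omega> * sqint w \<le> dirichlet \<Omega> w"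
proof -
  obtain w0 where w0: "w0 \<in> Hza \<Omega>" "sqint w0 \<noteq> 0" by (rule Hza_nontrivial)
  obtain u where u: "u \<in> Hza \<Omega>" "sqint u = 1" "\<And>w. w \<in> Hza \<Omega> \<Longrightarrow> dirichlet \<Omega> u * sqint w \<le> dirichlet \<Omega> w"
    by (rule normalised_minimiser[OF closed_subspace_Hza w0]) blast
  have "dirichlet \<Omega> u \<noteq> 0" using dirichlet_zero[OF u(1)] u(2) by auto
  then have p: "dirichlet \<Omega> u > 0" using dirichlet_nonneg[of u] by linarith
  have "lambda2 \<Omega> = dirichlet \<Omega> u"
    unfolding lambda2_def
  proof (rule cInf_eq_minimum)
    show "dirichlet \<Omega> u \<in> {lam. lam > 0 \<and> (\<exists>u. neumann_eigenpair \<Omega> lam u)}"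
      using p minimal_eigenpair[OF u] by blast
    fix lam assume "lam \<in> {lam. lam > 0 \<and> (\<exists>u. neumann_eigenpair \<Omega> lam u)}"
    then obtain v where v: "lam > 0" "neumann_eigenpair \<Omega> lam v" by blast
    note vp = eigenpair_props[OF v(2,1)]
    have "dirichlet \<Omega> u * sqint v \<le> lam * sqint v" using u(3)[OF vp(1)] vp(2) by simp
    then show "dirichlet \<Omega> u \<le> lam" using vp(3) by simp
  qed
  then show "lambda2 \<Omega> > 0" "w \<in> Hza \<Omega> \<Longrightarrow> lambda2 \<Omega> * sqint w \<le> dirichlet \<Omega> w"
    using p u(3) by simp_all
qed

text \<open>The infimum over the complement of u_2 is attained. Were it equal to lambda_2, its
  minimizer would be minimal over all of H_za, hence an eigenfunction, hence by simplicity a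
  multiple of u_2; being orthogonal to u_2 it would vanish.\<close>

lemma spectral_gap:
  assumes eig: "neumann_eigenpair \<Omega> (lambda2 \<Omega>) u2"
    and simple: "\<forall>v. neumann_eigenpair \<Omega> (lambda2 \<Omega>) v \<longrightarrow> (\<exists>c. AE x in lebesgue_on \<Omega>. v x = c * u2 x)"
  obtains \<mu> where "\<mu> > lambda2 \<Omega>" "\<And>w. w \<in> Hza \<Omega> \<Longrightarrow> scal w u2 = 0 \<Longrightarrow> \<mu> * sqint w \<le> dirichlet \<Omega> w"
proof -
  note u2 = eigenpair_props[OF eig lambda2_props(1)]
  note u2H = Hza_H1[OF u2(1)]
  define V where "V = {w \<in> Hza \<Omega>. scal w u2 = 0}"
  have V: "closed_subspace V" unfolding V_def by (rule closed_subspace_Hza_orth[OF u2H])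
  show ?thesis
  proof (cases "\<exists>w0\<in>V. sqint w0 \<noteq> 0")
    case False
    \<comment> \<open>On a trivial complement every number above lambda_2 serves as the gap
      constant.\<close>
    show ?thesis
    proof (rule that[of "lambda2 \<Omega> + 1"])
      fix w assume "w \<in> Hza \<Omega>" "scal w u2 = 0"
      then have "sqint w = 0" using False unfolding V_def by blast
      then show "(lambda2 \<Omega> + 1) * sqint w \<le> dirichlet \<Omega> w" by (simp add: dirichlet_nonneg)
    qed simp
  next
    case True
    then obtain w0 where w0: "w0 \<in> V" "sqint w0 \<noteq> 0" by blast
    obtain u where u: "u \<in> V" "sqint u = 1" "\<And>w. w \<in> V \<Longrightarrow> dirichlet \<Omega> u * sqint w \<le> dirichlet \<Omega> w"
      by (rule normalised_minimiser[OF V w0]) blast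
    have uz: "u \<in> Hza \<Omega>" "scal u u2 = 0" using u(1) unfolding V_def by blast+
    have ge: "lambda2 \<Omega> \<le> dirichlet \<Omega> u" using lambda2_props(2)[OF uz(1)] u(2) by simp
    have "lambda2 \<Omega> \<noteq> dirichlet \<Omega> u"
    proof
      assume eq: "lambda2 \<Omega> = dirichlet \<Omega> u"
      have "neumann_eigenpair \<Omega> (dirichlet \<Omega> u) u"
        by (rule minimal_eigenpair[OF uz(1) u(2)]) (use lambda2_props(2) eq in simp)
      then obtain c where c: "AE x in lebesgue_on \<Omega>. u x = c * u2 x" using simple eq by auto
      note [measurable] = L2D(1)[OF H1D(1)[OF u2H]] L2D(1)[OF H1D(1)[OF Hza_H1[OF uz(1)]]]
      have "scal u u2 = (\<integral>x. c * (u2 x)\<^sup>2 \<partial>lebesgue_on \<Omega>)"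
      proof (rule integral_cong_AE)
        show "AE x in lebesgue_on \<Omega>. u x * u2 x = c * (u2 x)\<^sup>2" using c by eventually_elim (simp add: power2_eq_square)
      qed measurable
      also have "\<dots> = c * sqint u2" by (simp add: sqint_def)
      finally have "c = 0" using uz(2) u2(3) by simp
      then have "AE x in lebesgue_on \<Omega>. u x = 0" using c by simp
      then show False using sqint_zero_iff[OF Hza_H1[OF uz(1)]] u(2) by simp
    qed
    then have "dirichlet \<Omega> u > lambda2 \<Omega>" using ge by linarith
    then show ?thesis using that u(3) unfolding V_def by blast
  qed
qed

end

text \<open>A mean value bound, obtained from the tangent inequality for the exponent p - 1, which
  needs no derivative at 0. Exchanging x and y and the oddness of the nonlinearity reduce everything
  to |y| <= x.\<close>

lemma signed_powr_lipschitz: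
  assumes p: "p > 2"
  shows "(signed_powr p x - signed_powr p y) * (x - y) \<le> (p - 1) * (max \<bar>x\<bar> \<bar>y\<bar> powr (p - 2) * (x - y)\<^sup>2)"
proof -
  have tangent: "a powr (p - 1) - b powr (p - 1) \<le> (p - 1) * (a powr (p - 2) * (a - b))" if ab: "0 \<le> b" "b \<le> a" for a b :: real
  proof (cases "a = 0")
    case False
    then have a: "a > 0" using ab by simp
    have "\<bar>a\<bar> powr (p - 1) + (p - 1) * (signed_powr (p - 1) a * (b - a)) \<le> \<bar>a + (b - a)\<bar> powr (p - 1)"
      by (rule powr_tangent) (use p in simp)
    moreover have "signed_powr (p - 1) a = a powr (p - 2)" using a by (simp add: signed_powr_def)
    ultimately have "a powr (p - 1) + (p - 1) * (a powr (p - 2) * (b - a)) \<le> b powr (p - 1)" using a ab by simp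
    moreover have "(p - 1) * (a powr (p - 2) * (b - a)) = - ((p - 1) * (a powr (p - 2) * (a - b)))"
      by (simp add: algebra_simps)
    ultimately show ?thesis by argo
  qed (use ab in simp)
  have main: "(signed_powr p x - signed_powr p y) * (x - y) \<le> (p - 1) * (max \<bar>x\<bar> \<bar>y\<bar> powr (p - 2) * (x - y)\<^sup>2)"
    if xy: "y \<le> x" and pos: "\<bar>y\<bar> \<le> x" for x y
  proof -
    have x0: "x \<ge> 0" using pos by linarith
    have mx: "max \<bar>x\<bar> \<bar>y\<bar> = x" using pos x0 by simp
    have sx: "signed_powr p x = x powr (p - 1)" using x0 by (cases "x = 0") (simp_all add: signed_powr_def)
    have "signed_powr p x - signed_powr p y \<le> (p - 1) * (x powr (p - 2) * (x - y))"
    proof (cases "y \<ge> 0")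
      case True
      then have "signed_powr p y = y powr (p - 1)" by (cases "y = 0") (simp_all add: signed_powr_def)
      then show ?thesis using tangent[OF True xy] sx by simp
    next
      \<comment> \<open>For opposite signs both terms are bounded by x^(p-2) times the argument, and
        the constant 1 obtained is below p - 1.\<close>
      case False
      have e: "c powr (p - 1) \<le> x powr (p - 2) * c" if "0 \<le> c" "c \<le> x" for c
      proof -
        have "c powr (p - 1) = c powr (p - 2) * c powr 1" by (subst powr_add[symmetric]) simp
        also have "\<dots> = c powr (p - 2) * c" using that by simp
        also have "\<dots> \<le> x powr (p - 2) * c" by (intro mult_right_mono powr_mono2) (use p that in auto)
        finally show ?thesis .
      qed
      have "signed_powr p x - signed_powr p y = x powr (p - 1) + (- y) powr (p - 1)"
        using sx False by (simp add: signed_powr_def)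
      also have "\<dots> \<le> x powr (p - 2) * x + x powr (p - 2) * (- y)" using e[of x] e[of "- y"] x0 False pos by simp
      also have "\<dots> = 1 * (x powr (p - 2) * (x - y))" by (simp add: algebra_simps)
      also have "\<dots> \<le> (p - 1) * (x powr (p - 2) * (x - y))"
        by (rule mult_right_mono) (use p xy in auto)
      finally show ?thesis .
    qed
    then have "(signed_powr p x - signed_powr p y) * (x - y) \<le> (p - 1) * (x powr (p - 2) * (x - y)) * (x - y)"
      using xy by (intro mult_right_mono) auto
    then show ?thesis unfolding mx by (simp add: power2_eq_square mult_ac)
  qed
  have odd: "signed_powr p (- s) = - signed_powr p s" for s by (simp add: signed_powr_def)
  have sw1: "(signed_powr p x - signed_powr p y) * (x - y) = (signed_powr p y - signed_powr p x) * (y - x)" for x y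
    by (simp add: algebra_simps)
  have sw2: "(signed_powr p x - signed_powr p y) * (x - y) = (signed_powr p (- y) - signed_powr p (- x)) * (- y - (- x))" for x y
    unfolding odd by (simp add: algebra_simps)
  consider "\<bar>y\<bar> \<le> x" | "\<bar>x\<bar> \<le> y" | "\<bar>y\<bar> \<le> - x" | "\<bar>x\<bar> \<le> - y" by argo
  then show ?thesis
  proof cases
    case 1
    show ?thesis by (rule main) (use 1 in linarith)+
  next
    case 2
    show ?thesis unfolding sw1[of x y] power2_commute[of x y] max.commute[of "\<bar>x\<bar>"]
      by (rule main) (use 2 in linarith)+
  next
    case 3
    have "(signed_powr p (- x) - signed_powr p (- y)) * (- x - (- y)) \<le> (p - 1) * (max \<bar>- x\<bar> \<bar>- y\<bar> powr (p - 2) * (- x - (- y))\<^sup>2)"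
      by (rule main) (use 3 in linarith)+
    then show ?thesis unfolding sw1[of x y] unfolding sw2[of y x] by (simp add: power2_commute)
  next
    case 4
    have "(signed_powr p (- y) - signed_powr p (- x)) * (- y - (- x)) \<le> (p - 1) * (max \<bar>- y\<bar> \<bar>- x\<bar> powr (p - 2) * (- y - (- x))\<^sup>2)"
      by (rule main) (use 4 in linarith)+
    then show ?thesis unfolding sw2[of x y] by (simp add: max.commute power2_commute)
  qed
qed

lemma signed_powr_scale: "c > 0 \<Longrightarrow> signed_powr p (c * s) = c powr (p - 1) * signed_powr p s"
  by (simp add: signed_powr_def sgn_mult abs_mult powr_mult)

text \<open>After scaling by B this is 1 - x^(-r) <= r (x - 1) for x = A/B, from ln x <= x - 1 and
  exp z >= 1 + z. With r = p - 2 it compares the multipliers of two minimizers of different norms A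
  and B.\<close>

lemma powr_neg_difference:
  fixes A B r :: real
  assumes "0 < B" "B \<le> A" "r \<ge> 0"
  shows "(B powr (- r) - A powr (- r)) * B powr (r + 1) \<le> r * (A - B)"
proof -
  define x where "x = A / B"
  have x: "x > 0" using assms by (simp add: x_def)
  have "1 - r * (x - 1) \<le> 1 + (- r * ln x)"
    using mult_left_mono[OF ln_le_minus_one[OF x] assms(3)] by simp
  also have "\<dots> \<le> exp (- r * ln x)" by (rule exp_ge_add_one_self)
  also have "\<dots> = x powr (- r)" using x by (simp add: powr_def)
  finally have 1: "1 - x powr (- r) \<le> r * (x - 1)" by simp
  have "A powr (- r) = x powr (- r) * B powr (- r)"
    unfolding x_def using assms by (simp add: powr_divide)
  then have "(B powr (- r) - A powr (- r)) * B powr (r + 1) = (1 - x powr (- r)) * (B powr (- r) * B powr (r + 1))"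
    by (simp add: algebra_simps)
  also have "B powr (- r) * B powr (r + 1) = B" using assms by (simp add: powr_add[symmetric])
  also have "(1 - x powr (- r)) * B \<le> r * (x - 1) * B" using 1 assms by (intro mult_right_mono) auto
  also have "\<dots> = r * (A - B)" using assms by (simp add: x_def field_simps)
  finally show ?thesis .
qed

section \<open>Uniqueness of minimizers for p near 2\<close>

context neumann_domain
begin

text \<open>The constant of Holder's inequality from L^p to L^2, squared. It bounds Lambda_p by a
  multiple of lambda_2 and tends to 1 as p tends to 2.\<close>

definition vol_factor :: "real \<Rightarrow> real" where
  "vol_factor p = measure (lebesgue_on \<Omega>) (space (lebesgue_on \<Omega>)) powr (1 - 2 / p)"

text \<open>The two summands come from the Lipschitz bound for \<open>signed_powr p\<close> and from the difference of
  the norms of two minimizers in \<open>minimizer_difference_estimate\<close>.\<close>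

definition lip_factor :: "real \<Rightarrow> real" where
  "lip_factor p = (p - 1) * 2 powr ((p - 2) / p) + (p - 2)"

lemma lip_factor_ge_1: "p \<ge> 2 \<Longrightarrow> lip_factor p \<ge> 1"
proof -
  assume p: "p \<ge> 2"
  have "2 powr ((p - 2) / p) \<ge> (1::real)" using p by (intro ge_one_powr_ge_zero) auto
  then have "1 * 1 \<le> (p - 1) * 2 powr ((p - 2) / p)" using p by (intro mult_mono) auto
  then show ?thesis using p unfolding lip_factor_def by simp
qed

text \<open>Near \<open>p = 2\<close> the energy gap of the functions orthogonal to the second eigenfunction
  beats the constants coming from the nonlinearity.\<close>

lemma contraction:
  assumes mu: "\<mu> > lambda2 \<Omega>" "\<And>w. w \<in> V \<Longrightarrow> \<mu> * sqint w \<le> dirichlet \<Omega> w" and V: "V \<subseteq> Hza \<Omega>"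
  shows "\<forall>\<^sub>F p in at_right 2. \<forall>w\<in>V. dirichlet \<Omega> w \<le> lambda2 \<Omega> * vol_factor p * lip_factor p * (M.pnorm p w)\<^sup>2 \<longrightarrow> sqint w = 0"
proof -
  define lam where "lam = lambda2 \<Omega>"
  have lam: "lam > 0" "lam < \<mu>" using lambda2_props(1) mu(1) by (simp_all add: lam_def)
  define \<theta> where "\<theta> = lam / \<mu>"
  have \<theta>: "0 < \<theta>" "\<theta> < 1" using lam by (simp_all add: \<theta>_def)
  \<comment> \<open>Chosen so that the resulting factor
    \<open>\<theta> + e * (\<theta> + lam)\<close> is the midpoint of \<theta> and 1, still below
    1.\<close>
  define e where "e = (1 - \<theta>) / (2 * (\<theta> + lam))"
  have e: "e > 0" "\<theta> + e * (\<theta> + lam) = (1 + \<theta>) / 2"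
  proof -
    show "e > 0" using \<theta> lam by (simp add: e_def)
    have gen: "\<theta> + (1 - \<theta>) / (2 * c) * c = (1 + \<theta>) / 2" if "c > 0" for c using that by (simp add: field_simps)
    show "\<theta> + e * (\<theta> + lam) = (1 + \<theta>) / 2" unfolding e_def by (rule gen) (use \<theta> lam in simp)
  qed
  \<comment> \<open>Both factors tend to 1, so their product with the midpoint stays below 1 for p
    near 2.\<close>
  have "((\<lambda>p. vol_factor p * lip_factor p * ((1 + \<theta>) / 2)) \<longlongrightarrow>
    (measure (lebesgue_on \<Omega>) (space (lebesgue_on \<Omega>)) powr (1 - 2 / 2) * ((2 - 1) * 2 powr ((2 - 2) / 2) + (2 - 2))) * ((1 + \<theta>) / 2)) (at_right 2)"
    unfolding vol_factor_def lip_factor_def by (intro tendsto_intros) (use measure_pos in auto)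
  moreover have "measure (lebesgue_on \<Omega>) (space (lebesgue_on \<Omega>)) \<noteq> 0" using measure_pos by simp
  ultimately have "((\<lambda>p. vol_factor p * lip_factor p * ((1 + \<theta>) / 2)) \<longlongrightarrow> (1 + \<theta>) / 2) (at_right 2)"
    by simp
  then have ev: "\<forall>\<^sub>F p in at_right 2. vol_factor p * lip_factor p * ((1 + \<theta>) / 2) < 1"
    by (rule order_tendstoD(2)) (use \<theta> in simp)
  show ?thesis using ev pnorm_near_2[OF e(1)] eventually_at_right_less[of 2]
  proof eventually_elim
    case (elim p)
    show ?case
    proof (intro ballI impI)
      fix w assume w: "w \<in> V" and D: "dirichlet \<Omega> w \<le> lambda2 \<Omega> * vol_factor p * lip_factor p * (M.pnorm p w)\<^sup>2"
      have wz: "w \<in> Hza \<Omega>" using w V by blast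
      have fac: "vol_factor p * lip_factor p \<ge> 0"
        using lip_factor_ge_1[of p] elim(3) by (simp add: vol_factor_def)
      have s: "lam * sqint w \<le> \<theta> * dirichlet \<Omega> w"
      proof -
        have "\<theta> * (\<mu> * sqint w) \<le> \<theta> * dirichlet \<Omega> w" using mu(2)[OF w] \<theta> by (intro mult_left_mono) auto
        then show ?thesis using lam by (simp add: \<theta>_def)
      qed
      have "lam * (M.pnorm p w)\<^sup>2 \<le> lam * (sqint w + e * (sqint w + dirichlet \<Omega> w))"
        using elim(2) Hza_H1[OF wz] lam by (intro mult_left_mono) auto
      also have "\<dots> = (1 + e) * (lam * sqint w) + e * lam * dirichlet \<Omega> w" by (simp add: algebra_simps)
      also have "\<dots> \<le> (1 + e) * (\<theta> * dirichlet \<Omega> w) + e * lam * dirichlet \<Omega> w"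
        using s e(1) by (intro add_right_mono mult_left_mono) auto
      also have "\<dots> = (\<theta> + e * (\<theta> + lam)) * dirichlet \<Omega> w" by (simp add: algebra_simps)
      finally have "lam * (M.pnorm p w)\<^sup>2 \<le> (1 + \<theta>) / 2 * dirichlet \<Omega> w" unfolding e(2) .
      then have "(vol_factor p * lip_factor p) * (lam * (M.pnorm p w)\<^sup>2) \<le> (vol_factor p * lip_factor p) * ((1 + \<theta>) / 2 * dirichlet \<Omega> w)"
        by (rule mult_left_mono[OF _ fac])
      then have le: "dirichlet \<Omega> w \<le> (vol_factor p * lip_factor p * ((1 + \<theta>) / 2)) * dirichlet \<Omega> w"
        using D unfolding lam_def by (simp add: mult_ac)
      have "dirichlet \<Omega> w = 0"
      proof (rule ccontr)
        assume "dirichlet \<Omega> w \<noteq> 0"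
        then have "dirichlet \<Omega> w > 0" using dirichlet_nonneg[of w] by linarith
        then have "(vol_factor p * lip_factor p * ((1 + \<theta>) / 2)) * dirichlet \<Omega> w < 1 * dirichlet \<Omega> w"
          by (intro mult_strict_right_mono elim(1))
        then show False using le by simp
      qed
      then show "sqint w = 0" by (rule dirichlet_zero[OF wz])
    qed
  qed
qed

text \<open>The infimum is attained, which turns the quotient into a homogeneous equation with a
  multiplier m. For p below \<open>q_exp\<close> integrability of |u|^p is automatic, so
  admissibility reduces to a nonzero p-norm.\<close>

lemma minimizer_characterisation:
  assumes p: "2 < p" "p < q_exp"
  obtains m where "\<exists>u. minimizer \<Omega> p u"
    "\<And>u. minimizer \<Omega> p u \<longleftrightarrow> u \<in> Hza \<Omega> \<and> M.pnorm p u \<noteq> 0 \<and> dirichlet \<Omega> u = m * (M.pnorm p u)\<^sup>2"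
    "\<And>w. w \<in> Hza \<Omega> \<Longrightarrow> m * (M.pnorm p w)\<^sup>2 \<le> dirichlet \<Omega> w" "m \<ge> 0"
proof -
  have pq: "2 \<le> p" "p \<le> q_exp" using p by auto
  obtain w0 where w0: "w0 \<in> Hza \<Omega>" "sqint w0 \<noteq> 0" by (rule Hza_nontrivial)
  have "M.pnorm p w0 \<noteq> 0" using pnorm_zero_iff_sqint[OF Hza_H1[OF w0(1)] pq] w0(2) by simp
  from existence[OF closed_subspace_Hza pq(1) p(2) w0(1) this]
  obtain e where e: "e \<in> Hza \<Omega>" "M.pnorm p e = 1" "\<And>w. w \<in> Hza \<Omega> \<Longrightarrow> dirichlet \<Omega> e * (M.pnorm p w)\<^sup>2 \<le> dirichlet \<Omega> w"
    by blast
  define m where "m = dirichlet \<Omega> e"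
  have adm: "u \<in> admissible \<Omega> p \<longleftrightarrow> u \<in> Hza \<Omega> \<and> M.pnorm p u \<noteq> 0" for u
  proof (cases "u \<in> Hza \<Omega>")
    case True
    note L = H1_Lp'[OF Hza_H1[OF True] pq]
    then show ?thesis using M.pnorm_zero_iff[OF L] True by (simp add: admissible_def nonzero_fun_def M.Lp_def)
  qed (simp add: admissible_def)
  have ray: "rayleigh \<Omega> p u = dirichlet \<Omega> u / (M.pnorm p u)\<^sup>2" for u by (simp add: rayleigh_def Lp_norm_pnorm)
  have eadm: "e \<in> admissible \<Omega> p" unfolding adm using e by simp
  have ge: "m \<le> rayleigh \<Omega> p u" if "u \<in> admissible \<Omega> p" for u
    using that e(3)[of u] unfolding adm ray m_def by (simp add: pos_le_divide_eq)
  have eray: "rayleigh \<Omega> p e = m" unfolding ray m_def using e(2) by simp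
  have Lam: "Lambda_p \<Omega> p = m"
    unfolding Lambda_p_def
  proof (rule cInf_eq_minimum)
    show "m \<in> rayleigh \<Omega> p ` admissible \<Omega> p" using eadm eray by blast
  qed (use ge in blast)
  show ?thesis
  proof (rule that[of m])
    show "\<exists>u. minimizer \<Omega> p u" unfolding minimizer_def Lam using eadm eray by blast
    show "minimizer \<Omega> p u \<longleftrightarrow> u \<in> Hza \<Omega> \<and> M.pnorm p u \<noteq> 0 \<and> dirichlet \<Omega> u = m * (M.pnorm p u)\<^sup>2" for u
      unfolding minimizer_def Lam adm ray by (auto simp: divide_eq_eq)
    show "m * (M.pnorm p w)\<^sup>2 \<le> dirichlet \<Omega> w" if "w \<in> Hza \<Omega>" for w using e(3)[OF that] by (simp add: m_def)
    show "m \<ge> 0" by (simp add: m_def dirichlet_nonneg)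
  qed
qed

text \<open>Minimizers will be normalised by pairing with u_2, so their p-norm N is not 1. Scaling
  to norm 1 and back leaves N * N^(-(p-1)), the negative power of N in the multiplier.\<close>

lemma minimizer_euler_lagrange:
  assumes p: "2 < p" "p < q_exp" and u: "u \<in> Hza \<Omega>" "M.pnorm p u \<noteq> 0" "dirichlet \<Omega> u = m * (M.pnorm p u)\<^sup>2"
    and min: "\<And>w. w \<in> Hza \<Omega> \<Longrightarrow> m * (M.pnorm p w)\<^sup>2 \<le> dirichlet \<Omega> w" and \<phi>: "\<phi> \<in> Hza \<Omega>"
  shows "energy u \<phi> = m * M.pnorm p u powr (- (p - 2)) * (\<integral>x. signed_powr p (u x) * \<phi> x \<partial>lebesgue_on \<Omega>)"
proof -
  define N where "N = M.pnorm p u"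
  have N: "N > 0" using u(2) M.pnorm_nonneg[of p u] by (simp add: N_def)
  let ?v = "\<lambda>x. (1 / N) * u x"
  have v: "?v \<in> Hza \<Omega>" using Hza_lincomb[OF u(1) u(1), of "1/N" 0] by simp
  have vn: "M.pnorm p ?v = 1" using M.pnorm_scale[of p "1/N" u] p N by (simp add: N_def)
  have vd: "dirichlet \<Omega> ?v = m" using dirichlet_scale[OF Hza_H1[OF u(1)], of "1/N"] u(3) N by (simp add: N_def[symmetric] power_divide)
  have "energy ?v \<phi> = m * (\<integral>x. signed_powr p (?v x) * \<phi> x \<partial>lebesgue_on \<Omega>)"
    using euler_lagrange[OF closed_subspace_Hza _ _ v vn _ \<phi>] p min unfolding vd by simp
  also have "(\<integral>x. signed_powr p (?v x) * \<phi> x \<partial>lebesgue_on \<Omega>) = (\<integral>x. (1 / N) powr (p - 1) * (signed_powr p (u x) * \<phi> x) \<partial>lebesgue_on \<Omega>)"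
    using signed_powr_scale[of "1/N" p] N by (simp add: mult.assoc)
  also have "energy ?v \<phi> = (1 / N) * energy u \<phi>"
    using energy_lincomb[OF Hza_H1[OF u(1)] Hza_H1[OF u(1)] Hza_H1[OF \<phi>], of "1/N" 0] by simp
  finally have X: "(1 / N) * energy u \<phi> = m * (\<integral>x. (1 / N) powr (p - 1) * (signed_powr p (u x) * \<phi> x) \<partial>lebesgue_on \<Omega>)" .
  have "energy u \<phi> = (N * (1 / N) powr (p - 1)) * (m * (\<integral>x. signed_powr p (u x) * \<phi> x \<partial>lebesgue_on \<Omega>))"
  proof -
    have "e = (N * c) * (m * I)" if "(1 / N) * e = m * (c * I)" for c e I :: real
      using that N by (simp add: field_simps)
    then show ?thesis using X by (simp only: Bochner_Integration.integral_mult_right_zero)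
  qed
  also have "N * (1 / N) powr (p - 1) = N powr (- (p - 2))"
  proof -
    have "(1 / N) powr (p - 1) = N powr (- (p - 1))" by (subst powr_minus_divide) (simp add: powr_divide N less_imp_le)
    then have "N * (1 / N) powr (p - 1) = N powr 1 * N powr (- (p - 1))" using N by simp
    also have "\<dots> = N powr (- (p - 2))" by (subst powr_add[symmetric]) simp
    finally show ?thesis .
  qed
  finally show ?thesis unfolding N_def by (simp only: mult_ac)
qed

text \<open>Both Euler-Lagrange equations are tested with w = u - v and subtracted. The change of
  the nonlinearity, under the multiplier of u, costs (p-1) 2^((p-2)/p); the change of the multiplier
  costs p - 2, because it is controlled by |A - B|, which is at most the p-norm of w.\<close>

lemma minimizer_difference_estimate:
  assumes p: "2 < p" "p < q_exp" and u: "u \<in> Hza \<Omega>" "M.pnorm p u \<noteq> 0" "dirichlet \<Omega> u = m * (M.pnorm p u)\<^sup>2"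
    and v: "v \<in> Hza \<Omega>" "M.pnorm p v \<noteq> 0" "dirichlet \<Omega> v = m * (M.pnorm p v)\<^sup>2"
    and min: "\<And>w. w \<in> Hza \<Omega> \<Longrightarrow> m * (M.pnorm p w)\<^sup>2 \<le> dirichlet \<Omega> w" and m0: "m \<ge> 0"
    and AB: "M.pnorm p v \<le> M.pnorm p u"
  shows "dirichlet \<Omega> (\<lambda>x. u x - v x) \<le> m * lip_factor p * (M.pnorm p (\<lambda>x. u x - v x))\<^sup>2"
proof -
  let ?w = "\<lambda>x. u x - v x"
  define A where "A = M.pnorm p u"
  define B where "B = M.pnorm p v"
  define W where "W = M.pnorm p ?w"
  have p1: "p > 1" "p > 0" "2 \<le> p" "p \<le> q_exp" using p by auto
  have A: "A > 0" "B > 0" "B \<le> A" using u(2) v(2) M.pnorm_nonneg[of p u] M.pnorm_nonneg[of p v] AB by (simp_all add: A_def B_def)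
  have wz: "?w \<in> Hza \<Omega>" using Hza_lincomb[OF u(1) v(1), of 1 "-1"] by simp
  note uH = Hza_H1[OF u(1)] and vH = Hza_H1[OF v(1)] and wH = Hza_H1[OF wz]
  note Lu = H1_Lp'[OF uH p1(3,4)] and Lv = H1_Lp'[OF vH p1(3,4)] and Lw = H1_Lp'[OF wH p1(3,4)]
  let ?fu = "\<integral>x. signed_powr p (u x) * ?w x \<partial>lebesgue_on \<Omega>" and ?fv = "\<integral>x. signed_powr p (v x) * ?w x \<partial>lebesgue_on \<Omega>"
  note iu = M.holder_signed(1)[OF p1(1) Lu Lw] and iv = M.holder_signed(1)[OF p1(1) Lv Lw]
  have "dirichlet \<Omega> ?w = energy u ?w - energy v ?w"
    using energy_lincomb[OF uH vH wH, of 1 "-1"] by (simp add: dirichlet_energy)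
  also have "\<dots> = m * A powr (- (p - 2)) * ?fu - m * B powr (- (p - 2)) * ?fv"
    unfolding A_def B_def
    using minimizer_euler_lagrange[OF p u min wz] minimizer_euler_lagrange[OF p v min wz] by simp
  also have "\<dots> = m * (A powr (- (p - 2)) * (?fu - ?fv) + (A powr (- (p - 2)) - B powr (- (p - 2))) * ?fv)"
    by (simp only: right_diff_distrib left_diff_distrib distrib_left mult.assoc)
  also have "\<dots> \<le> m * ((p - 1) * 2 powr ((p - 2) / p) * W\<^sup>2 + (p - 2) * W\<^sup>2)"
  proof (intro mult_left_mono[OF add_mono m0])
    \<comment> \<open>The Lipschitz weight. Its p-integral is at most A^p + B^p <= 2 A^p, whence the
      factor 2^((p-2)/p); the remaining power A^(p-2) cancels against the multiplier.\<close>
    define M where "M x = max \<bar>u x\<bar> \<bar>v x\<bar>" for x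
    have LM: "M.Lp p M"
      unfolding M.Lp_def
    proof
      note [measurable] = Lu[unfolded M.Lp_def, THEN conjunct1] Lv[unfolded M.Lp_def, THEN conjunct1]
      show mm: "M \<in> borel_measurable (lebesgue_on \<Omega>)" unfolding M_def by measurable
      show "integrable (lebesgue_on \<Omega>) (\<lambda>x. \<bar>M x\<bar> powr p)"
      proof (rule Bochner_Integration.integrable_bound)
        show "integrable (lebesgue_on \<Omega>) (\<lambda>x. \<bar>u x\<bar> powr p + \<bar>v x\<bar> powr p)" using Lu Lv by (simp add: M.Lp_def)
        show "AE x in lebesgue_on \<Omega>. norm (\<bar>M x\<bar> powr p) \<le> norm (\<bar>u x\<bar> powr p + \<bar>v x\<bar> powr p)"
          by (rule AE_I2) (simp add: M_def max_def)
        show "(\<lambda>x. \<bar>M x\<bar> powr p) \<in> borel_measurable (lebesgue_on \<Omega>)" using mm by measurable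
      qed
    qed
    have pM: "M.pint p M \<le> 2 * A powr p"
    proof -
      have "M.pint p M \<le> (\<integral>x. \<bar>u x\<bar> powr p + \<bar>v x\<bar> powr p \<partial>lebesgue_on \<Omega>)"
        unfolding M.pint_def
      proof (rule integral_mono)
        show "integrable (lebesgue_on \<Omega>) (\<lambda>x. \<bar>M x\<bar> powr p)" using LM by (simp add: M.Lp_def)
        show "integrable (lebesgue_on \<Omega>) (\<lambda>x. \<bar>u x\<bar> powr p + \<bar>v x\<bar> powr p)" using Lu Lv by (simp add: M.Lp_def)
        show "\<bar>M x\<bar> powr p \<le> \<bar>u x\<bar> powr p + \<bar>v x\<bar> powr p" for x by (simp add: M_def max_def)
      qed
      also have "\<dots> = A powr p + B powr p"
        using Lu Lv M.pnorm_powr[OF p1(2), of u] M.pnorm_powr[OF p1(2), of v] by (simp add: M.Lp_def M.pint_def A_def B_def)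
      also have "\<dots> \<le> A powr p + A powr p" using A p1 by (intro add_left_mono powr_mono2) auto
      finally show ?thesis by simp
    qed
    note hs = M.holder_square[OF p(1) LM Lw]
    have "?fu - ?fv = (\<integral>x. (signed_powr p (u x) - signed_powr p (v x)) * ?w x \<partial>lebesgue_on \<Omega>)"
      using iu iv by (simp only: left_diff_distrib Bochner_Integration.integral_diff)
    also have "\<dots> \<le> (\<integral>x. (p - 1) * (\<bar>M x\<bar> powr (p - 2) * (?w x)\<^sup>2) \<partial>lebesgue_on \<Omega>)"
    proof (rule integral_mono)
      show "integrable (lebesgue_on \<Omega>) (\<lambda>x. (signed_powr p (u x) - signed_powr p (v x)) * ?w x)"
        unfolding left_diff_distrib by (rule Bochner_Integration.integrable_diff[OF iu iv])
      show "integrable (lebesgue_on \<Omega>) (\<lambda>x. (p - 1) * (\<bar>M x\<bar> powr (p - 2) * (?w x)\<^sup>2))" using hs(1) by simp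
      show "(signed_powr p (u x) - signed_powr p (v x)) * ?w x \<le> (p - 1) * (\<bar>M x\<bar> powr (p - 2) * (?w x)\<^sup>2)" for x
      proof -
        have "\<bar>M x\<bar> = max \<bar>u x\<bar> \<bar>v x\<bar>" unfolding M_def by linarith
        then show ?thesis using signed_powr_lipschitz[OF p(1), of "u x" "v x"] by simp
      qed
    qed
    also have "\<dots> = (p - 1) * (\<integral>x. \<bar>M x\<bar> powr (p - 2) * (?w x)\<^sup>2 \<partial>lebesgue_on \<Omega>)" by simp
    also have "\<dots> \<le> (p - 1) * (M.pint p M powr ((p - 2) / p) * W\<^sup>2)"
      unfolding W_def by (rule mult_left_mono[OF hs(2)]) (use p1 in simp)
    also have "\<dots> \<le> (p - 1) * ((2 * A powr p) powr ((p - 2) / p) * W\<^sup>2)"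
      using p1 p pM M.pint_nonneg by (intro mult_left_mono mult_right_mono powr_mono2) auto
    also have "(2 * A powr p) powr ((p - 2) / p) = 2 powr ((p - 2) / p) * A powr (p - 2)"
      using A p1 by (simp add: powr_mult powr_powr)
    finally have "A powr (- (p - 2)) * (?fu - ?fv) \<le> A powr (- (p - 2)) * ((p - 1) * (2 powr ((p - 2) / p) * A powr (p - 2) * W\<^sup>2))"
      by (rule mult_left_mono) simp
    also have "\<dots> = (A powr (- (p - 2)) * A powr (p - 2)) * ((p - 1) * 2 powr ((p - 2) / p) * W\<^sup>2)" by (simp only: mult_ac)
    also have "A powr (- (p - 2)) * A powr (p - 2) = 1" using A by (subst powr_add[symmetric]) simp
    finally show "A powr (- (p - 2)) * (?fu - ?fv) \<le> (p - 1) * 2 powr ((p - 2) / p) * W\<^sup>2" by simp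
    \<comment> \<open>Since B <= A the multiplier of v is the larger one, so an upper bound for
      \<open>- ?fv\<close> is enough.\<close>
    have Bp: "B powr (- (p - 2)) - A powr (- (p - 2)) \<ge> 0"
      using powr_mono2'[of "- (p - 2)" B A] p A by simp
    have "- ?fv \<le> \<bar>?fv\<bar>" by simp
    also have "\<dots> \<le> (\<integral>x. \<bar>signed_powr p (v x) * ?w x\<bar> \<partial>lebesgue_on \<Omega>)" by (rule integral_abs_bound)
    also have "\<dots> = (\<integral>x. \<bar>v x\<bar> powr (p - 1) * \<bar>?w x\<bar> \<partial>lebesgue_on \<Omega>)" by (simp add: abs_mult abs_signed_powr)
    also have "\<dots> \<le> B powr (p - 1) * W" unfolding B_def W_def by (rule M.holder_signed(3)[OF p1(1) Lv Lw])
    finally have fv: "- ?fv \<le> B powr (p - 1) * W" .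
    have "(A powr (- (p - 2)) - B powr (- (p - 2))) * ?fv = (B powr (- (p - 2)) - A powr (- (p - 2))) * (- ?fv)"
      by (simp add: left_diff_distrib)
    also have "\<dots> \<le> (B powr (- (p - 2)) - A powr (- (p - 2))) * (B powr (p - 1) * W)"
      by (rule mult_left_mono[OF fv Bp])
    also have "\<dots> = (B powr (- (p - 2)) - A powr (- (p - 2))) * B powr ((p - 2) + 1) * W" by simp
    also have "\<dots> \<le> (p - 2) * (A - B) * W"
      by (rule mult_right_mono[OF powr_neg_difference]) (use A p W_def M.pnorm_nonneg in auto)
    also have "\<dots> \<le> (p - 2) * W * W"
    proof -
      have "A - B \<le> W" unfolding A_def B_def W_def by (rule M.pnorm_triangle_lower[OF p1(1) Lu Lv])
      then show ?thesis using p M.pnorm_nonneg[of p ?w] by (intro mult_right_mono mult_left_mono) (auto simp: W_def)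
    qed
    finally show "(A powr (- (p - 2)) - B powr (- (p - 2))) * ?fv \<le> (p - 2) * W\<^sup>2" by (simp add: power2_eq_square mult.assoc)
  qed
  also have "\<dots> = m * lip_factor p * W\<^sup>2" by (simp add: lip_factor_def algebra_simps)
  finally show ?thesis unfolding W_def .
qed

text \<open>The factor between two minimizers is given explicitly by their pairings with u_2, so
  that it can be evaluated when one is the reflection of the other.\<close>

lemma minimizers_near_2:
  assumes eig: "neumann_eigenpair \<Omega> (lambda2 \<Omega>) u2"
    and simple: "\<forall>v. neumann_eigenpair \<Omega> (lambda2 \<Omega>) v \<longrightarrow> (\<exists>c. AE x in lebesgue_on \<Omega>. v x = c * u2 x)"
  shows "\<forall>\<^sub>F p in at_right 2. 2 < p \<and> p < q_exp \<and> (\<exists>u. minimizer \<Omega> p u) \<and>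
     (\<forall>u. minimizer \<Omega> p u \<longrightarrow> scal u u2 \<noteq> 0) \<and>
     (\<forall>u v. minimizer \<Omega> p u \<and> minimizer \<Omega> p v \<longrightarrow> (AE x in lebesgue_on \<Omega>. v x = (scal v u2 / scal u u2) * u x))"
proof -
  note u2 = eigenpair_props[OF eig lambda2_props(1)]
  note u2H = Hza_H1[OF u2(1)]
  obtain \<mu> where mu: "\<mu> > lambda2 \<Omega>" "\<And>w. w \<in> Hza \<Omega> \<Longrightarrow> scal w u2 = 0 \<Longrightarrow> \<mu> * sqint w \<le> dirichlet \<Omega> w"
    by (rule spectral_gap[OF eig simple]) blast
  have c: "\<forall>\<^sub>F p in at_right 2. \<forall>w\<in>{w \<in> Hza \<Omega>. scal w u2 = 0}. dirichlet \<Omega> w \<le> lambda2 \<Omega> * vol_factor p * lip_factor p * (M.pnorm p w)\<^sup>2 \<longrightarrow> sqint w = 0"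
    by (rule contraction[OF mu(1)]) (use mu(2) in blast)+
  have q: "\<forall>\<^sub>F p in at_right (2::real). p \<in> {2<..<q_exp}" by (rule eventually_at_right_real[OF q_exp_gt])
  show ?thesis using c q
  proof eventually_elim
    case (elim p)
    have p: "2 < p" "p < q_exp" and pq: "2 \<le> p" "p \<le> q_exp" using elim(2) by auto
    have con: "sqint w = 0" if "w \<in> Hza \<Omega>" "scal w u2 = 0"
        "dirichlet \<Omega> w \<le> lambda2 \<Omega> * vol_factor p * lip_factor p * (M.pnorm p w)\<^sup>2" for w
      using elim(1) that by blast
    obtain m where m: "\<exists>u. minimizer \<Omega> p u"
      "\<And>u. minimizer \<Omega> p u \<longleftrightarrow> u \<in> Hza \<Omega> \<and> M.pnorm p u \<noteq> 0 \<and> dirichlet \<Omega> u = m * (M.pnorm p u)\<^sup>2"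
      "\<And>w. w \<in> Hza \<Omega> \<Longrightarrow> m * (M.pnorm p w)\<^sup>2 \<le> dirichlet \<Omega> w" "m \<ge> 0"
      by (rule minimizer_characterisation[OF p]) blast
    \<comment> \<open>The eigenfunction u_2 as competitor for Lambda_p, with Holder to return from
      L^2 to L^p.\<close>
    have m_le: "m \<le> lambda2 \<Omega> * vol_factor p"
    proof -
      have n: "M.pnorm p u2 \<noteq> 0" using pnorm_zero_iff_sqint[OF u2H pq] u2(3) by simp
      have "m * (M.pnorm p u2)\<^sup>2 \<le> lambda2 \<Omega> * sqint u2" using m(3)[OF u2(1)] u2(2) by simp
      also have "\<dots> \<le> lambda2 \<Omega> * ((M.pnorm p u2)\<^sup>2 * vol_factor p)"
        unfolding vol_factor_def by (intro mult_left_mono sqint_le_pnorm[OF pq u2H]) (use lambda2_props(1) in simp)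
      also have "\<dots> = (lambda2 \<Omega> * vol_factor p) * (M.pnorm p u2)\<^sup>2" by (simp only: mult_ac)
      finally show ?thesis using n by (simp add: mult_le_cancel_right)
    qed
    have lf: "lip_factor p \<ge> 1" by (rule lip_factor_ge_1[OF pq(1)])
    have mlf: "m * lip_factor p * X\<^sup>2 \<le> lambda2 \<Omega> * vol_factor p * lip_factor p * X\<^sup>2" for X
      by (intro mult_right_mono m_le) (use lf in auto)
    have ne: "scal u u2 \<noteq> 0" if "minimizer \<Omega> p u" for u
    proof
      assume z: "scal u u2 = 0"
      have u: "u \<in> Hza \<Omega>" "M.pnorm p u \<noteq> 0" "dirichlet \<Omega> u = m * (M.pnorm p u)\<^sup>2" using that m(2) by blast+
      \<comment> \<open>A minimizer orthogonal to u_2 would satisfy the premise of the contraction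
        by itself, since its energy is m times its squared p-norm and \<open>lip_factor p\<close> is
        at least 1.\<close>
      have "m * 1 * (M.pnorm p u)\<^sup>2 \<le> m * lip_factor p * (M.pnorm p u)\<^sup>2"
        by (intro mult_right_mono mult_left_mono lf m(4)) simp
      then have "sqint u = 0" using con[OF u(1) z] mlf[of "M.pnorm p u"] u(3) by simp
      then show False using pnorm_zero_iff_sqint[OF Hza_H1[OF u(1)] pq] u(2) by simp
    qed
    have scale: "minimizer \<Omega> p (\<lambda>x. c * u x)" if "minimizer \<Omega> p u" "c \<noteq> 0" for u c
    proof -
      have u: "u \<in> Hza \<Omega>" "M.pnorm p u \<noteq> 0" "dirichlet \<Omega> u = m * (M.pnorm p u)\<^sup>2" using that m(2) by blast+
      show ?thesis unfolding m(2)
        using Hza_lincomb[OF u(1) u(1), of c 0] u M.pnorm_scale[of p c u] p dirichlet_scale[OF Hza_H1[OF u(1)], of c] that(2)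
        by (simp add: power_mult_distrib)
    qed
    have same0: "AE x in lebesgue_on \<Omega>. v x = u x"
      if uv: "minimizer \<Omega> p u" "minimizer \<Omega> p v" "scal u u2 = 1" "scal v u2 = 1" and le: "M.pnorm p v \<le> M.pnorm p u" for u v
    proof -
      have u: "u \<in> Hza \<Omega>" "M.pnorm p u \<noteq> 0" "dirichlet \<Omega> u = m * (M.pnorm p u)\<^sup>2" using uv(1) m(2) by blast+
      have v: "v \<in> Hza \<Omega>" "M.pnorm p v \<noteq> 0" "dirichlet \<Omega> v = m * (M.pnorm p v)\<^sup>2" using uv(2) m(2) by blast+
      let ?w = "\<lambda>x. u x - v x"
      have wz: "?w \<in> Hza \<Omega>" using Hza_lincomb[OF u(1) v(1), of 1 "-1"] by simp
      have "scal ?w u2 = 0" using scal_lincomb[OF Hza_H1[OF u(1)] Hza_H1[OF v(1)] u2H, of 1 "-1"] uv(3,4) by simp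
      from con[OF wz this order_trans[OF minimizer_difference_estimate[OF p u v m(3,4) le] mlf]]
      have "AE x in lebesgue_on \<Omega>. u x - v x = 0" using sqint_zero_iff[OF Hza_H1[OF wz]] by simp
      then show ?thesis by eventually_elim simp
    qed
    have same: "AE x in lebesgue_on \<Omega>. v x = (scal v u2 / scal u u2) * u x" if uv: "minimizer \<Omega> p u" "minimizer \<Omega> p v" for u v
    proof -
      let ?a = "scal u u2" and ?b = "scal v u2"
      note n = ne[OF uv(1)] ne[OF uv(2)]
      have H: "u \<in> H1 \<Omega>" "v \<in> H1 \<Omega>" using uv m(2) Hza_H1 by blast+
      have s: "minimizer \<Omega> p (\<lambda>x. (1 / ?a) * u x)" "minimizer \<Omega> p (\<lambda>x. (1 / ?b) * v x)"
        by (rule scale[OF uv(1)], use n in simp) (rule scale[OF uv(2)], use n in simp)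
      have one: "scal (\<lambda>x. (1 / ?a) * u x) u2 = 1" "scal (\<lambda>x. (1 / ?b) * v x) u2 = 1"
        using scal_lincomb[OF H(1) H(1) u2H, of "1 / ?a" 0] scal_lincomb[OF H(2) H(2) u2H, of "1 / ?b" 0] n by simp_all
      have "AE x in lebesgue_on \<Omega>. (1 / ?b) * v x = (1 / ?a) * u x"
      \<comment> \<open>\<open>same0\<close> presumes an order of the two norms; the roles of u and
        v can be exchanged.\<close>
      proof (cases "M.pnorm p (\<lambda>x. (1 / ?b) * v x) \<le> M.pnorm p (\<lambda>x. (1 / ?a) * u x)")
        case True
        then show ?thesis by (rule same0[OF s one])
      next
        case False
        then have "M.pnorm p (\<lambda>x. (1 / ?a) * u x) \<le> M.pnorm p (\<lambda>x. (1 / ?b) * v x)" by linarith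
        from same0[OF s(2,1) one(2,1) this] show ?thesis by eventually_elim simp
      qed
      then show ?thesis
      proof eventually_elim
        case (elim x)
        then have "?b * ((1 / ?b) * v x) = ?b * ((1 / ?a) * u x)" by (simp only:)
        then show ?case using n by simp
      qed
    qed
    show ?case using p m(1) ne same by blast
  qed
qed

end

section \<open>Reflection\<close>

lemma nn_integral_lborel_translate:
  fixes f :: "'a::euclidean_space \<Rightarrow> ennreal"
  shows "f \<in> borel_measurable borel \<Longrightarrow> (\<integral>\<^sup>+x. f (t + x) \<partial>lborel) = (\<integral>\<^sup>+x. f x \<partial>lborel)"
  using nn_integral_lborel_affine[of f 1 t] by simp

text \<open>Tonelli and translation invariance only: both sides, multiplied by the volume of the unit
  ball, equal the same double integral.\<close>
lemma nn_integral_isometric_involution: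
  fixes L :: "'a::euclidean_space \<Rightarrow> 'a" and f :: "'a \<Rightarrow> ennreal"
  assumes L: "linear L" "\<And>x. L (L x) = x" "\<And>x. norm (L x) = norm x" and f [measurable]: "f \<in> borel_measurable borel"
  shows "(\<integral>\<^sup>+x. f (L x) \<partial>lborel) = (\<integral>\<^sup>+x. f x \<partial>lborel)"
proof -
  have [measurable]: "L \<in> borel_measurable borel"
    by (intro borel_measurable_continuous_onI linear_continuous_on linear_conv_bounded_linear[THEN iffD1] L)
  have [measurable]: "ball (0::'a) 1 \<in> sets borel" by simp
  \<comment> \<open>Any set of finite positive volume that is invariant under L and the sign would
    do; its volume is cancelled at the end.\<close>
  let ?B = "indicator (ball (0::'a) 1) :: 'a \<Rightarrow> ennreal"
  have BL: "?B (- L x) = ?B x" for x using L(3)[of x] by (simp add: indicator_def)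
  let ?c = "\<integral>\<^sup>+y. ?B y \<partial>lborel"
  have "(\<integral>\<^sup>+x. f (L x) \<partial>lborel) * ?c = (\<integral>\<^sup>+x. f (L x) * ?c \<partial>lborel)" by (rule nn_integral_multc[symmetric]) measurable
  also have "\<dots> = (\<integral>\<^sup>+x. (\<integral>\<^sup>+y. f (L x) * ?B y \<partial>lborel) \<partial>lborel)"
    by (intro nn_integral_cong nn_integral_cmult[symmetric]) measurable
  also have "\<dots> = (\<integral>\<^sup>+x. (\<integral>\<^sup>+y. f (L x) * ?B (- L x + y) \<partial>lborel) \<partial>lborel)"
  proof (rule nn_integral_cong)
    fix x
    show "(\<integral>\<^sup>+y. f (L x) * ?B y \<partial>lborel) = (\<integral>\<^sup>+y. f (L x) * ?B (- L x + y) \<partial>lborel)"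
      by (rule nn_integral_lborel_translate[symmetric, of "\<lambda>y. f (L x) * ?B y"]) measurable
  qed
  also have "\<dots> = (\<integral>\<^sup>+y. (\<integral>\<^sup>+x. f (L x) * ?B (- L x + y) \<partial>lborel) \<partial>lborel)"
    by (rule lborel_pair.Fubini') measurable
  also have "\<dots> = (\<integral>\<^sup>+y. (\<integral>\<^sup>+x. f (L x + y) * ?B (- L x) \<partial>lborel) \<partial>lborel)"
  proof (rule nn_integral_cong)
    fix y
    \<comment> \<open>Substituting L y + x for x: L maps it to y + L x, so the shift y moves into f
      and disappears from the indicator.\<close>
    have "(\<integral>\<^sup>+x. f (L x) * ?B (- L x + y) \<partial>lborel) = (\<integral>\<^sup>+x. f (L (L y + x)) * ?B (- L (L y + x) + y) \<partial>lborel)"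
      by (rule nn_integral_lborel_translate[symmetric, of "\<lambda>x. f (L x) * ?B (- L x + y)"]) measurable
    also have "\<dots> = (\<integral>\<^sup>+x. f (L x + y) * ?B (- L x) \<partial>lborel)"
      by (simp add: linear_add[OF L(1)] L(2) add.commute)
    finally show "(\<integral>\<^sup>+x. f (L x) * ?B (- L x + y) \<partial>lborel) = (\<integral>\<^sup>+x. f (L x + y) * ?B (- L x) \<partial>lborel)" .
  qed
  also have "\<dots> = (\<integral>\<^sup>+x. (\<integral>\<^sup>+y. f (L x + y) * ?B (- L x) \<partial>lborel) \<partial>lborel)"
    by (rule lborel_pair.Fubini'[symmetric]) measurable
  also have "\<dots> = (\<integral>\<^sup>+x. (\<integral>\<^sup>+y. f y \<partial>lborel) * ?B x \<partial>lborel)"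
  proof (rule nn_integral_cong)
    fix x
    have "(\<integral>\<^sup>+y. f (L x + y) * ?B (- L x) \<partial>lborel) = (\<integral>\<^sup>+y. f (L x + y) \<partial>lborel) * ?B (- L x)"
      by (rule nn_integral_multc) measurable
    then show "(\<integral>\<^sup>+y. f (L x + y) * ?B (- L x) \<partial>lborel) = (\<integral>\<^sup>+y. f y \<partial>lborel) * ?B x"
      by (simp only: BL nn_integral_lborel_translate[OF f])
  qed
  also have "\<dots> = (\<integral>\<^sup>+y. f y \<partial>lborel) * ?c" by (rule nn_integral_cmult) measurable
  finally have eq: "(\<integral>\<^sup>+x. f (L x) \<partial>lborel) * ?c = (\<integral>\<^sup>+y. f y \<partial>lborel) * ?c" .
  have c: "?c = emeasure lborel (ball (0::'a) 1)" by simp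
  have "?c \<noteq> \<infinity>" unfolding c using emeasure_lborel_ball_finite[of "0::'a" 1] by (simp add: less_top)
  moreover have "?c \<noteq> 0"
  proof
    assume "?c = 0"
    then have "ball (0::'a) 1 \<in> null_sets lborel" unfolding c by (simp add: null_sets_def)
    then have "negligible (ball (0::'a) 1)" by (simp add: negligible_iff_null_sets null_sets_completionI)
    then show False using open_not_negligible[of "ball (0::'a) 1"] by simp
  qed
  moreover have "x = y" if "x * k = y * k" "k \<noteq> \<infinity>" "k \<noteq> 0" for x y k :: ennreal
  proof -
    have "x = x * k / k" using that(2,3) by (simp add: mult_divide_eq_ennreal)
    also have "\<dots> = y" unfolding that(1) using that(2,3) by (simp add: mult_divide_eq_ennreal)
    finally show ?thesis .
  qed
  ultimately show ?thesis using eq by blast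
qed

section \<open>Reflections as affine isometries\<close>

definition reflect_lin :: "'a::euclidean_space \<Rightarrow> 'a \<Rightarrow> 'a" where
  "reflect_lin a x = x - (2 * (a \<bullet> x) / (a \<bullet> a)) *\<^sub>R a"

lemma reflect_affine: "reflect a b x = (2 * b / (a \<bullet> a)) *\<^sub>R a + reflect_lin a x"
  by (simp add: reflect_def reflect_lin_def diff_divide_distrib scaleR_diff_left right_diff_distrib)

lemma linear_reflect_lin: "linear (reflect_lin a)"
  by (rule linearI) (simp_all add: reflect_lin_def inner_add_right add_divide_distrib distrib_left scaleR_add_left scaleR_diff_right)

lemma reflect_lin_adjoint: "reflect_lin a x \<bullet> y = x \<bullet> reflect_lin a y"
  by (simp add: reflect_lin_def inner_diff_left inner_diff_right inner_commute)

lemma reflect_lin_self: "a \<noteq> 0 \<Longrightarrow> a \<bullet> reflect_lin a x = - (a \<bullet> x)"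
  by (simp add: reflect_lin_def inner_diff_right)

lemma reflect_lin_involution: "a \<noteq> 0 \<Longrightarrow> reflect_lin a (reflect_lin a x) = x"
  by (subst reflect_lin_def, subst reflect_lin_self) (simp_all add: reflect_lin_def)

lemma norm_reflect_lin: "a \<noteq> 0 \<Longrightarrow> norm (reflect_lin a x) = norm x"
  by (simp add: norm_eq_sqrt_inner reflect_lin_adjoint reflect_lin_involution)

lemma reflect_involution: "a \<noteq> 0 \<Longrightarrow> reflect a b (reflect a b x) = x"
proof -
  assume a: "a \<noteq> 0"
  \<comment> \<open>The translation part is a multiple of a, which the linear part reverses; so the
    two translations cancel.\<close>
  have "reflect_lin a a = - a" using a by (simp add: reflect_lin_def scaleR_2)
  then have "reflect_lin a ((2 * b / (a \<bullet> a)) *\<^sub>R a) = - ((2 * b / (a \<bullet> a)) *\<^sub>R a)"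
    by (simp only: linear_scale[OF linear_reflect_lin] scaleR_minus_right)
  then show ?thesis
    by (simp only: reflect_affine linear_add[OF linear_reflect_lin] reflect_lin_involution[OF a]) simp
qed

lemma continuous_reflect: "continuous_on UNIV (reflect a b)"
  unfolding reflect_affine
  by (intro continuous_intros linear_continuous_on linear_conv_bounded_linear[THEN iffD1] linear_reflect_lin)

lemma measurable_reflect [measurable]: "reflect a b \<in> borel_measurable borel"
  by (rule borel_measurable_continuous_onI[OF continuous_reflect])

lemma distr_reflect:
  assumes a: "a \<noteq> 0"
  shows "distr lborel borel (reflect a b) = lborel"
proof (rule measure_eqI)
  fix A assume "A \<in> sets (distr lborel borel (reflect a b))"
  then have A [measurable]: "A \<in> sets borel" by simp
  let ?d = "(2 * b / (a \<bullet> a)) *\<^sub>R a"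
  have "emeasure (distr lborel borel (reflect a b)) A = (\<integral>\<^sup>+x. indicator A x \<partial>distr lborel borel (reflect a b))" by simp
  also have "\<dots> = (\<integral>\<^sup>+x. indicator A (reflect a b x) \<partial>lborel)" by (rule nn_integral_distr) measurable
  also have "\<dots> = (\<integral>\<^sup>+x. indicator A (?d + reflect_lin a x) \<partial>lborel)" by (simp only: reflect_affine)
  also have "\<dots> = (\<integral>\<^sup>+x. indicator A (?d + x) \<partial>lborel)"
    by (rule nn_integral_isometric_involution[OF linear_reflect_lin reflect_lin_involution[OF a] norm_reflect_lin[OF a], of "\<lambda>x. indicator A (?d + x)"]) measurable
  also have "\<dots> = (\<integral>\<^sup>+x. indicator A x \<partial>lborel)" by (rule nn_integral_lborel_translate) measurable
  finally show "emeasure (distr lborel borel (reflect a b)) A = emeasure lborel A" by simp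
qed simp

lemma frechet_derivative_affine:
  fixes L :: "'a::euclidean_space \<Rightarrow> 'b::euclidean_space" and f :: "'b \<Rightarrow> real"
  assumes "linear L" "f differentiable (at (d + L x))"
  shows "frechet_derivative (\<lambda>x. f (d + L x)) (at x) v = frechet_derivative f (at (d + L x)) (L v)"
proof -
  have "((\<lambda>x. d + L x) has_derivative L) (at x)"
    using assms(1) by (auto intro!: derivative_eq_intros linear_imp_has_derivative)
  from has_derivative_compose[OF this frechet_derivative_works[THEN iffD1, OF assms(2)]]
  show ?thesis by (rule frechet_derivative_at[symmetric, THEN fun_cong])
qed

section \<open>Domains invariant under a reflection\<close>

locale symmetric_domain = neumann_domain +
  fixes a :: 'a and b :: real
  assumes a_nz: "a \<noteq> 0" and reflect_image: "reflect a b ` \<Omega> = \<Omega>"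
begin

abbreviation R :: "'a \<Rightarrow> 'a" where "R \<equiv> reflect a b"

lemma R_R [simp]: "R (R x) = x"
  by (rule reflect_involution[OF a_nz])

lemma R_mem_iff [simp]: "R x \<in> \<Omega> \<longleftrightarrow> x \<in> \<Omega>"
  using reflect_image R_R by (metis imageI)

lemma AE_R:
  assumes "AE x in lebesgue_on \<Omega>. P x"
  shows "AE x in lebesgue_on \<Omega>. P (R x)"
proof -
  have "AE x in distr lborel borel R. x \<in> \<Omega> \<longrightarrow> P x"
    using assms unfolding distr_reflect[OF a_nz] AE_lebesgue_on_iff[OF borel_dom] .
  then have "AE x in lborel. R x \<in> \<Omega> \<longrightarrow> P (R x)" by (rule AE_distrD[rotated]) simp
  then show ?thesis unfolding AE_lebesgue_on_iff[OF borel_dom] by simp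
qed

text \<open>Completeness of Lebesgue measure. It is needed for compositions with the reflection,
  since composing a Lebesgue measurable function with a Borel map does not preserve measurability in
  general.\<close>

lemma measurable_AE_eq:
  fixes f g :: "'a \<Rightarrow> 'b::euclidean_space"
  assumes g: "g \<in> borel_measurable (lebesgue_on \<Omega>)" and ae: "AE x in lebesgue_on \<Omega>. g x = f x"
  shows "f \<in> borel_measurable (lebesgue_on \<Omega>)"
proof -
  have "(\<lambda>x. if x \<in> \<Omega> then g x else 0) \<in> borel_measurable lebesgue" using g by (simp add: borel_measurable_if)
  then have "(\<lambda>x. if x \<in> \<Omega> then f x else 0) \<in> borel_measurable lebesgue"
  proof (rule borel_measurable_AE)
    have "AE x in lebesgue. x \<in> \<Omega> \<longrightarrow> g x = f x" using ae by (simp add: AE_restrict_space_iff)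
    then show "AE x in lebesgue. (if x \<in> \<Omega> then g x else 0) = (if x \<in> \<Omega> then f x else 0)" by eventually_elim auto
  qed
  then show ?thesis by (simp add: borel_measurable_if)
qed

text \<open>Invariance holds for Borel functions because the reflection preserves
  \<open>lborel\<close>; a Borel representative extends it to Lebesgue measurable ones.\<close>

lemma integral_R:
  fixes f :: "'a \<Rightarrow> 'b::euclidean_space"
  assumes f: "f \<in> borel_measurable (lebesgue_on \<Omega>)"
  shows "(\<lambda>x. f (R x)) \<in> borel_measurable (lebesgue_on \<Omega>)"
    "(\<integral>x. f (R x) \<partial>lebesgue_on \<Omega>) = (\<integral>x. f x \<partial>lebesgue_on \<Omega>)"
    "integrable (lebesgue_on \<Omega>) (\<lambda>x. f (R x)) \<longleftrightarrow> integrable (lebesgue_on \<Omega>) f"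
proof -
  obtain F where F: "F \<in> borel_measurable borel" "\<And>x. x \<notin> \<Omega> \<Longrightarrow> F x = 0" "AE x in lebesgue_on \<Omega>. f x = F x"
    by (rule borel_representative[OF borel_dom f]) blast
  have FR: "(\<lambda>x. F (R x)) \<in> borel_measurable borel" using F(1) by measurable
  have FR0: "F (R x) = 0" if "x \<notin> \<Omega>" for x using F(2)[of "R x"] that by simp
  note ae = AE_R[OF F(3)]
  show m: "(\<lambda>x. f (R x)) \<in> borel_measurable (lebesgue_on \<Omega>)"
    by (rule measurable_AE_eq[OF borel_measurable_lebesgue_onI[OF FR]]) (use ae in \<open>eventually_elim, simp\<close>)
  note 1 = integral_lebesgue_on_eq_lborel[OF borel_dom F(1,2) f F(3)]
  note 2 = integral_lebesgue_on_eq_lborel[OF borel_dom FR FR0 m ae]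
  have "(\<integral>x. F x \<partial>lborel) = (\<integral>x. F x \<partial>distr lborel borel R)" by (simp only: distr_reflect[OF a_nz])
  also have "\<dots> = (\<integral>x. F (R x) \<partial>lborel)" by (rule integral_distr) (use F(1) in auto)
  finally show "(\<integral>x. f (R x) \<partial>lebesgue_on \<Omega>) = (\<integral>x. f x \<partial>lebesgue_on \<Omega>)" using 1(1) 2(1) by simp
  have "integrable lborel F \<longleftrightarrow> integrable (distr lborel borel R) F" by (simp only: distr_reflect[OF a_nz])
  also have "\<dots> \<longleftrightarrow> integrable lborel (\<lambda>x. F (R x))" by (rule integrable_distr_eq) (use F(1) in auto)
  finally show "integrable (lebesgue_on \<Omega>) (\<lambda>x. f (R x)) \<longleftrightarrow> integrable (lebesgue_on \<Omega>) f" using 1(2) 2(2) by simp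
qed

lemma L2_R:
  assumes "L2 \<Omega> u"
  shows "L2 \<Omega> (\<lambda>x. u (R x))"
proof -
  note m = L2D(1)[OF assms]
  have "(\<lambda>x. (u x)\<^sup>2) \<in> borel_measurable (lebesgue_on \<Omega>)" using m by measurable
  from integral_R(3)[OF this] show ?thesis using integral_R(1)[OF m] L2D(2)[OF assms] by (simp add: L2_def)
qed

lemma test_fun_R:
  assumes "test_fun \<Omega> \<phi>"
  shows "test_fun \<Omega> (\<lambda>x. \<phi> (R x))"
proof (rule test_funI)
  have t: "smooth_on UNIV \<phi>" "compact (closure {x. \<phi> x \<noteq> 0})" "closure {x. \<phi> x \<noteq> 0} \<subseteq> \<Omega>"
    using assms by (auto simp: test_fun_def)
  show "smooth_on UNIV (\<lambda>x. \<phi> (R x))" unfolding reflect_affine by (rule smooth_affine[OF t(1) linear_reflect_lin])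
  show "compact (R ` closure {x. \<phi> x \<noteq> 0})"
    by (rule compact_continuous_image[OF continuous_on_subset[OF continuous_reflect] t(2)]) simp
  show "R ` closure {x. \<phi> x \<noteq> 0} \<subseteq> \<Omega>" using t(3) by auto
  show "\<phi> (R x) = 0" if "x \<notin> R ` closure {x. \<phi> x \<noteq> 0}" for x
  proof (rule ccontr)
    assume "\<phi> (R x) \<noteq> 0"
    then have "R x \<in> closure {x. \<phi> x \<noteq> 0}" using closure_subset[of "{x. \<phi> x \<noteq> 0}"] by auto
    then have "R (R x) \<in> R ` closure {x. \<phi> x \<noteq> 0}" by (rule imageI)
    then show False using that by simp
  qed
qed

text \<open>The change of variables moves the reflection to the test function. The linear part is
  its own adjoint and inverse, so it returns from the direction of differentiation to the
  gradient.\<close>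

lemma weak_gradient_R:
  assumes u: "L2 \<Omega> u" and G: "weak_gradient \<Omega> u G"
  shows "weak_gradient \<Omega> (\<lambda>x. u (R x)) (\<lambda>x. reflect_lin a (G (R x)))"
  unfolding weak_gradient_def
proof (intro conjI allI impI)
  note Gm = weak_gradientD(1)[OF G]
  have Lc: "continuous_on UNIV (reflect_lin a)"
    by (intro linear_continuous_on linear_conv_bounded_linear[THEN iffD1] linear_reflect_lin)
  show "(\<lambda>x. reflect_lin a (G (R x))) \<in> borel_measurable (lebesgue_on \<Omega>)"
    by (rule borel_measurable_continuous_on[OF Lc integral_R(1)[OF Gm]])
  have "(\<lambda>x. (norm (G x))\<^sup>2) \<in> borel_measurable (lebesgue_on \<Omega>)" using Gm by measurable
  from integral_R(3)[OF this]
  show "integrable (lebesgue_on \<Omega>) (\<lambda>x. (norm (reflect_lin a (G (R x))))\<^sup>2)"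
    using weak_gradientD(2)[OF G] by (simp add: norm_reflect_lin[OF a_nz])
  fix \<phi> :: "'a \<Rightarrow> real" and i :: 'a assume t: "test_fun \<Omega> \<phi>" and i: "i \<in> Basis"
  let ?\<psi> = "\<lambda>x. \<phi> (R x)"
  note tR = test_fun_R[OF t]
  have sm: "smooth_on UNIV \<phi>" "smooth_on UNIV ?\<psi>" using t tR by (auto simp: test_fun_def)
  have diff: "f differentiable (at x)" if "smooth_on UNIV f" for f :: "'a \<Rightarrow> real" and x
    using smooth_has_derivative[OF that, of x] unfolding differentiable_def by blast
  \<comment> \<open>Differentiating \<phi> along i at the reflected point is differentiating
    \<open>?\<psi>\<close> along the reflected direction, as the linear part applied twice is the
    identity; expanding in the basis then permits the use of the weak gradient.\<close>
  have chain: "frechet_derivative \<phi> (at (R x)) i = (\<Sum>j\<in>Basis. (reflect_lin a i \<bullet> j) * frechet_derivative ?\<psi> (at x) j)" for x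
  proof -
    have "frechet_derivative ?\<psi> (at x) (reflect_lin a i) = frechet_derivative \<phi> (at (R x)) (reflect_lin a (reflect_lin a i))"
      unfolding reflect_affine by (rule frechet_derivative_affine[OF linear_reflect_lin diff[OF sm(1)]])
    then show ?thesis using frechet_derivative_Basis_expand[OF diff[OF sm(2)], of x "reflect_lin a i"]
      by (simp add: reflect_lin_involution[OF a_nz])
  qed
  have m1: "(\<lambda>y. u y * frechet_derivative \<phi> (at (R y)) i) \<in> borel_measurable (lebesgue_on \<Omega>)"
    by (intro borel_measurable_times L2D(1)[OF u] integral_R(1) borel_measurable_lebesgue_onI test_fun_measurable[OF t])
  have m2: "(\<lambda>y. (reflect_lin a (G y) \<bullet> i) * \<phi> (R y)) \<in> borel_measurable (lebesgue_on \<Omega>)"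
    by (intro borel_measurable_times borel_measurable_inner borel_measurable_const borel_measurable_continuous_on[OF Lc Gm]
        integral_R(1) borel_measurable_lebesgue_onI test_fun_measurable[OF t])
  note I1 = integrable_test(2)[OF u tR] and I2 = integrable_test(1)[OF weak_gradientD(4)[OF G] tR]
  have "(\<integral>x. u (R x) * frechet_derivative \<phi> (at x) i \<partial>lebesgue_on \<Omega>) = (\<integral>y. u y * frechet_derivative \<phi> (at (R y)) i \<partial>lebesgue_on \<Omega>)"
    using integral_R(2)[OF m1] by simp
  also have "\<dots> = (\<integral>y. (\<Sum>j\<in>Basis. (reflect_lin a i \<bullet> j) * (u y * frechet_derivative ?\<psi> (at y) j)) \<partial>lebesgue_on \<Omega>)"
    unfolding chain by (simp only: sum_distrib_left mult.left_commute)
  also have "\<dots> = (\<Sum>j\<in>Basis. (reflect_lin a i \<bullet> j) * (\<integral>y. u y * frechet_derivative ?\<psi> (at y) j \<partial>lebesgue_on \<Omega>))"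
    by (subst Bochner_Integration.integral_sum) (use I1 in auto)
  also have "\<dots> = (\<Sum>j\<in>Basis. (reflect_lin a i \<bullet> j) * - (\<integral>y. (G y \<bullet> j) * ?\<psi> y \<partial>lebesgue_on \<Omega>))"
    by (intro sum.cong refl) (simp only: weak_gradientD(3)[OF G tR])
  also have "\<dots> = - (\<Sum>j\<in>Basis. (reflect_lin a i \<bullet> j) * (\<integral>y. (G y \<bullet> j) * ?\<psi> y \<partial>lebesgue_on \<Omega>))"
    by (simp only: mult_minus_right sum_negf)
  also have "(\<Sum>j\<in>Basis. (reflect_lin a i \<bullet> j) * (\<integral>y. (G y \<bullet> j) * ?\<psi> y \<partial>lebesgue_on \<Omega>))
      = (\<integral>y. (\<Sum>j\<in>Basis. (reflect_lin a i \<bullet> j) * ((G y \<bullet> j) * ?\<psi> y)) \<partial>lebesgue_on \<Omega>)"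
    by (subst Bochner_Integration.integral_sum) (use I2 in auto)
  also have "\<dots> = (\<integral>y. (reflect_lin a (G y) \<bullet> i) * ?\<psi> y \<partial>lebesgue_on \<Omega>)"
  proof (intro Bochner_Integration.integral_cong refl)
    fix y
    have "(\<Sum>j\<in>Basis. (reflect_lin a i \<bullet> j) * ((G y \<bullet> j) * ?\<psi> y)) = (reflect_lin a i \<bullet> G y) * ?\<psi> y"
      by (subst euclidean_inner) (simp only: sum_distrib_right mult.assoc)
    then show "(\<Sum>j\<in>Basis. (reflect_lin a i \<bullet> j) * ((G y \<bullet> j) * ?\<psi> y)) = (reflect_lin a (G y) \<bullet> i) * ?\<psi> y"
      by (simp only: reflect_lin_adjoint inner_commute[of i])
  qed
  also have "\<dots> = (\<integral>x. (reflect_lin a (G (R x)) \<bullet> i) * \<phi> x \<partial>lebesgue_on \<Omega>)"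
    using integral_R(2)[OF m2] by simp
  finally show "(\<integral>x. u (R x) * frechet_derivative \<phi> (at x) i \<partial>lebesgue_on \<Omega>) =
    - (\<integral>x. (reflect_lin a (G (R x)) \<bullet> i) * \<phi> x \<partial>lebesgue_on \<Omega>)" .
qed

lemma Hza_R: 
  assumes u: "u \<in> Hza \<Omega>"
  shows "(\<lambda>x. u (R x)) \<in> Hza \<Omega>" "dirichlet \<Omega> (\<lambda>x. u (R x)) = dirichlet \<Omega> u"
    "M.pnorm p (\<lambda>x. u (R x)) = M.pnorm p u"
proof -
  note uH = Hza_H1[OF u]
  note L = H1D(1)[OF uH] and W = H1D(2)[OF uH]
  note WR = weak_gradient_R[OF L W]
  have h: "(\<lambda>x. u (R x)) \<in> H1 \<Omega>" by (rule H1I[OF L2_R[OF L] WR])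
  then show "(\<lambda>x. u (R x)) \<in> Hza \<Omega>" using u integral_R(2)[OF L2D(1)[OF L]] by (simp add: Hza_def)
  have m: "(\<lambda>x. (norm (grad \<Omega> u x))\<^sup>2) \<in> borel_measurable (lebesgue_on \<Omega>)"
    using grad_measurable[OF uH] by measurable
  show "dirichlet \<Omega> (\<lambda>x. u (R x)) = dirichlet \<Omega> u"
    using dirichlet_eq_gradint[OF h WR] integral_R(2)[OF m]
    by (simp add: gradint_def dirichlet_def norm_reflect_lin[OF a_nz])
  have "(\<lambda>x. \<bar>u x\<bar> powr p) \<in> borel_measurable (lebesgue_on \<Omega>)" using L2D(1)[OF L] by measurable
  from integral_R(2)[OF this] show "M.pnorm p (\<lambda>x. u (R x)) = M.pnorm p u"
    by (simp add: M.pnorm_def M.pint_def)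
qed

lemma minimizer_R:
  assumes p: "2 < p" "p < q_exp" and u: "minimizer \<Omega> p u"
  shows "minimizer \<Omega> p (\<lambda>x. u (R x))"
proof -
  obtain m where m: "\<And>u. minimizer \<Omega> p u \<longleftrightarrow> u \<in> Hza \<Omega> \<and> M.pnorm p u \<noteq> 0 \<and> dirichlet \<Omega> u = m * (M.pnorm p u)\<^sup>2"
    by (rule minimizer_characterisation[OF p]) blast
  have h: "u \<in> Hza \<Omega>" using u m by blast
  show ?thesis unfolding m using u[unfolded m] Hza_R[OF h] by simp
qed

text \<open>A real factor s treats the symmetric and the antisymmetric case, s = 1 and s = -1,
  together.\<close>

lemma scal_R:
  assumes u: "u \<in> H1 \<Omega>" and v: "v \<in> H1 \<Omega>" and s: "AE x in lebesgue_on \<Omega>. v (R x) = s * v x"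
  shows "scal (\<lambda>x. u (R x)) v = s * scal u v"
proof -
  note um = L2D(1)[OF H1D(1)[OF u]] and vm = L2D(1)[OF H1D(1)[OF v]]
  have m: "(\<lambda>x. u x * v (R x)) \<in> borel_measurable (lebesgue_on \<Omega>)"
    by (intro borel_measurable_times um integral_R(1)[OF vm])
  have "scal (\<lambda>x. u (R x)) v = (\<integral>x. u x * v (R x) \<partial>lebesgue_on \<Omega>)"
    using integral_R(2)[OF m] by simp
  also have "\<dots> = (\<integral>x. s * (u x * v x) \<partial>lebesgue_on \<Omega>)"
  proof (rule integral_cong_AE[OF m])
    show "(\<lambda>x. s * (u x * v x)) \<in> borel_measurable (lebesgue_on \<Omega>)" using um vm by measurable
    show "AE x in lebesgue_on \<Omega>. u x * v (R x) = s * (u x * v x)" using s by eventually_elim simp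
  qed
  finally show ?thesis by simp
qed

text \<open>The reflection of a minimizer u is a minimizer, hence a multiple of u; by
  \<open>scal_R\<close> the quotient of the pairings with u_2 that gives the factor is exactly
  s.\<close>

lemma minimizers_near_2_symmetric:
  assumes eig: "neumann_eigenpair \<Omega> (lambda2 \<Omega>) u2"
    and simple: "\<forall>v. neumann_eigenpair \<Omega> (lambda2 \<Omega>) v \<longrightarrow> (\<exists>c. AE x in lebesgue_on \<Omega>. v x = c * u2 x)"
    and s: "AE x in lebesgue_on \<Omega>. u2 (R x) = s * u2 x"
  shows "\<exists>\<epsilon>>0. \<forall>p. 2 < p \<and> p < 2 + \<epsilon> \<longrightarrow> (\<exists>u. minimizer \<Omega> p u) \<and>
      (\<forall>u v. minimizer \<Omega> p u \<and> minimizer \<Omega> p v \<longrightarrow> (\<exists>c. AE x in lebesgue_on \<Omega>. v x = c * u x)) \<and>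
      (\<forall>u. minimizer \<Omega> p u \<longrightarrow> (AE x in lebesgue_on \<Omega>. u (R x) = s * u x))"
proof -
  note u2H = Hza_H1[OF eigenpair_props(1)[OF eig lambda2_props(1)]]
  from minimizers_near_2[OF eig simple] obtain c where c: "c > 2"
    "\<forall>p>2. p < c \<longrightarrow> 2 < p \<and> p < q_exp \<and> (\<exists>u. minimizer \<Omega> p u) \<and>
     (\<forall>u. minimizer \<Omega> p u \<longrightarrow> scal u u2 \<noteq> 0) \<and>
     (\<forall>u v. minimizer \<Omega> p u \<and> minimizer \<Omega> p v \<longrightarrow> (AE x in lebesgue_on \<Omega>. v x = (scal v u2 / scal u u2) * u x))"
    unfolding eventually_at_right_field by blast
  show ?thesis
  proof (rule exI[of _ "c - 2"], intro conjI allI impI)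
    show "c - 2 > 0" using c by simp
    fix p assume "2 < p \<and> p < 2 + (c - 2)"
    then have p: "2 < p" "p < c" by auto
    note cp = c(2)[rule_format, OF p]
    have pq: "p < q_exp" and ex: "\<exists>u. minimizer \<Omega> p u" and nz: "\<And>u. minimizer \<Omega> p u \<Longrightarrow> scal u u2 \<noteq> 0"
      and un: "\<And>u v. minimizer \<Omega> p u \<Longrightarrow> minimizer \<Omega> p v \<Longrightarrow> AE x in lebesgue_on \<Omega>. v x = (scal v u2 / scal u u2) * u x"
      using cp by blast+
    show "\<exists>u. minimizer \<Omega> p u" by (rule ex)
    show "\<exists>c. AE x in lebesgue_on \<Omega>. v x = c * u x" if "minimizer \<Omega> p u \<and> minimizer \<Omega> p v" for u v
      by (rule exI) (rule un[OF that[THEN conjunct1] that[THEN conjunct2]])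
    show "AE x in lebesgue_on \<Omega>. u (R x) = s * u x" if u: "minimizer \<Omega> p u" for u
    proof -
      have "u \<in> H1 \<Omega>" using u by (simp add: minimizer_def admissible_def Hza_def)
      from scal_R[OF this u2H s] have "scal (\<lambda>x. u (R x)) u2 / scal u u2 = s" using nz[OF u] by simp
      with un[OF u minimizer_R[OF p(1) pq u]] show ?thesis by (simp only:)
    qed
  qed
qed

end

theorem theorem6p2:
  fixes \<Omega> :: "'a::euclidean_space set" and a :: 'a and b :: real and u2 :: "'a \<Rightarrow> real"
  assumes dom: "smooth_bounded_domain \<Omega>"
    and a_nz: "a \<noteq> 0"
    and sym_dom: "reflect a b ` \<Omega> = \<Omega>"
    and eig: "neumann_eigenpair \<Omega> (lambda2 \<Omega>) u2"
    and simple: "\<forall>v. neumann_eigenpair \<Omega> (lambda2 \<Omega>) v \<longrightarrow>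
                    (\<exists>c. AE x in lebesgue_on \<Omega>. v x = c * u2 x)"
  shows "((AE x in lebesgue_on \<Omega>. u2 (reflect a b x) = u2 x) \<longrightarrow>
           (\<exists>\<epsilon>>0. \<forall>p. 2 < p \<and> p < 2 + \<epsilon> \<longrightarrow>
              (\<exists>u. minimizer \<Omega> p u) \<and>
              (\<forall>u v. minimizer \<Omega> p u \<and> minimizer \<Omega> p v \<longrightarrow>
                 (\<exists>c. AE x in lebesgue_on \<Omega>. v x = c * u x)) \<and>
              (\<forall>u. minimizer \<Omega> p u \<longrightarrow>
                 (AE x in lebesgue_on \<Omega>. u (reflect a b x) = u x))))
       \<and> ((AE x in lebesgue_on \<Omega>. u2 (reflect a b x) = - u2 x) \<longrightarrow>
           (\<exists>\<epsilon>>0. \<forall>p. 2 < p \<and> p < 2 + \<epsilon> \<longrightarrow>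
              (\<exists>u. minimizer \<Omega> p u) \<and>
              (\<forall>u v. minimizer \<Omega> p u \<and> minimizer \<Omega> p v \<longrightarrow>
                 (\<exists>c. AE x in lebesgue_on \<Omega>. v x = c * u x)) \<and>
              (\<forall>u. minimizer \<Omega> p u \<longrightarrow>
                 (AE x in lebesgue_on \<Omega>. u (reflect a b x) = - u x))))"
proof -
  interpret bounded_open \<Omega> by (rule smooth_bounded_domain_bounded_open[OF dom])
  interpret symmetric_domain \<Omega> a b
    by unfold_locales
      (use dom a_nz sym_dom smooth_bounded_domain_smoothable[OF dom] in \<open>auto simp: smooth_bounded_domain_def\<close>)
  \<comment> \<open>The two instances s = 1 and s = -1, with the factor simplified to match the
    claim literally.\<close>
  have one: "1 * r = r" and neg: "- 1 * r = - r" for r :: real by simp_all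
  show ?thesis
  proof (intro conjI impI)
    assume "AE x in lebesgue_on \<Omega>. u2 (reflect a b x) = u2 x"
    from minimizers_near_2_symmetric[OF eig simple, of 1, unfolded one, OF this]
    show "\<exists>\<epsilon>>0. \<forall>p. 2 < p \<and> p < 2 + \<epsilon> \<longrightarrow>
              (\<exists>u. minimizer \<Omega> p u) \<and>
              (\<forall>u v. minimizer \<Omega> p u \<and> minimizer \<Omega> p v \<longrightarrow>
                 (\<exists>c. AE x in lebesgue_on \<Omega>. v x = c * u x)) \<and>
              (\<forall>u. minimizer \<Omega> p u \<longrightarrow>
                 (AE x in lebesgue_on \<Omega>. u (reflect a b x) = u x))" .
  next
    assume "AE x in lebesgue_on \<Omega>. u2 (reflect a b x) = - u2 x"
    from minimizers_near_2_symmetric[OF eig simple, of "- 1", unfolded neg, OF this]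
    show "\<exists>\<epsilon>>0. \<forall>p. 2 < p \<and> p < 2 + \<epsilon> \<longrightarrow>
              (\<exists>u. minimizer \<Omega> p u) \<and>
              (\<forall>u v. minimizer \<Omega> p u \<and> minimizer \<Omega> p v \<longrightarrow>
                 (\<exists>c. AE x in lebesgue_on \<Omega>. v x = c * u x)) \<and>
              (\<forall>u. minimizer \<Omega> p u \<longrightarrow>
                 (AE x in lebesgue_on \<Omega>. u (reflect a b x) = - u x))" .
  qed
qed

end
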